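(* Let $\Sigma$ be an embedded submanifold of codimension $d$, $1\le d\le n-1$, in a conformal manifold $(M,\boldsymbol{c})$ of dimension $n\ge3$. Then the following are equivalent: (i) $\Sigma$ is distinguished; (ii) there exists a nowhere-zero section $\Psi\in\Gamma(\Lambda^d\mathcal{T}^*|_\Sigma)$ such that $X\lrcorner\Psi=0$ (that is, $X^{A_1}\Psi_{A_1A_2\cdots A_d}=0$) and $\nabla_i\Psi=0$ along $\Sigma$; (iii) there exists a nowhere-zero section $\star\Psi\in\Gamma(\Lambda^{n+2-d}\mathcal{T}^*|_\Sigma)$ such that $X\wedge\star\Psi=0$ and $\nabla_i\star\Psi=0$ along $\Sigma$.
   Context: Conformal tractors. $(M,\boldsymbol{c})$ is a smooth connected oriented $n$-manifold with a class $\boldsymbol{c}$ of conformally related Riemannian metrics. Sections of the density bundle $\mathcal{E}[w]$ are classes of pairs $(g,f)\sim(\Omega^2g,\Omega^wf)$; $\mathcal{B}[w]:=\mathcal{B}\otimes\mathcal{E}[w]$; the conformal metric $\boldsymbol{g}\in\Gamma(S^2T^*M[2])$ is the class of $(g,g)$ and raises and lowers indices. For $g\in\boldsymbol{c}$, $\nabla$ is the Levi-Civita connection, $(\nabla_a\nabla_b-\nabla_b\nabla_a)v^c=R_{ab}{}^c{}_dv^d$, $R_{ab}=R_{ca}{}^c{}_b$, and $P_{ab}$ (Schouten) is defined by $R_{ab}=(n-2)P_{ab}+J\boldsymbol{g}_{ab}$, $J=\boldsymbol{g}^{ab}P_{ab}$. The standard tractor bundle $\mathcal{T}$ is identified by $g\in\boldsymbol{c}$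 with $\mathcal{E}[1]\oplus T^*M[1]\oplus\mathcal{E}[-1]$, $V=(\sigma,\mu_a,\rho)$; for $\hat g=\Omega^2g$, $\Upsilon_a=\Omega^{-1}\nabla_a\Omega$, the triple becomes $(\sigma,\mu_a+\Upsilon_a\sigma,\rho-\Upsilon^b\mu_b-\tfrac12\Upsilon^b\Upsilon_b\sigma)$. The canonical tractor $X\in\Gamma(\mathcal{T}[1])$ is the invariant inclusion $\mathcal{E}[-1]\to\mathcal{T}$, $\rho\mapsto(0,0,\rho)$. The invariant tractor metric $h(V,V)=2\sigma\rho+\boldsymbol{g}^{ab}\mu_a\mu_b$ identifies $\mathcal{T}\cong\mathcal{T}^*$, and the invariant tractor connection is $\nabla_a(\sigma,\mu_b,\rho)=(\nabla_a\sigma-\mu_a,\ \nabla_a\mu_b+P_{ab}\sigma+\boldsymbol{g}_{ab}\rho,\ \nabla_a\rho-P_{ab}\mu^b)$. $\star$ denotes the Hodge star of $h$ (and the orientation). Submanifold objects. With $m=n-d$: index $i$ refers to $T\Sigma$ and $\nabla_i$ is the pullback to $\Sigma$ of the ambient (tractor) connection. For $g\in\boldsymbol{c}$, $H^c=\frac1m\boldsymbol{g}^{ij}I\!I_{ij}{}^c$ is the mean curvature. The normal tractor bundle $\mathcal{N}\subset\mathcal{T}|_\Sigma$ is the image of $N\Sigma[-1]$ under the invariant map $n^a\mapsto(0,n_a,n_cH^c)$; $\mathrm{N}^A_B$ is the orthogonal projection onto $\mathcal{N}$. The tractor second fundamental form is $\mathbb{L}_i{}^C(V)=\mathrm{N}^C_A\nabla_iV^A$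 for $V\in\Gamma(\mathcal{N}^\perp)$, and $\Sigma$ is distinguished if $\mathbb{L}=0$.
   Formalization: The submanifold Σ is additionally assumed orientable; without this the equivalence fails, e.g. for the totally geodesic RP² in round RP³, which is distinguished but carries no nowhere-zero parallel Ψ with X⌟Ψ=0. *)

theory Defs
  imports "HOL-Analysis.Analysis" "HOL-Combinatorics.Permutations"
begin

section \<open>Smooth maps between Euclidean spaces\<close>

primrec Ck_on :: "nat \<Rightarrow> 'a::real_normed_vector set \<Rightarrow> ('a \<Rightarrow> 'b::real_normed_vector) \<Rightarrow> bool" where
  "Ck_on 0 U f \<longleftrightarrow> continuous_on U f"
| "Ck_on (Suc k) U f \<longleftrightarrow> (\<forall>x\<in>U. f differentiable (at x)) \<and>
     (\<forall>v. Ck_on k U (\<lambda>x. frechet_derivative f (at x) v))"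

text \<open>\<open>smooth_on\<close> is meant for open sets. On an arbitrary set (below: the coordinate image of a
  piece of a submanifold) a map is smooth if it locally extends to a smooth map.\<close>

definition smooth_on :: "'a::real_normed_vector set \<Rightarrow> ('a \<Rightarrow> 'b::real_normed_vector) \<Rightarrow> bool" where
  "smooth_on U f \<longleftrightarrow> (\<forall>k. Ck_on k U f)"

definition smooth_on_subset ::
    "'a::real_normed_vector set \<Rightarrow> ('a \<Rightarrow> 'b::real_normed_vector) \<Rightarrow> bool" where
  "smooth_on_subset B f \<longleftrightarrow>
     (\<forall>x\<in>B. \<exists>W F. open W \<and> x \<in> W \<and> smooth_on W F \<and> (\<forall>y\<in>B \<inter> W. F y = f y))"

definition pdiff :: "'n::finite \<Rightarrow> (real^'n \<Rightarrow> 'b::real_normed_vector) \<Rightarrow> real^'n \<Rightarrow> 'b" where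
  "pdiff i f x = vector_derivative (\<lambda>t. f (x + t *\<^sub>R axis i 1)) (at 0)"


section \<open>Oriented smooth manifolds\<close>

text \<open>The manifold is a whole (Hausdorff, second countable) type \<open>'a\<close>, of dimension \<open>CARD('n)\<close>.
  A chart is a pair \<open>(U, \<phi>)\<close>; the values of \<open>\<phi>\<close> off \<open>U\<close> are irrelevant.\<close>

type_synonym ('a, 'n) chart = "'a set \<times> ('a \<Rightarrow> real^'n)"

abbreviation dom_of :: "('a, 'n) chart \<Rightarrow> 'a set" where
  "dom_of \<equiv> fst"

abbreviation coord :: "('a, 'n) chart \<Rightarrow> 'a \<Rightarrow> real^'n" where
  "coord \<equiv> snd"

abbreviation point_of :: "('a, 'n) chart \<Rightarrow> real^'n \<Rightarrow> 'a" where
  "point_of u \<equiv> inv_into (dom_of u) (coord u)"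

definition is_chart :: "('a::topological_space, 'n::finite) chart \<Rightarrow> bool" where
  "is_chart u \<longleftrightarrow> open (dom_of u) \<and> open (coord u ` dom_of u) \<and>
     homeomorphism (dom_of u) (coord u ` dom_of u) (coord u) (point_of u)"

text \<open>\<open>jac u v p\<close> has \<open>(a, b)\<close> entry \<open>\<partial>y\<^sup>a/\<partial>x\<^sup>b\<close> at \<open>p\<close>, where \<open>x\<close>, \<open>y\<close> are the coordinates
  of \<open>u\<close>, \<open>v\<close>.\<close>

definition jac :: "('a, 'n::finite) chart \<Rightarrow> ('a, 'n) chart \<Rightarrow> 'a \<Rightarrow> real^'n^'n" where
  "jac u v p = jacobian (coord v \<circ> point_of u) (at (coord u p))"

definition oriented_compatible :: "('a, 'n::finite) chart \<Rightarrow> ('a, 'n) chart \<Rightarrow> bool" where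
  "oriented_compatible u v \<longleftrightarrow>
     smooth_on (coord u ` (dom_of u \<inter> dom_of v)) (coord v \<circ> point_of u) \<and>
     smooth_on (coord v ` (dom_of u \<inter> dom_of v)) (coord u \<circ> point_of v) \<and>
     (\<forall>p\<in>dom_of u \<inter> dom_of v. det (jac u v p) > 0)"

text \<open>A smooth structure together with an orientation is the same as a maximal atlas with
  orientation-preserving transition maps.\<close>

definition oriented_smooth_structure :: "('a::topological_space, 'n::finite) chart set \<Rightarrow> bool" where
  "oriented_smooth_structure A \<longleftrightarrow>
     (\<forall>u\<in>A. is_chart u) \<and>
     (\<Union>u\<in>A. dom_of u) = UNIV \<and>
     (\<forall>u\<in>A. \<forall>v\<in>A. oriented_compatible u v) \<and>
     (\<forall>u. is_chart u \<longrightarrow> (\<forall>v\<in>A. oriented_compatible u v) \<longrightarrow> u \<in> A)"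

definition smooth_function :: "('a, 'n::finite) chart set \<Rightarrow> ('a \<Rightarrow> real) \<Rightarrow> bool" where
  "smooth_function A f \<longleftrightarrow> (\<forall>u\<in>A. smooth_on (coord u ` dom_of u) (f \<circ> point_of u))"


section \<open>Conformal classes\<close>

text \<open>A metric is given by its component matrix in each chart, as a function of the coordinates.\<close>

type_synonym ('a, 'n) metric = "('a, 'n) chart \<Rightarrow> real^'n \<Rightarrow> real^'n^'n"

definition riemannian_metric ::
    "('a, 'n::finite) chart set \<Rightarrow> ('a, 'n) metric \<Rightarrow> bool" where
  "riemannian_metric A g \<longleftrightarrow>
     (\<forall>u\<in>A. smooth_on (coord u ` dom_of u) (g u) \<and>
        (\<forall>x\<in>coord u ` dom_of u. transpose (g u x) = g u x \<and>
           (\<forall>v. v \<noteq> 0 \<longrightarrow> v \<bullet> (g u x *v v) > 0))) \<and>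
     (\<forall>u\<in>A. \<forall>v\<in>A. \<forall>p\<in>dom_of u \<inter> dom_of v.
        g u (coord u p) = transpose (jac u v p) ** g v (coord v p) ** jac u v p)"

text \<open>\<open>rescaling A \<Omega> g g'\<close>: \<open>\<Omega>\<close> is a smooth positive function with \<open>g' = \<Omega>\<^sup>2 g\<close>.\<close>

definition rescaling ::
    "('a, 'n::finite) chart set \<Rightarrow> ('a \<Rightarrow> real) \<Rightarrow> ('a, 'n) metric \<Rightarrow> ('a, 'n) metric \<Rightarrow> bool" where
  "rescaling A \<Omega> g g' \<longleftrightarrow> smooth_function A \<Omega> \<and> (\<forall>p. \<Omega> p > 0) \<and>
     (\<forall>u\<in>A. \<forall>p\<in>dom_of u. g' u (coord u p) = (\<Omega> p)\<^sup>2 *\<^sub>R g u (coord u p))"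

definition conformal_class ::
    "('a, 'n::finite) chart set \<Rightarrow> ('a, 'n) metric set \<Rightarrow> bool" where
  "conformal_class A c \<longleftrightarrow>
     (\<exists>g. riemannian_metric A g \<and> c = {g'. riemannian_metric A g' \<and> (\<exists>\<Omega>. rescaling A \<Omega> g g')})"


section \<open>Levi-Civita connection and curvature in coordinates\<close>

text \<open>Here \<open>G\<close> is the component matrix of a metric as a function of the coordinates of one chart.
  \<open>christoffel G x a b $ c\<close> is \<open>\<Gamma>\<^sup>c\<^sub>a\<^sub>b\<close>, the \<open>c\<close> component of the covariant derivative of the
  coordinate field \<open>\<partial>\<^sub>b\<close> along \<open>\<partial>\<^sub>a\<close>, and \<open>riemann G x a b c d\<close> is \<open>R\<^sub>a\<^sub>b\<^sup>c\<^sub>d\<close>.\<close>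

definition christoffel ::
    "(real^'n \<Rightarrow> real^'n^'n) \<Rightarrow> real^'n \<Rightarrow> 'n::finite \<Rightarrow> 'n \<Rightarrow> real^'n" where
  "christoffel G x a b = (\<chi> c. \<Sum>d\<in>UNIV. (1/2) * matrix_inv (G x) $ c $ d *
     (pdiff a (\<lambda>y. G y $ b $ d) x + pdiff b (\<lambda>y. G y $ a $ d) x - pdiff d (\<lambda>y. G y $ a $ b) x))"

definition riemann ::
    "(real^'n \<Rightarrow> real^'n^'n) \<Rightarrow> real^'n \<Rightarrow> 'n::finite \<Rightarrow> 'n \<Rightarrow> 'n \<Rightarrow> 'n \<Rightarrow> real" where
  "riemann G x a b c d =
     pdiff a (\<lambda>y. christoffel G y b d $ c) x - pdiff b (\<lambda>y. christoffel G y a d $ c) x +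
     (\<Sum>e\<in>UNIV. christoffel G x a e $ c * christoffel G x b d $ e
            - christoffel G x b e $ c * christoffel G x a d $ e)"

definition ricci :: "(real^'n \<Rightarrow> real^'n^'n) \<Rightarrow> real^'n \<Rightarrow> real^'n::finite^'n" where
  "ricci G x = (\<chi> a b. \<Sum>c\<in>UNIV. riemann G x c a c b)"

definition trace_wrt :: "real^'n^'n \<Rightarrow> real^'n^'n \<Rightarrow> real" where
  "trace_wrt M B = (\<Sum>a\<in>UNIV. \<Sum>b\<in>UNIV. matrix_inv M $ a $ b * B $ a $ b)"

definition schouten :: "(real^'n \<Rightarrow> real^'n^'n) \<Rightarrow> real^'n \<Rightarrow> real^'n::finite^'n" where
  "schouten G x = (THE P. ricci G x = (real CARD('n) - 2) *\<^sub>R P + trace_wrt (G x) P *\<^sub>R G x)"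


section \<open>Standard tractors\<close>

text \<open>With respect to a metric \<open>g \<in> c\<close> and a chart, a tractor is the triple \<open>(\<sigma>, \<mu>\<^sub>a, \<rho>)\<close>.
  A section of a density bundle is the family \<open>(f\<^sub>g)\<close>, \<open>g \<in> c\<close>, of functions representing it,
  with \<open>f\<close> for \<open>\<Omega>\<^sup>2 g\<close> being \<open>\<Omega>\<^sup>w f\<^sub>g\<close>. The slots have weights \<open>1, 1, -1\<close>,
  which is the origin of the outer powers of \<open>\<Omega>\<close> in \<open>rescale_tractor\<close>.
  In the scale \<open>g\<close> the conformal metric is represented by \<open>g\<close>, and the Levi-Civita connection acts
  on representatives of densities as the ordinary derivative.\<close>

type_synonym 'n tractor = "real \<times> (real^'n) \<times> real"

definition rescale_tractor ::
    "real^'n^'n \<Rightarrow> real \<Rightarrow> real^'n \<Rightarrow> 'n::finite tractor \<Rightarrow> 'n tractor" where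
  "rescale_tractor M \<omega> \<Upsilon> V = (case V of (\<sigma>, \<mu>, \<rho>) \<Rightarrow>
     (\<omega> * \<sigma>,
      \<omega> *\<^sub>R (\<mu> + \<sigma> *\<^sub>R \<Upsilon>),
      inverse \<omega> * (\<rho> - \<Upsilon> \<bullet> (matrix_inv M *v \<mu>) - (1/2) * (\<Upsilon> \<bullet> (matrix_inv M *v \<Upsilon>)) * \<sigma>)))"

text \<open>The change of components at \<open>p\<close> from the metric \<open>g\<close> and chart \<open>u\<close> to \<open>\<Omega>\<^sup>2 g\<close> and chart \<open>v\<close>:
  first the metric is changed, then the covector \<open>\<mu>\<close> is transformed.\<close>

definition tractor_change ::
    "('a, 'n::finite) metric \<Rightarrow> ('a, 'n) chart \<Rightarrow> ('a \<Rightarrow> real) \<Rightarrow> ('a, 'n) chart \<Rightarrow> 'a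
      \<Rightarrow> 'n tractor \<Rightarrow> 'n tractor" where
  "tractor_change g u \<Omega> v p V =
     (case rescale_tractor (g u (coord u p)) (\<Omega> p)
             (\<chi> a. inverse (\<Omega> p) * pdiff a (\<Omega> \<circ> point_of u) (coord u p)) V
      of (\<sigma>, \<mu>, \<rho>) \<Rightarrow> (\<sigma>, transpose (jac v u p) *v \<mu>, \<rho>))"

definition tractor_metric :: "real^'n^'n \<Rightarrow> 'n::finite tractor \<Rightarrow> 'n tractor \<Rightarrow> real" where
  "tractor_metric M V W = (case V of (\<sigma>, \<mu>, \<rho>) \<Rightarrow> case W of (\<sigma>', \<mu>', \<rho>') \<Rightarrow>
     \<sigma> * \<rho>' + \<rho> * \<sigma>' + \<mu> \<bullet> (matrix_inv M *v \<mu>'))"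

text \<open>The canonical tractor has weight \<open>1\<close>; it is represented by this triple in every scale.\<close>

definition canonical_tractor :: "'n::finite tractor" where
  "canonical_tractor = (0, 0, 1)"

text \<open>The zeroth order part of the tractor connection: \<open>\<nabla>\<^sub>i V = \<partial>\<^sub>i V + connection_form G x i V\<close>.\<close>

definition connection_form ::
    "(real^'n \<Rightarrow> real^'n^'n) \<Rightarrow> real^'n \<Rightarrow> 'n::finite \<Rightarrow> 'n tractor \<Rightarrow> 'n tractor" where
  "connection_form G x i V = (case V of (\<sigma>, \<mu>, \<rho>) \<Rightarrow>
     (- \<mu> $ i,
      (\<chi> b. - (\<Sum>c\<in>UNIV. christoffel G x i b $ c * \<mu> $ c) + schouten G x $ i $ b * \<sigma> + G x $ i $ b * \<rho>),
      - (\<Sum>b\<in>UNIV. schouten G x $ i $ b * (matrix_inv (G x) *v \<mu>) $ b)))"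

definition tractor_nabla ::
    "(real^'n \<Rightarrow> real^'n^'n) \<Rightarrow> 'n::finite \<Rightarrow> (real^'n \<Rightarrow> 'n tractor) \<Rightarrow> real^'n \<Rightarrow> 'n tractor" where
  "tractor_nabla G i V x = pdiff i V x + connection_form G x i (V x)"

text \<open>Sections of the restriction of the tractor bundle to a subset \<open>S\<close>: one component function for
  each \<open>g \<in> c\<close> and each chart.\<close>

type_synonym ('a, 'n) tractor_field = "('a, 'n) metric \<Rightarrow> ('a, 'n) chart \<Rightarrow> real^'n \<Rightarrow> 'n tractor"

definition tractor_section ::
    "('a, 'n::finite) chart set \<Rightarrow> ('a, 'n) metric set \<Rightarrow> 'a set \<Rightarrow> ('a, 'n) tractor_field \<Rightarrow> bool" where
  "tractor_section A c S V \<longleftrightarrow>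
     (\<forall>g\<in>c. \<forall>u\<in>A. smooth_on_subset (coord u ` (dom_of u \<inter> S)) (V g u)) \<and>
     (\<forall>g\<in>c. \<forall>g'\<in>c. \<forall>\<Omega>. rescaling A \<Omega> g g' \<longrightarrow>
        (\<forall>u\<in>A. \<forall>v\<in>A. \<forall>p\<in>dom_of u \<inter> dom_of v \<inter> S.
           V g' v (coord v p) = tractor_change g u \<Omega> v p (V g u (coord u p))))"


section \<open>Tractor forms\<close>

text \<open>Forms of degree \<open>k\<close> are functions on lists of length \<open>k\<close>; values on other lists are irrelevant.\<close>

definition alternating_form :: "nat \<Rightarrow> ('v::real_vector list \<Rightarrow> real) \<Rightarrow> bool" where
  "alternating_form k \<alpha> \<longleftrightarrow>
     (\<forall>xs ys. length xs + length ys + 1 = k \<longrightarrow> linear (\<lambda>v. \<alpha> (xs @ v # ys))) \<and>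
     (\<forall>xs. length xs = k \<and> \<not> distinct xs \<longrightarrow> \<alpha> xs = 0)"

type_synonym ('a, 'n) tractor_form =
  "('a, 'n) metric \<Rightarrow> ('a, 'n) chart \<Rightarrow> real^'n \<Rightarrow> 'n tractor list \<Rightarrow> real"

definition form_section ::
    "('a, 'n::finite) chart set \<Rightarrow> ('a, 'n) metric set \<Rightarrow> 'a set \<Rightarrow> nat \<Rightarrow> ('a, 'n) tractor_form \<Rightarrow> bool"
  where
  "form_section A c S k \<Psi> \<longleftrightarrow>
     (\<forall>g\<in>c. \<forall>u\<in>A.
        (\<forall>x\<in>coord u ` (dom_of u \<inter> S). alternating_form k (\<Psi> g u x)) \<and>
        (\<forall>Vs. length Vs = k \<longrightarrow> smooth_on_subset (coord u ` (dom_of u \<inter> S)) (\<lambda>x. \<Psi> g u x Vs))) \<and>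
     (\<forall>g\<in>c. \<forall>g'\<in>c. \<forall>\<Omega>. rescaling A \<Omega> g g' \<longrightarrow>
        (\<forall>u\<in>A. \<forall>v\<in>A. \<forall>p\<in>dom_of u \<inter> dom_of v \<inter> S. \<forall>Vs. length Vs = k \<longrightarrow>
           \<Psi> g' v (coord v p) (map (tractor_change g u \<Omega> v p) Vs) = \<Psi> g u (coord u p) Vs))"

definition nowhere_zero ::
    "('a, 'n::finite) chart set \<Rightarrow> ('a, 'n) metric set \<Rightarrow> 'a set \<Rightarrow> nat \<Rightarrow> ('a, 'n) tractor_form \<Rightarrow> bool"
  where
  "nowhere_zero A c S k \<Psi> \<longleftrightarrow>
     (\<forall>g\<in>c. \<forall>u\<in>A. \<forall>x\<in>coord u ` (dom_of u \<inter> S). \<exists>Vs. length Vs = k \<and> \<Psi> g u x Vs \<noteq> 0)"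

definition contract :: "'v \<Rightarrow> ('v list \<Rightarrow> real) \<Rightarrow> 'v list \<Rightarrow> real" where
  "contract X \<alpha> = (\<lambda>Vs. \<alpha> (X # Vs))"

text \<open>\<open>X \<and> \<alpha>\<close>, with \<open>X\<close> turned into a 1-form by the tractor metric.\<close>

definition wedge_vector ::
    "real^'n^'n \<Rightarrow> 'n::finite tractor \<Rightarrow> ('n tractor list \<Rightarrow> real) \<Rightarrow> 'n tractor list \<Rightarrow> real" where
  "wedge_vector M X \<alpha> Vs =
     (\<Sum>k<length Vs. (-1) ^ k * tractor_metric M X (Vs ! k) * \<alpha> (take k Vs @ drop (Suc k) Vs))"

text \<open>The Leibniz rule, with the arguments having constant components.\<close>

definition form_nabla ::
    "(real^'n \<Rightarrow> real^'n^'n) \<Rightarrow> 'n::finite \<Rightarrow> (real^'n \<Rightarrow> 'n tractor list \<Rightarrow> real) \<Rightarrow> real^'n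
      \<Rightarrow> 'n tractor list \<Rightarrow> real" where
  "form_nabla G i \<psi> x Vs = pdiff i (\<lambda>y. \<psi> y Vs) x -
     (\<Sum>k<length Vs. \<psi> x (Vs[k := connection_form G x i (Vs ! k)]))"


subsection \<open>Volume form and Hodge star\<close>

text \<open>The frame \<open>(1,0,0), (0,dx\<^sup>a,0), (0,0,1)\<close>, listed after choosing once and for all an enumeration
  of the index type; this convention fixes the orientation of the tractor bundle induced by that of
  the manifold. The Gram determinant of the tractor metric in this frame is, up to sign, the inverse
  of \<open>det g\<close>.\<close>

definition frame_list :: "'n::finite tractor list" where
  "frame_list = (1, 0, 0) #
     map (\<lambda>a. (0, axis a 1, 0)) (SOME is. distinct is \<and> set is = (UNIV :: 'n set)) @ [(0, 0, 1)]"

definition volume_form :: "real^'n^'n \<Rightarrow> 'n::finite tractor list \<Rightarrow> real" where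
  "volume_form M Vs = inverse (sqrt (det M)) *
     (\<Sum>\<pi> | \<pi> permutes {..<CARD('n) + 2}. of_int (sign \<pi>) *
        (\<Prod>k<CARD('n) + 2. (Vs ! k) \<bullet> (frame_list ! \<pi> k)))"

text \<open>\<open>sharp M \<theta>\<close> is the tractor with \<open>h(sharp M \<theta>, V) = \<theta> \<bullet> V\<close>, where the right hand side is the
  Euclidean product of components; so \<open>sharp M\<close> maps the frame to its \<open>h\<close>-dual frame.\<close>

definition sharp :: "real^'n^'n \<Rightarrow> 'n::finite tractor \<Rightarrow> 'n tractor" where
  "sharp M \<theta> = (case \<theta> of (\<alpha>, \<beta>, \<gamma>) \<Rightarrow> (\<gamma>, M *v \<beta>, \<alpha>))"

text \<open>\<open>(\<star>\<alpha>)\<^sub>B\<^sub>1\<^sub>B\<^sub>2\<^sub>\<dots> = (1/d!) \<alpha>\<^sup>A\<^sup>1\<^sup>\<dots>\<^sup>A\<^sup>d \<epsilon>\<^sub>A\<^sub>1\<^sub>\<dots>\<^sub>A\<^sub>d\<^sub>B\<^sub>1\<^sub>B\<^sub>2\<^sub>\<dots>\<close> for a form \<open>\<alpha>\<close> of degree \<open>d\<close>.\<close>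

definition hodge_star ::
    "nat \<Rightarrow> real^'n^'n \<Rightarrow> ('n::finite tractor list \<Rightarrow> real) \<Rightarrow> 'n tractor list \<Rightarrow> real" where
  "hodge_star d M \<alpha> Ws = inverse (fact d) *
     (\<Sum>es | length es = d \<and> set es \<subseteq> set frame_list.
        \<alpha> (map (sharp M) es) * volume_form M (es @ Ws))"

definition hodge_star_field :: "nat \<Rightarrow> ('a, 'n::finite) tractor_form \<Rightarrow> ('a, 'n) tractor_form" where
  "hodge_star_field d \<Psi> = (\<lambda>g u x. hodge_star d (g u x) (\<Psi> g u x))"


section \<open>Submanifolds\<close>

text \<open>\<open>slice_chart A d S u K\<close>: in the chart \<open>u\<close> the set \<open>S\<close> is cut out by the vanishing of the \<open>d\<close>
  coordinates with index in \<open>K\<close>. In such a chart the index \<open>i\<close> of \<open>T\<Sigma>\<close> ranges over the complement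
  of \<open>K\<close>, and \<open>\<nabla>\<^sub>i\<close> along \<open>S\<close> only involves derivatives along the slice.\<close>

definition slice_chart ::
    "('a, 'n::finite) chart set \<Rightarrow> nat \<Rightarrow> 'a set \<Rightarrow> ('a, 'n) chart \<Rightarrow> 'n set \<Rightarrow> bool" where
  "slice_chart A d S u K \<longleftrightarrow> u \<in> A \<and> card K = d \<and>
     coord u ` (dom_of u \<inter> S) = coord u ` dom_of u \<inter> {x. \<forall>k\<in>K. x $ k = 0}"

definition embedded_submanifold :: "('a, 'n::finite) chart set \<Rightarrow> nat \<Rightarrow> 'a set \<Rightarrow> bool" where
  "embedded_submanifold A d S \<longleftrightarrow> (\<forall>p\<in>S. \<exists>u K. slice_chart A d S u K \<and> p \<in> dom_of u)"

text \<open>The block of \<open>B\<close> with indices outside \<open>K\<close>, completed to a square matrix by the identity on \<open>K\<close>;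
  its determinant and the corresponding block of its inverse are those of the tangential block.\<close>

definition tangential_block :: "'n set \<Rightarrow> real^'n^'n \<Rightarrow> real^'n::finite^'n" where
  "tangential_block K B = (\<chi> i j. if i \<in> K \<or> j \<in> K then (if i = j then 1 else 0) else B $ i $ j)"

text \<open>Orientability of \<open>S\<close>: an atlas of slice charts inducing an oriented atlas of \<open>S\<close>.
  After permuting coordinates and changing their signs, the same \<open>K\<close> can be used for all charts.\<close>

definition orientable_submanifold :: "('a, 'n::finite) chart set \<Rightarrow> nat \<Rightarrow> 'a set \<Rightarrow> bool" where
  "orientable_submanifold A d S \<longleftrightarrow>
     (\<exists>K B. (\<forall>u\<in>B. slice_chart A d S u K) \<and> S \<subseteq> (\<Union>u\<in>B. dom_of u) \<and>
        (\<forall>u\<in>B. \<forall>v\<in>B. \<forall>p\<in>dom_of u \<inter> dom_of v \<inter> S. det (tangential_block K (jac u v p)) > 0))"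

text \<open>Orthogonal projection onto a subspace on which the symmetric bilinear form \<open>b\<close> is nondegenerate.\<close>

definition orth_proj :: "('v::real_vector \<Rightarrow> 'v \<Rightarrow> real) \<Rightarrow> 'v set \<Rightarrow> 'v \<Rightarrow> 'v" where
  "orth_proj b T v = (THE w. w \<in> T \<and> (\<forall>z\<in>T. b (v - w) z = 0))"

definition normal_space :: "real^'n^'n \<Rightarrow> 'n set \<Rightarrow> (real^'n::finite) set" where
  "normal_space M K = {n. \<forall>v. (\<forall>k\<in>K. v $ k = 0) \<longrightarrow> v \<bullet> (M *v n) = 0}"

definition second_ff ::
    "(real^'n \<Rightarrow> real^'n^'n) \<Rightarrow> 'n::finite set \<Rightarrow> real^'n \<Rightarrow> 'n \<Rightarrow> 'n \<Rightarrow> real^'n" where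
  "second_ff G K x i j =
     orth_proj (\<lambda>v w. v \<bullet> (G x *v w)) (normal_space (G x) K) (christoffel G x i j)"

definition mean_curvature ::
    "(real^'n \<Rightarrow> real^'n^'n) \<Rightarrow> 'n::finite set \<Rightarrow> real^'n \<Rightarrow> real^'n" where
  "mean_curvature G K x = inverse (real (CARD('n) - card K)) *\<^sub>R
     (\<Sum>i\<in>-K. \<Sum>j\<in>-K. matrix_inv (tangential_block K (G x)) $ i $ j *\<^sub>R second_ff G K x i j)"

definition normal_tractors ::
    "(real^'n \<Rightarrow> real^'n^'n) \<Rightarrow> 'n::finite set \<Rightarrow> real^'n \<Rightarrow> 'n tractor set" where
  "normal_tractors G K x =
     (\<lambda>n. (0, G x *v n, (G x *v n) \<bullet> mean_curvature G K x)) ` normal_space (G x) K"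

definition perp_section ::
    "('a, 'n::finite) chart set \<Rightarrow> ('a, 'n) metric set \<Rightarrow> nat \<Rightarrow> 'a set \<Rightarrow> ('a, 'n) tractor_field \<Rightarrow> bool"
  where
  "perp_section A c d S V \<longleftrightarrow> tractor_section A c S V \<and>
     (\<forall>g\<in>c. \<forall>u K. slice_chart A d S u K \<longrightarrow>
        (\<forall>x\<in>coord u ` (dom_of u \<inter> S). \<forall>Z\<in>normal_tractors (g u) K x.
           tractor_metric (g u x) (V g u x) Z = 0))"

definition tractor_second_ff ::
    "(real^'n \<Rightarrow> real^'n^'n) \<Rightarrow> 'n::finite set \<Rightarrow> 'n \<Rightarrow> (real^'n \<Rightarrow> 'n tractor) \<Rightarrow> real^'n \<Rightarrow> 'n tractor"
  where
  "tractor_second_ff G K i V x =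
     orth_proj (tractor_metric (G x)) (normal_tractors G K x) (tractor_nabla G i V x)"

text \<open>The tractor second fundamental form is a bundle map; its vanishing is tested on all
  local sections of the orthogonal complement of the normal tractor bundle, that is on sections over
  relatively open subsets of \<open>S\<close>.\<close>

definition distinguished ::
    "('a::topological_space, 'n::finite) chart set \<Rightarrow> ('a, 'n) metric set \<Rightarrow> nat \<Rightarrow> 'a set \<Rightarrow> bool" where
  "distinguished A c d S \<longleftrightarrow>
     (\<forall>W V. open W \<longrightarrow> perp_section A c d (S \<inter> W) V \<longrightarrow>
        (\<forall>g\<in>c. \<forall>u K. slice_chart A d (S \<inter> W) u K \<longrightarrow>
           (\<forall>x\<in>coord u ` (dom_of u \<inter> (S \<inter> W)). \<forall>i\<in>-K. tractor_second_ff (g u) K i (V g u) x = 0)))"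

definition parallel_along ::
    "('a, 'n::finite) chart set \<Rightarrow> ('a, 'n) metric set \<Rightarrow> nat \<Rightarrow> 'a set \<Rightarrow> nat \<Rightarrow> ('a, 'n) tractor_form \<Rightarrow> bool"
  where
  "parallel_along A c d S k \<Psi> \<longleftrightarrow>
     (\<forall>g\<in>c. \<forall>u K. slice_chart A d S u K \<longrightarrow>
        (\<forall>x\<in>coord u ` (dom_of u \<inter> S). \<forall>i\<in>-K. \<forall>Vs. length Vs = k \<longrightarrow>
           form_nabla (g u) i (\<Psi> g u) x Vs = 0))"

definition X_contraction_zero ::
    "('a, 'n::finite) chart set \<Rightarrow> ('a, 'n) metric set \<Rightarrow> 'a set \<Rightarrow> nat \<Rightarrow> ('a, 'n) tractor_form \<Rightarrow> bool"
  where
  "X_contraction_zero A c S k \<Psi> \<longleftrightarrow>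
     (\<forall>g\<in>c. \<forall>u\<in>A. \<forall>x\<in>coord u ` (dom_of u \<inter> S). \<forall>Vs. length Vs + 1 = k \<longrightarrow>
        contract canonical_tractor (\<Psi> g u x) Vs = 0)"

definition X_wedge_zero ::
    "('a, 'n::finite) chart set \<Rightarrow> ('a, 'n) metric set \<Rightarrow> 'a set \<Rightarrow> nat \<Rightarrow> ('a, 'n) tractor_form \<Rightarrow> bool"
  where
  "X_wedge_zero A c S k \<Psi> \<longleftrightarrow>
     (\<forall>g\<in>c. \<forall>u\<in>A. \<forall>x\<in>coord u ` (dom_of u \<inter> S). \<forall>Vs. length Vs = k + 1 \<longrightarrow>
        wedge_vector (g u x) canonical_tractor (\<Psi> g u x) Vs = 0)"

end

theory Submission
  imports Defs
begin

text \<open>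
  In a slice chart the normal bundle \<open>\<N>\<close> is spanned by the tractors \<open>(0, dx\<^sup>k, H\<^sup>k)\<close> with \<open>k \<in> K\<close>, so
  \<open>\<N>\<close>-perp is the common kernel of \<open>d\<close> functionals.

  Let \<open>\<Psi>\<close> be parallel with \<open>X \<lrcorner> \<Psi> = 0\<close>. Differentiating along \<open>\<Sigma>\<close>, the tractors \<open>\<nabla>\<^sub>i X\<close> and
  \<open>\<nabla>\<^sub>j \<nabla>\<^sub>i X\<close> are annihilated by \<open>\<Psi>\<close> too. Together with \<open>X\<close>, the tangential trace of the latter, whose
  middle slot carries the mean curvature, and the former span \<open>\<N>\<close>-perp. As this has codimension \<open>d\<close>,
  it is the whole annihilator of \<open>\<Psi> \<noteq> 0\<close>; the annihilator of a parallel form is preserved by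
  \<open>\<nabla>\<^sub>i\<close>, so the tractor second fundamental form vanishes.

  Conversely, if \<open>\<Sigma>\<close> is distinguished then \<open>\<N>\<close> is preserved by the metric connection \<open>\<nabla>\<^sub>i\<close>, and its
  volume form, the determinant of the \<open>d\<close> functionals divided by the square root of their Gram
  determinant, is parallel. The orientations of \<open>M\<close> and \<open>\<Sigma>\<close> fix its sign globally.

  The Hodge star is injective and parallel, and \<open>X \<and> \<star>\<Psi> = \<plusminus> \<star>(X \<lrcorner> \<Psi>)\<close>; this relates forms of degree
  \<open>d\<close> and \<open>n + 2 - d\<close>.
\<close>

section \<open>Calculus of smooth maps\<close>

text \<open>Everything is reduced to the functionals \<open>wcomp\<close> in one scale and one slice
  chart at a time. They use a trace of Christoffel symbols, \<open>mcurv\<close>, in place of the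
  projected mean curvature: the two agree in the coordinates of \<open>K\<close>, and the former is
  smooth at sight. Distinguishedness makes the covariant derivative of each functional vanish on
  their common kernel, hence a combination of the functionals; the trace of the coefficient matrix
  is what the Gram determinant absorbs. The obstacle is that a test section for the tractor second
  fundamental form must be a section in all scales and charts at once. It is built in one scale and
  transported, which requires the transformation law of the mean curvature; there the Hessian of the
  transition map drops out because it is tangential along the submanifold. For the Hodge star, a sum
  over lists of basis vectors depends only on the inverse tractor metric, as the sum of
  \<open>sharp e \<otimes> e\<close>. Its invariance and parallelism are passed to the star by
  changing one slot at a time.\<close>

lemma has_derivative_cong_open:
  assumes "open U" "x \<in> U" "\<And>y. y \<in> U \<Longrightarrow> f y = g y"
  shows "(f has_derivative D) (at x) \<longleftrightarrow> (g has_derivative D) (at x)"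
  using assms by (metis has_derivative_transform_within_open)

lemma frechet_derivative_cong_open:
  assumes "open U" "x \<in> U" "\<And>y. y \<in> U \<Longrightarrow> f y = g y"
  shows "frechet_derivative f (at x) = frechet_derivative g (at x)"
proof -
  have "(f has_derivative D) (at x) \<longleftrightarrow> (g has_derivative D) (at x)" for D
    using assms by (rule has_derivative_cong_open)
  then show ?thesis unfolding frechet_derivative_def by simp
qed

text \<open>Openness of \<open>U\<close> makes the functions agree near each point, so their
  derivatives agree on \<open>U\<close> too and the induction can go on with the directional
  derivatives.\<close>

lemma Ck_on_cong:
  assumes "open U" "\<And>x. x \<in> U \<Longrightarrow> f x = g x" "Ck_on k U f"
  shows "Ck_on k U g"
  using assms(2,3)
proof (induction k arbitrary: f g)
  case 0
  then show ?case by (simp cong: continuous_on_cong)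
next
  case (Suc k)
  have fd: "frechet_derivative f (at x) = frechet_derivative g (at x)" if "x \<in> U" for x
    by (rule frechet_derivative_cong_open[OF assms(1) that Suc.prems(1)])
  have "g differentiable (at x)" if "x \<in> U" for x
  proof -
    have "(f has_derivative D) (at x) \<longleftrightarrow> (g has_derivative D) (at x)" for D
      by (rule has_derivative_cong_open[OF assms(1) that Suc.prems(1)])
    then show ?thesis using Suc.prems(2) that unfolding Ck_on.simps differentiable_def by metis
  qed
  moreover have "Ck_on k U (\<lambda>x. frechet_derivative g (at x) v)" for v
    using Suc.IH[of "\<lambda>x. frechet_derivative f (at x) v"] Suc.prems fd by simp
  ultimately show ?case by simp
qed

lemma Ck_on_SucI:
  assumes "open U" "\<And>x. x \<in> U \<Longrightarrow> (f has_derivative f' x) (at x)"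
    and "\<And>v. Ck_on k U (\<lambda>x. f' x v)"
  shows "Ck_on (Suc k) U f"
proof -
  have "f' x v = frechet_derivative f (at x) v" if "x \<in> U" for x v
    using frechet_derivative_at[OF assms(2)[OF that]] by simp
  then have "Ck_on k U (\<lambda>x. frechet_derivative f (at x) v)" for v
    using Ck_on_cong[OF assms(1) _ assms(3)[of v], of "\<lambda>x. frechet_derivative f (at x) v"] by simp
  moreover have "f differentiable (at x)" if "x \<in> U" for x
    using assms(2)[OF that] unfolding differentiable_def by blast
  ultimately show ?thesis by simp
qed

lemma Ck_on_SucD:
  assumes "Ck_on (Suc k) U f" "x \<in> U"
  shows "(f has_derivative frechet_derivative f (at x)) (at x)"
  using assms by (simp add: frechet_derivative_works[symmetric])

lemma Ck_on_Suc_imp: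
  assumes "Ck_on (Suc k) U f" shows "Ck_on k U f"
  using assms
proof (induction k arbitrary: f)
  case 0
  then have "f differentiable (at x)" if "x \<in> U" for x using that by simp
  then show ?case
    by (simp add: continuous_at_imp_continuous_on differentiable_imp_continuous_within)
qed auto

lemma Ck_on_imp_continuous: "Ck_on k U f \<Longrightarrow> continuous_on U f"
proof (induction k)
  case 0
  then show ?case by simp
next
  case (Suc k)
  then show ?case using Ck_on_Suc_imp by blast
qed

lemma Ck_on_subset: "Ck_on k U f \<Longrightarrow> V \<subseteq> U \<Longrightarrow> Ck_on k V f"
  by (induction k arbitrary: f) (auto intro: continuous_on_subset)

lemma Ck_on_const:
  assumes "open U" shows "Ck_on k U (\<lambda>x. c)"
proof (induction k arbitrary: c)
  case (Suc k)
  show ?case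
    by (rule Ck_on_SucI[where f' = "\<lambda>_ _. 0"]) (rule assms has_derivative_const Suc)+
qed simp

lemma Ck_on_linear:
  assumes "bounded_linear L" "open U" "Ck_on k U f"
  shows "Ck_on k U (\<lambda>x. L (f x))"
  using assms(3)
proof (induction k arbitrary: f)
  case 0
  then show ?case using assms(1) by (simp add: bounded_linear.continuous_on)
next
  case (Suc k)
  show ?case
    by (rule Ck_on_SucI[where f' = "\<lambda>x v. L (frechet_derivative f (at x) v)"])
       (use assms Suc bounded_linear.has_derivative[OF assms(1) Ck_on_SucD[OF Suc.prems]] in auto)
qed

lemma Ck_on_ident:
  assumes "open U" shows "Ck_on k U (\<lambda>x. x)"
proof (cases k)
  case (Suc k)
  show ?thesis unfolding Suc
    by (rule Ck_on_SucI[where f' = "\<lambda>x v. v"])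
       (simp_all del: Ck_on.simps add: assms Ck_on_const)
qed simp

lemma Ck_on_add:
  assumes "open U" "Ck_on k U f" "Ck_on k U g"
  shows "Ck_on k U (\<lambda>x. f x + g x)"
  using assms(2,3)
proof (induction k arbitrary: f g)
  case 0
  then show ?case by (simp add: continuous_on_add)
next
  case (Suc k)
  have "Ck_on k U (\<lambda>x. frechet_derivative f (at x) v + frechet_derivative g (at x) v)" for v
    by (rule Suc.IH) (use Suc.prems in simp_all)
  then show ?case
    by (rule Ck_on_SucI[where f' = "\<lambda>x v. frechet_derivative f (at x) v + frechet_derivative g (at x) v",
          OF assms(1), rotated])
       (intro has_derivative_add Ck_on_SucD[OF Suc.prems(1)] Ck_on_SucD[OF Suc.prems(2)])
qed

lemma Ck_on_sum:
  assumes "open U" "\<And>i. i \<in> I \<Longrightarrow> Ck_on k U (f i)"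
  shows "Ck_on k U (\<lambda>x. \<Sum>i\<in>I. f i x)"
  using assms(2)
  by (induction I rule: infinite_finite_induct) (simp_all add: Ck_on_const Ck_on_add assms(1))

lemma Ck_on_bilinear:
  assumes "bounded_bilinear B" "open U" "Ck_on k U f" "Ck_on k U g"
  shows "Ck_on k U (\<lambda>x. B (f x) (g x))"
  using assms(3,4)
proof (induction k arbitrary: f g)
  case 0
  then show ?case using assms(1) by (simp add: bounded_bilinear.continuous_on)
next
  case (Suc k)
  have "Ck_on k U (\<lambda>x. frechet_derivative f (at x) v)" "Ck_on k U (\<lambda>x. frechet_derivative g (at x) v)" for v
    using Suc.prems by simp_all
  then have "Ck_on k U (\<lambda>x. B (f x) (frechet_derivative g (at x) v) + B (frechet_derivative f (at x) v) (g x))" for v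
    by (intro Ck_on_add Suc.IH assms(2) Suc.prems[THEN Ck_on_Suc_imp])
  then show ?case
    by (rule Ck_on_SucI[where f' = "\<lambda>x v. B (f x) (frechet_derivative g (at x) v)
            + B (frechet_derivative f (at x) v) (g x)", OF assms(2), rotated])
       (intro bounded_bilinear.FDERIV[OF assms(1)] Ck_on_SucD[OF Suc.prems(1)] Ck_on_SucD[OF Suc.prems(2)])
qed

text \<open>The derivative of the inverse contains the inverse itself only undifferentiated, so its
  regularity of order \<open>k\<close> gives order \<open>Suc k\<close>.\<close>

lemma Ck_on_inverse:
  fixes f :: "'a::real_normed_vector \<Rightarrow> real"
  assumes "open U" "Ck_on k U f" "\<And>x. x \<in> U \<Longrightarrow> f x \<noteq> 0"
  shows "Ck_on k U (\<lambda>x. inverse (f x))"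
  using assms(2)
proof (induction k)
  case 0
  then show ?case using assms(3) by (auto intro: continuous_intros)
next
  case (Suc k)
  have "Ck_on k U (\<lambda>x. inverse (f x))"
    using Suc Ck_on_Suc_imp by blast
  moreover have "Ck_on k U (\<lambda>x. frechet_derivative f (at x) v)" for v
    using Suc.prems by simp
  ultimately have "Ck_on k U (\<lambda>x. - (inverse (f x) * frechet_derivative f (at x) v * inverse (f x)))" for v
    by (intro Ck_on_linear[OF bounded_linear_minus[OF bounded_linear_ident]]
          Ck_on_bilinear[OF bounded_bilinear_mult] assms(1))
  moreover have "((\<lambda>x. inverse (f x)) has_derivative
     (\<lambda>v. - (inverse (f x) * frechet_derivative f (at x) v * inverse (f x)))) (at x)" if "x \<in> U" for x
    by (rule Deriv.has_derivative_inverse[OF assms(3)[OF that] Ck_on_SucD[OF Suc.prems that]])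
  ultimately show ?case
    by (rule Ck_on_SucI[OF assms(1),
          where f' = "\<lambda>x v. - (inverse (f x) * frechet_derivative f (at x) v * inverse (f x))", rotated])
qed

text \<open>Same bootstrap as for the inverse: the root occurs undifferentiated in its own
  derivative.\<close>

lemma Ck_on_sqrt:
  fixes f :: "'a::real_normed_vector \<Rightarrow> real"
  assumes "open U" "Ck_on k U f" "\<And>x. x \<in> U \<Longrightarrow> f x > 0"
  shows "Ck_on k U (\<lambda>x. sqrt (f x))"
  using assms(2)
proof (induction k)
  case 0
  then show ?case by (auto intro: continuous_intros)
next
  case (Suc k)
  have "Ck_on k U (\<lambda>x. sqrt (f x))"
    using Suc Ck_on_Suc_imp by blast
  moreover have "Ck_on k U (\<lambda>x. frechet_derivative f (at x) v)" for v
    using Suc.prems by simp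
  moreover have "sqrt (f x) \<noteq> 0" if "x \<in> U" for x using assms(3)[OF that] by simp
  ultimately have "Ck_on k U (\<lambda>x. (inverse (sqrt (f x)) * (1/2)) * frechet_derivative f (at x) v)" for v
    by (intro Ck_on_bilinear[OF bounded_bilinear_mult] Ck_on_const Ck_on_inverse assms(1))
  moreover have "((\<lambda>x. sqrt (f x)) has_derivative
     (\<lambda>v. (inverse (sqrt (f x)) * (1/2)) * frechet_derivative f (at x) v)) (at x)" if "x \<in> U" for x
    by (rule has_derivative_eq_rhs[OF DERIV_compose_FDERIV[OF DERIV_real_sqrt[OF assms(3)[OF that]]
          Ck_on_SucD[OF Suc.prems that]]]) (simp add: fun_eq_iff)
  ultimately show ?case
    by (rule Ck_on_SucI[OF assms(1),
          where f' = "\<lambda>x v. (inverse (sqrt (f x)) * (1/2)) * frechet_derivative f (at x) v", rotated])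
qed

text \<open>The chain rule applies a varying linear map to a varying vector. Expanding the vector in
  the basis of the Euclidean middle space turns this into a finite sum of products, to whose factors
  the induction applies.\<close>

lemma Ck_on_compose:
  fixes g :: "'a::real_normed_vector \<Rightarrow> 'b::euclidean_space"
  assumes "open U" "open V" "\<And>x. x \<in> U \<Longrightarrow> g x \<in> V" "Ck_on k U g" "Ck_on k V f"
  shows "Ck_on k U (\<lambda>x. f (g x))"
  using assms(4,5)
proof (induction k arbitrary: f)
  case 0
  then show ?case using assms(3) by (auto intro: continuous_on_compose2)
next
  case (Suc k)
  let ?f' = "\<lambda>x v. \<Sum>b\<in>Basis. (frechet_derivative g (at x) v \<bullet> b) *\<^sub>R frechet_derivative f (at (g x)) b"
  have "((\<lambda>x. f (g x)) has_derivative ?f' x) (at x)" if x: "x \<in> U" for x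
  proof -
    have f: "(f has_derivative frechet_derivative f (at (g x))) (at (g x))"
      using Ck_on_SucD[OF Suc.prems(2)] assms(3)[OF x] by blast
    have "frechet_derivative f (at (g x)) (frechet_derivative g (at x) v) = ?f' x v" for v
    proof -
      have l: "linear (frechet_derivative f (at (g x)))" using f has_derivative_linear by blast
      have "frechet_derivative f (at (g x)) (\<Sum>b\<in>Basis. (frechet_derivative g (at x) v \<bullet> b) *\<^sub>R b) = ?f' x v"
        by (simp add: linear_sum[OF l] linear_scale[OF l])
      then show ?thesis by (simp add: euclidean_representation)
    qed
    then show ?thesis
      using has_derivative_compose[OF Ck_on_SucD[OF Suc.prems(1) x] f] by simp
  qed
  moreover have "Ck_on k U (\<lambda>x. ?f' x v)" for v
    by (intro Ck_on_sum Ck_on_bilinear[OF bounded_bilinear_scaleR] Ck_on_linear[OF bounded_linear_inner_left]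
          Suc.IH assms(1) Ck_on_Suc_imp[OF Suc.prems(1)]) (use Suc.prems in auto)
  ultimately show ?case by (intro Ck_on_SucI[OF assms(1)])
qed

lemma smooth_on_cong:
  "open U \<Longrightarrow> (\<And>x. x \<in> U \<Longrightarrow> f x = g x) \<Longrightarrow> smooth_on U f \<Longrightarrow> smooth_on U g"
  unfolding smooth_on_def using Ck_on_cong by blast

lemma smooth_on_subset': "smooth_on U f \<Longrightarrow> V \<subseteq> U \<Longrightarrow> smooth_on V f"
  unfolding smooth_on_def using Ck_on_subset by blast

lemma smooth_on_continuous: "smooth_on U f \<Longrightarrow> continuous_on U f"
  unfolding smooth_on_def using Ck_on_imp_continuous by blast

lemma smooth_on_has_derivative:
  "smooth_on U f \<Longrightarrow> x \<in> U \<Longrightarrow> (f has_derivative frechet_derivative f (at x)) (at x)"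
  unfolding smooth_on_def using Ck_on_SucD by blast

lemma smooth_on_derivative: "smooth_on U f \<Longrightarrow> smooth_on U (\<lambda>x. frechet_derivative f (at x) v)"
  unfolding smooth_on_def by (metis Ck_on.simps(2))

named_theorems smooth

lemma smooth_on_const [smooth]: "open U \<Longrightarrow> smooth_on U (\<lambda>x. c)"
  unfolding smooth_on_def using Ck_on_const by blast

lemma smooth_on_ident [smooth]: "open U \<Longrightarrow> smooth_on U (\<lambda>x. x)"
  unfolding smooth_on_def using Ck_on_ident by blast

lemma smooth_on_linear:
  "bounded_linear L \<Longrightarrow> open U \<Longrightarrow> smooth_on U f \<Longrightarrow> smooth_on U (\<lambda>x. L (f x))"
  unfolding smooth_on_def using Ck_on_linear by blast

lemma smooth_on_add [smooth]:
  "open U \<Longrightarrow> smooth_on U f \<Longrightarrow> smooth_on U g \<Longrightarrow> smooth_on U (\<lambda>x. f x + g x)"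
  unfolding smooth_on_def using Ck_on_add by blast

lemma smooth_on_sum [smooth]:
  "open U \<Longrightarrow> (\<And>i. i \<in> I \<Longrightarrow> smooth_on U (f i)) \<Longrightarrow> smooth_on U (\<lambda>x. \<Sum>i\<in>I. f i x)"
  unfolding smooth_on_def using Ck_on_sum[of U I _ f] by blast

lemma smooth_on_bilinear:
  "bounded_bilinear B \<Longrightarrow> open U \<Longrightarrow> smooth_on U f \<Longrightarrow> smooth_on U g \<Longrightarrow> smooth_on U (\<lambda>x. B (f x) (g x))"
  unfolding smooth_on_def using Ck_on_bilinear by blast

lemmas smooth_on_mult [smooth] = smooth_on_bilinear[OF bounded_bilinear_mult]
lemmas smooth_on_scaleR [smooth] = smooth_on_bilinear[OF bounded_bilinear_scaleR]
lemmas smooth_on_inner [smooth] = smooth_on_bilinear[OF bounded_bilinear_inner]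
lemmas smooth_on_minus [smooth] = smooth_on_linear[OF bounded_linear_minus[OF bounded_linear_ident]]
lemmas smooth_on_nth [smooth] = smooth_on_linear[OF bounded_linear_vec_nth]
lemmas smooth_on_fst [smooth] = smooth_on_linear[OF bounded_linear_fst]
lemmas smooth_on_snd [smooth] = smooth_on_linear[OF bounded_linear_snd]

lemma smooth_on_diff [smooth]:
  "open U \<Longrightarrow> smooth_on U f \<Longrightarrow> smooth_on U g \<Longrightarrow> smooth_on U (\<lambda>x. f x - g x)"
  using smooth_on_add[OF _ _ smooth_on_minus, of U f g] by simp

lemma smooth_on_prod [smooth]:
  fixes f :: "'i \<Rightarrow> 'a::real_normed_vector \<Rightarrow> real"
  shows "open U \<Longrightarrow> (\<And>i. i \<in> I \<Longrightarrow> smooth_on U (f i)) \<Longrightarrow> smooth_on U (\<lambda>x. \<Prod>i\<in>I. f i x)"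
  by (induction I rule: infinite_finite_induct) (auto intro: smooth)

lemma smooth_on_inverse [smooth]:
  fixes f :: "'a::real_normed_vector \<Rightarrow> real"
  shows "open U \<Longrightarrow> smooth_on U f \<Longrightarrow> (\<And>x. x \<in> U \<Longrightarrow> f x \<noteq> 0) \<Longrightarrow> smooth_on U (\<lambda>x. inverse (f x))"
  unfolding smooth_on_def using Ck_on_inverse by blast

lemma smooth_on_sqrt [smooth]:
  fixes f :: "'a::real_normed_vector \<Rightarrow> real"
  shows "open U \<Longrightarrow> smooth_on U f \<Longrightarrow> (\<And>x. x \<in> U \<Longrightarrow> f x > 0) \<Longrightarrow> smooth_on U (\<lambda>x. sqrt (f x))"
  unfolding smooth_on_def using Ck_on_sqrt by blast

lemma smooth_on_compose:
  fixes g :: "'a::real_normed_vector \<Rightarrow> 'b::euclidean_space"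
  shows "open U \<Longrightarrow> open V \<Longrightarrow> (\<And>x. x \<in> U \<Longrightarrow> g x \<in> V) \<Longrightarrow> smooth_on U g \<Longrightarrow> smooth_on V f
    \<Longrightarrow> smooth_on U (\<lambda>x. f (g x))"
  unfolding smooth_on_def using Ck_on_compose by blast

lemma smooth_on_euclidean:
  fixes f :: "'a::real_normed_vector \<Rightarrow> 'b::euclidean_space"
  assumes "open U" "\<And>b. b \<in> Basis \<Longrightarrow> smooth_on U (\<lambda>x. f x \<bullet> b)"
  shows "smooth_on U f"
proof -
  have "smooth_on U (\<lambda>x. \<Sum>b\<in>Basis. (f x \<bullet> b) *\<^sub>R b)"
    by (intro smooth_on_sum smooth_on_scaleR smooth_on_const assms)
  then show ?thesis by (simp add: euclidean_representation)
qed

lemma smooth_on_vec_lambda [smooth]: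
  fixes f :: "'n::finite \<Rightarrow> 'a::real_normed_vector \<Rightarrow> 'b::euclidean_space"
  assumes "open U" "\<And>i. smooth_on U (f i)"
  shows "smooth_on U (\<lambda>x. \<chi> i. f i x)"
proof (rule smooth_on_euclidean[OF assms(1)])
  fix b :: "'b^'n" assume "b \<in> Basis"
  then obtain i u where "b = axis i u" by (auto simp: Basis_vec_def)
  then show "smooth_on U (\<lambda>x. (\<chi> i. f i x) \<bullet> b)"
    using assms by (auto simp: inner_axis intro!: smooth)
qed

lemma smooth_on_Pair [smooth]:
  fixes f :: "'a::real_normed_vector \<Rightarrow> 'b::euclidean_space" and g :: "'a \<Rightarrow> 'c::euclidean_space"
  assumes "open U" "smooth_on U f" "smooth_on U g"
  shows "smooth_on U (\<lambda>x. (f x, g x))"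
proof (rule smooth_on_euclidean[OF assms(1)])
  fix b :: "'b \<times> 'c"
  have "smooth_on U (\<lambda>x. f x \<bullet> fst b + g x \<bullet> snd b)"
    by (intro smooth assms)
  then show "smooth_on U (\<lambda>x. (f x, g x) \<bullet> b)" by (simp add: inner_prod_def)
qed

lemma smooth_on_det [smooth]:
  fixes f :: "'a::real_normed_vector \<Rightarrow> real^'n^'n"
  assumes "open U" "smooth_on U f"
  shows "smooth_on U (\<lambda>x. det (f x))"
  unfolding det_def by (intro smooth assms)

section \<open>Matrix inverses and their smoothness\<close>

lemma matrix_inv_inverse:
  fixes A :: "real^'n^'n"
  assumes "det A \<noteq> 0"
  shows "A ** matrix_inv A = mat 1" "matrix_inv A ** A = mat 1"
proof -
  have "A ** matrix_inv A = mat 1 \<and> matrix_inv A ** A = mat 1"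
    unfolding matrix_inv_def
    by (rule someI_ex) (use assms invertible_det_nz[of A] in \<open>simp add: invertible_def\<close>)
  then show "A ** matrix_inv A = mat 1" "matrix_inv A ** A = mat 1" by auto
qed

lemma matrix_inv_unique:
  fixes A B :: "real^'n^'n"
  assumes "A ** B = mat 1"
  shows "matrix_inv A = B"
proof -
  have "det A * det B = 1" using assms det_mul[of A B] by simp
  then have "det A \<noteq> 0" by auto
  then have "matrix_inv A ** (A ** B) = B"
    by (simp add: matrix_mul_assoc matrix_inv_inverse)
  then show ?thesis using assms by simp
qed

text \<open>Cramer's rule with the \<open>j\<close>-th unit vector on the right. The entries of the
  inverse become quotients of determinants, whose smoothness is known.\<close>

lemma matrix_inv_cramer:
  fixes A :: "real^'n^'n"
  assumes "det A \<noteq> 0"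
  shows "matrix_inv A $ i $ j = det (\<chi> k l. if l = i then axis j 1 $ k else A $ k $ l) / det A"
proof -
  let ?x = "matrix_inv A *v axis j 1"
  have "A *v ?x = axis j 1"
    by (simp add: matrix_vector_mul_assoc matrix_inv_inverse assms)
  then have "?x = (\<chi> i. det (\<chi> k l. if l = i then axis j 1 $ k else A $ k $ l) / det A)"
    using cramer[OF assms] by blast
  moreover have "?x $ i = matrix_inv A $ i $ j"
    by (simp add: matrix_vector_mult_basis column_def)
  ultimately show ?thesis by simp
qed

lemma smooth_on_matrix_inv [smooth]:
  fixes f :: "'a::real_normed_vector \<Rightarrow> real^'n^'n"
  assumes "open U" "smooth_on U f" "\<And>x. x \<in> U \<Longrightarrow> det (f x) \<noteq> 0"
  shows "smooth_on U (\<lambda>x. matrix_inv (f x))"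
proof -
  have "smooth_on U (\<lambda>x. \<chi> i j. det (\<chi> k l. if l = i then axis j 1 $ k else f x $ k $ l) * inverse (det (f x)))"
  proof (intro smooth_on_vec_lambda smooth_on_mult smooth_on_det smooth_on_inverse assms)
    fix i j k l
    show "smooth_on U (\<lambda>x. if l = i then axis j 1 $ k else f x $ k $ l)"
      by (cases "l = i") (auto intro!: smooth assms)
  qed
  then show ?thesis
    by (rule smooth_on_cong[OF assms(1), rotated])
       (simp add: vec_eq_iff matrix_inv_cramer assms(3) divide_inverse)
qed

lemma smooth_on_matrix_vector_mult [smooth]:
  fixes M :: "'a::real_normed_vector \<Rightarrow> real^'n^'m"
  assumes "open U" "smooth_on U M" "smooth_on U v"
  shows "smooth_on U (\<lambda>x. M x *v v x)"
  unfolding matrix_vector_mult_def by (intro smooth assms)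

lemma smooth_on_transpose [smooth]:
  fixes M :: "'a::real_normed_vector \<Rightarrow> real^'n^'m"
  assumes "open U" "smooth_on U M"
  shows "smooth_on U (\<lambda>x. transpose (M x))"
  unfolding transpose_def by (intro smooth assms)

lemma has_derivative_imp_pdiff:
  fixes f :: "real^'n::finite \<Rightarrow> 'b::real_normed_vector"
  assumes "(f has_derivative f') (at x)"
  shows "((\<lambda>t. f (x + t *\<^sub>R axis i 1)) has_vector_derivative f' (axis i 1)) (at 0)"
proof -
  have "((\<lambda>t. x + t *\<^sub>R axis i 1) has_derivative (\<lambda>t. t *\<^sub>R axis i 1)) (at 0)"
    by (auto intro!: derivative_eq_intros)
  moreover have "(f has_derivative f') (at (x + 0 *\<^sub>R axis i 1))" using assms by simp
  ultimately have "((\<lambda>t. f (x + t *\<^sub>R axis i 1)) has_derivative (\<lambda>t. f' (t *\<^sub>R axis i 1))) (at 0)"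
    using has_derivative_compose by fastforce
  then show ?thesis
    unfolding has_vector_derivative_def by (simp add: linear_scale[OF has_derivative_linear[OF assms]])
qed

lemma pdiff_frechet:
  "(f has_derivative f') (at x) \<Longrightarrow> pdiff i f x = f' (axis i 1)"
  unfolding pdiff_def by (rule vector_derivative_at[OF has_derivative_imp_pdiff])

lemma smooth_on_pdiff [smooth]:
  assumes "open U" "smooth_on U f"
  shows "smooth_on U (pdiff i f)"
  by (rule smooth_on_cong[OF assms(1) _ smooth_on_derivative[OF assms(2), of "axis i 1"]])
     (rule pdiff_frechet[OF smooth_on_has_derivative[OF assms(2)], symmetric])

section \<open>Alternating forms on lists\<close>

lemma alternating_form_linear:
  "alternating_form k \<alpha> \<Longrightarrow> length xs + length ys + 1 = k \<Longrightarrow> linear (\<lambda>v. \<alpha> (xs @ v # ys))"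
  unfolding alternating_form_def by blast

lemma alternating_form_repeat:
  "alternating_form k \<alpha> \<Longrightarrow> length xs = k \<Longrightarrow> \<not> distinct xs \<Longrightarrow> \<alpha> xs = 0"
  unfolding alternating_form_def by blast

lemma alternating_formI:
  assumes "\<And>xs ys. length xs + length ys + 1 = k \<Longrightarrow> linear (\<lambda>v. \<alpha> (xs @ v # ys))"
    and "\<And>xs. length xs = k \<Longrightarrow> \<not> distinct xs \<Longrightarrow> \<alpha> xs = 0"
  shows "alternating_form k \<alpha>"
  unfolding alternating_form_def using assms by blast

text \<open>Polarisation: the form vanishes when \<open>u + v\<close> stands in both slots, and
  expanding leaves the two mixed terms.\<close>

lemma alternating_form_swap:
  assumes "alternating_form k \<alpha>" "length xs + length ys + 2 = k"
  shows "\<alpha> (xs @ u # v # ys) = - \<alpha> (xs @ v # u # ys)"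
proof -
  have z: "\<alpha> (xs @ a # a # ys) = 0" for a
    by (rule alternating_form_repeat[OF assms(1)]) (use assms(2) in auto)
  have l1: "\<alpha> (xs @ (a + b) # c # ys) = \<alpha> (xs @ a # c # ys) + \<alpha> (xs @ b # c # ys)" for a b c
    using linear_add[OF alternating_form_linear[OF assms(1), of xs "c # ys"]] assms(2) by simp
  have l2: "\<alpha> (xs @ c # (a + b) # ys) = \<alpha> (xs @ c # a # ys) + \<alpha> (xs @ c # b # ys)" for a b c
    using linear_add[OF alternating_form_linear[OF assms(1), of "xs @ [c]" ys]] assms(2) by simp
  have "0 = \<alpha> (xs @ (u + v) # (u + v) # ys)" using z by simp
  also have "\<dots> = \<alpha> (xs @ u # v # ys) + \<alpha> (xs @ v # u # ys)" by (simp only: l1 l2) (simp add: z)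
  finally show ?thesis by simp
qed

lemma alternating_form_move:
  assumes "alternating_form k \<alpha>" "length xs + length ys + length zs + 1 = k"
  shows "\<alpha> (xs @ ys @ v # zs) = (-1) ^ length ys * \<alpha> (xs @ v # ys @ zs)"
  using assms(2)
proof (induction ys arbitrary: xs)
  case (Cons y ys)
  have "\<alpha> (xs @ (y # ys) @ v # zs) = \<alpha> ((xs @ [y]) @ ys @ v # zs)" by simp
  also have "\<dots> = (-1) ^ length ys * \<alpha> ((xs @ [y]) @ v # ys @ zs)"
    by (rule Cons.IH) (use Cons.prems in simp)
  also have "\<alpha> ((xs @ [y]) @ v # ys @ zs) = - \<alpha> (xs @ v # y # ys @ zs)"
    using alternating_form_swap[OF assms(1), of xs "ys @ zs" y v] Cons.prems by simp
  finally show ?case by simp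
qed simp

lemma alternating_form_append:
  assumes "alternating_form (j + k) \<alpha>" "length xs = j"
  shows "alternating_form k (\<lambda>ys. \<alpha> (xs @ ys))"
proof (rule alternating_formI)
  fix as bs :: "'a list" assume "length as + length bs + 1 = k"
  then show "linear (\<lambda>v. \<alpha> (xs @ as @ v # bs))"
    using alternating_form_linear[OF assms(1), of "xs @ as" bs] assms(2) by simp
next
  fix as :: "'a list" assume "length as = k" "\<not> distinct as"
  then show "\<alpha> (xs @ as) = 0"
    using alternating_form_repeat[OF assms(1), of "xs @ as"] assms(2) by simp
qed

lemma alternating_form_append_right:
  assumes "alternating_form (j + k) \<alpha>" "length ys = k"
  shows "alternating_form j (\<lambda>xs. \<alpha> (xs @ ys))"
proof (rule alternating_formI)
  fix as bs :: "'a list" assume "length as + length bs + 1 = j"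
  then show "linear (\<lambda>v. \<alpha> ((as @ v # bs) @ ys))"
    using alternating_form_linear[OF assms(1), of as "bs @ ys"] assms(2) by simp
next
  fix as :: "'a list" assume "length as = j" "\<not> distinct as"
  then show "\<alpha> (as @ ys) = 0"
    using alternating_form_repeat[OF assms(1), of "as @ ys"] assms(2) by simp
qed

lemma alternating_form_Cons:
  "alternating_form (Suc k) \<alpha> \<Longrightarrow> alternating_form k (\<lambda>ys. \<alpha> (v # ys))"
  using alternating_form_append[of 1 k \<alpha> "[v]"] by simp

lemma alternating_form_Cons_linear:
  "alternating_form (Suc k) \<alpha> \<Longrightarrow> length ys = k \<Longrightarrow> linear (\<lambda>v. \<alpha> (v # ys))"
  using alternating_form_linear[of "Suc k" \<alpha> "[]" ys] by simp

lemma alternating_form_cmult: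
  assumes "alternating_form k \<alpha>"
  shows "alternating_form k (\<lambda>xs. c * \<alpha> xs)"
proof (rule alternating_formI)
  fix xs ys :: "'a list" assume "length xs + length ys + 1 = k"
  from linear_compose_scale_right[OF alternating_form_linear[OF assms this], of c]
  show "linear (\<lambda>v. c * \<alpha> (xs @ v # ys))" by simp
qed (simp add: alternating_form_repeat[OF assms])

lemma alternating_form_sum:
  assumes "\<And>i. i \<in> I \<Longrightarrow> alternating_form k (\<alpha> i)"
  shows "alternating_form k (\<lambda>xs. \<Sum>i\<in>I. \<alpha> i xs)"
proof (rule alternating_formI)
  fix xs ys :: "'b list" assume "length xs + length ys + 1 = k"
  then have "\<forall>i\<in>I. linear (\<lambda>v. \<alpha> i (xs @ v # ys))"
    using alternating_form_linear[OF assms] by auto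
  then show "linear (\<lambda>v. \<Sum>i\<in>I. \<alpha> i (xs @ v # ys))"
    by (simp add: linear_iff sum.distrib sum_distrib_left)
next
  fix xs :: "'b list" assume "length xs = k" "\<not> distinct xs"
  then show "(\<Sum>i\<in>I. \<alpha> i xs) = 0"
    using alternating_form_repeat[OF assms] by simp
qed

lemma alternating_form_diff:
  assumes "alternating_form k \<alpha>" "alternating_form k \<beta>"
  shows "alternating_form k (\<lambda>xs. \<alpha> xs - \<beta> xs)"
proof (rule alternating_formI)
  fix xs ys :: "'a list" assume "length xs + length ys + 1 = k"
  then show "linear (\<lambda>v. \<alpha> (xs @ v # ys) - \<beta> (xs @ v # ys))"
    using alternating_form_linear[OF assms(1)] alternating_form_linear[OF assms(2)]
    by (simp add: linear_compose_sub)
next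
  fix xs :: "'a list" assume "length xs = k" "\<not> distinct xs"
  then show "\<alpha> xs - \<beta> xs = 0"
    using alternating_form_repeat[OF assms(1)] alternating_form_repeat[OF assms(2)] by simp
qed

lemma alternating_form_map:
  assumes "alternating_form k \<alpha>" "linear L"
  shows "alternating_form k (\<lambda>xs. \<alpha> (map L xs))"
proof (rule alternating_formI)
  fix xs ys :: "'b list" assume "length xs + length ys + 1 = k"
  then have "linear (\<lambda>v. \<alpha> (map L xs @ v # map L ys))"
    using alternating_form_linear[OF assms(1), of "map L xs" "map L ys"] by simp
  from linear_compose[OF assms(2) this]
  show "linear (\<lambda>v. \<alpha> (map L (xs @ v # ys)))" by (simp add: o_def)
next
  fix xs :: "'b list" assume "length xs = k" "\<not> distinct xs"
  then show "\<alpha> (map L xs) = 0"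
    using alternating_form_repeat[OF assms(1), of "map L xs"] by (simp add: distinct_map)
qed

lemma alternating_form_cong:
  assumes "\<And>xs. length xs = k \<Longrightarrow> \<alpha> xs = \<beta> xs" "alternating_form k \<alpha>"
  shows "alternating_form k \<beta>"
proof (rule alternating_formI)
  fix xs ys :: "'a list" assume *: "length xs + length ys + 1 = k"
  have "(\<lambda>v. \<beta> (xs @ v # ys)) = (\<lambda>v. \<alpha> (xs @ v # ys))" using assms(1) * by simp
  then show "linear (\<lambda>v. \<beta> (xs @ v # ys))" using alternating_form_linear[OF assms(2) *] by simp
next
  fix xs :: "'a list" assume "length xs = k" "\<not> distinct xs"
  then show "\<beta> xs = 0" using alternating_form_repeat[OF assms(2)] assms(1)[of xs] by simp
qed

text \<open>\<open>F\<close> has to span only modulo vectors that annihilate \<alpha>. The arguments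
  are replaced from left to right: the next one is expanded, its annihilating part is moved to the
  front where it gives zero, and elements of \<open>F\<close> are collected in the prefix.\<close>

lemma alternating_form_vanish:
  assumes alt: "alternating_form k \<alpha>" and "finite F"
    and span: "\<And>v. \<exists>c a. v = (\<Sum>f\<in>F. c f *\<^sub>R f) + a \<and> (\<forall>Vs. length Vs + 1 = k \<longrightarrow> \<alpha> (a # Vs) = 0)"
    and zero: "\<And>fs. length fs = k \<Longrightarrow> set fs \<subseteq> F \<Longrightarrow> distinct fs \<Longrightarrow> \<alpha> fs = 0"
    and "length Vs = k"
  shows "\<alpha> Vs = 0"
proof -
  have "\<alpha> (fs @ Us) = 0" if "length fs + length Us = k" "set fs \<subseteq> F" for fs Us
    using that
  proof (induction Us arbitrary: fs)
    case Nil
    then show ?case using zero[of fs] alternating_form_repeat[OF alt, of fs] by auto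
  next
    case (Cons v Us)
    obtain c a where v: "v = (\<Sum>f\<in>F. c f *\<^sub>R f) + a"
      and a: "\<And>Vs. length Vs + 1 = k \<Longrightarrow> \<alpha> (a # Vs) = 0"
      using span[of v] by blast
    have lin: "linear (\<lambda>v. \<alpha> (fs @ v # Us))"
      by (rule alternating_form_linear[OF alt]) (use Cons.prems in simp)
    have a0: "\<alpha> (fs @ a # Us) = 0"
      using alternating_form_move[OF alt, of "[]" fs Us a] a[of "fs @ Us"] Cons.prems by simp
    have f0: "\<alpha> (fs @ f # Us) = 0" if "f \<in> F" for f
      using Cons.IH[of "fs @ [f]"] Cons.prems that by simp
    show ?case
      unfolding v using linear_add[OF lin] linear_sum[OF lin, of "\<lambda>f. c f *\<^sub>R f" F] linear_scale[OF lin] a0 f0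
      by simp
  qed
  from this[of "[]" Vs] show ?thesis using assms(5) by simp
qed

text \<open>Pigeonhole: \<open>k\<close> elements of \<open>F\<close> must repeat. Put differently,
  the annihilator of a nonzero \<open>k\<close>-form has codimension at least \<open>k\<close>; this
  is the dimension count that identifies the annihilator of a parallel form.\<close>

lemma alternating_form_vanish_card:
  assumes "alternating_form k \<alpha>" "finite F" "card F < k"
    and "\<And>v. \<exists>c a. v = (\<Sum>f\<in>F. c f *\<^sub>R f) + a \<and> (\<forall>Vs. length Vs + 1 = k \<longrightarrow> \<alpha> (a # Vs) = 0)"
    and "length Vs = k"
  shows "\<alpha> Vs = 0"
proof (rule alternating_form_vanish[OF assms(1,2,4) _ assms(5)])
  fix fs assume fs: "length fs = k" "set fs \<subseteq> F" "distinct fs"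
  then have "k \<le> card F" using card_mono[OF assms(2) fs(2)] distinct_card[OF fs(3)] by simp
  then show "\<alpha> fs = 0" using assms(3) by simp
qed

lemma alternating_form_vanish_Basis:
  fixes \<alpha> :: "'v::euclidean_space list \<Rightarrow> real"
  assumes "alternating_form k \<alpha>"
    and "\<And>fs. length fs = k \<Longrightarrow> set fs \<subseteq> Basis \<Longrightarrow> distinct fs \<Longrightarrow> \<alpha> fs = 0"
    and "length Vs = k"
  shows "\<alpha> Vs = 0"
proof (rule alternating_form_vanish[OF assms(1) finite_Basis _ assms(2,3)])
  fix v :: 'v
  have "v = (\<Sum>f\<in>Basis. (v \<bullet> f) *\<^sub>R f) + 0" by (simp add: euclidean_representation)
  moreover have "\<alpha> (0 # Vs) = 0" if "length Vs + 1 = k" for Vs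
    using linear_0[OF alternating_form_linear[OF assms(1), of "[]" Vs]] that by simp
  ultimately show "\<exists>c a. v = (\<Sum>f\<in>Basis. c f *\<^sub>R f) + a \<and> (\<forall>Vs. length Vs + 1 = k \<longrightarrow> \<alpha> (a # Vs) = 0)"
    by blast
qed

lemma alternating_form_vanish_DIM:
  fixes \<alpha> :: "'v::euclidean_space list \<Rightarrow> real"
  assumes "alternating_form k \<alpha>" "DIM('v) < k" "length Vs = k"
  shows "\<alpha> Vs = 0"
proof (rule alternating_form_vanish_Basis[OF assms(1) _ assms(3)])
  fix fs :: "'v list" assume fs: "length fs = k" "set fs \<subseteq> Basis" "distinct fs"
  then have "k \<le> DIM('v)" using card_mono[OF finite_Basis fs(2)] distinct_card[OF fs(3)] by simp
  then show "\<alpha> fs = 0" using assms(2) by simp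
qed

text \<open>Only vanishing is carried through the permutation, so no sign is tracked; the elements
  are moved to the front one after the other.\<close>

lemma alternating_form_mset_zero:
  assumes "alternating_form k \<alpha>" "length xs = k" "mset xs = mset ys" "\<alpha> ys = 0"
  shows "\<alpha> xs = 0"
proof -
  have "\<alpha> (pre @ xs) = 0" if "length pre + length xs = k" "mset xs = mset ys" "\<alpha> (pre @ ys) = 0" for pre
    using that
  proof (induction xs arbitrary: pre ys)
    case Nil
    then show ?case by simp
  next
    case (Cons x xs)
    have "x \<in> set ys" using Cons.prems(2) by (metis list.set_intros(1) set_mset_mset)
    then obtain as bs where ys: "ys = as @ x # bs" by (meson split_list)
    have m: "mset xs = mset (as @ bs)" using Cons.prems(2) ys by simp
    have len: "length xs = length as + length bs" using mset_eq_length[OF m] by simp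
    have "\<alpha> (pre @ as @ x # bs) = (-1) ^ length as * \<alpha> (pre @ x # as @ bs)"
      by (rule alternating_form_move[OF assms(1)]) (use Cons.prems(1) len in simp)
    then have "\<alpha> ((pre @ [x]) @ as @ bs) = 0" using Cons.prems(3) ys by simp
    then have "\<alpha> ((pre @ [x]) @ xs) = 0"
      by (intro Cons.IH[OF _ m]) (use Cons.prems(1) in auto)
    then show ?case by simp
  qed
  from this[of "[]"] show ?thesis using assms by simp
qed

text \<open>The difference of the two sides vanishes on \<open>fl\<close>, hence on every ordering
  of the basis, hence everywhere.\<close>

lemma alternating_form_top_unique:
  fixes \<alpha> \<beta> :: "'v::euclidean_space list \<Rightarrow> real"
  assumes "alternating_form DIM('v) \<alpha>" "alternating_form DIM('v) \<beta>"
    and "distinct fl" "set fl = Basis" "\<beta> fl = 1" "length Vs = DIM('v)"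
  shows "\<alpha> Vs = \<alpha> fl * \<beta> Vs"
proof -
  have len: "length fl = DIM('v)" using distinct_card[OF assms(3)] assms(4) by simp
  have alt: "alternating_form DIM('v) (\<lambda>Vs. \<alpha> Vs - \<alpha> fl * \<beta> Vs)"
    by (intro alternating_form_diff alternating_form_cmult assms)
  have "\<alpha> Vs - \<alpha> fl * \<beta> Vs = 0"
  proof (rule alternating_form_vanish_Basis[OF alt _ assms(6)])
    fix fs :: "'v list" assume fs: "length fs = DIM('v)" "set fs \<subseteq> Basis" "distinct fs"
    then have "set fs = Basis" using distinct_card[OF fs(3)] card_subset_eq[OF finite_Basis fs(2)] by simp
    then have "mset fs = mset fl" using fs assms(3,4) set_eq_iff_mset_eq_distinct by blast
    from alternating_form_mset_zero[OF alt fs(1) this]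
    show "\<alpha> fs - \<alpha> fl * \<beta> fs = 0" using assms(5) by simp
  qed
  then show ?thesis by simp
qed

subsection \<open>Derivatives of families of forms\<close>

lemma has_vector_derivative_transform_ev:
  assumes "(g has_vector_derivative g') (at x)" "\<forall>\<^sub>F t in nhds x. f t = g t"
  shows "(f has_vector_derivative g') (at x)"
proof -
  obtain U where U: "open U" "x \<in> U" "\<And>t. t \<in> U \<Longrightarrow> f t = g t"
    using assms(2) unfolding eventually_nhds by blast
  show ?thesis
    by (rule has_vector_derivative_transform_within_open[OF assms(1) U(1,2)]) (simp add: U(3))
qed

lemma has_vector_derivative_unique_ev:
  assumes "(f has_vector_derivative f') (at x)" "(g has_vector_derivative g') (at x)"
    and "\<forall>\<^sub>F t in nhds x. f t = g t"
  shows "f' = g'"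
  by (rule vector_derivative_unique_at[OF assms(1) has_vector_derivative_transform_ev[OF assms(2,3)]])

text \<open>The defining identities hold for all small \<open>t\<close>, so both sides have the same
  derivative at 0. They are asked near 0 only, because forms along a submanifold are alternating
  just at its points.\<close>

lemma alternating_form_derivative:
  assumes alt: "\<forall>\<^sub>F t in nhds 0. alternating_form k (\<alpha> t)"
    and der: "\<And>Vs. length Vs = k \<Longrightarrow> ((\<lambda>t. \<alpha> t Vs) has_vector_derivative \<alpha>' Vs) (at 0)"
  shows "alternating_form k \<alpha>'"
proof (rule alternating_formI)
  fix xs ys :: "'a list" assume l: "length xs + length ys + 1 = k"
  show "linear (\<lambda>v. \<alpha>' (xs @ v # ys))"
  proof (rule linearI)
    fix u v
    show "\<alpha>' (xs @ (u + v) # ys) = \<alpha>' (xs @ u # ys) + \<alpha>' (xs @ v # ys)"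
    proof (rule has_vector_derivative_unique_ev)
      show "\<forall>\<^sub>F t in nhds 0. \<alpha> t (xs @ (u + v) # ys) = \<alpha> t (xs @ u # ys) + \<alpha> t (xs @ v # ys)"
        using alt by eventually_elim (rule linear_add[OF alternating_form_linear[OF _ l]])
    qed (use l in \<open>auto intro!: has_vector_derivative_add der\<close>)
  next
    fix c v
    show "\<alpha>' (xs @ (c *\<^sub>R v) # ys) = c *\<^sub>R \<alpha>' (xs @ v # ys)"
    proof (rule has_vector_derivative_unique_ev)
      show "\<forall>\<^sub>F t in nhds 0. \<alpha> t (xs @ (c *\<^sub>R v) # ys) = c *\<^sub>R \<alpha> t (xs @ v # ys)"
        using alt by eventually_elim (rule linear_scale[OF alternating_form_linear[OF _ l]])
      show "((\<lambda>t. c *\<^sub>R \<alpha> t (xs @ v # ys)) has_vector_derivative c *\<^sub>R \<alpha>' (xs @ v # ys)) (at 0)"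
        by (rule bounded_linear.has_vector_derivative[OF bounded_linear_scaleR_right der]) (use l in simp)
    qed (use l in \<open>auto intro!: der\<close>)
  qed
next
  fix xs :: "'a list" assume *: "length xs = k" "\<not> distinct xs"
  show "\<alpha>' xs = 0"
  proof (rule has_vector_derivative_unique_ev[OF der[OF *(1)] has_vector_derivative_const])
    show "\<forall>\<^sub>F t in nhds 0. \<alpha> t xs = 0"
      using alt by eventually_elim (rule alternating_form_repeat[OF _ *])
  qed
qed

lemma alternating_form_expand_head:
  fixes \<alpha> :: "'v::euclidean_space list \<Rightarrow> real"
  assumes "alternating_form (Suc k) \<alpha>" "length Vs = k"
  shows "\<alpha> (v # Vs) = (\<Sum>b\<in>Basis. (v \<bullet> b) * \<alpha> (b # Vs))"
proof -
  have lin: "linear (\<lambda>v. \<alpha> (v # Vs))" by (rule alternating_form_Cons_linear[OF assms])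
  have "\<alpha> ((\<Sum>b\<in>Basis. (v \<bullet> b) *\<^sub>R b) # Vs) = (\<Sum>b\<in>Basis. (v \<bullet> b) * \<alpha> (b # Vs))"
    by (simp only: linear_sum[OF lin] linear_scale[OF lin] real_scaleR_def)
  then show ?thesis by (simp add: euclidean_representation)
qed

text \<open>Product rule for a moving form with moving arguments; \<alpha>' is the derivative with
  frozen arguments. Expanding the first argument in the basis leaves scalar factors times forms of
  smaller degree.\<close>

lemma has_vector_derivative_form:
  fixes \<alpha> :: "real \<Rightarrow> 'v::euclidean_space list \<Rightarrow> real"
  assumes "\<forall>\<^sub>F t in nhds 0. alternating_form k (\<alpha> t)"
    and "\<And>Vs. length Vs = k \<Longrightarrow> ((\<lambda>t. \<alpha> t Vs) has_vector_derivative \<alpha>' Vs) (at 0)"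
    and "list_all2 (\<lambda>p p'. (p has_vector_derivative p') (at 0)) ps ps'" "length ps = k"
  shows "((\<lambda>t. \<alpha> t (map (\<lambda>p. p t) ps)) has_vector_derivative
           \<alpha>' (map (\<lambda>p. p 0) ps) + (\<Sum>j<k. \<alpha> 0 ((map (\<lambda>p. p 0) ps)[j := ps' ! j]))) (at 0)"
  using assms
proof (induction k arbitrary: \<alpha> \<alpha>' ps ps')
  case 0
  then show ?case by simp
next
  case (Suc k)
  from Suc.prems(3,4) obtain p qs p' qs' where ps: "ps = p # qs" "ps' = p' # qs'"
    and p: "(p has_vector_derivative p') (at 0)"
    and qs: "list_all2 (\<lambda>p p'. (p has_vector_derivative p') (at 0)) qs qs'" "length qs = k"
    by (cases ps; cases ps') auto
  let ?q = "map (\<lambda>p. p 0) qs"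
  have alt': "alternating_form (Suc k) \<alpha>'"
    by (rule alternating_form_derivative[OF Suc.prems(1,2)])
  have alt0: "alternating_form (Suc k) (\<alpha> 0)"
    using eventually_nhds_x_imp_x[OF Suc.prems(1)] .
  have ih: "((\<lambda>t. \<alpha> t (b # map (\<lambda>p. p t) qs)) has_vector_derivative
      \<alpha>' (b # ?q) + (\<Sum>j<k. \<alpha> 0 (b # ?q[j := qs' ! j]))) (at 0)" for b
  proof (rule Suc.IH[OF _ _ qs])
    show "\<forall>\<^sub>F t in nhds 0. alternating_form k (\<lambda>ys. \<alpha> t (b # ys))"
      using Suc.prems(1) by eventually_elim (rule alternating_form_Cons)
  qed (use Suc.prems(2) in auto)
  have pb: "((\<lambda>t. p t \<bullet> b) has_vector_derivative p' \<bullet> b) (at 0)" for b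
    by (rule bounded_linear.has_vector_derivative[OF bounded_linear_inner_left p])
  have e1: "(\<Sum>b\<in>Basis. (p 0 \<bullet> b) * \<alpha>' (b # ?q)) = \<alpha>' (p 0 # ?q)"
    by (rule alternating_form_expand_head[OF alt', symmetric]) (simp add: qs(2))
  have e2: "(\<Sum>b\<in>Basis. (p 0 \<bullet> b) * \<alpha> 0 (b # ?q[j := qs' ! j])) = \<alpha> 0 (p 0 # ?q[j := qs' ! j])" for j
    by (rule alternating_form_expand_head[OF alt0, symmetric]) (simp add: qs(2))
  have e3: "(\<Sum>b\<in>Basis. (p' \<bullet> b) * \<alpha> 0 (b # ?q)) = \<alpha> 0 (p' # ?q)"
    by (rule alternating_form_expand_head[OF alt0, symmetric]) (simp add: qs(2))
  have "((\<lambda>t. \<Sum>b\<in>Basis. (p t \<bullet> b) * \<alpha> t (b # map (\<lambda>p. p t) qs)) has_vector_derivative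
     (\<Sum>b\<in>Basis. (p 0 \<bullet> b) * (\<alpha>' (b # ?q) + (\<Sum>j<k. \<alpha> 0 (b # ?q[j := qs' ! j])))
         + (p' \<bullet> b) * \<alpha> 0 (b # ?q))) (at 0)"
    by (intro has_vector_derivative_sum has_vector_derivative_mult pb ih)
  also have "(\<Sum>b\<in>Basis. (p 0 \<bullet> b) * (\<alpha>' (b # ?q) + (\<Sum>j<k. \<alpha> 0 (b # ?q[j := qs' ! j])))
         + (p' \<bullet> b) * \<alpha> 0 (b # ?q))
    = (\<Sum>b\<in>Basis. (p 0 \<bullet> b) * \<alpha>' (b # ?q))
      + (\<Sum>j<k. \<Sum>b\<in>Basis. (p 0 \<bullet> b) * \<alpha> 0 (b # ?q[j := qs' ! j]))
      + (\<Sum>b\<in>Basis. (p' \<bullet> b) * \<alpha> 0 (b # ?q))"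
    by (subst sum.swap) (simp add: sum.distrib distrib_left sum_distrib_left)
  also have "\<dots> = \<alpha>' (p 0 # ?q) + (\<Sum>j<k. \<alpha> 0 (p 0 # ?q[j := qs' ! j])) + \<alpha> 0 (p' # ?q)"
    by (simp only: e1 e2 e3)
  also have "\<dots> = \<alpha>' (map (\<lambda>p. p 0) ps) + (\<Sum>j<Suc k. \<alpha> 0 ((map (\<lambda>p. p 0) ps)[j := ps' ! j]))"
    by (simp add: ps sum.lessThan_Suc_shift del: sum.lessThan_Suc)
  finally have der: "((\<lambda>t. \<Sum>b\<in>Basis. (p t \<bullet> b) * \<alpha> t (b # map (\<lambda>p. p t) qs)) has_vector_derivative
     \<alpha>' (map (\<lambda>p. p 0) ps) + (\<Sum>j<Suc k. \<alpha> 0 ((map (\<lambda>p. p 0) ps)[j := ps' ! j]))) (at 0)" .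
  have ev: "\<forall>\<^sub>F t in nhds 0. \<alpha> t (map (\<lambda>p. p t) ps) = (\<Sum>b\<in>Basis. (p t \<bullet> b) * \<alpha> t (b # map (\<lambda>p. p t) qs))"
    using Suc.prems(1)
  proof eventually_elim
    case (elim t)
    show ?case unfolding ps list.map
      by (rule alternating_form_expand_head[OF elim]) (simp add: qs(2))
  qed
  show ?case
    using has_vector_derivative_transform_ev[OF der ev] .
qed

subsection \<open>Sums over lists of basis vectors\<close>

lemma sum_lists_Suc:
  assumes "finite F"
  shows "(\<Sum>es | length es = Suc d \<and> set es \<subseteq> F. f es)
    = (\<Sum>e\<in>F. \<Sum>es | length es = d \<and> set es \<subseteq> F. f (e # es))"
proof -
  have eq: "{es. length es = Suc d \<and> set es \<subseteq> F}
      = (\<lambda>(e, es). e # es) ` (F \<times> {es. length es = d \<and> set es \<subseteq> F})"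
    by (auto simp: length_Suc_conv image_iff)
  have inj: "inj_on (\<lambda>(e, es). e # es) (F \<times> {es. length es = d \<and> set es \<subseteq> F})"
    by (auto simp: inj_on_def)
  show ?thesis
    unfolding eq sum.reindex[OF inj] by (simp add: sum.cartesian_product case_prod_unfold)
qed

lemma sum_lists_0: "(\<Sum>es | length es = 0 \<and> set es \<subseteq> F. f es) = f []"
proof -
  have "{es. length es = 0 \<and> set es \<subseteq> F} = {[]}" by auto
  then show ?thesis by simp
qed

text \<open>The sum is a full contraction with the \<open>d\<close>-th power of the tensor summed
  from \<open>A e \<otimes> B e\<close>, and \<open>t\<close> says that \<open>A'\<close> and
  \<open>B'\<close> give the same tensor. The slots are exchanged one at a time.\<close>

lemma sum_lists_tensor_cong:
  fixes A A' :: "'e \<Rightarrow> 'v::real_vector" and B B' :: "'e \<Rightarrow> 'w::real_vector"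
  assumes F: "finite F"
    and t: "\<And>f g. linear f \<Longrightarrow> linear g \<Longrightarrow>
        (\<Sum>e\<in>F. f (A e) * g (B e) :: real) = (\<Sum>e\<in>F. f (A' e) * g (B' e))"
    and "alternating_form d \<alpha>" "alternating_form d \<beta>"
  shows "(\<Sum>es | length es = d \<and> set es \<subseteq> F. \<alpha> (map A es) * \<beta> (map B es))
       = (\<Sum>es | length es = d \<and> set es \<subseteq> F. \<alpha> (map A' es) * \<beta> (map B' es))"
  using assms(3,4)
proof (induction d arbitrary: \<alpha> \<beta>)
  case 0
  then show ?case by (simp only: sum_lists_0 list.map)
next
  case (Suc d)
  let ?L = "{es. length es = d \<and> set es \<subseteq> F}"
  have "(\<Sum>es | length es = Suc d \<and> set es \<subseteq> F. \<alpha> (map A es) * \<beta> (map B es))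
      = (\<Sum>e\<in>F. \<Sum>es\<in>?L. \<alpha> (A e # map A es) * \<beta> (B e # map B es))"
    by (simp add: sum_lists_Suc[OF F])
  also have "\<dots> = (\<Sum>e\<in>F. \<Sum>es\<in>?L. \<alpha> (A e # map A' es) * \<beta> (B e # map B' es))"
    by (intro sum.cong refl Suc.IH alternating_form_Cons Suc.prems)
  also have "\<dots> = (\<Sum>es\<in>?L. \<Sum>e\<in>F. \<alpha> (A e # map A' es) * \<beta> (B e # map B' es))"
    by (rule sum.swap)
  also have "\<dots> = (\<Sum>es\<in>?L. \<Sum>e\<in>F. \<alpha> (A' e # map A' es) * \<beta> (B' e # map B' es))"
    by (intro sum.cong refl t alternating_form_Cons_linear[OF Suc.prems(1)]
          alternating_form_Cons_linear[OF Suc.prems(2)]) auto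
  also have "\<dots> = (\<Sum>e\<in>F. \<Sum>es\<in>?L. \<alpha> (A' e # map A' es) * \<beta> (B' e # map B' es))"
    by (rule sum.swap)
  also have "\<dots> = (\<Sum>es | length es = Suc d \<and> set es \<subseteq> F. \<alpha> (map A' es) * \<beta> (map B' es))"
    by (simp add: sum_lists_Suc[OF F])
  finally show ?case .
qed

text \<open>Infinitesimal version of the exchange: by \<open>t\<close> the first variation of the
  tensor summed from \<open>A e \<otimes> B e\<close> is zero, hence so is that of its
  \<open>d\<close>-th power. The tensor will be the inverse tractor metric, varied by the
  connection.\<close>

lemma sum_lists_tensor_derivation:
  fixes A A' :: "'e \<Rightarrow> 'v::real_vector" and B B' :: "'e \<Rightarrow> 'w::real_vector"
  assumes F: "finite F"
    and t: "\<And>f g. linear f \<Longrightarrow> linear g \<Longrightarrow>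
        (\<Sum>e\<in>F. f (A' e) * g (B e) + f (A e) * g (B' e) :: real) = 0"
    and "alternating_form d \<alpha>" "alternating_form d \<beta>"
  shows "(\<Sum>es | length es = d \<and> set es \<subseteq> F.
       (\<Sum>k<d. \<alpha> ((map A es)[k := A' (es ! k)])) * \<beta> (map B es)
       + \<alpha> (map A es) * (\<Sum>k<d. \<beta> ((map B es)[k := B' (es ! k)]))) = 0"
  using assms(3,4)
proof (induction d arbitrary: \<alpha> \<beta>)
  case 0
  then show ?case by simp
next
  case (Suc d)
  let ?L = "{es. length es = d \<and> set es \<subseteq> F}"
  have "(\<Sum>es | length es = Suc d \<and> set es \<subseteq> F.
       (\<Sum>k<Suc d. \<alpha> ((map A es)[k := A' (es ! k)])) * \<beta> (map B es)
       + \<alpha> (map A es) * (\<Sum>k<Suc d. \<beta> ((map B es)[k := B' (es ! k)])))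
     = (\<Sum>e\<in>F. \<Sum>es\<in>?L.
       (\<alpha> (A' e # map A es) + (\<Sum>k<d. \<alpha> (A e # (map A es)[k := A' (es ! k)]))) * \<beta> (B e # map B es)
       + \<alpha> (A e # map A es) * (\<beta> (B' e # map B es) + (\<Sum>k<d. \<beta> (B e # (map B es)[k := B' (es ! k)]))))"
    by (simp add: sum_lists_Suc[OF F] sum.lessThan_Suc_shift del: sum.lessThan_Suc)
  \<comment> \<open>Variation of the first slot, killed by \<open>t\<close>, plus variation of the
    other slots, killed by the induction hypothesis.\<close>
  also have "\<dots> = (\<Sum>e\<in>F. \<Sum>es\<in>?L. \<alpha> (A' e # map A es) * \<beta> (B e # map B es)
          + \<alpha> (A e # map A es) * \<beta> (B' e # map B es))
     + (\<Sum>e\<in>F. \<Sum>es\<in>?L. (\<Sum>k<d. \<alpha> (A e # (map A es)[k := A' (es ! k)])) * \<beta> (B e # map B es)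
       + \<alpha> (A e # map A es) * (\<Sum>k<d. \<beta> (B e # (map B es)[k := B' (es ! k)])))"
    by (simp add: sum.distrib algebra_simps)
  also have "(\<Sum>e\<in>F. \<Sum>es\<in>?L. \<alpha> (A' e # map A es) * \<beta> (B e # map B es)
          + \<alpha> (A e # map A es) * \<beta> (B' e # map B es)) =
      (\<Sum>es\<in>?L. \<Sum>e\<in>F. \<alpha> (A' e # map A es) * \<beta> (B e # map B es)
          + \<alpha> (A e # map A es) * \<beta> (B' e # map B es))"
    by (rule sum.swap)
  also have "\<dots> = (\<Sum>es\<in>?L. 0)"
    by (intro sum.cong refl t alternating_form_Cons_linear[OF Suc.prems(1)]
          alternating_form_Cons_linear[OF Suc.prems(2)]) auto
  also have "(\<Sum>e\<in>F. \<Sum>es\<in>?L. (\<Sum>k<d. \<alpha> (A e # (map A es)[k := A' (es ! k)])) * \<beta> (B e # map B es)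
       + \<alpha> (A e # map A es) * (\<Sum>k<d. \<beta> (B e # (map B es)[k := B' (es ! k)]))) = (\<Sum>e\<in>F. 0)"
    by (intro sum.cong refl Suc.IH alternating_form_Cons Suc.prems)
  finally show ?case by simp
qed

subsection \<open>Exterior multiplication by a functional\<close>

text \<open>\<open>wedge_vector\<close> unfolded along the list, for any functional: the alternating
  sign arises from passing the head. This form admits induction on the arguments.\<close>

primrec wedge :: "('v \<Rightarrow> real) \<Rightarrow> ('v list \<Rightarrow> real) \<Rightarrow> 'v list \<Rightarrow> real" where
  "wedge f \<beta> [] = 0"
| "wedge f \<beta> (v # Vs) = f v * \<beta> Vs - wedge f (\<lambda>us. \<beta> (v # us)) Vs"

lemma wedge_vector_eq_wedge: "wedge_vector M X \<alpha> Vs = wedge (tractor_metric M X) \<alpha> Vs"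
proof (induction Vs arbitrary: \<alpha>)
  case Nil
  then show ?case by (simp add: wedge_vector_def)
next
  case (Cons v Vs)
  have "wedge_vector M X \<alpha> (v # Vs) = tractor_metric M X v * \<alpha> Vs - wedge_vector M X (\<lambda>us. \<alpha> (v # us)) Vs"
    by (simp add: wedge_vector_def sum.lessThan_Suc_shift sum_negf del: sum.lessThan_Suc)
  then show ?case using Cons by simp
qed

lemma wedge_append:
  "wedge f \<beta> (es @ Vs) = wedge f (\<lambda>us. \<beta> (us @ Vs)) es + (-1) ^ length es * wedge f (\<lambda>us. \<beta> (es @ us)) Vs"
  by (induction es arbitrary: \<beta>) (simp_all add: algebra_simps)

lemma wedge_zero:
  assumes "\<And>us. length us + 1 = length Vs \<Longrightarrow> \<beta> us = 0"
  shows "wedge f \<beta> Vs = 0"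
  using assms by (induction Vs arbitrary: \<beta>) simp_all

lemma wedge_sum:
  "wedge f (\<lambda>us. \<Sum>i\<in>I. c i * \<beta> i us) Vs = (\<Sum>i\<in>I. c i * wedge f (\<beta> i) Vs)"
  by (induction Vs arbitrary: \<beta>)
     (simp_all add: sum_distrib_left right_diff_distrib sum_subtractf mult_ac)

lemma wedge_cmult: "wedge f (\<lambda>us. c * \<beta> us) Vs = c * wedge f \<beta> Vs"
  by (induction Vs arbitrary: \<beta>) (simp_all add: right_diff_distrib)

lemma wedge_linear_param:
  assumes "\<And>us. length us + 1 = length ys \<Longrightarrow> linear (\<lambda>v. B v us)"
  shows "linear (\<lambda>v. wedge f (B v) ys)"
  using assms
proof (induction ys arbitrary: B)
  case Nil
  then show ?case by (simp add: module_hom_zero)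
next
  case (Cons y ys)
  have "linear (\<lambda>v. f y * B v ys)"
    using linear_compose_scale_right[of "\<lambda>v. B v ys" "f y"] Cons.prems[of ys] by simp
  moreover have "linear (\<lambda>v. wedge f (\<lambda>us. B v (y # us)) ys)"
    by (rule Cons.IH) (use Cons.prems in auto)
  ultimately show ?case by (simp add: linear_compose_sub)
qed

text \<open>The hypothesis kills every term in which \<open>v\<close> stays among the arguments of
  \<gamma>, so only the term that feeds this \<open>v\<close> to \<open>f\<close> survives.\<close>

lemma wedge_single:
  assumes "\<And>us. v \<in> set us \<Longrightarrow> length us = length ys + length zs \<Longrightarrow> \<gamma> us = 0"
  shows "wedge f \<gamma> (ys @ v # zs) = (-1) ^ length ys * f v * \<gamma> (ys @ zs)"
  using assms
proof (induction ys arbitrary: \<gamma>)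
  case Nil
  have "wedge f (\<lambda>us. \<gamma> (v # us)) zs = 0"
    by (rule wedge_zero) (use Nil in auto)
  then show ?case by simp
next
  case (Cons y ys)
  have "wedge f (\<lambda>us. \<gamma> (y # us)) (ys @ v # zs) = (-1) ^ length ys * f v * \<gamma> (y # ys @ zs)"
    by (rule Cons.IH) (use Cons.prems in auto)
  moreover have "\<gamma> (ys @ v # zs) = 0" by (rule Cons.prems) auto
  ultimately show ?case by simp
qed

lemma alternating_form_wedge:
  assumes "alternating_form k \<beta>" "linear f"
  shows "alternating_form (Suc k) (wedge f \<beta>)"
proof (rule alternating_formI)
  fix xs ys :: "'a list" assume "length xs + length ys + 1 = Suc k"
  then show "linear (\<lambda>v. wedge f \<beta> (xs @ v # ys))"
    using assms(1)
  proof (induction xs arbitrary: \<beta> k)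
    case Nil
    have "linear (\<lambda>v. f v * \<beta> ys)"
      using linear_compose_scale_right[OF assms(2), of "\<beta> ys"] by (simp add: mult.commute)
    moreover have "linear (\<lambda>v. wedge f (\<lambda>us. \<beta> (v # us)) ys)"
      by (rule wedge_linear_param, rule alternating_form_linear[OF Nil(2), of "[]", simplified])
         (use Nil(1) in auto)
    ultimately show ?case by (simp add: linear_compose_sub)
  next
    case (Cons x xs)
    obtain k' where k: "k = Suc k'" using Cons.prems(1) by (cases k) auto
    have "linear (\<lambda>v. f x * \<beta> (xs @ v # ys))"
      using linear_compose_scale_right[of "\<lambda>v. \<beta> (xs @ v # ys)" "f x"]
        alternating_form_linear[OF Cons.prems(2), of xs ys] Cons.prems(1) by simp
    moreover have "linear (\<lambda>v. wedge f (\<lambda>us. \<beta> (x # us)) (xs @ v # ys))"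
      by (rule Cons.IH[of k', OF _ alternating_form_Cons]) (use Cons.prems k in auto)
    ultimately show ?case by (simp add: linear_compose_sub)
  qed
next
  fix xs :: "'a list" assume "length xs = Suc k" "\<not> distinct xs"
  then show "wedge f \<beta> xs = 0"
    using assms(1)
  proof (induction xs arbitrary: \<beta> k)
    case Nil
    then show ?case by simp
  next
    case (Cons x xs)
    show ?case
    proof (cases "distinct xs")
      case False
      obtain k' where k: "k = Suc k'" using Cons.prems(1) False by (cases k) auto
      have "wedge f (\<lambda>us. \<beta> (x # us)) xs = 0"
        by (rule Cons.IH[of k', OF _ False alternating_form_Cons]) (use Cons.prems k in auto)
      then show ?thesis using alternating_form_repeat[OF Cons.prems(3) _ False] Cons.prems(1) by simp
    next
      case True
      then have "x \<in> set xs" using Cons.prems(2) by simp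
      then obtain ys zs where xs: "xs = ys @ x # zs" by (meson split_list)
      \<comment> \<open>The vector \<open>x\<close> stands at the head and occurs again later. The
        term in which \<open>f\<close> takes the head cancels the one in which \<open>f\<close>
        takes the other occurrence.\<close>
      have "wedge f (\<lambda>us. \<beta> (x # us)) (ys @ x # zs) = (-1) ^ length ys * f x * \<beta> (x # ys @ zs)"
        by (rule wedge_single, rule alternating_form_repeat[OF Cons.prems(3)]) (use Cons.prems(1) xs in auto)
      moreover have "\<beta> (ys @ x # zs) = (-1) ^ length ys * \<beta> (x # ys @ zs)"
        using alternating_form_move[OF Cons.prems(3), of "[]" ys zs x] Cons.prems(1) xs by simp
      ultimately show ?thesis by (simp add: xs)
    qed
  qed
qed

text \<open>The Hodge star without the factor \<open>1/d!\<close>, for an arbitrary frame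
  \<open>F\<close>, index raising map \<open>S\<close> and form \<epsilon>, so that its algebra is
  separated from tractors.\<close>

definition star :: "nat \<Rightarrow> 'e set \<Rightarrow> ('e \<Rightarrow> 'v) \<Rightarrow> ('e list \<Rightarrow> real) \<Rightarrow> ('v list \<Rightarrow> real) \<Rightarrow> 'e list \<Rightarrow> real" where
  "star d F S \<epsilon> \<alpha> Ws = (\<Sum>es | length es = d \<and> set es \<subseteq> F. \<alpha> (map S es) * \<epsilon> (es @ Ws))"

text \<open>The \<open>Suc d\<close> positions from which \<open>f\<close> can take its argument
  contribute equally: moving the chosen vector to the front of \<alpha> costs the same sign as the
  wedge does.\<close>

lemma sum_lists_wedge:
  fixes \<alpha> :: "'v::real_vector list \<Rightarrow> real"
  assumes F: "finite F" and "alternating_form (Suc d) \<alpha>"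
  shows "(\<Sum>es | length es = Suc d \<and> set es \<subseteq> F. \<alpha> (map S es) * wedge f \<gamma> es)
    = real (Suc d) * (\<Sum>e\<in>F. \<Sum>es | length es = d \<and> set es \<subseteq> F. f e * \<alpha> (S e # map S es) * \<gamma> es)"
  using assms(2)
proof (induction d arbitrary: \<alpha> \<gamma>)
  case 0
  show ?case unfolding sum_lists_Suc[OF F] sum_lists_0 by (simp add: mult_ac)
next
  case (Suc d)
  let ?L = "\<lambda>d. {es. length es = d \<and> set es \<subseteq> F}"
  let ?P = "\<Sum>e\<in>F. \<Sum>es\<in>?L (Suc d). f e * \<alpha> (S e # map S es) * \<gamma> es"
  have sw: "\<alpha> (S e # S e' # map S es) = - \<alpha> (S e' # S e # map S es)" if "es \<in> ?L d" for e e' es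
    using alternating_form_swap[OF Suc.prems, of "[]" "map S es" "S e" "S e'"] that by simp
  have "(\<Sum>es\<in>?L (Suc (Suc d)). \<alpha> (map S es) * wedge f \<gamma> es)
      = (\<Sum>e\<in>F. \<Sum>es\<in>?L (Suc d). \<alpha> (S e # map S es) * (f e * \<gamma> es - wedge f (\<lambda>us. \<gamma> (e # us)) es))"
    by (simp add: sum_lists_Suc[OF F, where d = "Suc d"])
  also have "\<dots> = ?P - (\<Sum>e\<in>F. \<Sum>es\<in>?L (Suc d). \<alpha> (S e # map S es) * wedge f (\<lambda>us. \<gamma> (e # us)) es)"
    by (simp add: right_diff_distrib sum_subtractf mult_ac)
  also have "(\<Sum>e\<in>F. \<Sum>es\<in>?L (Suc d). \<alpha> (S e # map S es) * wedge f (\<lambda>us. \<gamma> (e # us)) es)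
     = (\<Sum>e\<in>F. real (Suc d) * (\<Sum>e'\<in>F. \<Sum>es\<in>?L d. f e' * \<alpha> (S e # S e' # map S es) * \<gamma> (e # es)))"
    by (intro sum.cong refl Suc.IH alternating_form_Cons[OF Suc.prems])
  also have "\<dots> = - real (Suc d) * (\<Sum>e\<in>F. \<Sum>e'\<in>F. \<Sum>es\<in>?L d. f e' * \<alpha> (S e' # S e # map S es) * \<gamma> (e # es))"
    unfolding sum_distrib_left
  proof (intro sum.cong refl)
    fix e e' es assume "es \<in> ?L d"
    then show "real (Suc d) * (f e' * \<alpha> (S e # S e' # map S es) * \<gamma> (e # es))
        = - real (Suc d) * (f e' * \<alpha> (S e' # S e # map S es) * \<gamma> (e # es))"
      by (subst sw) (simp_all add: algebra_simps)
  qed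
  also have "(\<Sum>e\<in>F. \<Sum>e'\<in>F. \<Sum>es\<in>?L d. f e' * \<alpha> (S e' # S e # map S es) * \<gamma> (e # es)) = ?P"
    by (subst sum.swap) (simp add: sum_lists_Suc[OF F])
  finally show ?case by (simp add: algebra_simps)
qed

text \<open>The wedge of \<open>f\<close> with \<epsilon> exceeds the top degree, so it vanishes on
  \<open>es @ Vs\<close>. Splitting it there moves \<open>f\<close> from the arguments of the star
  to the summed basis vectors, where it contracts \<alpha>.\<close>

lemma wedge_star:
  fixes \<alpha> :: "'v::real_vector list \<Rightarrow> real" and \<epsilon> :: "'e::euclidean_space list \<Rightarrow> real"
  assumes F: "finite F" and \<alpha>: "alternating_form (Suc d) \<alpha>"
    and \<epsilon>: "alternating_form DIM('e) \<epsilon>" and f: "linear f" and len: "Suc d + length Vs = Suc DIM('e)"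
  shows "wedge f (star (Suc d) F S \<epsilon> \<alpha>) Vs
    = (-1) ^ d * real (Suc d) * star d F S \<epsilon> (\<lambda>us. \<alpha> ((\<Sum>e\<in>F. f e *\<^sub>R S e) # us)) Vs"
proof -
  let ?L = "\<lambda>d. {es. length es = d \<and> set es \<subseteq> F}"
  have "wedge f \<epsilon> (es @ Vs) = 0" if "length es = Suc d" for es
    by (rule alternating_form_vanish_DIM[OF alternating_form_wedge[OF \<epsilon> f]]) (use len that in auto)
  then have eq: "(-1) ^ Suc d * wedge f (\<lambda>us. \<epsilon> (es @ us)) Vs = - wedge f (\<lambda>us. \<epsilon> (us @ Vs)) es"
    if "es \<in> ?L (Suc d)" for es
    using that wedge_append[of f \<epsilon> es Vs] by simp
  have "(-1) ^ Suc d * wedge f (star (Suc d) F S \<epsilon> \<alpha>) Vs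
      = (\<Sum>es\<in>?L (Suc d). \<alpha> (map S es) * ((-1) ^ Suc d * wedge f (\<lambda>us. \<epsilon> (es @ us)) Vs))"
    unfolding star_def wedge_sum sum_distrib_left by (simp only: mult_ac)
  also have "\<dots> = - (\<Sum>es\<in>?L (Suc d). \<alpha> (map S es) * wedge f (\<lambda>us. \<epsilon> (us @ Vs)) es)"
    unfolding sum_negf[symmetric] by (intro sum.cong refl) (simp only: eq mult_minus_right)
  also have "\<dots> = - (real (Suc d) * (\<Sum>e\<in>F. \<Sum>es\<in>?L d. f e * \<alpha> (S e # map S es) * \<epsilon> (es @ Vs)))"
    by (simp only: sum_lists_wedge[OF F \<alpha>])
  also have "(\<Sum>e\<in>F. \<Sum>es\<in>?L d. f e * \<alpha> (S e # map S es) * \<epsilon> (es @ Vs))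
      = (\<Sum>es\<in>?L d. (\<Sum>e\<in>F. f e * \<alpha> (S e # map S es)) * \<epsilon> (es @ Vs))"
    by (subst sum.swap) (simp add: sum_distrib_right)
  also have "\<dots> = star d F S \<epsilon> (\<lambda>us. \<alpha> ((\<Sum>e\<in>F. f e *\<^sub>R S e) # us)) Vs"
    unfolding star_def
  proof (intro sum.cong refl arg_cong2[where f = "(*)"])
    fix es assume "es \<in> ?L d"
    then have lin: "linear (\<lambda>v. \<alpha> (v # map S es))"
      by (intro alternating_form_Cons_linear[OF \<alpha>]) simp
    show "(\<Sum>e\<in>F. f e * \<alpha> (S e # map S es)) = \<alpha> ((\<Sum>e\<in>F. f e *\<^sub>R S e) # map S es)"
      using linear_sum[OF lin, of "\<lambda>e. f e *\<^sub>R S e" F] linear_scale[OF lin] by simp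
  qed
  finally have "(-1) ^ Suc d * wedge f (star (Suc d) F S \<epsilon> \<alpha>) Vs
      = - (real (Suc d) * star d F S \<epsilon> (\<lambda>us. \<alpha> ((\<Sum>e\<in>F. f e *\<^sub>R S e) # us)) Vs)" .
  then have "(-1) ^ d * ((-1) ^ d * wedge f (star (Suc d) F S \<epsilon> \<alpha>) Vs)
      = (-1) ^ d * (real (Suc d) * star d F S \<epsilon> (\<lambda>us. \<alpha> ((\<Sum>e\<in>F. f e *\<^sub>R S e) # us)) Vs)"
    by simp
  then show ?thesis by (simp add: power_mult_distrib[symmetric] mult.assoc[symmetric])
qed

text \<open>Induction on the degree: contracting \<alpha> with a vector corresponds under the star
  to a wedge with a functional, so if the star of \<alpha> is zero, the stars of all contractions
  are zero as well.\<close>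

lemma star_injective:
  fixes \<alpha> :: "'v::real_vector list \<Rightarrow> real" and \<epsilon> :: "'e::euclidean_space list \<Rightarrow> real"
  assumes S: "linear S" "surj S"
    and \<epsilon>: "alternating_form DIM('e) \<epsilon>" "length Us = DIM('e)" "\<epsilon> Us \<noteq> 0"
    and "alternating_form d \<alpha>" "d \<le> DIM('e)"
    and "\<And>Ws. length Ws = DIM('e) - d \<Longrightarrow> star d Basis S \<epsilon> \<alpha> Ws = 0" "length Vs = d"
  shows "\<alpha> Vs = 0"
  using assms(6-9)
proof (induction d arbitrary: \<alpha> Vs)
  case 0
  have "star 0 Basis S \<epsilon> \<alpha> Us = \<alpha> [] * \<epsilon> Us"
    unfolding star_def by (simp only: sum_lists_0 list.map append_Nil)
  then show ?case using 0 \<epsilon> by simp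
next
  case (Suc d)
  obtain Y Ys where Vs: "Vs = Y # Ys" "length Ys = d" using Suc.prems(4) by (cases Vs) auto
  obtain y where y: "Y = S y" using S(2) by (metis surjD)
  \<comment> \<open>The functional is chosen so that the vector contracted into \<alpha> becomes
    \<open>S y = Y\<close>.\<close>
  have f: "linear (\<lambda>v. v \<bullet> y)" by (simp add: bounded_linear.linear bounded_linear_inner_left)
  have "(\<Sum>e\<in>Basis. (e \<bullet> y) *\<^sub>R S e) = S (\<Sum>e\<in>Basis. (y \<bullet> e) *\<^sub>R e)"
    by (simp add: linear_sum[OF S(1)] linear_scale[OF S(1)] inner_commute)
  then have Y: "(\<Sum>e\<in>Basis. (e \<bullet> y) *\<^sub>R S e) = Y" by (simp add: euclidean_representation y)
  have "star d Basis S \<epsilon> (\<lambda>us. \<alpha> (Y # us)) Ws = 0" if Ws: "length Ws = DIM('e) - d" for Ws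
  proof -
    have "wedge (\<lambda>v. v \<bullet> y) (star (Suc d) Basis S \<epsilon> \<alpha>) Ws = 0"
      by (rule wedge_zero, rule Suc.prems(3)) (use Ws Suc.prems(2) in simp)
    then show ?thesis
      using wedge_star[OF finite_Basis Suc.prems(1) \<epsilon>(1) f, of Ws S] Ws Suc.prems(2) by (simp add: Y)
  qed
  from Suc.IH[OF alternating_form_Cons[OF Suc.prems(1)] _ this Vs(2)] show ?case
    using Suc.prems(2) Vs(1) by simp
qed

section \<open>The tractor volume form\<close>

definition index_list :: "'n::finite list" where
  "index_list = (SOME is. distinct is \<and> set is = (UNIV :: 'n set))"

lemma index_list: "distinct (index_list :: 'n::finite list)" "set (index_list :: 'n list) = UNIV"
proof -
  have "\<exists>is. distinct is \<and> set is = (UNIV :: 'n set)"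
    using finite_distinct_list[of "UNIV :: 'n set"] by auto
  from someI_ex[OF this] show "distinct (index_list :: 'n list)" "set (index_list :: 'n list) = UNIV"
    unfolding index_list_def by auto
qed

lemma length_index_list [simp]: "length (index_list :: 'n::finite list) = CARD('n)"
  using distinct_card[OF index_list(1)] index_list(2) by metis

text \<open>Position of an index in the chosen enumeration. In \<open>frame_list\<close> the index
  \<open>a\<close> stands at \<open>Suc (index_pos a)\<close>, because the top slot comes
  first.\<close>

definition index_pos :: "'n::finite \<Rightarrow> nat" where
  "index_pos = inv_into {..<CARD('n)} ((!) index_list)"

lemma bij_index_list: "bij_betw ((!) (index_list :: 'n::finite list)) {..<CARD('n)} UNIV"
  by (rule bij_betw_nth) (auto simp: index_list)

lemma bij_index_pos: "bij_betw (index_pos :: 'n::finite \<Rightarrow> nat) UNIV {..<CARD('n)}"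
  unfolding index_pos_def by (rule bij_betw_inv_into[OF bij_index_list])

lemma index_pos_less: "index_pos (a :: 'n::finite) < CARD('n)"
  using bij_index_pos[where 'n='n] by (auto simp: bij_betw_def)

lemma index_list_pos: "index_list ! index_pos (a :: 'n::finite) = a"
  unfolding index_pos_def by (rule bij_betw_inv_into_right[OF bij_index_list]) simp

lemma frame_list_eq:
  "frame_list = ((1, 0, 0) :: 'n::finite tractor) # map (\<lambda>a. (0, axis a 1, 0)) index_list @ [(0, 0, 1)]"
  unfolding frame_list_def index_list_def ..

lemma DIM_tractor: "DIM('n::finite tractor) = CARD('n) + 2"
  by (simp add: DIM_prod)

lemma length_frame_list: "length (frame_list :: 'n::finite tractor list) = CARD('n) + 2"
  by (simp add: frame_list_eq)

lemma frame_list_0: "(frame_list :: 'n::finite tractor list) ! 0 = (1, 0, 0)"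
  by (simp add: frame_list_eq)

lemma frame_list_last: "(frame_list :: 'n::finite tractor list) ! Suc CARD('n) = (0, 0, 1)"
  by (simp add: frame_list_eq nth_append)

lemma frame_list_mid: "(frame_list :: 'n::finite tractor list) ! Suc (index_pos a) = (0, axis a 1, 0)"
  by (simp add: frame_list_eq nth_append index_pos_less index_list_pos)

lemma set_frame_list: "set (frame_list :: 'n::finite tractor list) = Basis"
proof -
  have "set (frame_list :: 'n tractor list)
      = {(1, 0, 0), (0, 0, 1)} \<union> (\<lambda>a. (0, axis a 1, 0)) ` UNIV"
    by (auto simp: frame_list_eq index_list)
  also have "\<dots> = Basis"
    by (auto simp: Basis_prod_def Basis_vec_def zero_prod_def)
  finally show ?thesis .
qed

lemma distinct_frame_list: "distinct (frame_list :: 'n::finite tractor list)"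
  by (rule card_distinct) (simp add: set_frame_list length_frame_list DIM_tractor del: DIM_prod)

text \<open>All metric dependence of \<open>volume_form\<close> sits in a scalar factor; what
  remains is this constant determinant in the frame.\<close>

definition vol :: "'n::finite tractor list \<Rightarrow> real" where
  "vol Vs = (\<Sum>\<pi> | \<pi> permutes {..<CARD('n) + 2}. of_int (sign \<pi>) *
        (\<Prod>k<CARD('n) + 2. (Vs ! k) \<bullet> (frame_list ! \<pi> k)))"

lemma volume_form_eq: "volume_form M Vs = inverse (sqrt (det M)) * vol Vs"
  unfolding volume_form_def vol_def ..

lemma linear_sum_inner:
  fixes w :: "'i \<Rightarrow> 'v::real_inner"
  shows "linear (\<lambda>v. \<Sum>i\<in>I. c i * (v \<bullet> w i))"
  by (rule linearI) (simp_all add: inner_add_left distrib_left sum.distrib sum_distrib_left mult.left_commute)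

lemma alternating_vol: "alternating_form (CARD('n) + 2) (vol :: 'n::finite tractor list \<Rightarrow> real)"
proof (rule alternating_formI)
  fix xs ys :: "'n tractor list" assume l: "length xs + length ys + 1 = CARD('n) + 2"
  have p: "length xs \<in> {..<CARD('n) + 2}" using l by simp
  have "vol (xs @ v # ys) = (\<Sum>\<pi> | \<pi> permutes {..<CARD('n) + 2}. of_int (sign \<pi>) *
      (\<Prod>k\<in>{..<CARD('n) + 2} - {length xs}. ((xs @ 0 # ys) ! k) \<bullet> (frame_list ! \<pi> k)) *
      (v \<bullet> (frame_list ! \<pi> (length xs))))" for v
    unfolding vol_def
  proof (intro sum.cong refl)
    fix \<pi> :: "nat \<Rightarrow> nat"
    have "(\<Prod>k\<in>{..<CARD('n) + 2} - {length xs}. ((xs @ v # ys) ! k) \<bullet> (frame_list ! \<pi> k))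
       = (\<Prod>k\<in>{..<CARD('n) + 2} - {length xs}. ((xs @ 0 # ys) ! k) \<bullet> (frame_list ! \<pi> k))"
      by (rule prod.cong) (auto simp: nth_append nth_Cons')
    then show "of_int (sign \<pi>) * (\<Prod>k<CARD('n) + 2. ((xs @ v # ys) ! k) \<bullet> (frame_list ! \<pi> k))
      = of_int (sign \<pi>) *
      (\<Prod>k\<in>{..<CARD('n) + 2} - {length xs}. ((xs @ 0 # ys) ! k) \<bullet> (frame_list ! \<pi> k)) *
      (v \<bullet> (frame_list ! \<pi> (length xs)))"
      by (subst prod.remove[OF _ p]) (simp_all add: mult_ac)
  qed
  then show "linear (\<lambda>v. vol (xs @ v # ys))"
    by (simp only: linear_sum_inner)
next
  fix Vs :: "'n tractor list" assume l: "length Vs = CARD('n) + 2" "\<not> distinct Vs"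
  then obtain p q where pq: "p < CARD('n) + 2" "q < CARD('n) + 2" "p \<noteq> q" "Vs ! p = Vs ! q"
    by (auto simp: distinct_conv_nth)
  let ?S = "{..<CARD('n) + 2}" and ?t = "Transposition.transpose p q"
  have t: "?t permutes ?S" by (rule permutes_swap_id) (use pq in auto)
  let ?f = "\<lambda>\<pi>. of_int (sign \<pi>) * (\<Prod>k\<in>?S. (Vs ! k) \<bullet> (frame_list ! \<pi> k))"
  \<comment> \<open>Reindexing by the transposition of the two equal arguments reverses every sign
    and keeps every product, so the sum equals its own negative.\<close>
  have "vol Vs = (\<Sum>\<pi> | \<pi> permutes ?S. ?f (\<pi> \<circ> ?t))"
    unfolding vol_def by (rule sum_permutations_compose_right[OF t])
  also have "\<dots> = (\<Sum>\<pi> | \<pi> permutes ?S. - ?f \<pi>)"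
  proof (intro sum.cong refl)
    fix \<pi> assume "\<pi> \<in> {\<pi>. \<pi> permutes ?S}"
    then have \<pi>: "permutation \<pi>" using permutation_permutes finite_lessThan by blast
    have s: "sign (\<pi> \<circ> ?t) = - sign \<pi>"
      by (subst sign_compose[OF \<pi> permutation_swap_id]) (simp add: sign_swap_id pq(3))
    have "Vs ! ?t k = Vs ! k" for k using pq(4) by (cases "k = p"; cases "k = q") auto
    then have "(\<Prod>k\<in>?S. (Vs ! k) \<bullet> (frame_list ! (\<pi> \<circ> ?t) k))
        = (\<Prod>k\<in>?S. (Vs ! ?t k) \<bullet> (frame_list ! \<pi> (?t k)))" by simp
    also have "\<dots> = (\<Prod>k\<in>?S. (Vs ! k) \<bullet> (frame_list ! \<pi> k))"
      using prod.permute[OF t, of "\<lambda>k. (Vs ! k) \<bullet> (frame_list ! \<pi> k)"] by (simp add: o_def)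
    finally show "?f (\<pi> \<circ> ?t) = - ?f \<pi>" by (simp only: s of_int_minus mult_minus_left)
  qed
  also have "\<dots> = - vol Vs" unfolding vol_def sum_negf ..
  finally show "vol Vs = 0" by simp
qed

text \<open>The Leibniz sum of a block triangular matrix: column 0 vanishes below row 0, and the
  last row vanishes before its last entry. Only permutations fixing both ends survive, and the
  middle block is reindexed to a determinant over the index type.\<close>

lemma sum_permutes_block:
  fixes a :: "nat \<Rightarrow> nat \<Rightarrow> real"
  assumes c0: "\<And>k. 1 \<le> k \<Longrightarrow> k < CARD('n::finite) + 2 \<Longrightarrow> a k 0 = 0"
    and rl: "\<And>j. j < CARD('n) + 1 \<Longrightarrow> a (Suc CARD('n)) j = 0"
  shows "(\<Sum>\<pi> | \<pi> permutes {..<CARD('n) + 2}. of_int (sign \<pi>) * (\<Prod>k<CARD('n) + 2. a k (\<pi> k)))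
    = a 0 0 * a (Suc CARD('n)) (Suc CARD('n))
      * det (\<chi> i j. a (Suc (index_pos i)) (Suc (index_pos (j :: 'n))))"
proof -
  let ?N = "CARD('n) + 2" and ?l = "Suc CARD('n)" and ?M = "{1..CARD('n)}"
  let ?i = "\<lambda>i :: 'n. Suc (index_pos i)"
  let ?f = "\<lambda>\<pi>. of_int (sign \<pi>) * (\<Prod>k<?N. a k (\<pi> k))"
  have S: "{..<?N} = insert 0 (insert ?l ?M)" by auto
  have bij: "bij_betw ?i UNIV ?M"
  proof -
    have "bij_betw Suc {..<CARD('n)} ?M"
      by (auto simp: bij_betw_def image_Suc_lessThan)
    from bij_betw_trans[OF bij_index_pos this] show ?thesis by (simp add: o_def)
  qed
  have "(\<Sum>\<pi> | \<pi> permutes {..<?N}. ?f \<pi>) = (\<Sum>\<pi> | \<pi> permutes ?M. ?f \<pi>)"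
  proof (rule sum.mono_neutral_right)
    show "finite {\<pi>. \<pi> permutes {..<?N}}" by (simp add: finite_permutations)
    show "{\<pi>. \<pi> permutes ?M} \<subseteq> {\<pi>. \<pi> permutes {..<?N}}"
      by (auto intro: permutes_subset)
    show "\<forall>\<pi>\<in>{\<pi>. \<pi> permutes {..<?N}} - {\<pi>. \<pi> permutes ?M}. ?f \<pi> = 0"
    proof
      fix \<pi> assume "\<pi> \<in> {\<pi>. \<pi> permutes {..<?N}} - {\<pi>. \<pi> permutes ?M}"
      then have \<pi>: "\<pi> permutes {..<?N}" "\<not> \<pi> permutes ?M" by auto
      \<comment> \<open>A permutation that fixes both ends permutes the middle; any other one meets
        a zero entry in the last row or in column 0.\<close>
      have "\<pi> 0 \<noteq> 0 \<or> \<pi> ?l \<noteq> ?l"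
      proof (rule ccontr)
        assume neg: "\<not> ?thesis"
        have "\<pi> permutes ?M"
        proof (intro permutes_superset[OF \<pi>(1)])
          fix x assume "x \<in> {..<?N} - ?M"
          then have "x = 0 \<or> x = ?l" by auto
          then show "\<pi> x = x" using neg by auto
        qed
        then show False using \<pi>(2) by simp
      qed
      then have "\<exists>k<?N. a k (\<pi> k) = 0"
      proof
        assume l: "\<pi> ?l \<noteq> ?l"
        have "\<pi> ?l < ?N" using permutes_in_image[OF \<pi>(1), of ?l] by simp
        then have "a ?l (\<pi> ?l) = 0" using l by (intro rl) simp
        then show ?thesis by (intro exI[of _ ?l]) simp
      next
        assume z: "\<pi> 0 \<noteq> 0"
        \<comment> \<open>The row that \<pi> sends to column 0. It is not row 0, since \<pi> moves
          0.\<close>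
        define k where "k = inv \<pi> 0"
        have k: "\<pi> k = 0" unfolding k_def using permutes_inverses(1)[OF \<pi>(1)] .
        have "k < ?N" using permutes_in_image[OF \<pi>(1), of k] k by simp
        moreover have "k \<noteq> 0" using k z by (cases k) auto
        ultimately show ?thesis using c0[of k] k by (intro exI[of _ k]) simp
      qed
      then have "(\<Prod>k<?N. a k (\<pi> k)) = 0" by (intro prod_zero) auto
      then show "?f \<pi> = 0" by simp
    qed
  qed
  also have "\<dots> = (\<Sum>\<pi> | \<pi> permutes ?M. of_int (sign \<pi>) * (a 0 0 * a ?l ?l * (\<Prod>k\<in>?M. a k (\<pi> k))))"
  proof (intro sum.cong refl)
    fix \<pi> assume "\<pi> \<in> {\<pi>. \<pi> permutes ?M}"
    then have "\<pi> 0 = 0" "\<pi> ?l = ?l" by (auto simp: permutes_def)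
    then show "?f \<pi> = of_int (sign \<pi>) * (a 0 0 * a ?l ?l * (\<Prod>k\<in>?M. a k (\<pi> k)))"
      unfolding S by simp
  qed
  also have "\<dots> = (\<Sum>p | p permutes (UNIV :: 'n set). of_int (sign p) *
       (a 0 0 * a ?l ?l * (\<Prod>i\<in>UNIV. a (?i i) (?i (p i)))))"
  proof (rule sum.reindex_bij_witness[where i = "map_permutation UNIV ?i" and j = "map_permutation ?M (inv_into UNIV ?i)"])
    fix \<pi> assume "\<pi> \<in> {\<pi>. \<pi> permutes ?M}"
    then have \<pi>: "\<pi> permutes ?M" by simp
    have inv: "bij_betw (inv_into UNIV ?i) ?M UNIV" by (rule bij_betw_inv_into[OF bij])
    show "map_permutation UNIV ?i (map_permutation ?M (inv_into UNIV ?i) \<pi>) = \<pi>"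
      by (rule map_permutation_compose_inv[OF inv \<pi>]) (use bij_betw_inv_into_right[OF bij] in auto)
    show q: "map_permutation ?M (inv_into UNIV ?i) \<pi> \<in> {p. p permutes UNIV}"
      using map_permutation_permutes[OF inv \<pi>] by simp
    let ?q = "map_permutation ?M (inv_into UNIV ?i) \<pi>"
    have "sign ?q = sign \<pi>"
      by (rule sign_map_permutation[OF bij_betw_imp_inj_on[OF inv] \<pi>]) simp
    moreover have "?i (?q i) = \<pi> (?i i)" for i
    proof -
      have "?q (inv_into UNIV ?i (?i i)) = inv_into UNIV ?i (\<pi> (?i i))"
        by (rule map_permutation_apply[OF bij_betw_imp_inj_on[OF inv]]) (use bij in \<open>auto simp: bij_betw_def\<close>)
      moreover have "inv_into UNIV ?i (?i i) = i" using bij_betw_inv_into_left[OF bij] by simp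
      moreover have "?i (inv_into UNIV ?i (\<pi> (?i i))) = \<pi> (?i i)"
        by (rule bij_betw_inv_into_right[OF bij])
           (use permutes_in_image[OF \<pi>, of "?i i"] bij in \<open>auto simp: bij_betw_def\<close>)
      ultimately show ?thesis by simp
    qed
    ultimately show "of_int (sign ?q) * (a 0 0 * a ?l ?l * (\<Prod>i\<in>UNIV. a (?i i) (?i (?q i))))
        = of_int (sign \<pi>) * (a 0 0 * a ?l ?l * (\<Prod>k\<in>?M. a k (\<pi> k)))"
      using prod.reindex_bij_betw[OF bij, of "\<lambda>k. a k (\<pi> k)"] by simp
  next
    fix p assume "p \<in> {p. p permutes (UNIV :: 'n set)}"
    then have p: "p permutes (UNIV :: 'n set)" by simp
    show "map_permutation ?M (inv_into UNIV ?i) (map_permutation UNIV ?i p) = p"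
      by (rule map_permutation_compose_inv[OF bij p]) (use bij_betw_inv_into_left[OF bij] in auto)
    show "map_permutation UNIV ?i p \<in> {\<pi>. \<pi> permutes ?M}"
      using map_permutation_permutes[OF bij p] by simp
  qed
  also have "\<dots> = a 0 0 * a ?l ?l * det (\<chi> i j. a (?i i) (?i j))"
    unfolding det_def by (simp add: sum_distrib_left mult_ac)
  finally show ?thesis .
qed

lemma inner_frame_list:
  fixes V :: "'n::finite tractor"
  shows "V \<bullet> frame_list ! 0 = fst V"
    "V \<bullet> frame_list ! Suc CARD('n) = snd (snd V)"
    "V \<bullet> frame_list ! Suc (index_pos a) = fst (snd V) $ a"
  by (simp_all add: frame_list_0 frame_list_last frame_list_mid inner_prod_def inner_axis)

lemma frame_index_cases:
  assumes "k < CARD('n::finite) + 2"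
  obtains "k = 0" | a :: "'n::finite" where "k = Suc (index_pos a)" | "k = Suc CARD('n)"
proof -
  consider "k = 0" | "k = Suc CARD('n)" | j where "k = Suc j" "j < CARD('n)"
    using assms by (cases k) force+
  then show ?thesis
  proof cases
    case (3 j)
    then obtain a :: 'n where "j = index_pos a" using bij_index_pos[where 'n='n] by (auto simp: bij_betw_def)
    then show ?thesis using 3 that(2) by simp
  qed (use that in auto)
qed

text \<open>Changes of scale and chart respect the filtration of the tractor bundle by its slots, so
  they are block triangular in the frame and their determinant is the product of the three diagonal
  blocks.\<close>

lemma vol_map_frame_list:
  fixes K :: "'n::finite tractor \<Rightarrow> 'n tractor"
  assumes K1: "fst (K (1, 0, 0)) = x" and K2: "\<And>a. fst (K (0, axis a 1, 0)) = 0"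
      "\<And>a. fst (snd (K (0, axis a 1, 0))) = P *v axis a 1"
    and K3: "K (0, 0, 1) = (0, 0, z)"
  shows "vol (map K frame_list) = x * z * det P"
proof -
  let ?a = "\<lambda>k j. K (frame_list ! k) \<bullet> (frame_list ! j)"
  have "vol (map K frame_list) = (\<Sum>\<pi> | \<pi> permutes {..<CARD('n) + 2}. of_int (sign \<pi>) * (\<Prod>k<CARD('n) + 2. ?a k (\<pi> k)))"
    unfolding vol_def by (intro sum.cong prod.cong refl arg_cong2[where f = "(*)"]) (simp add: length_frame_list)
  also have "\<dots> = ?a 0 0 * ?a (Suc CARD('n)) (Suc CARD('n))
    * det (\<chi> i j. ?a (Suc (index_pos i)) (Suc (index_pos (j :: 'n))))"
  proof (rule sum_permutes_block)
    fix k assume k: "1 \<le> k" "k < CARD('n) + 2"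
    from frame_index_cases[OF k(2)] show "?a k 0 = 0"
      by cases (use k(1) K2(1) K3 in \<open>simp_all only: inner_frame_list frame_list_mid frame_list_last, simp_all\<close>)
  next
    fix j assume j: "j < CARD('n) + 1"
    then have "j < CARD('n) + 2" by simp
    from frame_index_cases[OF this] show "?a (Suc CARD('n)) j = 0"
      by cases (use j K3 in \<open>simp_all only: inner_frame_list frame_list_last, simp_all\<close>)
  qed
  also have "(\<chi> i j. ?a (Suc (index_pos i)) (Suc (index_pos (j :: 'n)))) = transpose P"
    unfolding inner_frame_list unfolding frame_list_mid K2
    by (simp add: transpose_def matrix_vector_mult_basis column_def)
  also have "?a 0 0 = x" unfolding inner_frame_list unfolding frame_list_0 by (rule K1)
  also have "?a (Suc CARD('n)) (Suc CARD('n)) = z"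
    unfolding inner_frame_list unfolding frame_list_last by (simp add: K3)
  finally show ?thesis by simp
qed

lemma vol_frame_list: "vol (frame_list :: 'n::finite tractor list) = 1"
  using vol_map_frame_list[of "\<lambda>v :: 'n tractor. v" 1 "mat 1" 1] by simp

lemma vol_top:
  fixes \<alpha> :: "'n::finite tractor list \<Rightarrow> real"
  assumes "alternating_form (CARD('n) + 2) \<alpha>" "length Vs = CARD('n) + 2"
  shows "\<alpha> Vs = \<alpha> frame_list * vol Vs"
  by (rule alternating_form_top_unique[where 'v = "'n tractor", unfolded DIM_tractor, OF assms(1) alternating_vol
        distinct_frame_list set_frame_list vol_frame_list assms(2)])

lemma vol_triangular:
  fixes L :: "'n::finite tractor \<Rightarrow> 'n tractor"
  assumes "linear L" "fst (L (1, 0, 0)) = x"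
    and "\<And>a. fst (L (0, axis a 1, 0)) = 0" "\<And>a. fst (snd (L (0, axis a 1, 0))) = P *v axis a 1"
    and "L (0, 0, 1) = (0, 0, z)" and "length Vs = CARD('n) + 2"
  shows "vol (map L Vs) = x * z * det P * vol Vs"
  using vol_top[OF alternating_form_map[OF alternating_vol assms(1)] assms(6)]
    vol_map_frame_list[of L x P z, OF assms(2-5)] by simp

text \<open>The expression is the derivative at \<open>t = 0\<close> of the pullback of \<alpha> by
  the linear maps \<open>v + t C v\<close>.\<close>

lemma alternating_form_derivation:
  fixes \<alpha> :: "'v::euclidean_space list \<Rightarrow> real"
  assumes "alternating_form k \<alpha>" "linear C"
  shows "alternating_form k (\<lambda>Vs. \<Sum>j<k. \<alpha> (Vs[j := C (Vs ! j)]))"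
proof (rule alternating_form_derivative)
  have lin: "linear (\<lambda>v. v + t *\<^sub>R C v)" for t
    using assms(2) by (simp add: linear_iff algebra_simps)
  show "\<forall>\<^sub>F t in nhds 0. alternating_form k (\<lambda>Vs. \<alpha> (map (\<lambda>v. v + t *\<^sub>R C v) Vs))"
    by (intro always_eventually allI alternating_form_map[OF assms(1) lin])
next
  fix Vs :: "'v list" assume Vs: "length Vs = k"
  have "((\<lambda>t. \<alpha> (map (\<lambda>p. p t) (map (\<lambda>v t. v + t *\<^sub>R C v) Vs))) has_vector_derivative
      0 + (\<Sum>j<k. \<alpha> ((map (\<lambda>p. p 0) (map (\<lambda>v t. v + t *\<^sub>R C v) Vs))[j := map C Vs ! j]))) (at 0)"
  proof (rule has_vector_derivative_form[where \<alpha> = "\<lambda>t. \<alpha>" and \<alpha>' = "\<lambda>_. 0"])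
    have "((\<lambda>t. v + t *\<^sub>R C v) has_vector_derivative C v) (at 0)" for v
      by (auto intro!: derivative_eq_intros)
    then show "list_all2 (\<lambda>p p'. (p has_vector_derivative p') (at 0)) (map (\<lambda>v t. v + t *\<^sub>R C v) Vs) (map C Vs)"
      by (simp add: list_all2_conv_all_nth)
  qed (use assms Vs in auto)
  then show "((\<lambda>t. \<alpha> (map (\<lambda>v. v + t *\<^sub>R C v) Vs)) has_vector_derivative
      (\<Sum>j<k. \<alpha> (Vs[j := C (Vs ! j)]))) (at 0)"
    using Vs by (simp add: o_def)
qed

text \<open>A derivation multiplies top forms by a number, which is read off on the frame: replacing
  the \<open>k\<close>-th frame vector by its image leaves the \<open>k\<close>-th diagonal entry,
  and these add up to the trace of \<open>C\<close>.\<close>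

lemma vol_derivation:
  fixes C :: "'n::finite tractor \<Rightarrow> 'n tractor"
  assumes "linear C" "length Vs = CARD('n) + 2"
  shows "(\<Sum>k<CARD('n) + 2. vol (Vs[k := C (Vs ! k)])) = (\<Sum>b\<in>Basis. C b \<bullet> b) * vol Vs"
proof -
  let ?fl = "frame_list :: 'n tractor list"
  have "vol (?fl[k := C (?fl ! k)]) = C (?fl ! k) \<bullet> (?fl ! k)" if k: "k < CARD('n) + 2" for k
  proof -
    have len: "k < length ?fl" using k by (simp add: length_frame_list)
    have upd: "?fl[k := v] = take k ?fl @ v # drop (Suc k) ?fl" for v
      by (rule upd_conv_take_nth_drop[OF len])
    have lin: "linear (\<lambda>v. vol (?fl[k := v]))"
      unfolding upd by (rule alternating_form_linear[OF alternating_vol]) (use k in \<open>simp add: length_frame_list\<close>)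
    have z: "vol (?fl[k := b]) = (if b = ?fl ! k then 1 else 0)" if b: "b \<in> Basis" for b
    proof (cases "b = ?fl ! k")
      case True
      then show ?thesis by (simp add: vol_frame_list)
    next
      case False
      from b obtain j where j: "j < length ?fl" "?fl ! j = b"
        using set_frame_list[where 'n='n] by (metis in_set_conv_nth)
      have "k \<noteq> j" using j False by auto
      moreover have "?fl[k := b] ! k = ?fl[k := b] ! j" using j len \<open>k \<noteq> j\<close> by simp
      ultimately have "\<not> distinct (?fl[k := b])"
        using j(1) len unfolding distinct_conv_nth by (metis length_list_update)
      then have "vol (?fl[k := b]) = 0"
        by (intro alternating_form_repeat[OF alternating_vol]) (simp_all add: length_frame_list)
      then show ?thesis using False by simp
    qed
    have "vol (?fl[k := (\<Sum>b\<in>Basis. (C (?fl ! k) \<bullet> b) *\<^sub>R b)])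
        = (\<Sum>b\<in>Basis. (C (?fl ! k) \<bullet> b) * vol (?fl[k := b]))"
      by (simp only: linear_sum[OF lin] linear_scale[OF lin] real_scaleR_def)
    also have "\<dots> = (\<Sum>b\<in>Basis. if b = ?fl ! k then C (?fl ! k) \<bullet> b else 0)"
      by (intro sum.cong refl) (simp add: z)
    also have "\<dots> = C (?fl ! k) \<bullet> (?fl ! k)"
      using nth_mem[OF len] by (simp add: set_frame_list)
    finally show ?thesis by (simp add: euclidean_representation)
  qed
  then have "(\<Sum>k<CARD('n) + 2. vol (?fl[k := C (?fl ! k)])) = (\<Sum>k<CARD('n) + 2. C (?fl ! k) \<bullet> (?fl ! k))"
    by simp
  also have "\<dots> = (\<Sum>b\<in>set ?fl. C b \<bullet> b)"
  proof -
    have "bij_betw ((!) ?fl) {..<CARD('n) + 2} (set ?fl)"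
      by (rule bij_betw_nth[OF distinct_frame_list _ refl]) (simp add: length_frame_list)
    from sum.reindex_bij_betw[OF this, of "\<lambda>b. C b \<bullet> b"] show ?thesis .
  qed
  finally have "(\<Sum>k<CARD('n) + 2. vol (?fl[k := C (?fl ! k)])) = (\<Sum>b\<in>Basis. C b \<bullet> b)"
    by (simp only: set_frame_list)
  then show ?thesis
    using vol_top[OF alternating_form_derivation[OF alternating_vol assms(1)] assms(2)] by simp
qed

section \<open>Symmetry of second derivatives\<close>

text \<open>The mean value theorem is applied in direction \<open>a\<close> to a difference in
  direction \<open>b\<close>, then in direction \<open>b\<close> to the derivative. The point is
  that the second difference is symmetric in \<open>a\<close> and \<open>b\<close>.\<close>

lemma double_difference_mvt:
  fixes f :: "'a::real_normed_vector \<Rightarrow> real"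
  assumes sm: "smooth_on U f" and s: "s > 0"
    and U: "\<And>p q. 0 \<le> p \<Longrightarrow> p \<le> s \<Longrightarrow> 0 \<le> q \<Longrightarrow> q \<le> s \<Longrightarrow> x + p *\<^sub>R a + q *\<^sub>R b \<in> U"
  shows "\<exists>p q. 0 \<le> p \<and> p \<le> s \<and> 0 \<le> q \<and> q \<le> s \<and>
    f (x + s *\<^sub>R a + s *\<^sub>R b) - f (x + s *\<^sub>R a) - f (x + s *\<^sub>R b) + f x
    = s * (s * frechet_derivative (\<lambda>y. frechet_derivative f (at y) a) (at (x + p *\<^sub>R a + q *\<^sub>R b)) b)"
proof -
  let ?F = "\<lambda>y. frechet_derivative f (at y) a"
  let ?G = "\<lambda>y. frechet_derivative ?F (at y) b"
  have d1: "((\<lambda>p. f (x + p *\<^sub>R a + q *\<^sub>R b)) has_real_derivative ?F (x + p *\<^sub>R a + q *\<^sub>R b)) (at p)"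
    if "0 \<le> p" "p \<le> s" "0 \<le> q" "q \<le> s" for p q
  proof -
    have "((\<lambda>p. x + p *\<^sub>R a + q *\<^sub>R b) has_derivative (\<lambda>t. t *\<^sub>R a)) (at p)"
      by (auto intro!: derivative_eq_intros)
    from has_derivative_compose[OF this smooth_on_has_derivative[OF sm U[OF that]]]
    show ?thesis unfolding has_field_derivative_def
      by (simp add: linear_scale[OF has_derivative_linear[OF smooth_on_has_derivative[OF sm U[OF that]]]] mult_commute_abs)
  qed
  have sm': "smooth_on U ?F" by (rule smooth_on_derivative[OF sm])
  have d2: "((\<lambda>q. ?F (x + p *\<^sub>R a + q *\<^sub>R b)) has_real_derivative ?G (x + p *\<^sub>R a + q *\<^sub>R b)) (at q)"
    if "0 \<le> p" "p \<le> s" "0 \<le> q" "q \<le> s" for p q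
  proof -
    have "((\<lambda>q. x + p *\<^sub>R a + q *\<^sub>R b) has_derivative (\<lambda>t. t *\<^sub>R b)) (at q)"
      by (auto intro!: derivative_eq_intros)
    from has_derivative_compose[OF this smooth_on_has_derivative[OF sm' U[OF that]]]
    show ?thesis unfolding has_field_derivative_def
      by (simp add: linear_scale[OF has_derivative_linear[OF smooth_on_has_derivative[OF sm' U[OF that]]]] mult_commute_abs)
  qed
  have "\<exists>p. 0 < p \<and> p < s \<and>
     (f (x + s *\<^sub>R a + s *\<^sub>R b) - f (x + s *\<^sub>R a + 0 *\<^sub>R b)) - (f (x + 0 *\<^sub>R a + s *\<^sub>R b) - f (x + 0 *\<^sub>R a + 0 *\<^sub>R b))
     = (s - 0) * (?F (x + p *\<^sub>R a + s *\<^sub>R b) - ?F (x + p *\<^sub>R a + 0 *\<^sub>R b))"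
    using s by (intro MVT2 DERIV_diff d1) auto
  then obtain p where p: "0 < p" "p < s" and
     eq1: "f (x + s *\<^sub>R a + s *\<^sub>R b) - f (x + s *\<^sub>R a) - f (x + s *\<^sub>R b) + f x
     = s * (?F (x + p *\<^sub>R a + s *\<^sub>R b) - ?F (x + p *\<^sub>R a + 0 *\<^sub>R b))"
    by auto
  have "\<exists>q. 0 < q \<and> q < s \<and>
     ?F (x + p *\<^sub>R a + s *\<^sub>R b) - ?F (x + p *\<^sub>R a + 0 *\<^sub>R b) = (s - 0) * ?G (x + p *\<^sub>R a + q *\<^sub>R b)"
    using s p by (intro MVT2 d2) auto
  then obtain q where q: "0 < q" "q < s" and
     eq2: "?F (x + p *\<^sub>R a + s *\<^sub>R b) - ?F (x + p *\<^sub>R a + 0 *\<^sub>R b) = s * ?G (x + p *\<^sub>R a + q *\<^sub>R b)"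
    by auto
  show ?thesis
    by (rule exI[of _ p], rule exI[of _ q]) (use p q eq1 eq2 in auto)
qed

text \<open>The second difference over a small parallelogram computes both mixed derivatives at
  nearby points, and both are continuous.\<close>

lemma second_derivative_symmetric_real:
  fixes f :: "'a::real_normed_vector \<Rightarrow> real"
  assumes sm: "smooth_on U f" and U: "open U" "x \<in> U"
  shows "frechet_derivative (\<lambda>y. frechet_derivative f (at y) a) (at x) b
       = frechet_derivative (\<lambda>y. frechet_derivative f (at y) b) (at x) a" (is "?G x = ?H x")
proof -
  have cont: "isCont ?G x" "isCont ?H x"
    using smooth_on_continuous[OF smooth_on_derivative[OF smooth_on_derivative[OF sm]]] U
      continuous_on_eq_continuous_at by blast+
  have "\<bar>?G x - ?H x\<bar> \<le> e" if e: "e > 0" for e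
  proof -
    obtain d0 where d0: "d0 > 0" "\<And>y. dist y x < d0 \<Longrightarrow> y \<in> U"
      using U unfolding open_dist by blast
    obtain d1 where d1: "d1 > 0" "\<And>y. dist y x < d1 \<Longrightarrow> dist (?G y) (?G x) < e / 2"
      using cont(1) e unfolding continuous_at_eps_delta by (meson half_gt_zero)
    obtain d2 where d2: "d2 > 0" "\<And>y. dist y x < d2 \<Longrightarrow> dist (?H y) (?H x) < e / 2"
      using cont(2) e unfolding continuous_at_eps_delta by (meson half_gt_zero)
    \<comment> \<open>\<open>m\<close> is a common radius for \<open>U\<close> and both continuity
      estimates; \<open>s\<close> keeps the whole parallelogram within \<open>m / 2\<close>. The
      summand 1 in \<open>N\<close> avoids a division by zero.\<close>
    define m where "m = min d0 (min d1 d2)"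
    define N where "N = norm a + norm b + 1"
    define s where "s = m / (2 * N)"
    have m: "m > 0" using d0 d1 d2 by (simp add: m_def)
    have n: "N > 0" using norm_ge_zero[of a] norm_ge_zero[of b] unfolding N_def by linarith
    have s: "s > 0" using m n by (simp add: s_def)
    have near: "dist (x + p *\<^sub>R a + q *\<^sub>R b) x < m" if "0 \<le> p" "p \<le> s" "0 \<le> q" "q \<le> s" for p q
    proof -
      have "dist (x + p *\<^sub>R a + q *\<^sub>R b) x = norm (p *\<^sub>R a + q *\<^sub>R b)" by (simp add: dist_norm)
      also have "\<dots> \<le> p * norm a + q * norm b" using norm_triangle_ineq[of "p *\<^sub>R a" "q *\<^sub>R b"] that by simp
      also have "\<dots> \<le> s * norm a + s * norm b" by (intro add_mono mult_right_mono) (use that in auto)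
      also have "\<dots> \<le> s * N" using s by (simp add: N_def distrib_left)
      also have "\<dots> = m / 2" using n by (simp add: s_def)
      finally show ?thesis using m by simp
    qed
    have inU: "x + p *\<^sub>R a + q *\<^sub>R b \<in> U" if "0 \<le> p" "p \<le> s" "0 \<le> q" "q \<le> s" for p q
      using near[OF that] d0 by (simp add: m_def)
    have inU': "x + q *\<^sub>R b + p *\<^sub>R a \<in> U" if "0 \<le> q" "q \<le> s" "0 \<le> p" "p \<le> s" for p q
      using inU[OF that(3,4,1,2)] by (simp add: add_ac)
    from double_difference_mvt[OF sm s inU] obtain p q where pq: "0 \<le> p" "p \<le> s" "0 \<le> q" "q \<le> s"
      and e1: "f (x + s *\<^sub>R a + s *\<^sub>R b) - f (x + s *\<^sub>R a) - f (x + s *\<^sub>R b) + f x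
        = s * (s * ?G (x + p *\<^sub>R a + q *\<^sub>R b))" by auto
    from double_difference_mvt[OF sm s inU'] obtain p' q' where pq': "0 \<le> p'" "p' \<le> s" "0 \<le> q'" "q' \<le> s"
      and e2: "f (x + s *\<^sub>R b + s *\<^sub>R a) - f (x + s *\<^sub>R b) - f (x + s *\<^sub>R a) + f x
        = s * (s * ?H (x + p' *\<^sub>R b + q' *\<^sub>R a))" by blast
    have "f (x + s *\<^sub>R a + s *\<^sub>R b) = f (x + s *\<^sub>R b + s *\<^sub>R a)" by (simp add: add_ac)
    then have "s * (s * ?G (x + p *\<^sub>R a + q *\<^sub>R b)) = s * (s * ?H (x + p' *\<^sub>R b + q' *\<^sub>R a))"
      using e1 e2 by linarith
    then have eq: "?G (x + p *\<^sub>R a + q *\<^sub>R b) = ?H (x + p' *\<^sub>R b + q' *\<^sub>R a)" using s by simp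
    have "dist (?G (x + p *\<^sub>R a + q *\<^sub>R b)) (?G x) < e / 2"
      by (rule d1(2)) (use near[OF pq] in \<open>simp add: m_def\<close>)
    moreover have "dist (?H (x + p' *\<^sub>R b + q' *\<^sub>R a)) (?H x) < e / 2"
      by (rule d2(2)) (use near[OF pq'(3,4,1,2)] in \<open>simp add: m_def add_ac\<close>)
    ultimately show ?thesis using eq unfolding dist_real_def by linarith
  qed
  then have "\<bar>?G x - ?H x\<bar> \<le> 0" using field_le_epsilon[of "\<bar>?G x - ?H x\<bar>" 0] by simp
  then show ?thesis by simp
qed

lemma frechet_derivative_linear_compose:
  assumes "bounded_linear L" "(f has_derivative f') (at x)"
  shows "frechet_derivative (\<lambda>y. L (f y)) (at x) = (\<lambda>v. L (f' v))"
  using frechet_derivative_at[OF bounded_linear.has_derivative[OF assms]] by simp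

lemma second_derivative_symmetric:
  fixes f :: "'a::real_normed_vector \<Rightarrow> 'b::euclidean_space"
  assumes sm: "smooth_on U f" and U: "open U" "x \<in> U"
  shows "frechet_derivative (\<lambda>y. frechet_derivative f (at y) a) (at x) b
       = frechet_derivative (\<lambda>y. frechet_derivative f (at y) b) (at x) a"
proof (rule euclidean_eqI)
  fix c :: 'b
  have *: "frechet_derivative (\<lambda>y. frechet_derivative f (at y) a) (at x) b \<bullet> c
     = frechet_derivative (\<lambda>y. frechet_derivative (\<lambda>y. f y \<bullet> c) (at y) a) (at x) b" for a b
  proof -
    have "frechet_derivative (\<lambda>y. frechet_derivative (\<lambda>y. f y \<bullet> c) (at y) a) (at x)
        = frechet_derivative (\<lambda>y. frechet_derivative f (at y) a \<bullet> c) (at x)"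
      by (rule frechet_derivative_cong_open[OF U])
         (simp add: frechet_derivative_linear_compose[OF bounded_linear_inner_left smooth_on_has_derivative[OF sm]])
    also have "\<dots> = (\<lambda>v. frechet_derivative (\<lambda>y. frechet_derivative f (at y) a) (at x) v \<bullet> c)"
      by (rule frechet_derivative_linear_compose[OF bounded_linear_inner_left
            smooth_on_has_derivative[OF smooth_on_derivative[OF sm] U(2)]])
    finally show ?thesis by simp
  qed
  have "smooth_on U (\<lambda>y. f y \<bullet> c)" by (intro smooth U sm)
  from second_derivative_symmetric_real[OF this U]
  show "frechet_derivative (\<lambda>y. frechet_derivative f (at y) a) (at x) b \<bullet> c
       = frechet_derivative (\<lambda>y. frechet_derivative f (at y) b) (at x) a \<bullet> c"
    unfolding * .
qed

section \<open>Positive definite matrices\<close>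

definition posdef :: "real^'n^'n \<Rightarrow> bool" where
  "posdef M \<longleftrightarrow> transpose M = M \<and> (\<forall>v. v \<noteq> 0 \<longrightarrow> v \<bullet> (M *v v) > 0)"

lemma inner_matrix_transpose:
  fixes A :: "real^'n^'m"
  shows "v \<bullet> (A *v w) = (transpose A *v v) \<bullet> w"
  by (simp add: dot_lmul_matrix)

lemma posdef_inner_commute: "posdef M \<Longrightarrow> v \<bullet> (M *v w) = w \<bullet> (M *v v)"
  unfolding posdef_def by (metis inner_commute inner_matrix_transpose)

lemma posdef_nonneg: "posdef M \<Longrightarrow> v \<bullet> (M *v v) \<ge> 0"
  unfolding posdef_def by (cases "v = 0") (auto simp: less_imp_le)

lemma posdef_sym: "posdef M \<Longrightarrow> M $ i $ j = M $ j $ i"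
  unfolding posdef_def by (metis transpose_def vec_lambda_beta)

lemma det_nonzero_of_kernel:
  fixes M :: "real^'n^'n"
  assumes "\<And>v. M *v v = 0 \<Longrightarrow> v = 0"
  shows "det M \<noteq> 0"
  using assms matrix_left_invertible_ker[of M] invertible_det_nz[of M] invertible_left_inverse[of M] by blast

lemma posdef_det_nonzero: "posdef M \<Longrightarrow> det M \<noteq> 0"
  by (rule det_nonzero_of_kernel) (auto simp: posdef_def)

text \<open>The segment from the identity to \<open>M\<close> consists of positive definite
  matrices, so the determinant has no zero on it and keeps the sign it has at the identity.\<close>

lemma posdef_det_pos:
  fixes M :: "real^'n^'n"
  assumes "posdef M"
  shows "det M > 0"
proof (rule ccontr)
  assume "\<not> det M > 0"
  let ?f = "\<lambda>t. det ((1 - t) *\<^sub>R mat 1 + t *\<^sub>R M)"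
  have "continuous_on {0..1} ?f"
    unfolding det_def by (intro continuous_intros)
  moreover have "?f 1 \<le> 0" "0 \<le> ?f 0" using \<open>\<not> det M > 0\<close> by simp_all
  ultimately obtain t where t: "0 \<le> t" "t \<le> 1" "?f t = 0"
    using IVT2'[of ?f 1 0 0] by auto
  have "?f t \<noteq> 0"
  proof (rule det_nonzero_of_kernel, rule ccontr)
    fix v :: "real^'n"
    assume v: "((1 - t) *\<^sub>R mat 1 + t *\<^sub>R M) *v v = 0" "v \<noteq> 0"
    then have "0 = v \<bullet> (((1 - t) *\<^sub>R mat 1 + t *\<^sub>R M) *v v)" by simp
    also have "\<dots> = (1 - t) * (v \<bullet> v) + t * (v \<bullet> (M *v v))"
      by (simp add: matrix_vector_mult_add_rdistrib scaleR_matrix_vector_assoc[symmetric] inner_add_right)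
    also have "\<dots> > 0"
    proof (cases "t = 0")
      case False
      have "v \<bullet> (M *v v) > 0" using assms v(2) by (simp add: posdef_def)
      then show ?thesis using t False by (intro add_nonneg_pos) auto
    qed (use v(2) in simp)
    finally show False by simp
  qed
  then show False using t by simp
qed

lemma transpose_matrix_inv:
  fixes M :: "real^'n^'n"
  assumes "det M \<noteq> 0"
  shows "transpose (matrix_inv M) = matrix_inv (transpose M)"
proof -
  have "transpose M ** transpose (matrix_inv M) = mat 1"
    by (simp add: matrix_transpose_mul[symmetric] matrix_inv_inverse[OF assms] transpose_mat)
  from matrix_inv_unique[OF this] show ?thesis by simp
qed

lemma posdef_matrix_inv:
  fixes M :: "real^'n^'n"
  assumes "posdef M"
  shows "posdef (matrix_inv M)"
proof -
  have nz: "det M \<noteq> 0" by (rule posdef_det_nonzero[OF assms])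
  have "v \<bullet> (matrix_inv M *v v) > 0" if "v \<noteq> 0" for v
  proof -
    let ?w = "matrix_inv M *v v"
    have v: "M *v ?w = v" by (simp add: matrix_vector_mul_assoc matrix_inv_inverse[OF nz])
    then have "?w \<noteq> 0" using that by auto
    then have "?w \<bullet> (M *v ?w) > 0" using assms by (simp add: posdef_def)
    then show ?thesis using v by (simp add: inner_commute)
  qed
  then show ?thesis
    using transpose_matrix_inv[OF nz] assms by (simp add: posdef_def)
qed

lemma tangential_block_mult:
  fixes M :: "real^'n^'n"
  shows "(tangential_block K M *v v) $ i
    = (if i \<in> K then v $ i else (M *v (\<chi> j. if j \<in> K then 0 else v $ j)) $ i)"
proof (cases "i \<in> K")
  case True
  then show ?thesis
    by (simp add: matrix_vector_mult_def tangential_block_def if_distrib[of "\<lambda>x. x * _"] cong: if_cong)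
next
  case False
  then show ?thesis
    by (auto simp: matrix_vector_mult_def tangential_block_def intro!: sum.cong)
qed

lemma posdef_tangential_block:
  fixes M :: "real^'n^'n"
  assumes "posdef M"
  shows "posdef (tangential_block K M)"
proof -
  have "v \<bullet> (tangential_block K M *v v) > 0" if "v \<noteq> 0" for v
  proof -
    define t where "t = (\<chi> i. if i \<in> K then 0 else v $ i)"
    \<comment> \<open>The quadratic form splits into the squared length of the components in
      \<open>K\<close> and the form of \<open>M\<close> on the tangential part \<open>t\<close>; at
      least one of the two is positive.\<close>
    have "v \<bullet> (tangential_block K M *v v) = (\<Sum>i\<in>UNIV. (if i \<in> K then v $ i * v $ i else 0)) + t \<bullet> (M *v t)"
    proof -
      have "(tangential_block K M *v v) $ i = (if i \<in> K then v $ i else (M *v t) $ i)" for i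
        unfolding t_def by (rule tangential_block_mult)
      then have "v \<bullet> (tangential_block K M *v v) = (\<Sum>i\<in>UNIV. v $ i * (if i \<in> K then v $ i else (M *v t) $ i))"
        by (simp add: inner_vec_def)
      also have "\<dots> = (\<Sum>i\<in>UNIV. (if i \<in> K then v $ i * v $ i else 0) + t $ i * (M *v t) $ i)"
        by (rule sum.cong) (auto simp: t_def)
      finally show ?thesis by (simp add: sum.distrib inner_vec_def)
    qed
    moreover have "(\<Sum>i\<in>UNIV. (if i \<in> K then v $ i * v $ i else 0)) \<ge> 0" by (rule sum_nonneg) auto
    moreover have "(\<Sum>i\<in>UNIV. (if i \<in> K then v $ i * v $ i else 0)) > 0" if "t = 0"
    proof -
      obtain i where "v $ i \<noteq> 0" using \<open>v \<noteq> 0\<close> by (auto simp: vec_eq_iff)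
      moreover have "i \<in> K" using that calculation by (auto simp: t_def vec_eq_iff split: if_splits)
      ultimately show ?thesis by (intro sum_pos2[of _ i]) (auto simp: zero_less_mult_iff)
    qed
    moreover have "t \<bullet> (M *v t) > 0" if "t \<noteq> 0" using assms that by (simp add: posdef_def)
    moreover have "t \<bullet> (M *v t) \<ge> 0" by (rule posdef_nonneg[OF assms])
    ultimately show ?thesis by (cases "t = 0") auto
  qed
  moreover have "transpose (tangential_block K M) = tangential_block K M"
    using posdef_sym[OF assms] by (simp add: vec_eq_iff transpose_def tangential_block_def)
  ultimately show ?thesis by (simp add: posdef_def)
qed

section \<open>Charts\<close>

locale oriented_atlas =
  fixes A :: "('a::{t2_space, second_countable_topology}, 'n::finite) chart set"
  assumes atlas: "oriented_smooth_structure A"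
begin

lemma is_chart: "u \<in> A \<Longrightarrow> is_chart u"
  using atlas by (auto simp: oriented_smooth_structure_def)

lemma chart_exists: "\<exists>u\<in>A. p \<in> dom_of u"
  using atlas by (auto simp: oriented_smooth_structure_def)

lemma compatible: "u \<in> A \<Longrightarrow> v \<in> A \<Longrightarrow> oriented_compatible u v"
  using atlas by (auto simp: oriented_smooth_structure_def)

lemma homeo: "u \<in> A \<Longrightarrow> homeomorphism (dom_of u) (coord u ` dom_of u) (coord u) (point_of u)"
  using is_chart by (auto simp: is_chart_def)

lemma open_dom: "u \<in> A \<Longrightarrow> open (dom_of u)"
  using is_chart by (auto simp: is_chart_def)

lemma open_image: "u \<in> A \<Longrightarrow> open (coord u ` dom_of u)"
  using is_chart by (auto simp: is_chart_def)

lemma point_of_coord: "u \<in> A \<Longrightarrow> p \<in> dom_of u \<Longrightarrow> point_of u (coord u p) = p"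
  using homeomorphism_apply1[OF homeo] .

lemma inj_coord: "u \<in> A \<Longrightarrow> inj_on (coord u) (dom_of u)"
  by (rule inj_on_inverseI[of _ "point_of u"]) (rule point_of_coord)

lemma open_coord_image:
  assumes "u \<in> A" "open W"
  shows "open (coord u ` (dom_of u \<inter> W))"
proof -
  have "openin (top_of_set (coord u ` dom_of u)) (coord u ` (dom_of u \<inter> W))"
    by (rule homeomorphism_imp_open_map[OF homeo[OF assms(1)]]) (simp add: assms(2) openin_open_Int)
  then show ?thesis using open_image[OF assms(1)] openin_open_trans by blast
qed

lemma smooth_transition:
  assumes "u \<in> A" "v \<in> A"
  shows "smooth_on (coord u ` (dom_of u \<inter> dom_of v)) (coord v \<circ> point_of u)"
  using compatible[OF assms] by (simp add: oriented_compatible_def)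

lemma det_jac_pos: "u \<in> A \<Longrightarrow> v \<in> A \<Longrightarrow> p \<in> dom_of u \<Longrightarrow> p \<in> dom_of v \<Longrightarrow> det (jac u v p) > 0"
  using compatible by (auto simp: oriented_compatible_def)

lemma transition_derivative:
  assumes "u \<in> A" "v \<in> A" "p \<in> dom_of u" "p \<in> dom_of v"
  shows "((coord v \<circ> point_of u) has_derivative (\<lambda>h. jac u v p *v h)) (at (coord u p))"
proof -
  have "((coord v \<circ> point_of u) has_derivative
      frechet_derivative (coord v \<circ> point_of u) (at (coord u p))) (at (coord u p))"
    by (rule smooth_on_has_derivative[OF smooth_transition[OF assms(1,2)]]) (use assms in auto)
  then have "(coord v \<circ> point_of u) differentiable (at (coord u p))"
    by (auto simp: differentiable_def)
  then show ?thesis unfolding jac_def by (simp add: jacobian_works[symmetric])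
qed

lemma jac_unique:
  assumes "u \<in> A" "v \<in> A" "p \<in> dom_of u" "p \<in> dom_of v"
    and "((coord v \<circ> point_of u) has_derivative (\<lambda>h. M *v h)) (at (coord u p))"
  shows "jac u v p = M"
proof -
  have "(\<lambda>h. jac u v p *v h) = (\<lambda>h. M *v h)"
    by (rule has_derivative_unique[OF transition_derivative[OF assms(1-4)] assms(5)])
  then show ?thesis by (simp add: matrix_eq fun_eq_iff)
qed

lemma jac_chain:
  assumes "u \<in> A" "v \<in> A" "w \<in> A" "p \<in> dom_of u" "p \<in> dom_of v" "p \<in> dom_of w"
  shows "jac u w p = jac v w p ** jac u v p"
proof (rule jac_unique[OF assms(1,3,4,6)])
  have p: "(coord v \<circ> point_of u) (coord u p) = coord v p" using point_of_coord assms by simp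
  have "((\<lambda>x. (coord w \<circ> point_of v) ((coord v \<circ> point_of u) x)) has_derivative
      (\<lambda>h. jac v w p *v (jac u v p *v h))) (at (coord u p))"
    by (rule has_derivative_compose[OF transition_derivative[OF assms(1,2,4,5)]])
       (subst p, rule transition_derivative[OF assms(2,3,5,6)])
  then have "((coord w \<circ> point_of u) has_derivative (\<lambda>h. jac v w p *v (jac u v p *v h))) (at (coord u p))"
  proof (rule has_derivative_transform_within_open)
    show "open (coord u ` (dom_of u \<inter> dom_of v))" by (rule open_coord_image[OF assms(1) open_dom[OF assms(2)]])
    show "coord u p \<in> coord u ` (dom_of u \<inter> dom_of v)" using assms by auto
  qed (use point_of_coord assms in auto)
  then show "((coord w \<circ> point_of u) has_derivative (\<lambda>h. (jac v w p ** jac u v p) *v h)) (at (coord u p))"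
    by (simp add: matrix_vector_mul_assoc)
qed

lemma jac_same: "u \<in> A \<Longrightarrow> p \<in> dom_of u \<Longrightarrow> jac u u p = mat 1"
proof (rule jac_unique)
  assume u: "u \<in> A" "p \<in> dom_of u"
  have "((\<lambda>x. x) has_derivative (\<lambda>h. h)) (at (coord u p))" by simp
  then have "((coord u \<circ> point_of u) has_derivative (\<lambda>h. h)) (at (coord u p))"
    by (rule has_derivative_transform_within_open[OF _ open_image[OF u(1)]]) (use u point_of_coord in auto)
  then show "((coord u \<circ> point_of u) has_derivative (\<lambda>h. mat 1 *v h)) (at (coord u p))" by simp
qed

lemma jac_inverse:
  assumes "u \<in> A" "v \<in> A" "p \<in> dom_of u" "p \<in> dom_of v"
  shows "jac v u p ** jac u v p = mat 1"
  using jac_chain[OF assms(1,2,1,3,4,3)] jac_same[OF assms(1,3)] by simp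

lemma restricted_point_of:
  assumes "u \<in> A" "p \<in> dom_of u \<inter> W"
  shows "inv_into (dom_of u \<inter> W) (coord u) (coord u p) = p"
  by (rule inv_into_f_f[OF inj_on_subset[OF inj_coord[OF assms(1)]]]) (use assms(2) in auto)

text \<open>This is where the maximality of the atlas enters. Restriction will turn a slice chart of
  an open piece of \<open>S\<close> into a slice chart of \<open>S\<close>.\<close>

lemma restrict_chart:
  assumes u: "u \<in> A" and W: "open W"
  shows "(dom_of u \<inter> W, coord u) \<in> A"
proof -
  let ?u = "(dom_of u \<inter> W, coord u)"
  have pt: "point_of ?u x = point_of u x" if "x \<in> coord u ` (dom_of u \<inter> W)" for x
    using that restricted_point_of[OF u] point_of_coord[OF u] by auto
  have "is_chart ?u"
    unfolding is_chart_def
  proof (intro conjI)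
    show "open (dom_of ?u)" by (simp add: open_Int open_dom[OF u] W)
    show "open (coord ?u ` dom_of ?u)" using open_coord_image[OF u W] by simp
    have "homeomorphism (dom_of u \<inter> W) (coord u ` (dom_of u \<inter> W)) (coord u) (point_of u)"
      using homeo[OF u] by (rule homeomorphism_of_subsets) auto
    then show "homeomorphism (dom_of ?u) (coord ?u ` dom_of ?u) (coord ?u) (point_of ?u)"
      by (simp, rule homeomorphism_cong) (use pt in auto)
  qed
  moreover have "oriented_compatible ?u v" if v: "v \<in> A" for v
    unfolding oriented_compatible_def
  proof (intro conjI ballI)
    let ?D = "dom_of u \<inter> (W \<inter> dom_of v)"
    have o: "open (coord u ` ?D)" by (rule open_coord_image[OF u]) (use W open_dom[OF v] in auto)
    have s1: "smooth_on (coord u ` ?D) (coord v \<circ> point_of u)"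
      by (rule smooth_on_subset'[OF smooth_transition[OF u v]]) auto
    have eq: "(coord v \<circ> point_of u) x = (coord v \<circ> point_of ?u) x" if "x \<in> coord u ` ?D" for x
      using pt that by auto
    show "smooth_on (coord ?u ` (dom_of ?u \<inter> dom_of v)) (coord v \<circ> point_of ?u)"
      using smooth_on_cong[OF o eq s1] by (simp add: Int_assoc o_def)
    have "smooth_on (coord v ` (dom_of v \<inter> dom_of u)) (coord u \<circ> point_of v)"
      by (rule smooth_transition[OF v u])
    then show "smooth_on (coord v ` (dom_of ?u \<inter> dom_of v)) (coord ?u \<circ> point_of v)"
      unfolding snd_conv by (rule smooth_on_subset') auto
    fix p assume p: "p \<in> dom_of ?u \<inter> dom_of v"
    have "frechet_derivative (coord v \<circ> point_of u) (at (coord u p))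
        = frechet_derivative (coord v \<circ> point_of ?u) (at (coord u p))"
      by (rule frechet_derivative_cong_open[OF o _ eq]) (use p in auto)
    then have "jac ?u v p = jac u v p" by (simp add: jac_def jacobian_def)
    then show "det (jac ?u v p) > 0" using det_jac_pos[OF u v, of p] p by simp
  qed
  ultimately show ?thesis using atlas unfolding oriented_smooth_structure_def by blast
qed

end

section \<open>Changes of scale and chart\<close>

text \<open>\<open>tractor_change\<close> as a function of plain data: metric matrix, scale factor,
  gradient and covector transformation. In this form the composition law is pure algebra.\<close>

definition tchange :: "real^'n^'n \<Rightarrow> real \<Rightarrow> real^'n \<Rightarrow> real^'n^'n \<Rightarrow> 'n::finite tractor \<Rightarrow> 'n tractor" where
  "tchange M \<omega> \<Upsilon> P V = (\<omega> * fst V, P *v (\<omega> *\<^sub>R (fst (snd V) + fst V *\<^sub>R \<Upsilon>)),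
     inverse \<omega> * (snd (snd V) - \<Upsilon> \<bullet> (matrix_inv M *v fst (snd V))
        - (1/2) * (\<Upsilon> \<bullet> (matrix_inv M *v \<Upsilon>)) * fst V))"

text \<open>The covector \<Upsilon> of a change of scale, that is, the differential of the logarithm
  of \<Omega>.\<close>

definition grad :: "('a, 'n::finite) chart \<Rightarrow> ('a \<Rightarrow> real) \<Rightarrow> 'a \<Rightarrow> real^'n" where
  "grad u \<Omega> p = (\<chi> a. inverse (\<Omega> p) * pdiff a (\<Omega> \<circ> point_of u) (coord u p))"

lemma scaleR_matrix_mult:
  fixes A :: "real^'n^'m" and B :: "real^'k^'n"
  shows "(c *\<^sub>R A) ** B = c *\<^sub>R (A ** B)" "A ** (c *\<^sub>R B) = c *\<^sub>R (A ** B)"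
  by (simp_all add: matrix_matrix_mult_def vec_eq_iff sum_distrib_left mult_ac)

lemma tractor_change_eq:
  "tractor_change g u \<Omega> v p = tchange (g u (coord u p)) (\<Omega> p) (grad u \<Omega> p)
     (transpose (jac v u p))"
  by (rule ext) (simp add: tractor_change_def rescale_tractor_def tchange_def grad_def split: prod.split)

lemma tractor_metric_eq:
  "tractor_metric M V W = fst V * snd (snd W) + snd (snd V) * fst W + fst (snd V) \<bullet> (matrix_inv M *v fst (snd W))"
  by (simp add: tractor_metric_def split: prod.split)

lemma linear_tchange: "linear (tchange M \<omega> \<Upsilon> P)"
  by (rule linearI) (simp_all add: tchange_def algebra_simps inner_add_right inner_diff_right
      matrix_vector_right_distrib matrix_vector_mult_scaleR)

lemma linear_tractor_change: "linear (tractor_change g u \<Omega> v p)"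
  unfolding tractor_change_eq by (rule linear_tchange)

text \<open>\<open>Q\<close> pulls covectors back, and \<open>B\<close> says that the second inverse
  metric is the rescaled transport of the first. The gradients add; the cross term in the square of
  their sum comes from pairing the second gradient with the middle slot shifted by the
  first.\<close>

lemma tchange_compose:
  fixes M M' :: "real^'n::finite^'n"
  assumes nz: "\<omega> \<noteq> 0"
    and B: "\<And>a b. a \<bullet> (matrix_inv M' *v b) = inverse (\<omega>\<^sup>2) * ((Q *v a) \<bullet> (matrix_inv M *v (Q *v b)))"
    and sym: "\<And>a b. a \<bullet> (matrix_inv M *v b) = b \<bullet> (matrix_inv M *v a)"
    and PQ: "P ** Q = mat 1" "Q ** P = mat 1"
  shows "tchange M' \<omega>' \<Upsilon>' P' (tchange M \<omega> \<Upsilon> P V) = tchange M (\<omega>' * \<omega>) (\<Upsilon> + Q *v \<Upsilon>') (P' ** P) V"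
proof -
  have pq: "P *v (Q *v x) = x" "Q *v (P *v x) = x" for x
    using PQ by (simp_all add: matrix_vector_mul_assoc)
  obtain s m r where V: "V = (s, m, r)" by (cases V) auto
  define q where "q a b = a \<bullet> (matrix_inv M *v b)" for a b
  have qs: "q a b = q b a" for a b unfolding q_def by (rule sym)
  have ql: "q (a + b) x = q a x + q b x" "q x (a + b) = q x a + q x b"
    "q (t *\<^sub>R a) x = t * q a x" "q x (t *\<^sub>R a) = t * q x a" for a b x t
    by (simp_all add: q_def algebra_simps inner_add_left inner_add_right matrix_vector_right_distrib matrix_vector_mult_scaleR)
  have B': "a \<bullet> (matrix_inv M' *v b) = inverse (\<omega>\<^sup>2) * q (Q *v a) (Q *v b)" for a b
    unfolding q_def by (rule B)
  let ?y = "Q *v \<Upsilon>'"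
  have c1: "fst (tchange M' \<omega>' \<Upsilon>' P' (tchange M \<omega> \<Upsilon> P V)) = fst (tchange M (\<omega>' * \<omega>) (\<Upsilon> + ?y) (P' ** P) V)"
    by (simp add: tchange_def)
  have c2: "fst (snd (tchange M' \<omega>' \<Upsilon>' P' (tchange M \<omega> \<Upsilon> P V)))
      = fst (snd (tchange M (\<omega>' * \<omega>) (\<Upsilon> + ?y) (P' ** P) V))"
    by (simp add: tchange_def V matrix_vector_mul_assoc[symmetric] matrix_vector_right_distrib
        matrix_vector_mult_scaleR pq algebra_simps)
  have Qm: "Q *v (P *v (\<omega> *\<^sub>R (m + s *\<^sub>R \<Upsilon>))) = \<omega> *\<^sub>R (m + s *\<^sub>R \<Upsilon>)" by (rule pq)
  have "snd (snd (tchange M' \<omega>' \<Upsilon>' P' (tchange M \<omega> \<Upsilon> P V)))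
     = inverse \<omega>' * (inverse \<omega> * (r - q \<Upsilon> m - (1/2) * q \<Upsilon> \<Upsilon> * s)
        - inverse (\<omega>\<^sup>2) * (\<omega> * (q ?y m + s * q ?y \<Upsilon>)) - (1/2) * (inverse (\<omega>\<^sup>2) * q ?y ?y) * (\<omega> * s))"
    by (simp only: tchange_def V fst_conv snd_conv B' Qm ql q_def[symmetric])
  also have "\<dots> = inverse (\<omega>' * \<omega>) * (r - q (\<Upsilon> + ?y) m - (1/2) * q (\<Upsilon> + ?y) (\<Upsilon> + ?y) * s)"
  proof -
    have *: "inverse (\<omega>\<^sup>2) * (\<omega> * z) = inverse \<omega> * z" for z
      using nz by (simp add: power2_eq_square field_simps)
    have **: "(1/2) * (inverse (\<omega>\<^sup>2) * z) * (\<omega> * s) = inverse \<omega> * ((1/2) * z * s)" for z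
      using nz by (simp add: power2_eq_square field_simps)
    have "q (\<Upsilon> + ?y) (\<Upsilon> + ?y) = q \<Upsilon> \<Upsilon> + 2 * q ?y \<Upsilon> + q ?y ?y"
      by (simp add: ql qs[of \<Upsilon> ?y])
    then show ?thesis unfolding * ** ql inverse_mult_distrib by (simp add: algebra_simps)
  qed
  also have "\<dots> = snd (snd (tchange M (\<omega>' * \<omega>) (\<Upsilon> + ?y) (P' ** P) V))"
    by (simp add: tchange_def V q_def)
  finally show ?thesis using c1 c2 by (simp add: prod_eq_iff)
qed

text \<open>Shifting the middle slot by a multiple of \<Upsilon> changes its square by terms that
  the corrections of the bottom slot cancel; the powers of \<omega> cancel against the weight of the
  inverse metric.\<close>

lemma tchange_isometry:
  fixes M M' :: "real^'n::finite^'n"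
  assumes nz: "\<omega> \<noteq> 0"
    and B: "\<And>a b. a \<bullet> (matrix_inv M' *v b) = inverse (\<omega>\<^sup>2) * ((Q *v a) \<bullet> (matrix_inv M *v (Q *v b)))"
    and sym: "\<And>a b. a \<bullet> (matrix_inv M *v b) = b \<bullet> (matrix_inv M *v a)"
    and PQ: "Q ** P = mat 1"
  shows "tractor_metric M' (tchange M \<omega> \<Upsilon> P V) (tchange M \<omega> \<Upsilon> P W) = tractor_metric M V W"
proof -
  have pq: "Q *v (P *v x) = x" for x
    using PQ by (simp_all add: matrix_vector_mul_assoc)
  obtain s m r where V: "V = (s, m, r)" by (cases V) auto
  obtain s' m' r' where W: "W = (s', m', r')" by (cases W) auto
  define q where "q a b = a \<bullet> (matrix_inv M *v b)" for a b
  have qs: "q a b = q b a" for a b unfolding q_def by (rule sym)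
  have ql: "q (a + b) x = q a x + q b x" "q x (a + b) = q x a + q x b"
    "q (t *\<^sub>R a) x = t * q a x" "q x (t *\<^sub>R a) = t * q x a" for a b x t
    by (simp_all add: q_def algebra_simps inner_add_left inner_add_right matrix_vector_right_distrib matrix_vector_mult_scaleR)
  have B': "a \<bullet> (matrix_inv M' *v b) = inverse (\<omega>\<^sup>2) * q (Q *v a) (Q *v b)" for a b
    unfolding q_def by (rule B)
  have "tractor_metric M' (tchange M \<omega> \<Upsilon> P V) (tchange M \<omega> \<Upsilon> P W) =
     \<omega> * s * (inverse \<omega> * (r' - q \<Upsilon> m' - (1/2) * q \<Upsilon> \<Upsilon> * s'))
     + inverse \<omega> * (r - q \<Upsilon> m - (1/2) * q \<Upsilon> \<Upsilon> * s) * (\<omega> * s')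
     + inverse (\<omega>\<^sup>2) * (\<omega> * (\<omega> * (q m m' + s * q \<Upsilon> m' + s' * (q m \<Upsilon> + s * q \<Upsilon> \<Upsilon>))))"
    by (simp only: tractor_metric_eq tchange_def V W fst_conv snd_conv B' pq ql q_def[symmetric])
       (simp add: algebra_simps)
  also have "\<dots> = s * (r' - q \<Upsilon> m' - (1/2) * q \<Upsilon> \<Upsilon> * s')
     + (r - q \<Upsilon> m - (1/2) * q \<Upsilon> \<Upsilon> * s) * s'
     + (q m m' + s * q \<Upsilon> m' + s' * (q m \<Upsilon> + s * q \<Upsilon> \<Upsilon>))"
    using nz by (simp add: power2_eq_square field_simps)
  also have "\<dots> = tractor_metric M V W"
    by (simp add: tractor_metric_eq V W q_def[symmetric] qs[of m \<Upsilon>] algebra_simps)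
  finally show ?thesis .
qed

lemma tractor_metric_sharp:
  assumes "posdef M"
  shows "tractor_metric M (sharp M a) V = a \<bullet> V"
proof -
  have nz: "det M \<noteq> 0" by (rule posdef_det_nonzero[OF assms])
  have "(M *v b) \<bullet> (matrix_inv M *v m) = b \<bullet> m" for b m
  proof -
    have "(M *v b) \<bullet> (matrix_inv M *v m) = b \<bullet> (M *v (matrix_inv M *v m))"
      using posdef_inner_commute[OF assms, of b "matrix_inv M *v m"] by (simp add: inner_commute)
    then show ?thesis by (simp add: matrix_vector_mul_assoc matrix_inv_inverse[OF nz])
  qed
  then show ?thesis
    by (simp add: tractor_metric_eq sharp_def inner_prod_def split: prod.split)
qed

lemma tractor_metric_commute: "posdef M \<Longrightarrow> tractor_metric M V W = tractor_metric M W V"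
  using posdef_inner_commute[OF posdef_matrix_inv[of M], of "fst (snd V)" "fst (snd W)"]
  by (simp add: tractor_metric_eq)

lemma linear_sharp: "linear (sharp M)"
  by (rule linearI) (simp_all add: sharp_def matrix_vector_right_distrib matrix_vector_mult_scaleR split: prod.split)

lemma surj_sharp:
  fixes M :: "real^'n::finite^'n"
  assumes "det M \<noteq> 0" shows "surj (sharp M)"
proof (rule surjI)
  fix V :: "'n tractor"
  show "sharp M (snd (snd V), matrix_inv M *v fst (snd V), fst V) = V"
    by (simp add: sharp_def matrix_vector_mul_assoc matrix_inv_inverse[OF assms])
qed

lemma linear_tractor_metric: "linear (tractor_metric M V)"
  by (rule linearI) (simp_all add: tractor_metric_eq algebra_simps inner_add_right matrix_vector_right_distrib matrix_vector_mult_scaleR)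

section \<open>Pointwise properties of the Hodge star\<close>

lemma alternating_volume_form: "alternating_form (CARD('n) + 2) (volume_form (M :: real^'n::finite^'n))"
  using alternating_form_cmult[OF alternating_vol] unfolding volume_form_eq[abs_def] .

lemma hodge_star_eq: "hodge_star d M \<alpha> Ws = inverse (fact d) * star d Basis (sharp M) (volume_form M) \<alpha> Ws"
  unfolding hodge_star_def star_def set_frame_list ..

lemma alternating_hodge_star:
  fixes M :: "real^'n::finite^'n"
  assumes "d \<le> CARD('n) + 2"
  shows "alternating_form (CARD('n) + 2 - d) (hodge_star d M \<alpha>)"
proof -
  have "alternating_form (CARD('n) + 2 - d) (\<lambda>Ws. volume_form M (es @ Ws))" if "length es = d" for es
    by (rule alternating_form_append[OF _ that]) (use assms alternating_volume_form[of M] in simp)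
  then show ?thesis
    unfolding hodge_star_def[abs_def]
    by (intro alternating_form_cmult alternating_form_sum) auto
qed

lemma volume_form_nonzero:
  fixes M :: "real^'n::finite^'n"
  assumes "posdef M"
  shows "volume_form M frame_list \<noteq> 0"
  using posdef_det_pos[OF assms] by (simp add: volume_form_eq vol_frame_list)

lemma hodge_star_injective:
  fixes M :: "real^'n::finite^'n"
  assumes M: "posdef M" and "alternating_form d \<alpha>" "d \<le> CARD('n) + 2"
    and "\<And>Ws. length Ws = CARD('n) + 2 - d \<Longrightarrow> hodge_star d M \<alpha> Ws = 0" "length Vs = d"
  shows "\<alpha> Vs = 0"
proof (rule star_injective[where 'e = "'n tractor", unfolded DIM_tractor, OF linear_sharp
      surj_sharp[OF posdef_det_nonzero[OF M]] alternating_volume_form length_frame_list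
      volume_form_nonzero[OF M] assms(2,3) _ assms(5)])
  fix Ws :: "'n tractor list" assume "length Ws = CARD('n) + 2 - d"
  from assms(4)[OF this] show "star d Basis (sharp M) (volume_form M) \<alpha> Ws = 0"
    by (simp add: hodge_star_eq)
qed

lemma wedge_hodge_star:
  fixes M :: "real^'n::finite^'n"
  assumes M: "posdef M" and \<alpha>: "alternating_form (Suc d) \<alpha>" and len: "Suc d + length Vs = CARD('n) + 3"
  shows "wedge_vector M canonical_tractor (hodge_star (Suc d) M \<alpha>) Vs
    = (-1) ^ d * hodge_star d M (contract canonical_tractor \<alpha>) Vs"
proof -
  \<comment> \<open>The functional dual to the canonical tractor reads off the top slot, and raising
    its index returns the canonical tractor.\<close>
  have X: "(\<Sum>e\<in>Basis. tractor_metric M canonical_tractor e *\<^sub>R sharp M e) = (canonical_tractor :: 'n tractor)"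
  proof -
    have "tractor_metric M canonical_tractor e = (1, 0, 0) \<bullet> e" for e :: "'n tractor"
      by (simp add: tractor_metric_eq canonical_tractor_def inner_prod_def)
    then have "(\<Sum>e\<in>Basis. tractor_metric M canonical_tractor e *\<^sub>R sharp M e)
        = sharp M (\<Sum>e\<in>Basis. ((1, 0, 0) \<bullet> e) *\<^sub>R e)"
      by (simp only: linear_sum[OF linear_sharp] linear_scale[OF linear_sharp])
    also have "(\<Sum>e\<in>Basis. ((1, 0, 0) \<bullet> e) *\<^sub>R e) = ((1, 0, 0) :: 'n tractor)"
      by (rule euclidean_representation)
    finally show ?thesis by (simp add: sharp_def canonical_tractor_def)
  qed
  have "wedge_vector M canonical_tractor (hodge_star (Suc d) M \<alpha>) Vs
      = inverse (fact (Suc d)) * wedge (tractor_metric M canonical_tractor)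
          (star (Suc d) Basis (sharp M) (volume_form M) \<alpha>) Vs"
    unfolding wedge_vector_eq_wedge hodge_star_eq[abs_def] by (rule wedge_cmult)
  also have "wedge (tractor_metric M canonical_tractor) (star (Suc d) Basis (sharp M) (volume_form M) \<alpha>) Vs
      = (-1) ^ d * real (Suc d) * star d Basis (sharp M) (volume_form M) (\<lambda>us. \<alpha> (canonical_tractor # us)) Vs"
    by (subst wedge_star[where 'e = "'n tractor", unfolded DIM_tractor, OF finite_Basis \<alpha>
          alternating_volume_form linear_tractor_metric]) (simp_all only: X, use len in simp)
  also have "inverse (fact (Suc d)) * \<dots> = (-1) ^ d * hodge_star d M (contract canonical_tractor \<alpha>) Vs"
  proof -
    have "inverse (fact (Suc d)) * ((-1) ^ d * real (Suc d) * Z) = (-1) ^ d * (inverse (fact d) * Z)" for Z :: real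
      unfolding fact_Suc by (simp add: field_simps del: of_nat_Suc)
    then show ?thesis unfolding hodge_star_eq contract_def .
  qed
  finally show ?thesis .
qed

lemma hodge_star_zero:
  assumes "\<And>Us. length Us = d \<Longrightarrow> \<alpha> Us = 0"
  shows "hodge_star d M \<alpha> Ws = 0"
  unfolding hodge_star_def using assms by (simp add: sum.neutral)

text \<open>The identity between wedge and contraction gives one direction; the other uses in
  addition that the star is injective in degree \<open>d - 1\<close>.\<close>

lemma contract_zero_iff_wedge_zero:
  fixes M :: "real^'n::finite^'n"
  assumes M: "posdef M" and \<alpha>: "alternating_form d \<alpha>" and d: "1 \<le> d" "d \<le> CARD('n) + 2"
  shows "(\<forall>Vs. length Vs + 1 = d \<longrightarrow> contract canonical_tractor \<alpha> Vs = 0) \<longleftrightarrow>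
    (\<forall>Vs. length Vs = CARD('n) + 2 - d + 1 \<longrightarrow> wedge_vector M canonical_tractor (hodge_star d M \<alpha>) Vs = 0)"
proof -
  obtain d' where d': "d = Suc d'" using d(1) by (cases d) auto
  have w: "wedge_vector M canonical_tractor (hodge_star d M \<alpha>) Vs
      = (-1) ^ d' * hodge_star d' M (contract canonical_tractor \<alpha>) Vs"
    if "length Vs = CARD('n) + 2 - d + 1" for Vs
    unfolding d' by (rule wedge_hodge_star[OF M \<alpha>[unfolded d']]) (use that d d' in simp)
  have alt: "alternating_form d' (contract canonical_tractor \<alpha>)"
    unfolding contract_def by (rule alternating_form_Cons) (use \<alpha> d' in simp)
  show ?thesis
  proof (intro iffI allI impI)
    fix Vs :: "'n tractor list" assume "\<forall>Vs. length Vs + 1 = d \<longrightarrow> contract canonical_tractor \<alpha> Vs = 0"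
      and len: "length Vs = CARD('n) + 2 - d + 1"
    then have "hodge_star d' M (contract canonical_tractor \<alpha>) Vs = 0"
      by (intro hodge_star_zero) (simp add: d')
    then show "wedge_vector M canonical_tractor (hodge_star d M \<alpha>) Vs = 0"
      by (simp only: w[OF len] mult_zero_right)
  next
    fix Vs :: "'n tractor list"
    assume z: "\<forall>Vs. length Vs = CARD('n) + 2 - d + 1 \<longrightarrow> wedge_vector M canonical_tractor (hodge_star d M \<alpha>) Vs = 0"
      and len: "length Vs + 1 = d"
    show "contract canonical_tractor \<alpha> Vs = 0"
    proof (rule hodge_star_injective[OF M alt])
      fix Ws :: "'n tractor list" assume "length Ws = CARD('n) + 2 - d'"
      then have "length Ws = CARD('n) + 2 - d + 1" using d d' by simp
      then show "hodge_star d' M (contract canonical_tractor \<alpha>) Ws = 0" using z w by simp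
    qed (use d d' len in auto)
  qed
qed

section \<open>Conformal classes\<close>

locale conformal_manifold = oriented_atlas A
  for A :: "('a::{t2_space, second_countable_topology}, 'n::finite) chart set" +
  fixes c :: "('a, 'n) metric set"
  assumes conformal: "conformal_class A c"
begin

lemma riemannian: "g \<in> c \<Longrightarrow> riemannian_metric A g"
  using conformal by (auto simp: conformal_class_def)

lemma metric_smooth: "g \<in> c \<Longrightarrow> u \<in> A \<Longrightarrow> smooth_on (coord u ` dom_of u) (g u)"
  using riemannian by (auto simp: riemannian_metric_def)

lemma metric_posdef: "g \<in> c \<Longrightarrow> u \<in> A \<Longrightarrow> p \<in> dom_of u \<Longrightarrow> posdef (g u (coord u p))"
  using riemannian by (auto simp: riemannian_metric_def posdef_def)

lemma metric_change:
  "g \<in> c \<Longrightarrow> u \<in> A \<Longrightarrow> v \<in> A \<Longrightarrow> p \<in> dom_of u \<Longrightarrow> p \<in> dom_of v \<Longrightarrow>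
    g u (coord u p) = transpose (jac u v p) ** g v (coord v p) ** jac u v p"
  using riemannian by (auto simp: riemannian_metric_def)

lemma rescaling_smooth: "rescaling A \<Omega> g g' \<Longrightarrow> u \<in> A \<Longrightarrow> smooth_on (coord u ` dom_of u) (\<Omega> \<circ> point_of u)"
  by (auto simp: rescaling_def smooth_function_def)

lemma rescaling_pos: "rescaling A \<Omega> g g' \<Longrightarrow> \<Omega> p > 0"
  by (auto simp: rescaling_def)

lemma rescaling_metric:
  "rescaling A \<Omega> g g' \<Longrightarrow> u \<in> A \<Longrightarrow> p \<in> dom_of u \<Longrightarrow> g' u (coord u p) = (\<Omega> p)\<^sup>2 *\<^sub>R g u (coord u p)"
  by (auto simp: rescaling_def)

lemma rescaling_refl: "rescaling A (\<lambda>_. 1) g g"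
  using open_image by (auto simp: rescaling_def smooth_function_def o_def intro: smooth_on_const)

lemma rescaling_exists:
  assumes "g \<in> c" "g' \<in> c"
  shows "\<exists>\<Omega>. rescaling A \<Omega> g g'"
proof -
  obtain g0 where "c = {g'. riemannian_metric A g' \<and> (\<exists>\<Omega>. rescaling A \<Omega> g0 g')}"
    using conformal by (auto simp: conformal_class_def)
  then obtain \<Omega> \<Omega>' where O: "rescaling A \<Omega> g0 g" "rescaling A \<Omega>' g0 g'" using assms by auto
  have "rescaling A (\<lambda>p. \<Omega>' p * inverse (\<Omega> p)) g g'"
    unfolding rescaling_def smooth_function_def
  proof (intro conjI ballI allI)
    fix u assume u: "u \<in> A"
    have "smooth_on (coord u ` dom_of u) (\<lambda>x. (\<Omega>' \<circ> point_of u) x * inverse ((\<Omega> \<circ> point_of u) x))"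
      using rescaling_pos[OF O(1)]
      by (intro smooth_on_mult smooth_on_inverse rescaling_smooth[OF O(1) u] rescaling_smooth[OF O(2) u] open_image[OF u])
         (simp add: less_imp_neq[symmetric] order_less_imp_not_eq2)
    then show "smooth_on (coord u ` dom_of u) ((\<lambda>p. \<Omega>' p * inverse (\<Omega> p)) \<circ> point_of u)"
      by (simp add: o_def)
  next
    fix p show "\<Omega>' p * inverse (\<Omega> p) > 0" using rescaling_pos[OF O(1)] rescaling_pos[OF O(2)] by simp
  next
    fix u p assume up: "u \<in> A" "p \<in> dom_of u"
    have "\<Omega> p \<noteq> 0" using rescaling_pos[OF O(1), of p] by simp
    then show "g' u (coord u p) = (\<Omega>' p * inverse (\<Omega> p))\<^sup>2 *\<^sub>R g u (coord u p)"
      using rescaling_metric[OF O(1) up] rescaling_metric[OF O(2) up]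
      by (simp add: power_mult_distrib power_inverse)
  qed
  then show ?thesis by blast
qed

text \<open>The metric is nonzero and scale factors are positive, so the square determines the
  factor. Composites and inverses of rescalings can thus be identified from their source and
  target.\<close>

lemma rescaling_unique:
  assumes "g \<in> c" "rescaling A \<Omega> g g'" "rescaling A \<Omega>' g g'"
  shows "\<Omega> = \<Omega>'"
proof
  fix p
  obtain u where u: "u \<in> A" "p \<in> dom_of u" using chart_exists by blast
  have "g u (coord u p) \<noteq> 0"
    using posdef_det_nonzero[OF metric_posdef[OF assms(1) u]] det_0[where 'n='n and 'a=real] by (metis mat_0)
  moreover have "(\<Omega> p)\<^sup>2 *\<^sub>R g u (coord u p) = (\<Omega>' p)\<^sup>2 *\<^sub>R g u (coord u p)"
    using rescaling_metric[OF assms(2) u] rescaling_metric[OF assms(3) u] by (rule trans[OF sym])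
  ultimately have "(\<Omega> p)\<^sup>2 = (\<Omega>' p)\<^sup>2" by (simp only: scaleR_cancel_right) simp
  then show "\<Omega> p = \<Omega>' p"
    using rescaling_pos[OF assms(2), of p] rescaling_pos[OF assms(3), of p] by simp
qed

lemma rescaling_compose:
  assumes "rescaling A \<Omega> g g'" "rescaling A \<Omega>' g' g''"
  shows "rescaling A (\<lambda>p. \<Omega>' p * \<Omega> p) g g''"
  unfolding rescaling_def smooth_function_def
proof (intro conjI ballI allI)
  fix u assume u: "u \<in> A"
  have "smooth_on (coord u ` dom_of u) (\<lambda>x. (\<Omega>' \<circ> point_of u) x * (\<Omega> \<circ> point_of u) x)"
    by (intro smooth_on_mult rescaling_smooth[OF assms(1) u] rescaling_smooth[OF assms(2) u] open_image[OF u])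
  then show "smooth_on (coord u ` dom_of u) ((\<lambda>p. \<Omega>' p * \<Omega> p) \<circ> point_of u)"
    by (simp add: o_def)
next
  fix p show "\<Omega>' p * \<Omega> p > 0" using rescaling_pos[OF assms(1)] rescaling_pos[OF assms(2)] by simp
next
  fix u p assume up: "u \<in> A" "p \<in> dom_of u"
  show "g'' u (coord u p) = (\<Omega>' p * \<Omega> p)\<^sup>2 *\<^sub>R g u (coord u p)"
    using rescaling_metric[OF assms(1) up] rescaling_metric[OF assms(2) up]
    by (simp add: power_mult_distrib)
qed

lemma rescaled_metric_change:
  assumes "g' \<in> c" "rescaling A \<Omega> g g'" "u \<in> A" "v \<in> A" "p \<in> dom_of u" "p \<in> dom_of v"
  shows "(\<Omega> p)\<^sup>2 *\<^sub>R g u (coord u p)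
    = transpose (jac u v p) ** g' v (coord v p) ** jac u v p"
  using metric_change[OF assms(1,3-6)] rescaling_metric[OF assms(2,3,5)] by simp

lemma rescaled_metric_inv:
  assumes "g \<in> c" "g' \<in> c" "rescaling A \<Omega> g g'" "u \<in> A" "v \<in> A" "p \<in> dom_of u" "p \<in> dom_of v"
  shows "matrix_inv (g' v (coord v p)) = inverse ((\<Omega> p)\<^sup>2) *\<^sub>R
     (jac u v p ** matrix_inv (g u (coord u p)) ** transpose (jac u v p))"
proof (rule matrix_inv_unique)
  let ?J = "jac u v p" and ?I = "jac v u p" and ?M = "g u (coord u p)" and ?M' = "g' v (coord v p)"
  let ?T = "transpose"
  have nz: "\<Omega> p \<noteq> 0" using rescaling_pos[OF assms(3), of p] by simp
  have IJ: "?I ** ?J = mat 1" "?J ** ?I = mat 1"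
    using jac_inverse[OF assms(4-7)] jac_inverse[OF assms(5,4,7,6)] by auto
  have M': "?M' = (\<Omega> p)\<^sup>2 *\<^sub>R (?T ?I ** ?M ** ?I)"
    using metric_change[OF assms(1,5,4,7,6)] rescaling_metric[OF assms(3,5,7)] by simp
  have "?M' ** (inverse ((\<Omega> p)\<^sup>2) *\<^sub>R (?J ** matrix_inv ?M ** ?T ?J))
      = ?T ?I ** ?M ** ?I ** (?J ** matrix_inv ?M ** ?T ?J)"
    using nz unfolding M' by (simp add: scaleR_matrix_mult)
  also have "\<dots> = ?T ?I ** (?M ** ((?I ** ?J) ** matrix_inv ?M)) ** ?T ?J"
    by (simp add: matrix_mul_assoc)
  also have "\<dots> = ?T ?I ** ?T ?J"
    by (simp add: IJ matrix_inv_inverse[OF posdef_det_nonzero[OF metric_posdef[OF assms(1,4,6)]]])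
  also have "\<dots> = mat 1" by (simp add: matrix_transpose_mul[symmetric] IJ transpose_mat)
  finally show "?M' ** (inverse ((\<Omega> p)\<^sup>2) *\<^sub>R (?J ** matrix_inv ?M ** ?T ?J)) = mat 1" .
qed

lemma smooth_grad_derivative:
  assumes "rescaling A \<Omega> g g'" "u \<in> A" "p \<in> dom_of u"
  shows "((\<Omega> \<circ> point_of u) has_derivative (\<lambda>h. \<Omega> p * (grad u \<Omega> p \<bullet> h))) (at (coord u p))"
proof -
  let ?D = "frechet_derivative (\<Omega> \<circ> point_of u) (at (coord u p))"
  have D: "((\<Omega> \<circ> point_of u) has_derivative ?D) (at (coord u p))"
    by (rule smooth_on_has_derivative[OF rescaling_smooth[OF assms(1,2)]]) (use assms(3) in simp)
  have lin: "linear ?D" by (rule has_derivative_linear[OF D])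
  have nz: "\<Omega> p \<noteq> 0" using rescaling_pos[OF assms(1), of p] by simp
  have "?D h = \<Omega> p * (grad u \<Omega> p \<bullet> h)" for h
  proof -
    have "?D (\<Sum>a\<in>UNIV. h $ a *\<^sub>R axis a 1) = (\<Sum>a\<in>UNIV. h $ a * ?D (axis a 1))"
      by (simp only: linear_sum[OF lin] linear_scale[OF lin] real_scaleR_def)
    moreover have "(\<Sum>a\<in>UNIV. h $ a *\<^sub>R axis a 1) = h"
      using basis_expansion[of h] by (simp add: scalar_mult_eq_scaleR)
    moreover have "\<Omega> p * (grad u \<Omega> p \<bullet> h) = (\<Sum>a\<in>UNIV. h $ a * ?D (axis a 1))"
      unfolding inner_vec_def sum_distrib_left
      by (rule sum.cong) (use nz in \<open>simp_all add: grad_def pdiff_frechet[OF D] field_simps\<close>)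
    ultimately show ?thesis by simp
  qed
  then have "?D = (\<lambda>h. \<Omega> p * (grad u \<Omega> p \<bullet> h))" by blast
  then show ?thesis using D by simp
qed

lemma grad_unique:
  assumes "\<Omega> p \<noteq> 0" "((\<Omega> \<circ> point_of u) has_derivative (\<lambda>h. \<Omega> p * (y \<bullet> h))) (at (coord u p))"
  shows "grad u \<Omega> p = y"
  using assms(1) by (simp add: grad_def vec_eq_iff pdiff_frechet[OF assms(2)] inner_axis)

lemma grad_chart:
  assumes "rescaling A \<Omega> g g'" "u \<in> A" "v \<in> A" "p \<in> dom_of u" "p \<in> dom_of v"
  shows "grad u \<Omega> p = transpose (jac u v p) *v grad v \<Omega> p"
proof (rule grad_unique)
  show "\<Omega> p \<noteq> 0" using rescaling_pos[OF assms(1), of p] by simp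
  have pt: "(coord v \<circ> point_of u) (coord u p) = coord v p" using point_of_coord assms by simp
  have "((\<lambda>x. (\<Omega> \<circ> point_of v) ((coord v \<circ> point_of u) x)) has_derivative
      (\<lambda>h. \<Omega> p * (grad v \<Omega> p \<bullet> (jac u v p *v h)))) (at (coord u p))"
    by (rule has_derivative_compose[OF transition_derivative[OF assms(2-5)]])
       (subst pt, rule smooth_grad_derivative[OF assms(1,3,5)])
  then have "((\<Omega> \<circ> point_of u) has_derivative (\<lambda>h. \<Omega> p * (grad v \<Omega> p \<bullet> (jac u v p *v h)))) (at (coord u p))"
  proof (rule has_derivative_transform_within_open)
    show "open (coord u ` (dom_of u \<inter> dom_of v))" by (rule open_coord_image[OF assms(2) open_dom[OF assms(3)]])
    show "coord u p \<in> coord u ` (dom_of u \<inter> dom_of v)" using assms by auto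
  qed (use point_of_coord assms in auto)
  then show "((\<Omega> \<circ> point_of u) has_derivative
     (\<lambda>h. \<Omega> p * ((transpose (jac u v p) *v grad v \<Omega> p) \<bullet> h))) (at (coord u p))"
    by (simp only: inner_matrix_transpose)
qed

lemma grad_mult:
  assumes "rescaling A \<Omega> g g'" "rescaling A \<Omega>' g' g''" "u \<in> A" "p \<in> dom_of u"
  shows "grad u (\<lambda>q. \<Omega>' q * \<Omega> q) p = grad u \<Omega> p + grad u \<Omega>' p"
proof (rule grad_unique)
  show "\<Omega>' p * \<Omega> p \<noteq> 0" using rescaling_pos[OF assms(1), of p] rescaling_pos[OF assms(2), of p] by simp
  have pt: "point_of u (coord u p) = p" by (rule point_of_coord[OF assms(3,4)])
  have "((\<lambda>x. (\<Omega>' \<circ> point_of u) x * (\<Omega> \<circ> point_of u) x) has_derivative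
      (\<lambda>h. (\<Omega>' \<circ> point_of u) (coord u p) * (\<Omega> p * (grad u \<Omega> p \<bullet> h))
        + (\<Omega>' p * (grad u \<Omega>' p \<bullet> h)) * (\<Omega> \<circ> point_of u) (coord u p))) (at (coord u p))"
    by (rule has_derivative_mult[OF smooth_grad_derivative[OF assms(2-4)] smooth_grad_derivative[OF assms(1,3,4)]])
  then show "(((\<lambda>q. \<Omega>' q * \<Omega> q) \<circ> point_of u) has_derivative
     (\<lambda>h. \<Omega>' p * \<Omega> p * ((grad u \<Omega> p + grad u \<Omega>' p) \<bullet> h))) (at (coord u p))"
    by (simp add: o_def pt algebra_simps inner_add_left)
qed

lemma rescaled_inner_inv:
  assumes "g \<in> c" "g' \<in> c" "rescaling A \<Omega> g g'" "u \<in> A" "v \<in> A" "p \<in> dom_of u" "p \<in> dom_of v"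
  shows "a \<bullet> (matrix_inv (g' v (coord v p)) *v b) = inverse ((\<Omega> p)\<^sup>2) *
     ((transpose (jac u v p) *v a) \<bullet>
       (matrix_inv (g u (coord u p)) *v (transpose (jac u v p) *v b)))"
  unfolding rescaled_metric_inv[OF assms]
  by (simp add: scaleR_matrix_vector_assoc[symmetric] matrix_vector_mul_assoc[symmetric]
      inner_matrix_transpose[of a "jac u v p"])

lemma jac_transpose_inverse:
  assumes "u \<in> A" "v \<in> A" "p \<in> dom_of u" "p \<in> dom_of v"
  shows "transpose (jac v u p) ** transpose (jac u v p) = mat 1"
  using jac_inverse[OF assms(2,1,4,3)] by (simp add: matrix_transpose_mul[symmetric] transpose_mat)

lemma inv_metric_sym:
  "g \<in> c \<Longrightarrow> u \<in> A \<Longrightarrow> p \<in> dom_of u \<Longrightarrow>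
     a \<bullet> (matrix_inv (g u (coord u p)) *v b) = b \<bullet> (matrix_inv (g u (coord u p)) *v a)"
  by (rule posdef_inner_commute[OF posdef_matrix_inv[OF metric_posdef]])

lemma tractor_change_compose:
  assumes "g \<in> c" "g' \<in> c" "rescaling A \<Omega> g g'" "rescaling A \<Omega>' g' g''"
    and "u \<in> A" "v \<in> A" "w \<in> A" "p \<in> dom_of u" "p \<in> dom_of v" "p \<in> dom_of w"
  shows "tractor_change g' v \<Omega>' w p (tractor_change g u \<Omega> v p V) = tractor_change g u (\<lambda>q. \<Omega>' q * \<Omega> q) w p V"
proof -
  have nz: "\<Omega> p \<noteq> 0" using rescaling_pos[OF assms(3), of p] by simp
  show ?thesis
    unfolding tractor_change_eq grad_mult[OF assms(3,4,5,8)] grad_chart[OF assms(4,5,6,8,9)]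
      jac_chain[OF assms(7,6,5,10,9,8)] matrix_transpose_mul
    by (rule tchange_compose[OF nz])
       (rule rescaled_inner_inv[OF assms(1-3,5,6,8,9)] inv_metric_sym[OF assms(1,5,8)]
          jac_transpose_inverse[OF assms(5,6,8,9)] jac_transpose_inverse[OF assms(6,5,9,8)])+
qed

lemma tractor_change_isometry:
  assumes "g \<in> c" "g' \<in> c" "rescaling A \<Omega> g g'" "u \<in> A" "v \<in> A" "p \<in> dom_of u" "p \<in> dom_of v"
  shows "tractor_metric (g' v (coord v p)) (tractor_change g u \<Omega> v p V) (tractor_change g u \<Omega> v p W)
    = tractor_metric (g u (coord u p)) V W"
proof -
  have nz: "\<Omega> p \<noteq> 0" using rescaling_pos[OF assms(3), of p] by simp
  show ?thesis
    unfolding tractor_change_eq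
    by (rule tchange_isometry[OF nz])
       (rule rescaled_inner_inv[OF assms] inv_metric_sym[OF assms(1,4,6)]
          jac_transpose_inverse[OF assms(5,4,7,6)])+
qed

lemma tractor_change_id:
  assumes "u \<in> A" "p \<in> dom_of u"
  shows "tractor_change g u (\<lambda>_. 1) u p V = V"
proof -
  have "((\<lambda>x. 1 :: real) has_derivative (\<lambda>h. 0)) (at (coord u p))" by simp
  then have "grad u (\<lambda>_. 1) p = 0" by (intro grad_unique) (simp_all add: o_def)
  then show ?thesis
    by (simp add: tractor_change_eq tchange_def jac_same[OF assms] transpose_mat)
qed

lemma tractor_change_inverse:
  assumes "g \<in> c" "g' \<in> c" "rescaling A \<Omega> g g'" "rescaling A \<Omega>' g' g"
    and "u \<in> A" "v \<in> A" "p \<in> dom_of u" "p \<in> dom_of v"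
  shows "tractor_change g' v \<Omega>' u p (tractor_change g u \<Omega> v p V) = V"
proof -
  have "(\<lambda>q. \<Omega>' q * \<Omega> q) = (\<lambda>_. 1)"
    by (rule rescaling_unique[OF assms(1) rescaling_compose[OF assms(3,4)] rescaling_refl])
  then show ?thesis
    using tractor_change_compose[OF assms(1-4,5,6,5,7,8,7)] tractor_change_id[OF assms(5,7)] by simp
qed

text \<open>The change of tractors has determinant \<open>\<Omega> p * inverse (\<Omega> p)\<close>
  times that of its middle block, which is the growth of the square root of \<open>det g\<close>.
  That root involves no absolute value, since oriented charts have positive Jacobian
  determinant.\<close>

lemma volume_form_change:
  assumes "g \<in> c" "g' \<in> c" "rescaling A \<Omega> g g'" "u \<in> A" "v \<in> A" "p \<in> dom_of u" "p \<in> dom_of v"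
    and "length Vs = CARD('n) + 2"
  shows "volume_form (g' v (coord v p)) (map (tractor_change g u \<Omega> v p) Vs) = volume_form (g u (coord u p)) Vs"
proof -
  let ?P = "transpose (jac v u p)"
  have pos: "\<Omega> p > 0" by (rule rescaling_pos[OF assms(3)])
  have M': "g' v (coord v p) = (\<Omega> p *\<^sub>R ?P) ** g u (coord u p) ** (\<Omega> p *\<^sub>R jac v u p)"
    using metric_change[OF assms(1,5,4,7,6)] rescaling_metric[OF assms(3,5,7)]
    by (simp add: scaleR_matrix_mult power2_eq_square)
  have d: "det (\<Omega> p *\<^sub>R N) = \<Omega> p ^ CARD('n) * det N" for N :: "real^'n^'n"
  proof -
    have "\<Omega> p *\<^sub>R N = (\<chi> i. \<Omega> p *s N $ i)" by (simp add: vec_eq_iff)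
    then show ?thesis using det_rows_mul[of "\<lambda>_. \<Omega> p" "\<lambda>i. N $ i"] by simp
  qed
  have "det (g' v (coord v p)) = (\<Omega> p ^ CARD('n) * det (jac v u p))\<^sup>2 * det (g u (coord u p))"
    unfolding M' det_mul d by (simp add: power2_eq_square mult_ac)
  then have sq: "sqrt (det (g' v (coord v p))) = \<Omega> p ^ CARD('n) * det (jac v u p) * sqrt (det (g u (coord u p)))"
    using pos det_jac_pos[OF assms(5,4,7,6)] by (simp add: real_sqrt_mult)
  have "vol (map (tractor_change g u \<Omega> v p) Vs) = \<Omega> p * inverse (\<Omega> p) * det (\<Omega> p *\<^sub>R ?P) * vol Vs"
    by (rule vol_triangular[OF linear_tractor_change _ _ _ _ assms(8)])
       (simp_all add: tractor_change_eq tchange_def matrix_vector_mult_scaleR scaleR_matrix_vector_assoc[symmetric])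
  then show ?thesis
    unfolding volume_form_eq sq d using pos det_jac_pos[OF assms(5,4,7,6)] by (simp add: field_simps)
qed

text \<open>After pulling back by the change \<open>L\<close>, the two sides differ only in the
  frame summed over: the basis with its raised duals, or the images of the corresponding vectors
  under the inverse of \<open>L\<close>. Both represent the inverse tractor metric because
  \<open>L\<close> is an isometry.\<close>

lemma hodge_star_change:
  assumes "g \<in> c" "g' \<in> c" "rescaling A \<Omega> g g'" "u \<in> A" "v \<in> A" "p \<in> dom_of u" "p \<in> dom_of v"
    and \<alpha>: "alternating_form d \<alpha>" "\<And>Us. length Us = d \<Longrightarrow> \<alpha>' (map (tractor_change g u \<Omega> v p) Us) = \<alpha> Us"
    and d: "d \<le> CARD('n) + 2" "length Ws = CARD('n) + 2 - d"
  shows "hodge_star d (g' v (coord v p)) \<alpha>' (map (tractor_change g u \<Omega> v p) Ws) = hodge_star d (g u (coord u p)) \<alpha> Ws"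
proof -
  let ?M = "g u (coord u p)" and ?M' = "g' v (coord v p)"
  define L where "L = tractor_change g u \<Omega> v p"
  obtain \<Omega>' where O': "rescaling A \<Omega>' g' g" using rescaling_exists[OF assms(2,1)] by blast
  define L' where "L' = tractor_change g' v \<Omega>' u p"
  have L'L: "L' (L V) = V" for V
    unfolding L_def L'_def by (rule tractor_change_inverse[OF assms(1-3) O' assms(4-7)])
  have LL': "L (L' V) = V" for V
    unfolding L_def L'_def by (rule tractor_change_inverse[OF assms(2,1) O' assms(3,5,4,7,6)])
  have lin': "linear L'" unfolding L'_def by (rule linear_tractor_change)
  have M: "posdef ?M" "posdef ?M'" using metric_posdef assms by auto
  have mapL: "map L (map L' es) = es" for es by (simp add: o_def LL')
  have "star d Basis (sharp ?M') (volume_form ?M') \<alpha>' (map L Ws)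
      = (\<Sum>es | length es = d \<and> set es \<subseteq> Basis. \<alpha> (map (\<lambda>e. L' (sharp ?M' e)) es) * volume_form ?M (map L' es @ Ws))"
    unfolding star_def
  proof (intro sum.cong refl arg_cong2[where f = "(*)"])
    fix es :: "'n tractor list" assume es: "es \<in> {es. length es = d \<and> set es \<subseteq> Basis}"
    have "\<alpha>' (map L (map (\<lambda>e. L' (sharp ?M' e)) es)) = \<alpha> (map (\<lambda>e. L' (sharp ?M' e)) es)"
      unfolding L_def by (rule \<alpha>(2)) (use es in simp)
    then show "\<alpha>' (map (sharp ?M') es) = \<alpha> (map (\<lambda>e. L' (sharp ?M' e)) es)" by (simp add: o_def LL')
    have "volume_form ?M' (map L (map L' es @ Ws)) = volume_form ?M (map L' es @ Ws)"
      unfolding L_def by (rule volume_form_change[OF assms(1-7)]) (use es d in simp)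
    then show "volume_form ?M' (es @ map L Ws) = volume_form ?M (map L' es @ Ws)" by (simp only: map_append mapL)
  qed
  also have "\<dots> = (\<Sum>es | length es = d \<and> set es \<subseteq> Basis. \<alpha> (map (sharp ?M) es) * volume_form ?M (map (\<lambda>e. e) es @ Ws))"
  proof (rule sum_lists_tensor_cong[OF finite_Basis _ \<alpha>(1)])
    show "alternating_form d (\<lambda>us. volume_form ?M (us @ Ws))"
      by (rule alternating_form_append_right[OF _ d(2)]) (use d alternating_volume_form[of ?M] in simp)
    fix f h :: "'n tractor \<Rightarrow> real" assume f: "linear f" and h: "linear h"
    \<comment> \<open>\<open>F\<close> represents \<open>f\<close> through the tractor metric; both
      sums will evaluate to \<open>h F\<close>.\<close>
    define F where "F = sharp ?M (\<Sum>b\<in>Basis. f b *\<^sub>R b)"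
    have fF: "f V = tractor_metric ?M F V" for V
    proof -
      have "f V = f (\<Sum>b\<in>Basis. (V \<bullet> b) *\<^sub>R b)" by (simp only: euclidean_representation)
      also have "\<dots> = (\<Sum>b\<in>Basis. (V \<bullet> b) * f b)"
        by (simp only: linear_sum[OF f] linear_scale[OF f] real_scaleR_def)
      also have "\<dots> = (\<Sum>b\<in>Basis. f b *\<^sub>R b) \<bullet> V"
        by (simp add: inner_sum_left inner_commute[of V] mult.commute)
      finally show ?thesis unfolding F_def by (simp add: tractor_metric_sharp[OF M(1)])
    qed
    have rep: "(\<Sum>e\<in>Basis. (e \<bullet> Z) * h (K e)) = h (K Z)" if "linear K" for K Z
    proof -
      have hk: "linear (\<lambda>v. h (K v))" using linear_compose[OF that h] by (simp add: o_def)
      have "h (K (\<Sum>e\<in>Basis. (Z \<bullet> e) *\<^sub>R e)) = (\<Sum>e\<in>Basis. (Z \<bullet> e) * h (K e))"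
        by (simp only: linear_sum[OF hk] linear_scale[OF hk] real_scaleR_def)
      then have "h (K Z) = (\<Sum>e\<in>Basis. (Z \<bullet> e) * h (K e))" by (simp only: euclidean_representation)
      then show ?thesis by (simp add: inner_commute)
    qed
    have "f (L' (sharp ?M' e)) = e \<bullet> L F" for e
    proof -
      have "f (L' (sharp ?M' e)) = tractor_metric ?M' (L F) (L (L' (sharp ?M' e)))"
        unfolding fF L_def by (rule tractor_change_isometry[OF assms(1-7), symmetric])
      also have "\<dots> = e \<bullet> L F"
        by (simp only: LL' tractor_metric_commute[OF M(2), of "L F"] tractor_metric_sharp[OF M(2)])
      finally show ?thesis .
    qed
    then have "(\<Sum>e\<in>Basis. f (L' (sharp ?M' e)) * h (L' e)) = h (L' (L F))"
      using rep[OF lin', of "L F"] by simp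
    also have "\<dots> = h F" by (simp add: L'L)
    also have "\<dots> = (\<Sum>e\<in>Basis. (e \<bullet> F) * h e)"
      by (rule rep[of "\<lambda>v. v" F, symmetric]) (simp add: linear_iff)
    also have "\<dots> = (\<Sum>e\<in>Basis. f (sharp ?M e) * h e)"
      by (simp only: fF tractor_metric_commute[OF M(1), of F] tractor_metric_sharp[OF M(1)])
    finally show "(\<Sum>e\<in>Basis. f (L' (sharp ?M' e)) * h (L' e)) = (\<Sum>e\<in>Basis. f (sharp ?M e) * h e)" .
  qed
  also have "\<dots> = star d Basis (sharp ?M) (volume_form ?M) \<alpha> Ws"
    unfolding star_def by simp
  finally show ?thesis unfolding hodge_star_eq L_def by simp
qed

end

section \<open>The normal tractor bundle\<close>

text \<open>Definiteness is asked on \<open>T\<close> only, because the tractor metric itself is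
  indefinite.\<close>

lemma orth_projI:
  assumes "w \<in> T" "\<And>z. z \<in> T \<Longrightarrow> b (v - w) z = 0"
    and diff: "\<And>x y. x \<in> T \<Longrightarrow> y \<in> T \<Longrightarrow> x - y \<in> T"
    and lin: "\<And>x y z. b (x - y) z = b x z - b y z"
    and def: "\<And>z. z \<in> T \<Longrightarrow> b z z = (0 :: real) \<Longrightarrow> z = 0"
  shows "orth_proj b T v = w"
  unfolding orth_proj_def
proof (rule the_equality)
  show "w \<in> T \<and> (\<forall>z\<in>T. b (v - w) z = 0)" using assms by blast
next
  fix w' assume w': "w' \<in> T \<and> (\<forall>z\<in>T. b (v - w') z = 0)"
  let ?d = "w' - w"
  have d: "?d \<in> T" using w' assms(1) diff by blast
  have "b (v - w) ?d - b (v - w') ?d = 0" using d w' assms(2) by simp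
  then have "b ((v - w) - (v - w')) ?d = 0" by (simp only: lin)
  then show "w' = w" using def[OF d] by simp
qed

lemma normal_space_iff:
  fixes M :: "real^'n::finite^'n"
  shows "n \<in> normal_space M K \<longleftrightarrow> (\<forall>i. i \<notin> K \<longrightarrow> (M *v n) $ i = 0)"
proof
  assume n: "n \<in> normal_space M K"
  show "\<forall>i. i \<notin> K \<longrightarrow> (M *v n) $ i = 0"
  proof (intro allI impI)
    fix i assume "i \<notin> K"
    then have "\<forall>k\<in>K. (axis i 1 :: real^'n) $ k = 0" by (auto simp: axis_def)
    then have "axis i 1 \<bullet> (M *v n) = 0" using n unfolding normal_space_def by blast
    then show "(M *v n) $ i = 0" by (simp add: inner_axis')
  qed
next
  assume *: "\<forall>i. i \<notin> K \<longrightarrow> (M *v n) $ i = 0"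
  show "n \<in> normal_space M K"
    unfolding normal_space_def
  proof (intro CollectI allI impI)
    fix v :: "real^'n" assume "\<forall>k\<in>K. v $ k = 0"
    then have z: "v $ i * (M *v n) $ i = 0" for i using * by (cases "i \<in> K") auto
    show "v \<bullet> (M *v n) = 0" by (simp only: inner_vec_def inner_real_def z sum.neutral_const)
  qed
qed

text \<open>The tangential part \<open>t\<close> of \<open>w\<close> solves the linear system of the
  tangential block; \<open>w - t\<close> is then orthogonal to all tangential directions and keeps
  the coordinates in \<open>K\<close>.\<close>

lemma normal_decomposition:
  fixes M :: "real^'n::finite^'n"
  assumes "posdef M"
  shows "\<exists>n\<in>normal_space M K. \<forall>k\<in>K. n $ k = w $ k"
proof -
  let ?B = "tangential_block K M"
  define r where "r = (\<chi> i. if i \<in> K then 0 else (M *v w) $ i)"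
  define t where "t = matrix_inv ?B *v r"
  have "?B *v t = r"
    unfolding t_def
    by (simp add: matrix_vector_mul_assoc matrix_inv_inverse[OF posdef_det_nonzero[OF posdef_tangential_block[OF assms]]])
  then have B: "(?B *v t) $ i = r $ i" for i by simp
  have tk: "t $ k = 0" if "k \<in> K" for k
    using B[of k] that by (simp add: tangential_block_mult r_def)
  then have "(\<chi> j. if j \<in> K then 0 else t $ j) = t" by (simp add: vec_eq_iff)
  then have "(M *v t) $ i = (M *v w) $ i" if "i \<notin> K" for i
    using B[of i] that by (simp add: tangential_block_mult r_def)
  then have "w - t \<in> normal_space M K"
    by (simp add: normal_space_iff matrix_vector_mult_diff_distrib)
  then show ?thesis using tk by (intro bexI[of _ "w - t"]) auto
qed

text \<open>The mean curvature without the projection to the normal space. It differs from the true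
  one by a tangential vector, so it agrees with it in the coordinates of \<open>K\<close>, and its
  smoothness is evident from the formula.\<close>

definition mcurv :: "(real^'n \<Rightarrow> real^'n^'n) \<Rightarrow> 'n::finite set \<Rightarrow> real^'n \<Rightarrow> real^'n" where
  "mcurv G K x = inverse (real (CARD('n) - card K)) *\<^sub>R
     (\<Sum>i\<in>-K. \<Sum>j\<in>-K. matrix_inv (tangential_block K (G x)) $ i $ j *\<^sub>R christoffel G x i j)"

text \<open>The pairing of a tractor with the normal tractor whose middle slot is the \<open>k\<close>-th coordinate
  covector.\<close>

definition wcomp :: "(real^'n \<Rightarrow> real^'n^'n) \<Rightarrow> 'n::finite set \<Rightarrow> real^'n \<Rightarrow> 'n \<Rightarrow> 'n tractor \<Rightarrow> real" where
  "wcomp G K x k V = fst V * mcurv G K x $ k + (matrix_inv (G x) *v fst (snd V)) $ k"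

lemma linear_wcomp: "linear (wcomp G K x k)"
  by (rule linearI) (simp_all add: wcomp_def algebra_simps matrix_vector_right_distrib matrix_vector_mult_scaleR)

text \<open>A family dual to the functionals: subtracting suitable multiples of these tractors moves
  any tractor into the common kernel.\<close>

lemma wcomp_dual:
  fixes G :: "real^'n::finite \<Rightarrow> real^'n^'n"
  assumes "posdef (G x)"
  shows "wcomp G K x l (0, G x *v axis m 1, 0) = (if l = m then 1 else 0)"
  by (simp add: wcomp_def matrix_vector_mul_assoc matrix_inv_inverse[OF posdef_det_nonzero[OF assms]] axis_def)

text \<open>Projection to the normal space changes a vector by a tangential one, whose coordinates
  in \<open>K\<close> vanish.\<close>

lemma second_ff_component:
  fixes G :: "real^'n::finite \<Rightarrow> real^'n^'n"
  assumes M: "posdef (G x)" and k: "k \<in> K"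
  shows "second_ff G K x i j $ k = christoffel G x i j $ k"
proof -
  let ?N = "normal_space (G x) K"
  obtain n where n: "n \<in> ?N" "\<forall>k\<in>K. n $ k = christoffel G x i j $ k"
    using normal_decomposition[OF M] by blast
  have "orth_proj (\<lambda>v w. v \<bullet> (G x *v w)) ?N (christoffel G x i j) = n"
  proof (rule orth_projI[OF n(1)])
    show "(christoffel G x i j - n) \<bullet> (G x *v z) = 0" if "z \<in> ?N" for z
      using that n(2) by (auto simp: normal_space_def)
    show "y - z \<in> ?N" if "y \<in> ?N" "z \<in> ?N" for y z
      using that by (simp add: normal_space_iff matrix_vector_mult_diff_distrib)
    show "z = 0" if "z \<bullet> (G x *v z) = 0" for z
      using M that unfolding posdef_def by (metis less_irrefl)
  qed (simp add: inner_diff_left)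
  then show ?thesis using n(2) k by (simp add: second_ff_def)
qed

lemma mean_curvature_component:
  fixes G :: "real^'n::finite \<Rightarrow> real^'n^'n"
  assumes "posdef (G x)" "k \<in> K"
  shows "mean_curvature G K x $ k = mcurv G K x $ k"
  unfolding mean_curvature_def mcurv_def
  by (simp add: second_ff_component[where G = G and x = x, OF assms] sum_component)

text \<open>Lowering a normal vector gives a covector with components in \<open>K\<close> only, so
  pairing with a normal tractor is a combination of the functionals.\<close>

lemma tractor_metric_normal:
  fixes G :: "real^'n::finite \<Rightarrow> real^'n^'n"
  assumes M: "posdef (G x)" and n: "n \<in> normal_space (G x) K"
  shows "tractor_metric (G x) V (0, G x *v n, (G x *v n) \<bullet> mean_curvature G K x)
    = (\<Sum>k\<in>K. (G x *v n) $ k * wcomp G K x k V)"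
proof -
  let ?\<xi> = "G x *v n"
  have inner: "?\<xi> \<bullet> y = (\<Sum>k\<in>K. ?\<xi> $ k * y $ k)" for y
    unfolding inner_vec_def inner_real_def
    by (rule sum.mono_neutral_right) (use n in \<open>auto simp: normal_space_iff\<close>)
  have "tractor_metric (G x) V (0, ?\<xi>, ?\<xi> \<bullet> mean_curvature G K x)
      = fst V * (?\<xi> \<bullet> mean_curvature G K x) + ?\<xi> \<bullet> (matrix_inv (G x) *v fst (snd V))"
    using posdef_inner_commute[OF posdef_matrix_inv[OF M]] by (simp add: tractor_metric_eq)
  also have "\<dots> = (\<Sum>k\<in>K. ?\<xi> $ k * wcomp G K x k V)"
    unfolding inner wcomp_def
    by (simp add: sum_distrib_left sum.distrib[symmetric] mean_curvature_component[where G = G and x = x, OF M] algebra_simps)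
  finally show ?thesis .
qed

lemma perp_iff_wcomp:
  fixes G :: "real^'n::finite \<Rightarrow> real^'n^'n"
  assumes M: "posdef (G x)"
  shows "(\<forall>Z\<in>normal_tractors G K x. tractor_metric (G x) V Z = 0) \<longleftrightarrow> (\<forall>k\<in>K. wcomp G K x k V = 0)"
proof
  assume *: "\<forall>Z\<in>normal_tractors G K x. tractor_metric (G x) V Z = 0"
  show "\<forall>k\<in>K. wcomp G K x k V = 0"
  proof
    fix k assume k: "k \<in> K"
    \<comment> \<open>The metric dual of the \<open>k\<close>-th coordinate covector, which is
      normal as \<open>k\<close> lies in \<open>K\<close>.\<close>
    define n where "n = matrix_inv (G x) *v axis k 1"
    have Gn: "G x *v n = axis k 1"
      unfolding n_def by (simp add: matrix_vector_mul_assoc matrix_inv_inverse[OF posdef_det_nonzero[OF M]])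
    have n: "n \<in> normal_space (G x) K" using k by (auto simp: normal_space_iff Gn axis_def)
    have "(\<Sum>l\<in>K. (G x *v n) $ l * wcomp G K x l V) = 0"
    proof -
      have "tractor_metric (G x) V (0, G x *v n, (G x *v n) \<bullet> mean_curvature G K x) = 0"
        using * n unfolding normal_tractors_def by blast
      then show ?thesis using tractor_metric_normal[where G = G and x = x, OF M n, of V] by simp
    qed
    then show "wcomp G K x k V = 0"
      using k by (simp add: Gn axis_def if_distrib[of "\<lambda>x. x * _"] cong: if_cong)
  qed
next
  assume "\<forall>k\<in>K. wcomp G K x k V = 0"
  then show "\<forall>Z\<in>normal_tractors G K x. tractor_metric (G x) V Z = 0"
    using tractor_metric_normal[where G = G and x = x, OF M] by (auto simp: normal_tractors_def)
qed

lemma tractor_second_ff_zero_iff: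
  fixes G :: "real^'n::finite \<Rightarrow> real^'n^'n"
  assumes M: "posdef (G x)"
  shows "tractor_second_ff G K i V x = 0 \<longleftrightarrow> (\<forall>k\<in>K. wcomp G K x k (tractor_nabla G i V x) = 0)"
proof -
  let ?b = "tractor_metric (G x)" and ?T = "normal_tractors G K x" and ?v = "tractor_nabla G i V x"
  have diff: "y - z \<in> ?T" if yz: "y \<in> ?T" "z \<in> ?T" for y z
  proof -
    obtain a b where "a \<in> normal_space (G x) K" "y = (0, G x *v a, (G x *v a) \<bullet> mean_curvature G K x)"
      "b \<in> normal_space (G x) K" "z = (0, G x *v b, (G x *v b) \<bullet> mean_curvature G K x)"
      using yz by (auto simp: normal_tractors_def)
    then have "a - b \<in> normal_space (G x) K"
      "y - z = (0, G x *v (a - b), (G x *v (a - b)) \<bullet> mean_curvature G K x)"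
      by (simp_all add: normal_space_iff matrix_vector_mult_diff_distrib inner_diff_left)
    then show ?thesis unfolding normal_tractors_def by blast
  qed
  have lin: "?b (y - z) w = ?b y w - ?b z w" for y z w
    by (simp add: tractor_metric_eq algebra_simps inner_diff_left)
  have def: "z = 0" if "z \<in> ?T" "?b z z = 0" for z
  proof -
    obtain n where n: "n \<in> normal_space (G x) K" "z = (0, G x *v n, (G x *v n) \<bullet> mean_curvature G K x)"
      using \<open>z \<in> ?T\<close> unfolding normal_tractors_def by blast
    have "?b z z = n \<bullet> (G x *v n)"
      using n(2) by (simp add: tractor_metric_eq matrix_vector_mul_assoc
          matrix_inv_inverse[OF posdef_det_nonzero[OF M]] inner_commute)
    then have "n = 0" using M that(2) unfolding posdef_def by (metis less_irrefl)
    then show ?thesis using n(2) by (simp add: zero_prod_def)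
  qed
  have zT: "0 \<in> ?T" unfolding normal_tractors_def
    by (rule image_eqI[of _ _ 0]) (simp_all add: zero_prod_def normal_space_iff)
  \<comment> \<open>The normal vector with these coordinates yields the projection, because the
    functionals take its coordinates as values on the corresponding normal tractor.\<close>
  obtain n where n: "n \<in> normal_space (G x) K" "\<forall>k\<in>K. n $ k = (\<chi> k. wcomp G K x k ?v) $ k"
    using normal_decomposition[OF M] by blast
  define w where "w = (0 :: real, G x *v n, (G x *v n) \<bullet> mean_curvature G K x)"
  have wT: "w \<in> ?T" using n(1) by (auto simp: w_def normal_tractors_def)
  have "wcomp G K x k w = n $ k" for k
    by (simp add: w_def wcomp_def matrix_vector_mul_assoc matrix_inv_inverse[OF posdef_det_nonzero[OF M]])
  then have "\<forall>k\<in>K. wcomp G K x k (?v - w) = 0"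
    using n(2) by (simp add: linear_diff[OF linear_wcomp])
  then have orth: "\<forall>z\<in>?T. ?b (?v - w) z = 0" by (simp only: perp_iff_wcomp[where G = G and x = x, OF M])
  have eq: "tractor_second_ff G K i V x = w"
    unfolding tractor_second_ff_def by (rule orth_projI[OF wT _ diff lin def]) (use orth in auto)
  show ?thesis
  proof
    assume "tractor_second_ff G K i V x = 0"
    then have "w = 0" using eq by simp
    then show "\<forall>k\<in>K. wcomp G K x k ?v = 0" using orth perp_iff_wcomp[where G = G and x = x, OF M, of K ?v] by simp
  next
    assume "\<forall>k\<in>K. wcomp G K x k ?v = 0"
    then have "\<forall>z\<in>?T. ?b (?v - 0) z = 0" using perp_iff_wcomp[where G = G and x = x, OF M, of K ?v] by simp
    then show "tractor_second_ff G K i V x = 0"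
      unfolding tractor_second_ff_def by (intro orth_projI[OF zT _ diff lin def]) auto
  qed
qed

section \<open>The Koszul form\<close>

text \<open>The Koszul formula: twice the metric product of \<open>c\<close> with the covariant
  derivative of the constant field \<open>b\<close> along \<open>a\<close>. With arbitrary vectors
  as arguments, its change of chart involves no inverse matrices.\<close>

definition kos :: "(real^'n \<Rightarrow> real^'n^'n) \<Rightarrow> real^'n \<Rightarrow> real^'n \<Rightarrow> real^'n \<Rightarrow> real^'n::finite \<Rightarrow> real" where
  "kos G x a b c = b \<bullet> (frechet_derivative G (at x) a *v c) + a \<bullet> (frechet_derivative G (at x) b *v c)
     - a \<bullet> (frechet_derivative G (at x) c *v b)"

lemma kos_linear:
  assumes "(G has_derivative frechet_derivative G (at x)) (at x)"
  shows "linear (\<lambda>c. kos G x a b c)" "linear (\<lambda>a. kos G x a b c)" "linear (\<lambda>b. kos G x a b c)"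
proof -
  have D: "linear (frechet_derivative G (at x))" by (rule has_derivative_linear[OF assms])
  note simps = linear_add[OF D] linear_scale[OF D] kos_def inner_add_left inner_add_right matrix_vector_right_distrib
    matrix_vector_mult_scaleR matrix_vector_mult_add_rdistrib scaleR_matrix_vector_assoc[symmetric] algebra_simps
  show "linear (\<lambda>c. kos G x a b c)" by (rule linearI) (simp_all add: simps)
  show "linear (\<lambda>a. kos G x a b c)" by (rule linearI) (simp_all add: simps)
  show "linear (\<lambda>b. kos G x a b c)" by (rule linearI) (simp_all add: simps)
qed

lemma vec_expand: "(v :: real^'n) = (\<Sum>i\<in>UNIV. v $ i *\<^sub>R axis i 1)"
  using basis_expansion[of v] by (simp add: scalar_mult_eq_scaleR)

lemma inner_axis_matrix: "axis i 1 \<bullet> ((M :: real^'n^'n) *v axis j 1) = M $ i $ j"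
  by (simp add: inner_axis' matrix_vector_mult_basis column_def)

lemma pdiff_component:
  fixes G :: "real^'n::finite \<Rightarrow> real^'n^'n"
  assumes "(G has_derivative D) (at x)"
  shows "pdiff a (\<lambda>y. G y $ b $ d) x = D (axis a 1) $ b $ d"
proof -
  have "((\<lambda>y. G y $ b $ d) has_derivative (\<lambda>h. D h $ b $ d)) (at x)"
    by (intro bounded_linear.has_derivative[OF bounded_linear_vec_nth] assms)
  then show ?thesis by (rule pdiff_frechet)
qed

lemma christoffel_kos:
  fixes G :: "real^'n::finite \<Rightarrow> real^'n^'n"
  assumes M: "posdef (G x)" and D: "(G has_derivative frechet_derivative G (at x)) (at x)"
  shows "christoffel G x a b $ k = (1/2) * kos G x (axis a 1) (axis b 1) (matrix_inv (G x) *v axis k 1)"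
proof -
  let ?n = "matrix_inv (G x) *v axis k 1"
  have n: "?n $ d = matrix_inv (G x) $ k $ d" for d
    using posdef_sym[OF posdef_matrix_inv[OF M], of d k] by (simp add: matrix_vector_mult_basis column_def)
  have "kos G x (axis a 1) (axis b 1) ?n = kos G x (axis a 1) (axis b 1) (\<Sum>d\<in>UNIV. ?n $ d *\<^sub>R axis d 1)"
    using vec_expand[of ?n] by simp
  also have "\<dots> = (\<Sum>d\<in>UNIV. ?n $ d * kos G x (axis a 1) (axis b 1) (axis d 1))"
    by (simp only: linear_sum[OF kos_linear(1)[OF D]] linear_scale[OF kos_linear(1)[OF D]] real_scaleR_def)
  finally show ?thesis
    by (simp add: christoffel_def pdiff_component[OF D] kos_def inner_axis_matrix n sum_distrib_left mult_ac)
qed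

text \<open>For normal \<open>n\<close>, the metric product of \<open>n\<close> with the mean
  curvature. It is written by the Koszul form because that is where changes of chart and scale are
  computed.\<close>

definition ncurv :: "(real^'n \<Rightarrow> real^'n^'n) \<Rightarrow> 'n::finite set \<Rightarrow> real^'n \<Rightarrow> real^'n \<Rightarrow> real" where
  "ncurv G K x n = inverse (real (CARD('n) - card K)) * ((1/2) *
     (\<Sum>i\<in>-K. \<Sum>j\<in>-K. matrix_inv (tangential_block K (G x)) $ i $ j * kos G x (axis i 1) (axis j 1) n))"

lemma ncurv_dual:
  fixes G :: "real^'n::finite \<Rightarrow> real^'n^'n"
  assumes M: "posdef (G x)" and D: "(G has_derivative frechet_derivative G (at x)) (at x)"
  shows "ncurv G K x (matrix_inv (G x) *v \<xi>) = \<xi> \<bullet> mcurv G K x"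
proof -
  have 1: "ncurv G K x (matrix_inv (G x) *v axis k 1) = mcurv G K x $ k" for k
    unfolding ncurv_def mcurv_def
    by (simp add: sum_component christoffel_kos[OF M D] sum_distrib_left mult_ac)
  have lin: "linear (\<lambda>\<xi>. ncurv G K x (matrix_inv (G x) *v \<xi>))"
    by (rule linearI)
       (simp_all add: ncurv_def matrix_vector_right_distrib matrix_vector_mult_scaleR
         linear_add[OF kos_linear(1)[OF D]] linear_scale[OF kos_linear(1)[OF D]]
         sum.distrib sum_distrib_left algebra_simps)
  have "ncurv G K x (matrix_inv (G x) *v (\<Sum>k\<in>UNIV. \<xi> $ k *\<^sub>R axis k 1)) = (\<Sum>k\<in>UNIV. \<xi> $ k * mcurv G K x $ k)"
    using linear_sum[OF lin, of "\<lambda>k. \<xi> $ k *\<^sub>R axis k 1" UNIV] linear_scale[OF lin] 1 by simp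
  then show ?thesis using vec_expand[of \<xi>] by (simp add: inner_vec_def)
qed

lemma tangential_inverse:
  fixes M :: "real^'n::finite^'n"
  assumes "posdef M" "i \<notin> K" "l \<notin> K"
  shows "(\<Sum>j\<in>-K. matrix_inv (tangential_block K M) $ i $ j * M $ j $ l) = (if i = l then 1 else 0)"
    "(\<Sum>j\<in>-K. M $ i $ j * matrix_inv (tangential_block K M) $ j $ l) = (if i = l then 1 else 0)"
proof -
  let ?B = "tangential_block K M"
  note inv = matrix_inv_inverse[OF posdef_det_nonzero[OF posdef_tangential_block[OF assms(1), of K]]]
  have "(if i = l then 1 else 0) = (matrix_inv ?B ** ?B) $ i $ l" by (simp add: inv mat_def)
  also have "\<dots> = (\<Sum>j\<in>UNIV. matrix_inv ?B $ i $ j * ?B $ j $ l)" by (simp add: matrix_matrix_mult_def)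
  also have "\<dots> = (\<Sum>j\<in>-K. matrix_inv ?B $ i $ j * M $ j $ l)"
    by (rule sum.mono_neutral_cong_right) (use assms(3) in \<open>auto simp: tangential_block_def\<close>)
  finally show "(\<Sum>j\<in>-K. matrix_inv ?B $ i $ j * M $ j $ l) = (if i = l then 1 else 0)" by simp
  have "(if i = l then 1 else 0) = (?B ** matrix_inv ?B) $ i $ l" by (simp add: inv mat_def)
  also have "\<dots> = (\<Sum>j\<in>UNIV. ?B $ i $ j * matrix_inv ?B $ j $ l)" by (simp add: matrix_matrix_mult_def)
  also have "\<dots> = (\<Sum>j\<in>-K. M $ i $ j * matrix_inv ?B $ j $ l)"
    by (rule sum.mono_neutral_cong_right) (use assms(2) in \<open>auto simp: tangential_block_def\<close>)
  finally show "(\<Sum>j\<in>-K. M $ i $ j * matrix_inv ?B $ j $ l) = (if i = l then 1 else 0)" by simp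
qed

lemma trace_tangential:
  fixes M :: "real^'n::finite^'n"
  assumes "posdef M"
  shows "(\<Sum>i\<in>-K. \<Sum>j\<in>-K. matrix_inv (tangential_block K M) $ i $ j * M $ i $ j) = real (CARD('n) - card K)"
proof -
  have "(\<Sum>i\<in>-K. \<Sum>j\<in>-K. matrix_inv (tangential_block K M) $ i $ j * M $ i $ j)
      = (\<Sum>i\<in>-K. \<Sum>j\<in>-K. matrix_inv (tangential_block K M) $ i $ j * M $ j $ i)"
    using posdef_sym[OF assms] by simp
  also have "\<dots> = (\<Sum>i\<in>-K. 1)"
    by (rule sum.cong) (use tangential_inverse(1)[OF assms] in auto)
  finally show ?thesis by (simp add: Compl_eq_Diff_UNIV card_Diff_subset)
qed

section \<open>Slice charts\<close>

context conformal_manifold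
begin

lemma metric_derivative:
  "g \<in> c \<Longrightarrow> u \<in> A \<Longrightarrow> p \<in> dom_of u \<Longrightarrow>
    (g u has_derivative frechet_derivative (g u) (at (coord u p))) (at (coord u p))"
  by (rule smooth_on_has_derivative[OF metric_smooth]) auto

lemma slice_iff:
  assumes "slice_chart A d S u K" "p \<in> dom_of u"
  shows "p \<in> S \<longleftrightarrow> (\<forall>k\<in>K. coord u p $ k = 0)"
proof -
  have u: "u \<in> A" and eq: "coord u ` (dom_of u \<inter> S) = coord u ` dom_of u \<inter> {x. \<forall>k\<in>K. x $ k = 0}"
    using assms(1) by (auto simp: slice_chart_def)
  show ?thesis
  proof
    assume "p \<in> S"
    then have "coord u p \<in> coord u ` (dom_of u \<inter> S)" using assms(2) by auto
    then show "\<forall>k\<in>K. coord u p $ k = 0" using eq by auto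
  next
    assume "\<forall>k\<in>K. coord u p $ k = 0"
    then have "coord u p \<in> coord u ` (dom_of u \<inter> S)" using eq assms(2) by auto
    then obtain q where "q \<in> dom_of u" "q \<in> S" "coord u p = coord u q" by auto
    then show "p \<in> S" using inj_onD[OF inj_coord[OF u]] assms(2) by metis
  qed
qed

text \<open>In a slice chart the coordinate line of a tangential index keeps the coordinates in
  \<open>K\<close> at zero, so it runs in \<open>S\<close> for small \<open>t\<close>. All
  derivatives along \<open>S\<close> are taken along such lines.\<close>

lemma slice_curve:
  assumes "slice_chart A d S u K" "p \<in> dom_of u \<inter> S" "i \<notin> K" "open W" "p \<in> W"
  shows "\<forall>\<^sub>F t in nhds 0. coord u p + t *\<^sub>R axis i 1 \<in> coord u ` (dom_of u \<inter> S \<inter> W)"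
proof -
  have u: "u \<in> A" using assms(1) by (auto simp: slice_chart_def)
  let ?f = "\<lambda>t :: real. coord u p + t *\<^sub>R axis i 1"
  have "((\<lambda>t. ?f t) \<longlongrightarrow> ?f 0) (nhds 0)"
    by (intro tendsto_intros filterlim_ident)
  moreover have "open (coord u ` (dom_of u \<inter> W))" "?f 0 \<in> coord u ` (dom_of u \<inter> W)"
    using open_coord_image[OF u assms(4)] assms by auto
  ultimately have "\<forall>\<^sub>F t in nhds 0. ?f t \<in> coord u ` (dom_of u \<inter> W)"
    by (rule topological_tendstoD)
  then show ?thesis
  proof eventually_elim
    case (elim t)
    then obtain q where q: "q \<in> dom_of u" "q \<in> W" "?f t = coord u q" by auto
    have "\<forall>k\<in>K. coord u p $ k = 0" using slice_iff[OF assms(1)] assms(2) by auto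
    then have "\<forall>k\<in>K. coord u q $ k = 0"
      using q(3)[symmetric] assms(3) by (auto simp: axis_def)
    then have "q \<in> S" using slice_iff[OF assms(1) q(1)] by blast
    then show ?case using q by auto
  qed
qed

end

section \<open>Comparison of two slice charts and two scales\<close>

locale slice_change = conformal_manifold A c
  for A :: "('a::{t2_space, second_countable_topology}, 'n::finite) chart set"
    and c :: "('a, 'n) metric set" +
  fixes g g' :: "('a, 'n) metric" and \<Omega> :: "'a \<Rightarrow> real" and d :: nat and S :: "'a set"
    and u v :: "('a, 'n) chart" and K K' :: "'n set"
  assumes g: "g \<in> c" "g' \<in> c" "rescaling A \<Omega> g g'"
    and slice: "slice_chart A d S u K" "slice_chart A d S v K'"
    and d: "d < CARD('n)"
begin

lemma charts: "u \<in> A" "v \<in> A"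
  using slice by (auto simp: slice_chart_def)

text \<open>The \<open>k\<close>-th coordinate of \<open>v\<close> is zero on \<open>S\<close>,
  hence constant along the tangential coordinate lines of \<open>u\<close>.\<close>

lemma jac_normal_tangential:
  assumes p: "p \<in> dom_of u \<inter> dom_of v \<inter> S" and "i \<notin> K" "k \<in> K'"
  shows "jac u v p $ k $ i = 0"
proof -
  have D: "((coord v \<circ> point_of u) has_derivative (\<lambda>h. jac u v p *v h)) (at (coord u p))"
    by (rule transition_derivative) (use charts p in auto)
  have "((\<lambda>t. (coord v \<circ> point_of u) (coord u p + t *\<^sub>R axis i 1) $ k) has_vector_derivative (jac u v p *v axis i 1) $ k) (at 0)"
    by (rule bounded_linear.has_vector_derivative[OF bounded_linear_vec_nth has_derivative_imp_pdiff[OF D]])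
  moreover have "\<forall>\<^sub>F t in nhds 0. (coord v \<circ> point_of u) (coord u p + t *\<^sub>R axis i 1) $ k = 0"
  proof -
    have "\<forall>\<^sub>F t in nhds 0. coord u p + t *\<^sub>R axis i 1 \<in> coord u ` (dom_of u \<inter> S \<inter> dom_of v)"
      by (rule slice_curve[OF slice(1) _ assms(2) open_dom[OF charts(2)]]) (use p in auto)
    then show ?thesis
    proof eventually_elim
      case (elim t)
      then obtain q where q: "q \<in> dom_of u" "q \<in> S" "q \<in> dom_of v" "coord u p + t *\<^sub>R axis i 1 = coord u q" by auto
      then show ?case using slice_iff[OF slice(2) q(3)] assms(3) point_of_coord[OF charts(1) q(1)] by simp
    qed
  qed
  ultimately have "(jac u v p *v axis i 1) $ k = 0"
    by (rule has_vector_derivative_unique_ev[OF _ has_vector_derivative_const])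
  then show ?thesis by (simp add: matrix_vector_mult_basis column_def)
qed

definition trans where "trans = coord v \<circ> point_of u"

text \<open>Second derivative of the transition map, the inhomogeneous term in the transformation of
  Christoffel symbols.\<close>

definition hess where
  "hess x a b = frechet_derivative (\<lambda>z. frechet_derivative trans (at z) a) (at x) b"

lemma trans_domain: "open (coord u ` (dom_of u \<inter> dom_of v))"
  by (rule open_coord_image[OF charts(1) open_dom[OF charts(2)]])

lemma trans_smooth: "smooth_on (coord u ` (dom_of u \<inter> dom_of v)) trans"
  unfolding trans_def by (rule smooth_transition[OF charts])

lemma trans_frechet:
  assumes "p \<in> dom_of u" "p \<in> dom_of v"
  shows "frechet_derivative trans (at (coord u p)) = (\<lambda>h. jac u v p *v h)"
  unfolding trans_def by (rule frechet_derivative_at[OF transition_derivative[OF charts assms], symmetric])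

lemma hess_symmetric: "p \<in> dom_of u \<Longrightarrow> p \<in> dom_of v \<Longrightarrow> hess (coord u p) a b = hess (coord u p) b a"
  unfolding hess_def by (rule second_derivative_symmetric[OF trans_smooth trans_domain]) auto

lemma hess_derivative:
  "p \<in> dom_of u \<Longrightarrow> p \<in> dom_of v \<Longrightarrow>
   ((\<lambda>z. frechet_derivative trans (at z) a) has_derivative hess (coord u p) a) (at (coord u p))"
  using smooth_on_has_derivative[OF smooth_on_derivative[OF trans_smooth, of a]]
  unfolding hess_def[abs_def] by auto

text \<open>The vanishing of these Jacobian entries holds all along \<open>S\<close> and can be
  differentiated once more. Thus the Hessian of tangential directions is tangential and disappears
  when paired with normal vectors.\<close>

lemma hess_tangential:
  assumes p: "p \<in> dom_of u \<inter> dom_of v \<inter> S" and "i \<notin> K" "j \<notin> K" "k \<in> K'"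
  shows "hess (coord u p) (axis i 1) (axis j 1) $ k = 0"
proof -
  have "((\<lambda>t. frechet_derivative trans (at (coord u p + t *\<^sub>R axis j 1)) (axis i 1) $ k)
      has_vector_derivative hess (coord u p) (axis i 1) (axis j 1) $ k) (at 0)"
    by (rule bounded_linear.has_vector_derivative[OF bounded_linear_vec_nth has_derivative_imp_pdiff[OF hess_derivative]])
       (use p in auto)
  moreover have "\<forall>\<^sub>F t in nhds 0. frechet_derivative trans (at (coord u p + t *\<^sub>R axis j 1)) (axis i 1) $ k = 0"
  proof -
    have "\<forall>\<^sub>F t in nhds 0. coord u p + t *\<^sub>R axis j 1 \<in> coord u ` (dom_of u \<inter> S \<inter> dom_of v)"
      by (rule slice_curve[OF slice(1) _ assms(3) open_dom[OF charts(2)]]) (use p in auto)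
    then show ?thesis
    proof eventually_elim
      case (elim t)
      then obtain q where q: "q \<in> dom_of u" "q \<in> S" "q \<in> dom_of v" "coord u p + t *\<^sub>R axis j 1 = coord u q" by auto
      show ?case
        unfolding q(4) trans_frechet[OF q(1,3)]
        using jac_normal_tangential[of q i k] q assms by (simp add: matrix_vector_mult_basis column_def)
    qed
  qed
  ultimately show ?thesis
    by (rule has_vector_derivative_unique_ev[OF _ has_vector_derivative_const])
qed

text \<open>Derivative along \<open>h\<close> of the transformation law of the metric on fixed
  vectors \<open>a\<close> and \<open>b\<close>: the product rule for
  \<open>\<Omega>\<^sup>2 g\<close> on the left, for the pullback of \<open>g'\<close> on the
  right.\<close>

lemma metric_first_derivative:
  assumes p: "p \<in> dom_of u" "p \<in> dom_of v"
  defines "x \<equiv> coord u p" and "J \<equiv> jac u v p" and "M' \<equiv> g' v (coord v p)"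
  shows "2 * (\<Omega> p)\<^sup>2 * (grad u \<Omega> p \<bullet> h) * (a \<bullet> (g u x *v b))
      + (\<Omega> p)\<^sup>2 * (a \<bullet> (frechet_derivative (g u) (at x) h *v b))
    = hess x a h \<bullet> (M' *v (J *v b)) + (J *v a) \<bullet> (frechet_derivative (g' v) (at (coord v p)) (J *v h) *v (J *v b))
      + (J *v a) \<bullet> (M' *v hess x b h)"
proof -
  let ?U = "coord u ` (dom_of u \<inter> dom_of v)"
  let ?F = "\<lambda>z. frechet_derivative trans (at z)"
  have xU: "x \<in> ?U" using p by (auto simp: x_def)
  have O: "((\<Omega> \<circ> point_of u) has_derivative (\<lambda>h. \<Omega> p * (grad u \<Omega> p \<bullet> h))) (at x)"
    unfolding x_def by (rule smooth_grad_derivative[OF g(3) charts(1) p(1)])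
  have mv: "bounded_bilinear ((*v) :: real^'n^'n \<Rightarrow> real^'n \<Rightarrow> real^'n)"
    unfolding bilinear_conv_bounded_bilinear[symmetric] bilinear_def
    by (auto intro!: linearI simp: matrix_vector_right_distrib matrix_vector_mult_scaleR
        matrix_vector_mult_add_rdistrib scaleR_matrix_vector_assoc)
  have G: "(g u has_derivative frechet_derivative (g u) (at x)) (at x)"
    unfolding x_def by (rule metric_derivative[OF g(1) charts(1) p(1)])
  have "(trans has_derivative (\<lambda>h. J *v h)) (at x)"
    unfolding x_def J_def trans_def by (rule transition_derivative[OF charts p])
  moreover have tx: "trans x = coord v p" unfolding x_def trans_def using point_of_coord[OF charts(1) p(1)] by simp
  ultimately have G': "((\<lambda>z. g' v (trans z)) has_derivative
      (\<lambda>h. frechet_derivative (g' v) (at (coord v p)) (J *v h))) (at x)"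
    using has_derivative_compose[of trans "\<lambda>h. J *v h" x UNIV "g' v" "frechet_derivative (g' v) (at (coord v p))"]
      metric_derivative[OF g(2) charts(2) p(2)] by simp
  have H: "((\<lambda>z. ?F z a) has_derivative hess x a) (at x)" for a
    unfolding x_def by (rule hess_derivative[OF p])
  have Fx: "?F x = (\<lambda>h. J *v h)" unfolding x_def J_def by (rule trans_frechet[OF p])
  have px: "(\<Omega> \<circ> point_of u) x = \<Omega> p" using point_of_coord[OF charts(1) p(1)] by (simp add: x_def)
  have L: "((\<lambda>z. ((\<Omega> \<circ> point_of u) z * (\<Omega> \<circ> point_of u) z) * (a \<bullet> (g u z *v b))) has_derivative
     (\<lambda>h. ((\<Omega> \<circ> point_of u) x * (\<Omega> \<circ> point_of u) x) * (a \<bullet> (frechet_derivative (g u) (at x) h *v b))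
       + ((\<Omega> \<circ> point_of u) x * (\<Omega> p * (grad u \<Omega> p \<bullet> h)) + (\<Omega> p * (grad u \<Omega> p \<bullet> h)) * (\<Omega> \<circ> point_of u) x)
          * (a \<bullet> (g u x *v b)))) (at x)"
    by (intro has_derivative_mult O bounded_linear.has_derivative[OF bounded_linear_inner_right]
        bounded_linear.has_derivative[OF bounded_bilinear.bounded_linear_left[OF mv]] G)
  have R: "((\<lambda>z. ?F z a \<bullet> (g' v (trans z) *v ?F z b)) has_derivative
     (\<lambda>h. ?F x a \<bullet> (g' v (trans x) *v hess x b h + frechet_derivative (g' v) (at (coord v p)) (J *v h) *v ?F x b)
        + hess x a h \<bullet> (g' v (trans x) *v ?F x b))) (at x)"
    by (intro has_derivative_inner H bounded_bilinear.FDERIV[OF mv] G')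
  have "((\<lambda>z. ((\<Omega> \<circ> point_of u) z * (\<Omega> \<circ> point_of u) z) * (a \<bullet> (g u z *v b))) has_derivative
     (\<lambda>h. ?F x a \<bullet> (g' v (trans x) *v hess x b h + frechet_derivative (g' v) (at (coord v p)) (J *v h) *v ?F x b)
        + hess x a h \<bullet> (g' v (trans x) *v ?F x b))) (at x)"
  proof (rule has_derivative_transform_within_open[OF R trans_domain xU])
    fix z assume "z \<in> ?U"
    then obtain q where q: "q \<in> dom_of u" "q \<in> dom_of v" "z = coord u q" by auto
    have "a \<bullet> (((\<Omega> q)\<^sup>2 *\<^sub>R g u (coord u q)) *v b)
        = (jac u v q *v a) \<bullet> (g' v (coord v q) *v (jac u v q *v b))"
      unfolding rescaled_metric_change[OF g(2,3) charts q(1,2)]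
      by (simp add: matrix_vector_mul_assoc[symmetric] inner_matrix_transpose[of a]
          del: transpose_matrix_vector)
    then show "?F z a \<bullet> (g' v (trans z) *v ?F z b)
        = ((\<Omega> \<circ> point_of u) z * (\<Omega> \<circ> point_of u) z) * (a \<bullet> (g u z *v b))"
      using point_of_coord[OF charts(1) q(1)] trans_frechet[OF q(1,2)]
      by (simp add: q(3) trans_def scaleR_matrix_vector_assoc[symmetric] power2_eq_square)
  qed
  from fun_cong[OF has_derivative_unique[OF L this], of h]
  show ?thesis unfolding px tx Fx M'_def by (simp add: power2_eq_square inner_add_right algebra_simps)
qed

text \<open>The Koszul combination of three instances of the differentiated metric law. By symmetry
  of the Hessian, four of its six terms cancel and the other two add up.\<close>

lemma kos_change:
  assumes p: "p \<in> dom_of u" "p \<in> dom_of v"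
  defines "x \<equiv> coord u p" and "J \<equiv> jac u v p"
  shows "(\<Omega> p)\<^sup>2 * kos (g u) x a b h + 2 * (\<Omega> p)\<^sup>2 *
       ((grad u \<Omega> p \<bullet> a) * (b \<bullet> (g u x *v h)) + (grad u \<Omega> p \<bullet> b) * (a \<bullet> (g u x *v h))
        - (grad u \<Omega> p \<bullet> h) * (a \<bullet> (g u x *v b)))
    = kos (g' v) (coord v p) (J *v a) (J *v b) (J *v h)
       + 2 * (hess x a b \<bullet> (g' v (coord v p) *v (J *v h)))"
proof -
  let ?M' = "g' v (coord v p)"
  have pd: "posdef ?M'" by (rule metric_posdef[OF g(2) charts(2) p(2)])
  note E = metric_first_derivative[OF p, folded x_def J_def]
  have s: "y \<bullet> (?M' *v z) = z \<bullet> (?M' *v y)" for y z by (rule posdef_inner_commute[OF pd])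
  have hs: "hess x y z = hess x z y" for y z unfolding x_def by (rule hess_symmetric[OF p])
  have "(\<Omega> p)\<^sup>2 * kos (g u) x a b h + 2 * (\<Omega> p)\<^sup>2 *
       ((grad u \<Omega> p \<bullet> a) * (b \<bullet> (g u x *v h)) + (grad u \<Omega> p \<bullet> b) * (a \<bullet> (g u x *v h))
        - (grad u \<Omega> p \<bullet> h) * (a \<bullet> (g u x *v b)))
    = (hess x b a \<bullet> (?M' *v (J *v h)) + (J *v b) \<bullet> (frechet_derivative (g' v) (at (coord v p)) (J *v a) *v (J *v h))
      + (J *v b) \<bullet> (?M' *v hess x h a))
     + (hess x a b \<bullet> (?M' *v (J *v h)) + (J *v a) \<bullet> (frechet_derivative (g' v) (at (coord v p)) (J *v b) *v (J *v h))
      + (J *v a) \<bullet> (?M' *v hess x h b))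
     - (hess x a h \<bullet> (?M' *v (J *v b)) + (J *v a) \<bullet> (frechet_derivative (g' v) (at (coord v p)) (J *v h) *v (J *v b))
      + (J *v a) \<bullet> (?M' *v hess x b h))"
    unfolding E[symmetric] kos_def by (simp add: algebra_simps)
  then show ?thesis
    unfolding kos_def using hs[of b a] hs[of h a] hs[of h b] s[of "J *v b" "hess x a h"] by simp
qed

text \<open>Makes the facts about the Jacobian from \<open>u\<close> to \<open>v\<close> available
  for its inverse.\<close>

lemma reverse: "\<exists>\<Omega>'. slice_change A c g' g \<Omega>' d S v u K' K"
proof -
  obtain \<Omega>' where "rescaling A \<Omega>' g' g" using rescaling_exists[OF g(2,1)] by blast
  then have "slice_change A c g' g \<Omega>' d S v u K' K"
    by unfold_locales (use g slice d in auto)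
  then show ?thesis by blast
qed

lemma jac_tangential_image:
  assumes p: "p \<in> dom_of u \<inter> dom_of v \<inter> S" and y: "\<forall>k\<in>K. y $ k = 0" and k: "k \<in> K'"
  shows "(jac u v p *v y) $ k = 0"
proof -
  have "jac u v p $ k $ i * y $ i = 0" for i
    using jac_normal_tangential[OF p _ k, of i] y by (cases "i \<in> K") auto
  then show ?thesis unfolding matrix_vector_mult_def by (simp only: vec_lambda_beta) simp
qed

text \<open>The Jacobian is block triangular along \<open>S\<close>. \<open>R\<close> is the first
  inverse tangential metric, pushed forward; its product with the second tangential metric is
  \<open>\<Omega>\<^sup>2\<close> times the identity, which determines it.\<close>

lemma tangential_metric_change:
  assumes p: "p \<in> dom_of u \<inter> dom_of v \<inter> S" and ab: "a \<notin> K'" "b \<notin> K'"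
  shows "(\<Sum>i\<in>-K. \<Sum>j\<in>-K. matrix_inv (tangential_block K (g u (coord u p))) $ i $ j *
        (jac u v p $ a $ i * jac u v p $ b $ j))
    = (\<Omega> p)\<^sup>2 * matrix_inv (tangential_block K' (g' v (coord v p))) $ a $ b"
proof -
  let ?M = "g u (coord u p)" and ?M' = "g' v (coord v p)" and ?J = "jac u v p" and ?I = "jac v u p"
  let ?\<gamma> = "matrix_inv (tangential_block K ?M)" and ?\<gamma>' = "matrix_inv (tangential_block K' ?M')"
  have M: "posdef ?M" "posdef ?M'" using metric_posdef g charts p by auto
  obtain \<Omega>' where "slice_change A c g' g \<Omega>' d S v u K' K" using reverse by blast
  then interpret rev: slice_change A c g' g \<Omega>' d S v u K' K .
  define R where "R a b = (\<Sum>i\<in>-K. \<Sum>j\<in>-K. ?\<gamma> $ i $ j * (?J $ a $ i * ?J $ b $ j))" for a b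
  have GJ: "(?J *v y) \<bullet> (?M' *v (?J *v z)) = (\<Omega> p)\<^sup>2 * (y \<bullet> (?M *v z))" for y z
  proof -
    have "y \<bullet> (((\<Omega> p)\<^sup>2 *\<^sub>R ?M) *v z) = (?J *v y) \<bullet> (?M' *v (?J *v z))"
      unfolding rescaled_metric_change[OF g(2,3) charts, of p, OF IntD1[OF IntD1[OF p]] IntD2[OF IntD1[OF p]]]
      by (simp add: matrix_vector_mul_assoc[symmetric] inner_matrix_transpose[of y]
          del: transpose_matrix_vector)
    then show ?thesis by (simp add: scaleR_matrix_vector_assoc[symmetric])
  qed
  \<comment> \<open>Tangential columns of the Jacobian have no normal entries, so the sum over all
    indices reduces to the tangential ones.\<close>
  have tang: "(\<Sum>b\<in>-K'. ?J $ b $ j * (?M' *v (?J *v z)) $ b) = (\<Omega> p)\<^sup>2 * (?M *v z) $ j" if "j \<notin> K" for j z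
  proof -
    have "(?J *v axis j 1) \<bullet> (?M' *v (?J *v z)) = (\<Sum>b\<in>UNIV. ?J $ b $ j * (?M' *v (?J *v z)) $ b)"
      by (simp add: inner_vec_def matrix_vector_mult_basis column_def)
    also have "\<dots> = (\<Sum>b\<in>-K'. ?J $ b $ j * (?M' *v (?J *v z)) $ b)"
      by (rule sum.mono_neutral_right) (use jac_normal_tangential[OF p that] in auto)
    finally show ?thesis using GJ[of "axis j 1" z] by (simp add: inner_axis')
  qed
  have step: "(\<Sum>b\<in>-K'. R a b * (?M' *v (?J *v axis l 1)) $ b) = (\<Omega> p)\<^sup>2 * ?J $ a $ l" if l: "l \<notin> K" for l
  proof -
    have "(\<Sum>b\<in>-K'. R a b * (?M' *v (?J *v axis l 1)) $ b)
        = (\<Sum>b\<in>-K'. \<Sum>i\<in>-K. \<Sum>j\<in>-K. ?\<gamma> $ i $ j * ?J $ a $ i * (?J $ b $ j * (?M' *v (?J *v axis l 1)) $ b))"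
      unfolding R_def sum_distrib_right by (simp add: mult_ac)
    also have "\<dots> = (\<Sum>i\<in>-K. \<Sum>j\<in>-K. ?\<gamma> $ i $ j * ?J $ a $ i * (\<Sum>b\<in>-K'. ?J $ b $ j * (?M' *v (?J *v axis l 1)) $ b))"
    proof -
      have "(\<Sum>b\<in>-K'. \<Sum>i\<in>-K. \<Sum>j\<in>-K. f b i j) = (\<Sum>i\<in>-K. \<Sum>j\<in>-K. \<Sum>b\<in>-K'. f b i j)"
        for f :: "'n \<Rightarrow> 'n \<Rightarrow> 'n \<Rightarrow> real"
        by (rule trans[OF sum.swap sum.cong[OF refl sum.swap]])
      then show ?thesis unfolding sum_distrib_left .
    qed
    also have "\<dots> = (\<Sum>i\<in>-K. \<Sum>j\<in>-K. ?\<gamma> $ i $ j * ?J $ a $ i * ((\<Omega> p)\<^sup>2 * ?M $ j $ l))"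
      by (intro sum.cong refl) (simp add: tang, simp add: matrix_vector_mult_basis column_def)
    also have "\<dots> = (\<Sum>i\<in>-K. (\<Omega> p)\<^sup>2 * ?J $ a $ i * (\<Sum>j\<in>-K. ?\<gamma> $ i $ j * ?M $ j $ l))"
      by (simp add: sum_distrib_left mult_ac)
    also have "\<dots> = (\<Sum>i\<in>-K. if i = l then (\<Omega> p)\<^sup>2 * ?J $ a $ i else 0)"
      by (intro sum.cong refl) (simp add: tangential_inverse(1)[OF M(1)] l)
    also have "\<dots> = (\<Omega> p)\<^sup>2 * ?J $ a $ l" using l by simp
    finally show ?thesis .
  qed
  have step2: "(\<Sum>b\<in>-K'. R a b * ?M' $ b $ e) = (if a = e then (\<Omega> p)\<^sup>2 else 0)" if e: "e \<notin> K'" for e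
  proof -
    \<comment> \<open>The preimage of the \<open>e\<close>-th direction of the second chart. It is
      tangential, so it involves only the columns treated in \<open>step\<close>.\<close>
    define y where "y = ?I *v axis e 1"
    have yK: "y $ k = 0" if "k \<in> K" for k
      unfolding y_def by (rule rev.jac_tangential_image) (use p that e in \<open>auto simp: axis_def\<close>)
    have Jy: "?J *v y = axis e 1"
      using jac_inverse[of v u p] charts p by (simp add: y_def matrix_vector_mul_assoc)
    have lin: "linear (\<lambda>y. \<Sum>b\<in>-K'. R a b * (?M' *v (?J *v y)) $ b)"
      by (rule linearI) (simp_all add: matrix_vector_right_distrib matrix_vector_mult_scaleR
          distrib_left sum.distrib sum_distrib_left mult.left_commute)
    have "(\<Sum>b\<in>-K'. R a b * (?M' *v (?J *v (\<Sum>l\<in>UNIV. y $ l *\<^sub>R axis l 1))) $ b)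
        = (\<Sum>l\<in>UNIV. y $ l * (\<Sum>b\<in>-K'. R a b * (?M' *v (?J *v axis l 1)) $ b))"
      by (simp only: linear_sum[OF lin] linear_scale[OF lin] real_scaleR_def)
    also have "\<dots> = (\<Sum>l\<in>UNIV. y $ l * ((\<Omega> p)\<^sup>2 * ?J $ a $ l))"
    proof (intro sum.cong refl)
      fix l show "y $ l * (\<Sum>b\<in>-K'. R a b * (?M' *v (?J *v axis l 1)) $ b) = y $ l * ((\<Omega> p)\<^sup>2 * ?J $ a $ l)"
        by (cases "l \<in> K") (simp_all add: yK step)
    qed
    also have "\<dots> = (\<Omega> p)\<^sup>2 * (?J *v y) $ a"
      by (simp add: matrix_vector_mult_def sum_distrib_left mult_ac)
    finally have "(\<Sum>b\<in>-K'. R a b * (?M' *v axis e 1) $ b) = (\<Omega> p)\<^sup>2 * axis e 1 $ a"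
      using Jy vec_expand[of y] by simp
    then show ?thesis by (simp add: matrix_vector_mult_basis column_def) (simp add: axis_def)
  qed
  have "R a b = (\<Sum>b'\<in>-K'. R a b' * (if b' = b then 1 else 0))"
    using ab(2) by (simp add: if_distrib[of "\<lambda>x. _ * x"] cong: if_cong)
  also have "\<dots> = (\<Sum>b'\<in>-K'. R a b' * (\<Sum>e\<in>-K'. ?M' $ b' $ e * ?\<gamma>' $ e $ b))"
    by (intro sum.cong refl) (simp add: tangential_inverse(2)[OF M(2)] ab)
  also have "\<dots> = (\<Sum>e\<in>-K'. (\<Sum>b'\<in>-K'. R a b' * ?M' $ b' $ e) * ?\<gamma>' $ e $ b)"
    unfolding sum_distrib_left sum_distrib_right by (subst sum.swap) (simp add: mult_ac)
  also have "\<dots> = (\<Sum>e\<in>-K'. if a = e then (\<Omega> p)\<^sup>2 * ?\<gamma>' $ e $ b else 0)"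
    by (intro sum.cong refl) (simp add: step2)
  also have "\<dots> = (\<Omega> p)\<^sup>2 * ?\<gamma>' $ a $ b" using ab by simp
  finally show ?thesis unfolding R_def .
qed

text \<open>Trace the Koszul identity over tangential directions: the Hessian is tangential, the
  products of tangential directions with \<open>n\<close> vanish, and the remaining gradient term
  carries the trace of the metric, which cancels the \<open>1/m\<close> in the mean
  curvature.\<close>

lemma ncurv_change:
  assumes p: "p \<in> dom_of u \<inter> dom_of v \<inter> S" and n: "n \<in> normal_space (g u (coord u p)) K"
  shows "ncurv (g' v) K' (coord v p) (jac u v p *v n) = ncurv (g u) K (coord u p) n - grad u \<Omega> p \<bullet> n"
proof -
  let ?M = "g u (coord u p)" and ?M' = "g' v (coord v p)" and ?J = "jac u v p"
  let ?\<gamma> = "matrix_inv (tangential_block K ?M)" and ?\<gamma>' = "matrix_inv (tangential_block K' ?M')"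
  let ?kos = "kos (g u) (coord u p)" and ?kos' = "kos (g' v) (coord v p)"
  let ?m = "real (CARD('n) - d)"
  have pp: "p \<in> dom_of u" "p \<in> dom_of v" using p by auto
  have M: "posdef ?M" "posdef ?M'" using metric_posdef g charts p by auto
  have D': "(g' v has_derivative frechet_derivative (g' v) (at (coord v p))) (at (coord v p))"
    by (rule metric_derivative[OF g(2) charts(2) pp(2)])
  obtain \<Omega>' where "slice_change A c g' g \<Omega>' d S v u K' K" using reverse by blast
  then interpret rev: slice_change A c g' g \<Omega>' d S v u K' K .
  have nz: "(\<Omega> p)\<^sup>2 \<noteq> 0" using rescaling_pos[OF g(3), of p] by simp
  have m: "?m > 0" using d by simp
  \<comment> \<open>Clears the factors 1/2 and \<open>1/m\<close> of the mean curvature, so that the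
    traces can be compared.\<close>
  have "2 * r * (inverse r * (1 / 2 * Z)) = Z" if "r > 0" for r Z :: real using that by simp
  note mm = this[OF m]
  have card: "card K = d" "card K' = d" using slice by (auto simp: slice_chart_def)
  have GJ: "(?J *v y) \<bullet> (?M' *v (?J *v z)) = (\<Omega> p)\<^sup>2 * (y \<bullet> (?M *v z))" for y z
  proof -
    have "y \<bullet> (((\<Omega> p)\<^sup>2 *\<^sub>R ?M) *v z) = (?J *v y) \<bullet> (?M' *v (?J *v z))"
      unfolding rescaled_metric_change[OF g(2,3) charts pp]
      by (simp add: matrix_vector_mul_assoc[symmetric] inner_matrix_transpose[of y]
          del: transpose_matrix_vector)
    then show ?thesis by (simp add: scaleR_matrix_vector_assoc[symmetric])
  qed
  have Jn: "y \<bullet> (?M' *v (?J *v n)) = 0" if y: "\<forall>k\<in>K'. y $ k = 0" for y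
  proof -
    have "?J *v (jac v u p *v y) = y" using jac_inverse[of v u p] charts pp by (simp add: matrix_vector_mul_assoc)
    then have "y \<bullet> (?M' *v (?J *v n)) = (\<Omega> p)\<^sup>2 * ((jac v u p *v y) \<bullet> (?M *v n))"
      using GJ[of "jac v u p *v y" n] by simp
    moreover have "\<forall>k\<in>K. (jac v u p *v y) $ k = 0" using rev.jac_tangential_image[OF _ y] p by auto
    ultimately show ?thesis using n by (simp add: normal_space_def)
  qed
  have key: "?kos' (?J *v axis i 1) (?J *v axis j 1) (?J *v n)
      = (\<Omega> p)\<^sup>2 * (?kos (axis i 1) (axis j 1) n - 2 * (grad u \<Omega> p \<bullet> n) * ?M $ i $ j)" if "i \<notin> K" "j \<notin> K" for i j
  proof -
    have "axis l 1 \<bullet> (?M *v n) = 0" if "l \<notin> K" for l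
      using n that by (simp add: normal_space_iff inner_axis')
    moreover have "hess (coord u p) (axis i 1) (axis j 1) \<bullet> (?M' *v (?J *v n)) = 0"
      by (rule Jn) (use hess_tangential[OF p that] in auto)
    ultimately show ?thesis
      using kos_change[OF pp, of "axis i 1" "axis j 1" n] that by (simp add: inner_axis_matrix algebra_simps)
  qed
  have exp: "?kos' (?J *v axis i 1) (?J *v axis j 1) z
      = (\<Sum>a\<in>-K'. \<Sum>b\<in>-K'. ?J $ a $ i * ?J $ b $ j * ?kos' (axis a 1) (axis b 1) z)" if "i \<notin> K" "j \<notin> K" for i j z
  proof -
    have col: "?J *v axis l 1 = (\<Sum>a\<in>-K'. ?J $ a $ l *\<^sub>R axis a 1)" if "l \<notin> K" for l
    proof -
      have "?J *v axis l 1 = (\<Sum>a\<in>UNIV. ?J $ a $ l *\<^sub>R axis a 1)"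
        by (subst vec_expand) (simp add: matrix_vector_mult_basis column_def)
      also have "\<dots> = (\<Sum>a\<in>-K'. ?J $ a $ l *\<^sub>R axis a 1)"
        by (rule sum.mono_neutral_right) (use jac_normal_tangential[OF p that] in auto)
      finally show ?thesis .
    qed
    have e1: "?kos' (?J *v axis i 1) Y z = (\<Sum>a\<in>-K'. ?J $ a $ i * ?kos' (axis a 1) Y z)" for Y
      unfolding col[OF that(1)]
      by (simp only: linear_sum[OF kos_linear(2)[OF D']] linear_scale[OF kos_linear(2)[OF D']] real_scaleR_def)
    have e2: "?kos' X (?J *v axis j 1) z = (\<Sum>b\<in>-K'. ?J $ b $ j * ?kos' X (axis b 1) z)" for X
      unfolding col[OF that(2)]
      by (simp only: linear_sum[OF kos_linear(3)[OF D']] linear_scale[OF kos_linear(3)[OF D']] real_scaleR_def)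
    have "?kos' (?J *v axis i 1) (?J *v axis j 1) z = (\<Sum>a\<in>-K'. ?J $ a $ i * ?kos' (axis a 1) (?J *v axis j 1) z)"
      by (rule e1)
    also have "\<dots> = (\<Sum>a\<in>-K'. \<Sum>b\<in>-K'. ?J $ a $ i * ?J $ b $ j * ?kos' (axis a 1) (axis b 1) z)"
      by (simp only: e2 sum_distrib_left mult.assoc)
    finally show ?thesis .
  qed
  have "(\<Sum>i\<in>-K. \<Sum>j\<in>-K. ?\<gamma> $ i $ j * ?kos' (?J *v axis i 1) (?J *v axis j 1) (?J *v n))
     = (\<Sum>i\<in>-K. \<Sum>j\<in>-K. \<Sum>a\<in>-K'. \<Sum>b\<in>-K'. ?\<gamma> $ i $ j * (?J $ a $ i * ?J $ b $ j) * ?kos' (axis a 1) (axis b 1) (?J *v n))"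
    by (intro sum.cong refl) (simp add: exp sum_distrib_left mult_ac)
  also have "\<dots> = (\<Sum>a\<in>-K'. \<Sum>b\<in>-K'. \<Sum>i\<in>-K. \<Sum>j\<in>-K. ?\<gamma> $ i $ j * (?J $ a $ i * ?J $ b $ j) * ?kos' (axis a 1) (axis b 1) (?J *v n))"
  proof -
    have "(\<Sum>i\<in>-K. \<Sum>j\<in>-K. \<Sum>a\<in>-K'. \<Sum>b\<in>-K'. f i j a b) = (\<Sum>a\<in>-K'. \<Sum>b\<in>-K'. \<Sum>i\<in>-K. \<Sum>j\<in>-K. f i j a b)"
      for f :: "'n \<Rightarrow> 'n \<Rightarrow> 'n \<Rightarrow> 'n \<Rightarrow> real"
    proof -
      have "(\<Sum>i\<in>-K. \<Sum>j\<in>-K. \<Sum>a\<in>-K'. \<Sum>b\<in>-K'. f i j a b) = (\<Sum>i\<in>-K. \<Sum>a\<in>-K'. \<Sum>j\<in>-K. \<Sum>b\<in>-K'. f i j a b)"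
        by (rule sum.cong[OF refl sum.swap])
      also have "\<dots> = (\<Sum>a\<in>-K'. \<Sum>i\<in>-K. \<Sum>j\<in>-K. \<Sum>b\<in>-K'. f i j a b)" by (rule sum.swap)
      also have "\<dots> = (\<Sum>a\<in>-K'. \<Sum>i\<in>-K. \<Sum>b\<in>-K'. \<Sum>j\<in>-K. f i j a b)"
        by (rule sum.cong[OF refl sum.cong[OF refl sum.swap]])
      also have "\<dots> = (\<Sum>a\<in>-K'. \<Sum>b\<in>-K'. \<Sum>i\<in>-K. \<Sum>j\<in>-K. f i j a b)"
        by (rule sum.cong[OF refl sum.swap])
      finally show ?thesis .
    qed
    then show ?thesis .
  qed
  also have "\<dots> = (\<Sum>a\<in>-K'. \<Sum>b\<in>-K'. (\<Omega> p)\<^sup>2 * ?\<gamma>' $ a $ b * ?kos' (axis a 1) (axis b 1) (?J *v n))"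
    unfolding sum_distrib_right[symmetric]
    by (intro sum.cong refl arg_cong2[where f = "(*)"] tangential_metric_change[OF p]) auto
  also have "\<dots> = (\<Omega> p)\<^sup>2 * (2 * ?m * ncurv (g' v) K' (coord v p) (?J *v n))"
    unfolding ncurv_def card mm by (simp only: sum_distrib_left mult.assoc)
  finally have R: "(\<Sum>i\<in>-K. \<Sum>j\<in>-K. ?\<gamma> $ i $ j * ?kos' (?J *v axis i 1) (?J *v axis j 1) (?J *v n))
      = (\<Omega> p)\<^sup>2 * (2 * ?m * ncurv (g' v) K' (coord v p) (?J *v n))" .
  \<comment> \<open>The same trace, now evaluated in the first chart by \<open>key\<close>.\<close>
  have "(\<Sum>i\<in>-K. \<Sum>j\<in>-K. ?\<gamma> $ i $ j * ?kos' (?J *v axis i 1) (?J *v axis j 1) (?J *v n))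
      = (\<Sum>i\<in>-K. \<Sum>j\<in>-K. ?\<gamma> $ i $ j * ((\<Omega> p)\<^sup>2 * (?kos (axis i 1) (axis j 1) n - 2 * (grad u \<Omega> p \<bullet> n) * ?M $ i $ j)))"
    by (intro sum.cong refl) (simp add: key)
  also have "\<dots> = (\<Omega> p)\<^sup>2 * ((\<Sum>i\<in>-K. \<Sum>j\<in>-K. ?\<gamma> $ i $ j * ?kos (axis i 1) (axis j 1) n)
       - 2 * (grad u \<Omega> p \<bullet> n) * (\<Sum>i\<in>-K. \<Sum>j\<in>-K. ?\<gamma> $ i $ j * ?M $ i $ j))"
    by (simp add: right_diff_distrib sum_subtractf sum_distrib_left mult_ac)
  also have "\<dots> = (\<Omega> p)\<^sup>2 * (2 * ?m * ncurv (g u) K (coord u p) n - 2 * (grad u \<Omega> p \<bullet> n) * ?m)"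
    unfolding trace_tangential[OF M(1)] ncurv_def card mm ..
  finally have "(\<Omega> p)\<^sup>2 * (2 * ?m * ncurv (g' v) K' (coord v p) (?J *v n))
      = (\<Omega> p)\<^sup>2 * (2 * ?m * (ncurv (g u) K (coord u p) n - grad u \<Omega> p \<bullet> n))"
    using R by (simp add: algebra_simps)
  then show ?thesis using nz m by simp
qed

text \<open>The shift of the middle slot by \<sigma>\<Upsilon> and the shift of the mean curvature
  by -\<Upsilon> cancel. What remains is a Jacobian acting on normal indices, so the common kernel
  of the functionals is independent of scale and chart.\<close>

lemma wcomp_change:
  assumes p: "p \<in> dom_of u \<inter> dom_of v \<inter> S" and k: "k \<in> K'"
  shows "wcomp (g' v) K' (coord v p) k (tractor_change g u \<Omega> v p V)
    = inverse (\<Omega> p) * (\<Sum>l\<in>K. jac u v p $ k $ l * wcomp (g u) K (coord u p) l V)"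
proof -
  let ?M = "g u (coord u p)" and ?M' = "g' v (coord v p)" and ?J = "jac u v p" and ?I = "jac v u p"
  let ?T = "transpose :: real^'n^'n \<Rightarrow> real^'n^'n"
  have pp: "p \<in> dom_of u" "p \<in> dom_of v" using p by auto
  have M: "posdef ?M" "posdef ?M'" using metric_posdef g charts p by auto
  have nz: "\<Omega> p \<noteq> 0" using rescaling_pos[OF g(3), of p] by simp
  \<comment> \<open>The \<open>k\<close>-th coordinate covector of the second chart, pulled back and
    weighted; \<open>n\<close> is its metric dual in the first scale.\<close>
  define \<xi> where "\<xi> = inverse ((\<Omega> p)\<^sup>2) *\<^sub>R (?T ?J *v axis k 1)"
  define n where "n = matrix_inv ?M *v \<xi>"
  have \<xi>l: "\<xi> $ l = inverse ((\<Omega> p)\<^sup>2) * ?J $ k $ l" for l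
    by (simp add: \<xi>_def matrix_vector_mult_basis column_def transpose_def)
  have \<xi>0: "\<xi> $ l = 0" if "l \<notin> K" for l
    using jac_normal_tangential[OF p that k] by (simp add: \<xi>l)
  have Mn: "?M *v n = \<xi>"
    unfolding n_def by (simp add: matrix_vector_mul_assoc matrix_inv_inverse[OF posdef_det_nonzero[OF M(1)]])
  have n: "n \<in> normal_space ?M K" using \<xi>0 by (simp add: normal_space_iff Mn)
  have Jn: "?J *v n = matrix_inv ?M' *v axis k 1"
    unfolding n_def \<xi>_def rescaled_metric_inv[OF g charts pp]
    by (simp add: matrix_vector_mul_assoc[symmetric] matrix_vector_mult_scaleR scaleR_matrix_vector_assoc[symmetric])
  have H: "mcurv (g' v) K' (coord v p) $ k = \<xi> \<bullet> mcurv (g u) K (coord u p) - grad u \<Omega> p \<bullet> n"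
  proof -
    have "mcurv (g' v) K' (coord v p) $ k = axis k 1 \<bullet> mcurv (g' v) K' (coord v p)" by (simp add: inner_axis')
    also have "\<dots> = ncurv (g' v) K' (coord v p) (?J *v n)"
      unfolding Jn by (rule ncurv_dual[OF M(2) metric_derivative[OF g(2) charts(2) pp(2)], symmetric])
    also have "\<dots> = ncurv (g u) K (coord u p) n - grad u \<Omega> p \<bullet> n" by (rule ncurv_change[OF p n])
    also have "ncurv (g u) K (coord u p) n = \<xi> \<bullet> mcurv (g u) K (coord u p)"
      unfolding n_def by (rule ncurv_dual[OF M(1) metric_derivative[OF g(1) charts(1) pp(1)]])
    finally show ?thesis .
  qed
  have sym: "a \<bullet> (matrix_inv ?M *v b) = b \<bullet> (matrix_inv ?M *v a)" for a b
    by (rule inv_metric_sym[OF g(1) charts(1) pp(1)])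
  obtain s m r where V: "V = (s, m, r)" by (cases V) auto
  have TT: "?T ?J *v (?T ?I *v z) = z" for z
    using jac_transpose_inverse[of v u p] charts pp
    by (simp add: matrix_vector_mul_assoc del: transpose_matrix_vector)
  have "(matrix_inv ?M' *v (?T ?I *v (\<Omega> p *\<^sub>R (m + s *\<^sub>R grad u \<Omega> p)))) $ k
      = axis k 1 \<bullet> (matrix_inv ?M' *v (?T ?I *v (\<Omega> p *\<^sub>R (m + s *\<^sub>R grad u \<Omega> p))))"
    by (simp add: inner_axis')
  also have "\<dots> = \<xi> \<bullet> (matrix_inv ?M *v (\<Omega> p *\<^sub>R (m + s *\<^sub>R grad u \<Omega> p)))"
    unfolding rescaled_inner_inv[OF g charts pp] TT \<xi>_def by simp
  also have "\<dots> = \<Omega> p * (\<xi> \<bullet> (matrix_inv ?M *v m) + s * (\<xi> \<bullet> (matrix_inv ?M *v grad u \<Omega> p)))"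
    by (simp add: matrix_vector_mult_scaleR matrix_vector_right_distrib inner_add_right)
  also have "\<xi> \<bullet> (matrix_inv ?M *v grad u \<Omega> p) = grad u \<Omega> p \<bullet> n" unfolding n_def by (rule sym)
  finally have "wcomp (g' v) K' (coord v p) k (tractor_change g u \<Omega> v p V)
     = \<Omega> p * (s * (\<xi> \<bullet> mcurv (g u) K (coord u p)) + \<xi> \<bullet> (matrix_inv ?M *v m))"
    by (simp add: wcomp_def tractor_change_eq tchange_def V H algebra_simps)
  also have "s * (\<xi> \<bullet> mcurv (g u) K (coord u p)) + \<xi> \<bullet> (matrix_inv ?M *v m) = (\<Sum>l\<in>K. \<xi> $ l * wcomp (g u) K (coord u p) l V)"
  proof -
    have in_sum: "\<xi> \<bullet> y = (\<Sum>l\<in>K. \<xi> $ l * y $ l)" for y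
      unfolding inner_vec_def inner_real_def by (rule sum.mono_neutral_right) (use \<xi>0 in auto)
    show ?thesis
      unfolding in_sum by (simp add: wcomp_def V sum_distrib_left sum.distrib[symmetric] algebra_simps)
  qed
  also have "\<Omega> p * \<dots> = inverse (\<Omega> p) * (\<Sum>l\<in>K. ?J $ k $ l * wcomp (g u) K (coord u p) l V)"
  proof -
    have "\<Omega> p * inverse ((\<Omega> p)\<^sup>2) = inverse (\<Omega> p)" using nz by (simp add: power2_eq_square)
    then show ?thesis unfolding \<xi>l sum_distrib_left by (simp add: mult.assoc[symmetric])
  qed
  finally show ?thesis .
qed

end

section \<open>The derivative of the determinant\<close>

text \<open>Kept abstract; its values are read off from explicit curves such as
  \<open>(1 + t B) M\<close>.\<close>

definition ddet :: "real^'n^'n \<Rightarrow> real^'n^'n \<Rightarrow> real" where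
  "ddet M = frechet_derivative det (at M)"

lemma det_has_derivative: "(det has_derivative ddet M) (at (M :: real^'n^'n))"
proof -
  have "smooth_on UNIV (\<lambda>M. det (M :: real^'n^'n))" by (intro smooth open_UNIV)
  then show ?thesis unfolding ddet_def using smooth_on_has_derivative by blast
qed

lemma linear_ddet: "linear (ddet M)"
  by (rule has_derivative_linear[OF det_has_derivative])

lemma has_vector_derivative_det:
  fixes M :: "real \<Rightarrow> real^'n^'n"
  assumes "(M has_vector_derivative N) (at t)"
  shows "((\<lambda>t. det (M t)) has_vector_derivative ddet (M t) N) (at t)"
  using has_derivative_compose[OF assms[unfolded has_vector_derivative_def] det_has_derivative]
  by (simp add: has_vector_derivative_def linear_scale[OF linear_ddet])

lemma ddet_curve:
  fixes M :: "real \<Rightarrow> real^'n^'n"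
  assumes "(M has_vector_derivative N) (at t)" "((\<lambda>t. det (M t)) has_vector_derivative D) (at t)"
  shows "ddet (M t) N = D"
  by (rule vector_derivative_unique_at[OF has_vector_derivative_det[OF assms(1)] assms(2)])

lemma matrix_mult_add:
  fixes A B :: "real^'n^'m" and M N :: "real^'k^'n"
  shows "(A + B) ** M = A ** M + B ** M" "A ** (M + N) = A ** M + A ** N"
  by (simp_all add: matrix_matrix_mult_def vec_eq_iff distrib_left distrib_right sum.distrib)

lemma ddet_mult_left: "ddet M (B ** M) = ddet (mat 1) B * det M"
proof -
  have 1: "((\<lambda>t. mat 1 + t *\<^sub>R B) has_vector_derivative B) (at 0)"
    by (auto intro!: derivative_eq_intros)
  have 2: "((\<lambda>t. M + t *\<^sub>R (B ** M)) has_vector_derivative B ** M) (at 0)"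
    by (auto intro!: derivative_eq_intros)
  have "((\<lambda>t. det (mat 1 + t *\<^sub>R B) * det M) has_vector_derivative ddet (mat 1 + 0 *\<^sub>R B) B * det M) (at 0)"
    by (rule has_vector_derivative_mult_left[OF has_vector_derivative_det[OF 1]])
  moreover have "det (mat 1 + t *\<^sub>R B) * det M = det (M + t *\<^sub>R (B ** M))" for t
    by (simp add: det_mul[symmetric] matrix_mult_add scaleR_matrix_mult)
  ultimately show ?thesis using ddet_curve[OF 2] by simp
qed

lemma ddet_mult_right: "ddet M (M ** B) = ddet (mat 1) B * det M"
proof -
  have 1: "((\<lambda>t. mat 1 + t *\<^sub>R B) has_vector_derivative B) (at 0)"
    by (auto intro!: derivative_eq_intros)
  have 2: "((\<lambda>t. M + t *\<^sub>R (M ** B)) has_vector_derivative M ** B) (at 0)"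
    by (auto intro!: derivative_eq_intros)
  have "((\<lambda>t. det (mat 1 + t *\<^sub>R B) * det M) has_vector_derivative ddet (mat 1 + 0 *\<^sub>R B) B * det M) (at 0)"
    by (rule has_vector_derivative_mult_left[OF has_vector_derivative_det[OF 1]])
  moreover have "det (mat 1 + t *\<^sub>R B) * det M = det (M + t *\<^sub>R (M ** B))" for t
    by (simp add: mult.commute[of _ "det M"] det_mul[symmetric] matrix_mult_add scaleR_matrix_mult)
  ultimately show ?thesis using ddet_curve[OF 2] by simp
qed

text \<open>When only one row moves, the determinant is affine in \<open>t\<close>.\<close>

lemma ddet_row: "ddet M (\<chi> i. if i = l then r else 0) = det (\<chi> i. if i = l then r else M $ i)"
proof -
  let ?E = "\<chi> i. if i = l then r else 0"
  have 1: "((\<lambda>t. M + t *\<^sub>R ?E) has_vector_derivative ?E) (at 0)"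
    by (auto intro!: derivative_eq_intros)
  have "det (M + t *\<^sub>R ?E) = det M + t * det (\<chi> i. if i = l then r else M $ i)" for t
  proof -
    have "M + t *\<^sub>R ?E = (\<chi> i. if i = l then M $ l + t *s r else M $ i)"
      by (simp add: vec_eq_iff)
    then have "det (M + t *\<^sub>R ?E) = det (\<chi> i. if i = l then M $ l else M $ i)
        + det (\<chi> i. if i = l then t *s r else M $ i)"
      using det_row_add[of l "\<lambda>_. M $ l" "\<lambda>_. t *s r" "\<lambda>i. M $ i"] by simp
    moreover have "(\<chi> i. if i = l then M $ l else M $ i) = M" by (simp add: vec_eq_iff)
    ultimately show ?thesis using det_row_mul[of l t "\<lambda>_. r" "\<lambda>i. M $ i"] by simp
  qed
  moreover have "((\<lambda>t. det M + t * det (\<chi> i. if i = l then r else M $ i)) has_vector_derivative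
      det (\<chi> i. if i = l then r else M $ i)) (at 0)"
    by (auto intro!: derivative_eq_intros)
  ultimately show ?thesis using ddet_curve[OF 1] by simp
qed

lemma ddet_rows: "ddet M N = (\<Sum>l\<in>UNIV. det (\<chi> i. if i = l then N $ l else M $ i))"
proof -
  have "N = (\<Sum>l\<in>UNIV. \<chi> i. if i = l then N $ l else 0)"
    by (simp add: vec_eq_iff sum_component if_distrib[of "\<lambda>x. x $ _"] cong: if_cong)
  then have "ddet M N = (\<Sum>l\<in>UNIV. ddet M (\<chi> i. if i = l then N $ l else 0))"
    by (metis (no_types) linear_sum[OF linear_ddet])
  then show ?thesis by (simp add: ddet_row)
qed

lemma ddet_one: "ddet (mat 1) (B :: real^'n^'n) = (\<Sum>l\<in>UNIV. B $ l $ l)"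
  unfolding ddet_rows
proof (rule sum.cong[OF refl])
  fix l
  have r: "row i (mat 1 :: real^'n^'n) = axis i 1" for i
    by (simp add: row_def mat_def axis_def vec_eq_iff eq_commute)
  have "(\<Sum>i\<in>UNIV. B $ l $ i *s (row i (mat 1 :: real^'n^'n))) = B $ l"
    unfolding r by (rule basis_expansion)
  then show "det (\<chi> i. if i = l then B $ l else mat 1 $ i) = B $ l $ l"
    using cramer_lemma_transpose[of l "B $ l" "mat 1 :: real^'n^'n"]
    by (simp add: row_def cong: if_cong)
qed

section \<open>Metric compatibility\<close>

lemma has_derivative_symmetric:
  fixes G :: "real^'n::finite \<Rightarrow> real^'n^'n"
  assumes D: "(G has_derivative D) (at x)" and "open U" "x \<in> U" "\<And>y. y \<in> U \<Longrightarrow> posdef (G y)"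
  shows "D h $ a $ b = D h $ b $ a"
proof -
  have d: "((\<lambda>y. G y $ a $ b) has_derivative (\<lambda>h. D h $ a $ b)) (at x)" for a b
    by (intro bounded_linear.has_derivative[OF bounded_linear_vec_nth] D)
  have "((\<lambda>y. G y $ a $ b) has_derivative (\<lambda>h. D h $ b $ a)) (at x)"
    by (rule has_derivative_transform_within_open[OF d[of b a] assms(2,3)]) (rule posdef_sym[OF assms(4)])
  from fun_cong[OF has_derivative_unique[OF d[of a b] this]] show ?thesis .
qed

lemma christoffel_lower:
  fixes G :: "real^'n::finite \<Rightarrow> real^'n^'n"
  assumes M: "posdef (G x)" and D: "(G has_derivative frechet_derivative G (at x)) (at x)"
  shows "(\<Sum>k\<in>UNIV. christoffel G x i j $ k * G x $ k $ b) = (1/2) * kos G x (axis i 1) (axis j 1) (axis b 1)"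
proof -
  let ?n = "\<lambda>k. matrix_inv (G x) *v axis k 1"
  have "(\<Sum>k\<in>UNIV. G x $ k $ b *\<^sub>R ?n k) = matrix_inv (G x) *v (\<Sum>k\<in>UNIV. G x $ b $ k *\<^sub>R axis k 1)"
    by (simp add: linear_sum[OF matrix_vector_mul_linear] matrix_vector_mult_scaleR posdef_sym[OF M, of b])
  also have "\<dots> = matrix_inv (G x) *v (G x *v axis b 1)"
  proof -
    have "G x *v axis b 1 = G x $ b"
      using posdef_sym[OF M] by (simp add: matrix_vector_mult_basis column_def vec_eq_iff)
    then show ?thesis by (simp only: vec_expand[symmetric])
  qed
  also have "\<dots> = axis b 1"
    by (simp add: matrix_vector_mul_assoc matrix_inv_inverse[OF posdef_det_nonzero[OF M]])
  finally have n: "(\<Sum>k\<in>UNIV. G x $ k $ b *\<^sub>R ?n k) = axis b 1" .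
  have "kos G x (axis i 1) (axis j 1) (axis b 1) = (\<Sum>k\<in>UNIV. G x $ k $ b * kos G x (axis i 1) (axis j 1) (?n k))"
    unfolding n[symmetric]
    by (simp only: linear_sum[OF kos_linear(1)[OF D]] linear_scale[OF kos_linear(1)[OF D]] real_scaleR_def)
  then show ?thesis
    by (simp add: christoffel_kos[where G = G and x = x, OF M D] sum_distrib_left mult_ac)
qed

locale metric_germ =
  fixes G :: "real^'n::finite \<Rightarrow> real^'n^'n" and U :: "(real^'n) set" and x :: "real^'n"
  assumes U: "open U" "x \<in> U" and pd: "\<And>y. y \<in> U \<Longrightarrow> posdef (G y)" and smooth_G: "smooth_on U G"
begin

abbreviation "DG i \<equiv> frechet_derivative G (at x) (axis i 1)"

lemma der: "(G has_derivative frechet_derivative G (at x)) (at x)"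
  by (rule smooth_on_has_derivative[OF smooth_G U(2)])

lemma pdx: "posdef (G x)" by (rule pd[OF U(2)])

lemma nz: "det (G x) \<noteq> 0" by (rule posdef_det_nonzero[OF pdx])

lemma christoffel_sym: "christoffel G x i j = christoffel G x j i"
proof -
  have "kos G x (axis i 1) (axis j 1) n = kos G x (axis j 1) (axis i 1) n" for n
  proof -
    have "transpose (frechet_derivative G (at x) n) = frechet_derivative G (at x) n"
      by (simp add: vec_eq_iff transpose_def
          has_derivative_symmetric[where G = G, OF der U pd])
    then have "axis i 1 \<bullet> (frechet_derivative G (at x) n *v axis j 1) = axis j 1 \<bullet> (frechet_derivative G (at x) n *v axis i 1)"
      by (metis inner_commute inner_matrix_transpose)
    then show ?thesis by (simp add: kos_def)
  qed
  then show ?thesis by (simp add: vec_eq_iff christoffel_kos[where G = G and x = x, OF pdx der])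
qed

text \<open>In the sum of the two lowered Christoffel symbols, all terms of the Koszul formula
  cancel except the derivative along \<open>i\<close>.\<close>

lemma metric_compatible:
  "DG i $ a $ b = (\<Sum>k\<in>UNIV. christoffel G x i a $ k * G x $ k $ b) + (\<Sum>k\<in>UNIV. christoffel G x i b $ k * G x $ k $ a)"
  unfolding christoffel_lower[where G = G and x = x, OF pdx der]
  by (simp add: kos_def inner_axis_matrix has_derivative_symmetric[where G = G, OF der U pd, of _ a i]
      has_derivative_symmetric[where G = G, OF der U pd, of _ b a] has_derivative_symmetric[where G = G, OF der U pd, of _ b i])
     (simp add: field_simps)

text \<open>Rows carry the lower index, so this matrix acts on covectors and its transpose on
  vectors.\<close>

definition "\<Gamma>mat i = (\<chi> a k. christoffel G x i a $ k)"

lemma DG_eq: "DG i = \<Gamma>mat i ** G x + G x ** transpose (\<Gamma>mat i)"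
  by (simp add: vec_eq_iff metric_compatible \<Gamma>mat_def matrix_matrix_mult_def
      transpose_def posdef_sym[OF pdx] mult.commute)

lemma curve_derivative: "((\<lambda>t. G (x + t *\<^sub>R axis i 1)) has_vector_derivative DG i) (at 0)"
  by (rule has_derivative_imp_pdiff[OF der])

lemma det_derivative: "ddet (G x) (DG i) = 2 * (\<Sum>a\<in>UNIV. christoffel G x i a $ a) * det (G x)"
  unfolding DG_eq linear_add[OF linear_ddet] ddet_mult_left ddet_mult_right ddet_one
  by (simp add: \<Gamma>mat_def transpose_def)

lemma connection_form_eq:
  "connection_form G x i V = (- fst (snd V) $ i,
     - (\<Gamma>mat i *v fst (snd V)) + fst V *\<^sub>R schouten G x $ i + snd (snd V) *\<^sub>R G x $ i,
     - (schouten G x $ i \<bullet> (matrix_inv (G x) *v fst (snd V))))"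
  by (simp add: connection_form_def \<Gamma>mat_def matrix_vector_mult_def inner_vec_def vec_eq_iff mult_ac split: prod.split)

lemma linear_connection_form: "linear (connection_form G x i)"
  unfolding connection_form_eq[abs_def]
  by (rule linearI) (simp_all add: algebra_simps matrix_vector_right_distrib matrix_vector_mult_scaleR inner_add_right)

text \<open>The connection form maps the two outer slots off themselves, so only the middle slot has
  diagonal entries.\<close>

lemma trace_connection_form: "(\<Sum>b\<in>Basis. connection_form G x i b \<bullet> b) = - (\<Sum>a\<in>UNIV. christoffel G x i a $ a)"
proof -
  have B: "(\<Sum>b\<in>Basis. f b) = f (1, 0, 0) + (\<Sum>a\<in>UNIV. f (0, axis a 1, 0)) + f (0, 0, 1)" for f :: "'n tractor \<Rightarrow> real"
  proof -
    have "(\<Sum>b\<in>Basis. f b) = (\<Sum>b\<leftarrow>frame_list. f b)"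
      by (simp add: sum_list_distinct_conv_sum_set[OF distinct_frame_list] set_frame_list)
    also have "\<dots> = f (1, 0, 0) + (\<Sum>a\<leftarrow>index_list. f (0, axis a 1, 0)) + f (0, 0, 1)"
      by (simp add: frame_list_eq o_def)
    also have "(\<Sum>a\<leftarrow>index_list. f (0, axis a 1, 0)) = (\<Sum>a\<in>UNIV. f (0, axis a 1, 0))"
      by (simp add: sum_list_distinct_conv_sum_set[OF index_list(1)] index_list(2))
    finally show ?thesis .
  qed
  show ?thesis
    unfolding B by (simp add: connection_form_eq inner_axis' inner_prod_def inner_axis \<Gamma>mat_def
        matrix_vector_mult_basis column_def sum_negf)
qed

text \<open>The volume form is parallel: the logarithmic derivative of \<open>det g\<close> is twice
  the trace of the Christoffel symbols, and the derivation by the connection form multiplies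
  \<open>vol\<close> by minus that trace.\<close>

lemma volume_form_derivative:
  assumes "length Us = CARD('n) + 2"
  shows "((\<lambda>t. volume_form (G (x + t *\<^sub>R axis i 1)) Us) has_vector_derivative
     (\<Sum>j<CARD('n) + 2. volume_form (G x) (Us[j := connection_form G x i (Us ! j)]))) (at 0)"
proof -
  let ?tr = "\<Sum>a\<in>UNIV. christoffel G x i a $ a"
  have pos: "det (G x) > 0" by (rule posdef_det_pos[OF pdx])
  have "((\<lambda>t. det (G (x + t *\<^sub>R axis i 1))) has_vector_derivative ddet (G (x + 0 *\<^sub>R axis i 1)) (DG i)) (at 0)"
    by (rule has_vector_derivative_det[OF curve_derivative])
  then have d: "((\<lambda>t. det (G (x + t *\<^sub>R axis i 1))) has_real_derivative 2 * ?tr * det (G x)) (at 0)"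
    by (simp add: det_derivative has_real_derivative_iff_has_vector_derivative)
  have "((\<lambda>t. sqrt (det (G (x + t *\<^sub>R axis i 1)))) has_real_derivative
      inverse (sqrt (det (G x))) / 2 * (2 * ?tr * det (G x))) (at 0)"
    using DERIV_chain2[OF DERIV_real_sqrt[of "det (G (x + 0 *\<^sub>R axis i 1))"] d] pos by simp
  from DERIV_cmult_right[OF DERIV_inverse'[OF this], of "vol Us"] pos
  have "((\<lambda>t. inverse (sqrt (det (G (x + t *\<^sub>R axis i 1)))) * vol Us) has_real_derivative
      - (inverse (sqrt (det (G x))) * (inverse (sqrt (det (G x))) / 2 * (2 * ?tr * det (G x))) * inverse (sqrt (det (G x)))) * vol Us) (at 0)"
    by simp
  also have "- (inverse (sqrt (det (G x))) * (inverse (sqrt (det (G x))) / 2 * (2 * ?tr * det (G x))) * inverse (sqrt (det (G x)))) * vol Us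
     = inverse (sqrt (det (G x))) * (- ?tr * vol Us)"
  proof -
    have "inverse (sqrt (det (G x))) * inverse (sqrt (det (G x))) * det (G x) = 1"
      using pos by (simp add: field_simps)
    then show ?thesis by (simp add: algebra_simps)
  qed
  also have "- ?tr * vol Us = (\<Sum>j<CARD('n) + 2. vol (Us[j := connection_form G x i (Us ! j)]))"
    using vol_derivation[OF linear_connection_form assms] by (simp only: trace_connection_form)
  finally show ?thesis
    unfolding volume_form_eq sum_distrib_left has_real_derivative_iff_has_vector_derivative .
qed

lemma sharp_derivative:
  "((\<lambda>t. sharp (G (x + t *\<^sub>R axis i 1)) e) has_vector_derivative (0, DG i *v fst (snd e), 0)) (at 0)"
proof -
  have "bounded_linear (\<lambda>M :: real^'n^'n. M *v fst (snd e))"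
    unfolding linear_conv_bounded_linear[symmetric]
    by (rule linearI) (simp_all add: matrix_vector_mult_add_rdistrib scaleR_matrix_vector_assoc)
  from bounded_linear.has_vector_derivative[OF this curve_derivative]
  have "((\<lambda>t. (snd (snd e), G (x + t *\<^sub>R axis i 1) *v fst (snd e), fst e)) has_vector_derivative
     (0, DG i *v fst (snd e), 0)) (at 0)"
    by (intro has_vector_derivative_Pair has_vector_derivative_const)
  then show ?thesis by (simp add: sharp_def split_beta)
qed

text \<open>Parallelism of the inverse tractor metric on a pair of covectors. The Schouten terms and
  the metric terms cancel in pairs, and the middle block is metric compatibility; the extra summand
  is the derivative of \<open>sharp\<close>.\<close>

lemma inverse_metric_parallel:
  "a \<bullet> (connection_form G x i (sharp (G x) b) + (0, DG i *v fst (snd b), 0)) + b \<bullet> connection_form G x i (sharp (G x) a) = 0"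
proof -
  have inv: "matrix_inv (G x) *v (G x *v z) = z" for z
    by (simp add: matrix_vector_mul_assoc matrix_inv_inverse[OF nz])
  have row: "G x $ i \<bullet> z = (G x *v z) $ i" for z by (simp add: matrix_vector_mul_component)
  obtain a1 a2 a3 b1 b2 b3 where ab: "a = (a1, a2, a3)" "b = (b1, b2, b3)" by (cases a; cases b) auto
  have "b2 \<bullet> (\<Gamma>mat i *v (G x *v a2)) = a2 \<bullet> (G x *v (transpose (\<Gamma>mat i) *v b2))"
    using posdef_inner_commute[OF pdx, of a2 "transpose (\<Gamma>mat i) *v b2"]
    by (simp add: inner_matrix_transpose[of b2 "\<Gamma>mat i"] del: transpose_matrix_vector)
  then have "a2 \<bullet> (DG i *v b2) = a2 \<bullet> (\<Gamma>mat i *v (G x *v b2)) + b2 \<bullet> (\<Gamma>mat i *v (G x *v a2))"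
    unfolding DG_eq by (simp add: matrix_vector_mult_add_rdistrib inner_add_right matrix_vector_mul_assoc[symmetric]
        del: transpose_matrix_vector)
  then show ?thesis
    by (simp add: ab sharp_def connection_form_eq inv inner_add_right inner_diff_right inner_commute[of a2 "G x $ i"]
        inner_commute[of b2 "G x $ i"] row inner_commute[of a2 "schouten G x $ i"] inner_commute[of b2 "schouten G x $ i"])
qed

end

section \<open>Smooth functions on subsets\<close>

lemma smooth_on_subset_of_smooth_on:
  assumes "open U" "smooth_on U f" "B \<subseteq> U" shows "smooth_on_subset B f"
  unfolding smooth_on_subset_def using assms by blast

lemma smooth_on_subset_cong:
  assumes "\<And>y. y \<in> B \<Longrightarrow> f y = h y" "smooth_on_subset B f" shows "smooth_on_subset B h"
  using assms unfolding smooth_on_subset_def by simp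

lemma smooth_on_subset_combine:
  fixes B :: "'a::real_normed_vector set"
  assumes f: "smooth_on_subset B f" and h: "smooth_on_subset B h"
    and op: "\<And>(W :: 'a set) F H. open W \<Longrightarrow> smooth_on W F \<Longrightarrow> smooth_on W H \<Longrightarrow> smooth_on W (\<lambda>y. Op (F y) (H y))"
  shows "smooth_on_subset B (\<lambda>y. Op (f y) (h y))"
  unfolding smooth_on_subset_def
proof
  fix x assume x: "x \<in> B"
  obtain W F where W: "open W" "x \<in> W" "smooth_on W F" "\<forall>y\<in>B \<inter> W. F y = f y"
    using f x unfolding smooth_on_subset_def by blast
  obtain W' H where W': "open W'" "x \<in> W'" "smooth_on W' H" "\<forall>y\<in>B \<inter> W'. H y = h y"
    using h x unfolding smooth_on_subset_def by blast
  have "smooth_on (W \<inter> W') (\<lambda>y. Op (F y) (H y))"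
    by (intro op open_Int W(1) W'(1) smooth_on_subset'[OF W(3)] smooth_on_subset'[OF W'(3)]) auto
  then show "\<exists>W F. open W \<and> x \<in> W \<and> smooth_on W F \<and> (\<forall>y\<in>B \<inter> W. F y = Op (f y) (h y))"
    using W W' by (intro exI[of _ "W \<inter> W'"] exI[of _ "\<lambda>y. Op (F y) (H y)"]) (auto intro: open_Int)
qed

lemma smooth_on_subset_const: "smooth_on_subset B (\<lambda>y. z)"
  by (rule smooth_on_subset_of_smooth_on[OF open_UNIV smooth_on_const[OF open_UNIV]]) auto

lemma smooth_on_subset_mult:
  fixes f h :: "'a::real_normed_vector \<Rightarrow> real"
  shows "smooth_on_subset B f \<Longrightarrow> smooth_on_subset B h \<Longrightarrow> smooth_on_subset B (\<lambda>y. f y * h y)"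
  by (rule smooth_on_subset_combine) (auto intro: smooth_on_mult)

lemma smooth_on_subset_sum:
  assumes "\<And>i. i \<in> I \<Longrightarrow> smooth_on_subset B (f i)"
  shows "smooth_on_subset B (\<lambda>y. \<Sum>i\<in>I. f i y)"
  using assms
proof (induction I rule: infinite_finite_induct)
  case (insert i I)
  have "smooth_on_subset B (\<lambda>y. f i y + (\<Sum>i\<in>I. f i y))"
    by (rule smooth_on_subset_combine) (use insert in \<open>auto intro: smooth_on_add\<close>)
  then show ?case using insert by simp
qed (simp_all add: smooth_on_subset_const)

text \<open>Expanding the arguments in the basis leaves products of their coordinates with values of
  the form on constant vectors.\<close>

lemma smooth_on_subset_form:
  fixes \<psi> :: "'a::real_normed_vector \<Rightarrow> 'v::euclidean_space list \<Rightarrow> real"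
  assumes "\<And>y. y \<in> B \<Longrightarrow> alternating_form k (\<psi> y)"
    and "\<And>Vs. length Vs = k \<Longrightarrow> smooth_on_subset B (\<lambda>y. \<psi> y Vs)"
    and "\<And>p b. p \<in> set ps \<Longrightarrow> smooth_on_subset B (\<lambda>y. p y \<bullet> b)" and "length ps = k"
  shows "smooth_on_subset B (\<lambda>y. \<psi> y (map (\<lambda>p. p y) ps))"
  using assms
proof (induction k arbitrary: \<psi> ps)
  case 0
  then show ?case by simp
next
  case (Suc k)
  then obtain p qs where ps: "ps = p # qs" "length qs = k" by (cases ps) auto
  have "smooth_on_subset B (\<lambda>y. \<psi> y (b # map (\<lambda>p. p y) qs))" for b
  proof (rule Suc.IH)
    show "alternating_form k (\<lambda>us. \<psi> y (b # us))" if "y \<in> B" for y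
      by (rule alternating_form_Cons[OF Suc.prems(1)[OF that]])
  qed (use Suc.prems ps in auto)
  then have "smooth_on_subset B (\<lambda>y. \<Sum>b\<in>Basis. (p y \<bullet> b) * \<psi> y (b # map (\<lambda>p. p y) qs))"
    by (intro smooth_on_subset_sum smooth_on_subset_mult Suc.prems(3)) (simp_all add: ps)
  then show ?case
  proof (rule smooth_on_subset_cong[rotated])
    fix y assume "y \<in> B"
    from alternating_form_expand_head[OF Suc.prems(1)[OF this], of "map (\<lambda>p. p y) qs" "p y"]
    show "(\<Sum>b\<in>Basis. (p y \<bullet> b) * \<psi> y (b # map (\<lambda>p. p y) qs)) = \<psi> y (map (\<lambda>p. p y) ps)"
      by (simp only: ps list.map length_map)
  qed
qed

lemma sum_lessThan_add: "(\<Sum>j<d + m. f j) = (\<Sum>j<d. f j) + (\<Sum>j<m :: nat. f (d + j) :: real)"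
  by (induction m) (simp_all add: add.assoc)

text \<open>The line stays in \<open>B\<close>, so \<open>f\<close> agrees along it with a smooth
  extension. Thus \<open>pdiff\<close> is a true derivative even for functions that are smooth on
  the slice only.\<close>

lemma smooth_on_subset_curve:
  assumes f: "smooth_on_subset B f" and x: "x \<in> B"
    and ev: "\<forall>\<^sub>F t in nhds 0. x + t *\<^sub>R axis i 1 \<in> B"
  shows "((\<lambda>t. f (x + t *\<^sub>R axis i 1)) has_vector_derivative pdiff i f x) (at 0)"
proof -
  obtain W F where W: "open W" "x \<in> W" "smooth_on W F" "\<forall>y\<in>B \<inter> W. F y = f y"
    using f x unfolding smooth_on_subset_def by blast
  have F: "((\<lambda>t. F (x + t *\<^sub>R axis i 1)) has_vector_derivative frechet_derivative F (at x) (axis i 1)) (at 0)"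
    by (rule has_derivative_imp_pdiff[OF smooth_on_has_derivative[OF W(3,2)]])
  have "((\<lambda>t :: real. x + t *\<^sub>R axis i 1) \<longlongrightarrow> x + 0 *\<^sub>R axis i 1) (nhds 0)"
    by (intro tendsto_intros filterlim_ident)
  then have "\<forall>\<^sub>F t in nhds (0 :: real). x + t *\<^sub>R axis i 1 \<in> W"
    by (rule topological_tendstoD) (use W in auto)
  with ev have "\<forall>\<^sub>F t in nhds (0 :: real). f (x + t *\<^sub>R axis i 1) = F (x + t *\<^sub>R axis i 1)"
    by eventually_elim (use W(4) in auto)
  from has_vector_derivative_transform_ev[OF F this]
  have "((\<lambda>t. f (x + t *\<^sub>R axis i 1)) has_vector_derivative frechet_derivative F (at x) (axis i 1)) (at 0)" .
  then show ?thesis unfolding pdiff_def by (simp add: vector_derivative_at)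
qed

section \<open>Covariant derivatives along a slice\<close>

locale slice_germ = metric_germ G U x
  for G :: "real^'n::finite \<Rightarrow> real^'n^'n" and U x +
  fixes B :: "(real^'n) set" and i :: 'n
  assumes B: "B \<subseteq> U" "x \<in> B" and curve: "\<forall>\<^sub>F t in nhds 0. x + t *\<^sub>R axis i 1 \<in> B"
begin

abbreviation "C \<equiv> connection_form G x i"

lemma form_curve:
  fixes \<psi> :: "real^'n \<Rightarrow> 'v::euclidean_space list \<Rightarrow> real"
  assumes alt: "\<And>y. y \<in> B \<Longrightarrow> alternating_form k (\<psi> y)"
    and sm: "\<And>Vs. length Vs = k \<Longrightarrow> smooth_on_subset B (\<lambda>y. \<psi> y Vs)"
    and ps: "list_all2 (\<lambda>p p'. (p has_vector_derivative p') (at 0)) ps ps'" "length ps = k"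
  shows "((\<lambda>t. \<psi> (x + t *\<^sub>R axis i 1) (map (\<lambda>p. p t) ps)) has_vector_derivative
     pdiff i (\<lambda>y. \<psi> y (map (\<lambda>p. p 0) ps)) x + (\<Sum>j<k. \<psi> x ((map (\<lambda>p. p 0) ps)[j := ps' ! j]))) (at 0)"
proof -
  have "\<forall>\<^sub>F t in nhds 0. alternating_form k (\<psi> (x + t *\<^sub>R axis i 1))"
    using curve by eventually_elim (rule alt)
  moreover have "((\<lambda>t. \<psi> (x + t *\<^sub>R axis i 1) Vs) has_vector_derivative pdiff i (\<lambda>y. \<psi> y Vs) x) (at 0)"
    if "length Vs = k" for Vs
    by (rule smooth_on_subset_curve[OF sm[OF that] B(2) curve])
  ultimately show ?thesis
    using has_vector_derivative_form[where \<alpha> = "\<lambda>t. \<psi> (x + t *\<^sub>R axis i 1)" and ps = ps and ps' = ps' and k = k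
        and \<alpha>' = "\<lambda>Vs. pdiff i (\<lambda>y. \<psi> y Vs) x"] ps by simp
qed

lemma alternating_form_nabla:
  fixes \<psi> :: "real^'n \<Rightarrow> 'n tractor list \<Rightarrow> real"
  assumes alt: "\<And>y. y \<in> B \<Longrightarrow> alternating_form k (\<psi> y)"
    and sm: "\<And>Vs. length Vs = k \<Longrightarrow> smooth_on_subset B (\<lambda>y. \<psi> y Vs)"
  shows "alternating_form k (form_nabla G i \<psi> x)"
proof -
  have "alternating_form k (\<lambda>Vs. pdiff i (\<lambda>y. \<psi> y Vs) x)"
  proof (rule alternating_form_derivative)
    show "\<forall>\<^sub>F t in nhds 0. alternating_form k (\<psi> (x + t *\<^sub>R axis i 1))"
      using curve by eventually_elim (rule alt)
    show "((\<lambda>t. \<psi> (x + t *\<^sub>R axis i 1) Vs) has_vector_derivative pdiff i (\<lambda>y. \<psi> y Vs) x) (at 0)"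
      if "length Vs = k" for Vs
      by (rule smooth_on_subset_curve[OF sm[OF that] B(2) curve])
  qed
  then have "alternating_form k (\<lambda>Vs. pdiff i (\<lambda>y. \<psi> y Vs) x - (\<Sum>j<k. \<psi> x (Vs[j := C (Vs ! j)])))"
    by (rule alternating_form_diff[OF _ alternating_form_derivation[OF alt[OF B(2)] linear_connection_form]])
  then show ?thesis
    by (rule alternating_form_cong[rotated]) (simp add: form_nabla_def)
qed

text \<open>Differentiate \<open>\<psi> y (V y # Vs) = 0\<close> along the slice. As \<psi> is
  parallel, the covariant derivative of \<open>V\<close> is left in the first slot; the terms for
  the other arguments vanish because \<open>V\<close> stays in front of them.\<close>

lemma parallel_contract:
  assumes alt: "\<And>y. y \<in> B \<Longrightarrow> alternating_form (Suc k) (\<psi> y)"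
    and sm: "\<And>Vs. length Vs = Suc k \<Longrightarrow> smooth_on_subset B (\<lambda>y. \<psi> y Vs)"
    and par: "\<And>Vs. length Vs = Suc k \<Longrightarrow> form_nabla G i \<psi> x Vs = 0"
    and V: "((\<lambda>t. V (x + t *\<^sub>R axis i 1)) has_vector_derivative V') (at 0)"
    and zero: "\<And>y Us. y \<in> B \<Longrightarrow> length Us = k \<Longrightarrow> \<psi> y (V y # Us) = 0"
    and Vs: "length Vs = k"
  shows "\<psi> x ((V' + C (V x)) # Vs) = 0"
proof -
  let ?ps = "(\<lambda>t. V (x + t *\<^sub>R axis i 1)) # map (\<lambda>v t. v) Vs" and ?ps' = "V' # map (\<lambda>v. 0) Vs"
  have m: "map (\<lambda>p. p t) ?ps = V (x + t *\<^sub>R axis i 1) # Vs" for t by (simp add: o_def)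
  have alt0: "alternating_form (Suc k) (\<psi> x)" by (rule alt[OF B(2)])
  have "list_all2 (\<lambda>p p'. (p has_vector_derivative p') (at 0)) ?ps ?ps'"
    using V by (simp add: list.rel_map list_all2_same)
  from form_curve[OF alt sm this]
  have D: "((\<lambda>t. \<psi> (x + t *\<^sub>R axis i 1) (V (x + t *\<^sub>R axis i 1) # Vs)) has_vector_derivative
     pdiff i (\<lambda>y. \<psi> y (V x # Vs)) x + (\<Sum>j<Suc k. \<psi> x ((V x # Vs)[j := ?ps' ! j]))) (at 0)"
    using Vs unfolding m by simp
  have "\<forall>\<^sub>F t in nhds 0. \<psi> (x + t *\<^sub>R axis i 1) (V (x + t *\<^sub>R axis i 1) # Vs) = 0"
    using curve by eventually_elim (rule zero[OF _ Vs])
  then have 0: "pdiff i (\<lambda>y. \<psi> y (V x # Vs)) x + (\<Sum>j<Suc k. \<psi> x ((V x # Vs)[j := ?ps' ! j])) = 0"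
    by (rule has_vector_derivative_unique_ev[OF D has_vector_derivative_const])
  have "\<psi> x (V x # Vs[j := 0]) = 0" if "j < k" for j
    by (rule zero[OF B(2)]) (use Vs in simp)
  then have 1: "(\<Sum>j<Suc k. \<psi> x ((V x # Vs)[j := ?ps' ! j])) = \<psi> x (V' # Vs)"
    using Vs by (simp add: sum.lessThan_Suc_shift del: sum.lessThan_Suc)
  have "pdiff i (\<lambda>y. \<psi> y (V x # Vs)) x = (\<Sum>j<Suc k. \<psi> x ((V x # Vs)[j := C ((V x # Vs) ! j)]))"
    using par[of "V x # Vs"] Vs by (simp add: form_nabla_def)
  also have "\<dots> = \<psi> x (C (V x) # Vs) + (\<Sum>j<k. \<psi> x (V x # Vs[j := C (Vs ! j)]))"
    by (simp add: sum.lessThan_Suc_shift del: sum.lessThan_Suc)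
  also have "(\<Sum>j<k. \<psi> x (V x # Vs[j := C (Vs ! j)])) = 0"
    by (rule sum.neutral) (use zero[OF B(2)] Vs in auto)
  finally show ?thesis
    using 0 1 linear_add[OF alternating_form_Cons_linear[OF alt0 Vs], of V' "C (V x)"] by simp
qed

text \<open>The star contracts with the inverse tractor metric and the volume form, both parallel.
  In the product rule the terms in which the connection acts on the summed basis vectors cancel, and
  the others make up the two sides.\<close>

lemma hodge_nabla:
  assumes alt: "\<And>y. y \<in> B \<Longrightarrow> alternating_form d (\<psi> y)"
    and sm: "\<And>Vs. length Vs = d \<Longrightarrow> smooth_on_subset B (\<lambda>y. \<psi> y Vs)"
    and d: "d \<le> CARD('n) + 2" and Ws: "length Ws = CARD('n) + 2 - d"
  shows "form_nabla G i (\<lambda>y. hodge_star d (G y) (\<psi> y)) x Ws = hodge_star d (G x) (form_nabla G i \<psi> x) Ws"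
proof -
  let ?N = "CARD('n) + 2" and ?\<epsilon> = "volume_form (G x)" and ?S = "sharp (G x)"
  let ?S' = "\<lambda>e :: 'n tractor. (0 :: real, DG i *v fst (snd e), 0 :: real)"
  let ?L = "{es. length es = d \<and> set es \<subseteq> (Basis :: 'n tractor set)}"
  have alt0: "alternating_form d (\<psi> x)" by (rule alt[OF B(2)])
  \<comment> \<open>The raised basis vectors move with the metric. Trading the partial derivative of
    the form for the covariant one adds the connection form to the derivative of
    \<open>sharp\<close>.\<close>
  have D1: "((\<lambda>t. \<psi> (x + t *\<^sub>R axis i 1) (map (sharp (G (x + t *\<^sub>R axis i 1))) es)) has_vector_derivative
     form_nabla G i \<psi> x (map ?S es) + (\<Sum>j<d. \<psi> x ((map ?S es)[j := C (?S (es ! j)) + ?S' (es ! j)]))) (at 0)"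
    if es: "length es = d" for es
  proof -
    let ?ps = "map (\<lambda>e t. sharp (G (x + t *\<^sub>R axis i 1)) e) es"
    have "list_all2 (\<lambda>p p'. (p has_vector_derivative p') (at 0)) ?ps (map ?S' es)"
      by (simp add: list_all2_conv_all_nth sharp_derivative)
    from form_curve[OF alt sm this] es
    have "((\<lambda>t. \<psi> (x + t *\<^sub>R axis i 1) (map (sharp (G (x + t *\<^sub>R axis i 1))) es)) has_vector_derivative
     pdiff i (\<lambda>y. \<psi> y (map ?S es)) x + (\<Sum>j<d. \<psi> x ((map ?S es)[j := ?S' (es ! j)]))) (at 0)"
      by (simp add: o_def)
    moreover have "pdiff i (\<lambda>y. \<psi> y (map ?S es)) x
        = form_nabla G i \<psi> x (map ?S es) + (\<Sum>j<d. \<psi> x ((map ?S es)[j := C (?S (es ! j))]))"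
      using es by (simp add: form_nabla_def)
    moreover have "\<psi> x ((map ?S es)[j := C (?S (es ! j))]) + \<psi> x ((map ?S es)[j := ?S' (es ! j)])
        = \<psi> x ((map ?S es)[j := C (?S (es ! j)) + ?S' (es ! j)])" if j: "j < d" for j
    proof -
      have u: "(map ?S es)[j := z] = take j (map ?S es) @ z # drop (Suc j) (map ?S es)" for z
        by (rule upd_conv_take_nth_drop) (use j es in simp)
      show ?thesis unfolding u
        by (rule linear_add[OF alternating_form_linear[OF alt0], symmetric]) (use j es in simp)
    qed
    ultimately show ?thesis by (simp add: sum.distrib[symmetric] add.assoc)
  qed
  have D2: "((\<lambda>t. volume_form (G (x + t *\<^sub>R axis i 1)) (es @ Ws)) has_vector_derivative
     (\<Sum>j<d. ?\<epsilon> (es[j := C (es ! j)] @ Ws)) + (\<Sum>j<?N - d. ?\<epsilon> (es @ Ws[j := C (Ws ! j)]))) (at 0)"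
    if es: "length es = d" for es
  proof -
    have "(\<Sum>j<?N. ?\<epsilon> ((es @ Ws)[j := C ((es @ Ws) ! j)]))
        = (\<Sum>j<d. ?\<epsilon> ((es @ Ws)[j := C ((es @ Ws) ! j)])) + (\<Sum>j<?N - d. ?\<epsilon> ((es @ Ws)[d + j := C ((es @ Ws) ! (d + j))]))"
    proof -
      show ?thesis
        using sum_lessThan_add[of "\<lambda>j. ?\<epsilon> ((es @ Ws)[j := C ((es @ Ws) ! j)])" d "?N - d"]
        unfolding le_add_diff_inverse[OF d] .
    qed
    also have "\<dots> = (\<Sum>j<d. ?\<epsilon> (es[j := C (es ! j)] @ Ws)) + (\<Sum>j<?N - d. ?\<epsilon> (es @ Ws[j := C (Ws ! j)]))"
      using es by (simp add: list_update_append nth_append)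
    finally show ?thesis
      using volume_form_derivative[of "es @ Ws" i] es Ws d by simp
  qed
  have DD: "((\<lambda>t. \<Sum>es\<in>?L. \<psi> (x + t *\<^sub>R axis i 1) (map (sharp (G (x + t *\<^sub>R axis i 1))) es)
        * volume_form (G (x + t *\<^sub>R axis i 1)) (es @ Ws)) has_vector_derivative
     (\<Sum>es\<in>?L. \<psi> (x + 0 *\<^sub>R axis i 1) (map (sharp (G (x + 0 *\<^sub>R axis i 1))) es)
          * ((\<Sum>j<d. ?\<epsilon> (es[j := C (es ! j)] @ Ws)) + (\<Sum>j<?N - d. ?\<epsilon> (es @ Ws[j := C (Ws ! j)])))
        + (form_nabla G i \<psi> x (map ?S es) + (\<Sum>j<d. \<psi> x ((map ?S es)[j := C (?S (es ! j)) + ?S' (es ! j)])))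
          * volume_form (G (x + 0 *\<^sub>R axis i 1)) (es @ Ws))) (at 0)"
    by (intro has_vector_derivative_sum has_vector_derivative_mult D1 D2) auto
  from vector_derivative_at[OF DD]
  have "pdiff i (\<lambda>y. star d Basis (sharp (G y)) (volume_form (G y)) (\<psi> y) Ws) x =
     (\<Sum>es\<in>?L. \<psi> x (map ?S es)
          * ((\<Sum>j<d. ?\<epsilon> (es[j := C (es ! j)] @ Ws)) + (\<Sum>j<?N - d. ?\<epsilon> (es @ Ws[j := C (Ws ! j)])))
        + (form_nabla G i \<psi> x (map ?S es) + (\<Sum>j<d. \<psi> x ((map ?S es)[j := C (?S (es ! j)) + ?S' (es ! j)])))
          * ?\<epsilon> (es @ Ws))"
    unfolding pdiff_def star_def by simp
  also have "\<dots> = (\<Sum>es\<in>?L. (\<Sum>j<d. \<psi> x ((map ?S es)[j := C (?S (es ! j)) + ?S' (es ! j)])) * ?\<epsilon> (map (\<lambda>e. e) es @ Ws)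
        + \<psi> x (map ?S es) * (\<Sum>j<d. ?\<epsilon> ((map (\<lambda>e. e) es)[j := C (es ! j)] @ Ws)))
     + (\<Sum>es\<in>?L. form_nabla G i \<psi> x (map ?S es) * ?\<epsilon> (es @ Ws))
     + (\<Sum>es\<in>?L. \<Sum>j<?N - d. \<psi> x (map ?S es) * ?\<epsilon> (es @ Ws[j := C (Ws ! j)]))"
    by (simp add: sum.distrib sum_distrib_left algebra_simps)
  also have "(\<Sum>es\<in>?L. (\<Sum>j<d. \<psi> x ((map ?S es)[j := C (?S (es ! j)) + ?S' (es ! j)])) * ?\<epsilon> (map (\<lambda>e. e) es @ Ws)
        + \<psi> x (map ?S es) * (\<Sum>j<d. ?\<epsilon> ((map (\<lambda>e. e) es)[j := C (es ! j)] @ Ws))) = 0"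
  proof (rule sum_lists_tensor_derivation[OF finite_Basis _ alt0])
    show "alternating_form d (\<lambda>us. ?\<epsilon> (us @ Ws))"
      by (rule alternating_form_append_right[OF _ Ws]) (use d alternating_volume_form[of "G x"] in simp)
    fix f h :: "'n tractor \<Rightarrow> real" assume f: "linear f" and h: "linear h"
    \<comment> \<open>\<open>f\<close> and \<open>h\<close> become inner products with
      \<open>a\<close> and \<open>b\<close>, so the variation of the tensor is
      \<open>inverse_metric_parallel\<close> for this pair.\<close>
    define a where "a = (\<Sum>b\<in>Basis. f b *\<^sub>R b)"
    define b where "b = (\<Sum>e\<in>Basis. h e *\<^sub>R e)"
    have rep: "q V = (\<Sum>b\<in>Basis. q b *\<^sub>R b) \<bullet> V" if q: "linear q" for q :: "'n tractor \<Rightarrow> real" and V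
    proof -
      have "q V = q (\<Sum>b\<in>Basis. (V \<bullet> b) *\<^sub>R b)" by (simp only: euclidean_representation)
      also have "\<dots> = (\<Sum>b\<in>Basis. (V \<bullet> b) * q b)"
        by (simp only: linear_sum[OF q] linear_scale[OF q] real_scaleR_def)
      also have "\<dots> = (\<Sum>b\<in>Basis. q b *\<^sub>R b) \<bullet> V"
        by (simp add: inner_sum_left inner_commute[of V] mult.commute)
      finally show ?thesis .
    qed
    have fa: "f V = a \<bullet> V" and hb: "h V = b \<bullet> V" for V
      unfolding a_def b_def by (rule rep[OF f], rule rep[OF h])
    have sumB: "(\<Sum>e\<in>Basis. (z \<bullet> K e) * (b' \<bullet> e)) = z \<bullet> K b'" if "linear K" for K :: "'n tractor \<Rightarrow> 'n tractor" and z b'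
    proof -
      have "z \<bullet> K (\<Sum>e\<in>Basis. (b' \<bullet> e) *\<^sub>R e) = (\<Sum>e\<in>Basis. (z \<bullet> K e) * (b' \<bullet> e))"
        by (simp only: linear_sum[OF that] linear_scale[OF that] inner_sum_right inner_scaleR_right mult.commute)
      then show ?thesis by (simp only: euclidean_representation)
    qed
    have l1: "linear (\<lambda>e. C (?S e) + ?S' e)"
    proof -
      have "linear (\<lambda>e. C (?S e))" using linear_compose[OF linear_sharp linear_connection_form] by (simp add: o_def)
      moreover have "linear ?S'"
        by (rule linearI) (simp_all add: matrix_vector_right_distrib matrix_vector_mult_scaleR)
      ultimately show ?thesis by (rule linear_compose_add)
    qed
    have sh: "a \<bullet> ?S e = ?S a \<bullet> e" for e
      using tractor_metric_sharp[OF pdx, of a "?S e"] tractor_metric_sharp[OF pdx, of e "?S a"]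
        tractor_metric_commute[OF pdx, of "?S a" "?S e"] by (simp add: inner_commute)
    have "(\<Sum>e\<in>Basis. f (C (?S e) + ?S' e) * h e + f (?S e) * h (C e))
       = (\<Sum>e\<in>Basis. (a \<bullet> (C (?S e) + ?S' e)) * (b \<bullet> e)) + (\<Sum>e\<in>Basis. (b \<bullet> C e) * (?S a \<bullet> e))"
      by (simp only: fa hb sh sum.distrib mult.commute)
    also have "\<dots> = a \<bullet> (C (?S b) + ?S' b) + b \<bullet> C (?S a)"
      by (simp only: sumB[OF l1] sumB[OF linear_connection_form])
    also have "\<dots> = 0" by (rule inverse_metric_parallel)
    finally show "(\<Sum>e\<in>Basis. f (C (?S e) + ?S' e) * h e + f (?S e) * h (C e)) = 0" .
  qed
  also have "(\<Sum>es\<in>?L. form_nabla G i \<psi> x (map ?S es) * ?\<epsilon> (es @ Ws)) = star d Basis ?S ?\<epsilon> (form_nabla G i \<psi> x) Ws"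
    unfolding star_def ..
  also have "(\<Sum>es\<in>?L. \<Sum>j<?N - d. \<psi> x (map ?S es) * ?\<epsilon> (es @ Ws[j := C (Ws ! j)]))
      = (\<Sum>j<?N - d. star d Basis ?S ?\<epsilon> (\<psi> x) (Ws[j := C (Ws ! j)]))"
    unfolding star_def by (rule sum.swap)
  finally have P: "pdiff i (\<lambda>y. star d Basis (sharp (G y)) (volume_form (G y)) (\<psi> y) Ws) x =
      star d Basis ?S ?\<epsilon> (form_nabla G i \<psi> x) Ws + (\<Sum>j<?N - d. star d Basis ?S ?\<epsilon> (\<psi> x) (Ws[j := C (Ws ! j)]))"
    by simp
  have Q: "pdiff i (\<lambda>y. inverse (fact d) * f y) x = inverse (fact d) * pdiff i f x"
    if "((\<lambda>t. f (x + t *\<^sub>R axis i 1)) has_vector_derivative f') (at 0)" for f and f' :: real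
    using vector_derivative_at[OF has_vector_derivative_mult_right[OF that, of "inverse (fact d)"]] vector_derivative_at[OF that]
    by (simp add: pdiff_def)
  have "pdiff i (\<lambda>y. hodge_star d (G y) (\<psi> y) Ws) x
      = inverse (fact d) * pdiff i (\<lambda>y. star d Basis (sharp (G y)) (volume_form (G y)) (\<psi> y) Ws) x"
    unfolding hodge_star_eq star_def
    by (rule Q[of "\<lambda>y. \<Sum>es\<in>?L. \<psi> y (map (sharp (G y)) es) * volume_form (G y) (es @ Ws)", OF DD])
  then show ?thesis
    unfolding form_nabla_def[of G i "\<lambda>y. hodge_star d (G y) (\<psi> y)"] P hodge_star_eq Ws
    by (simp add: distrib_left sum_distrib_left)
qed

end

section \<open>Parallel forms and the normal bundle\<close>

lemma pdiff_cong_ev: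
  assumes "\<forall>\<^sub>F t in nhds 0. f (x + t *\<^sub>R axis i 1) = h (x + t *\<^sub>R axis i 1)"
  shows "pdiff i f x = pdiff i h x"
proof -
  have ev: "\<forall>\<^sub>F t in nhds 0. h (x + t *\<^sub>R axis i 1) = f (x + t *\<^sub>R axis i 1)"
    using assms by eventually_elim simp
  have "((\<lambda>t. f (x + t *\<^sub>R axis i 1)) has_vector_derivative D) (at 0) \<longleftrightarrow>
      ((\<lambda>t. h (x + t *\<^sub>R axis i 1)) has_vector_derivative D) (at 0)" for D
    using has_vector_derivative_transform_ev[OF _ assms] has_vector_derivative_transform_ev[OF _ ev] by blast
  then show ?thesis unfolding pdiff_def vector_derivative_def by simp
qed

lemma eventually_line:
  fixes x v :: "'a::real_normed_vector"
  assumes "open U" "x \<in> U"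
  shows "\<forall>\<^sub>F t in nhds (0 :: real). x + t *\<^sub>R v \<in> U"
proof -
  have "((\<lambda>t :: real. x + t *\<^sub>R v) \<longlongrightarrow> x + 0 *\<^sub>R v) (nhds 0)"
    by (intro tendsto_intros filterlim_ident)
  then show ?thesis by (rule topological_tendstoD) (use assms in auto)
qed

lemma pdiff_cong_open:
  assumes "open U" "x \<in> U" "\<And>y. y \<in> U \<Longrightarrow> f y = h y"
  shows "pdiff i f x = pdiff i h x"
  by (rule pdiff_cong_ev) (use eventually_line[OF assms(1,2), of "axis i 1"] in eventually_elim, rule assms(3))

lemma christoffel_cong:
  assumes "open U" "x \<in> U" "\<And>y. y \<in> U \<Longrightarrow> G y = G' y"
  shows "christoffel G x = christoffel G' x"
proof -
  have "pdiff a (\<lambda>y. G y $ b $ d) x = pdiff a (\<lambda>y. G' y $ b $ d) x" for a b d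
    by (rule pdiff_cong_open[OF assms(1,2)]) (simp add: assms(3))
  then show ?thesis using assms(2,3) by (simp add: christoffel_def fun_eq_iff)
qed

text \<open>Curvature contains second derivatives, so the metrics must agree on a neighbourhood. The
  case in view is a chart and its restriction, at which a metric has formally different component
  functions.\<close>

lemma connection_form_cong:
  assumes "open U" "x \<in> U" "\<And>y. y \<in> U \<Longrightarrow> G y = G' y"
  shows "connection_form G x = connection_form G' x"
proof -
  have ch: "christoffel G y = christoffel G' y" if "y \<in> U" for y
    by (rule christoffel_cong[OF assms(1) that assms(3)])
  have "pdiff a (\<lambda>y. christoffel G y b d $ e) x = pdiff a (\<lambda>y. christoffel G' y b d $ e) x" for a b d e
    by (rule pdiff_cong_open[OF assms(1,2)]) (simp add: ch)
  then have "riemann G x = riemann G' x"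
    by (simp add: riemann_def fun_eq_iff ch[OF assms(2)])
  then have "schouten G x = schouten G' x"
    by (simp add: schouten_def ricci_def assms(2,3))
  then show ?thesis
    by (simp add: connection_form_def fun_eq_iff ch[OF assms(2)] assms(2,3) split: prod.split)
qed

lemma wcomp_cong:
  assumes "open U" "x \<in> U" "\<And>y. y \<in> U \<Longrightarrow> G y = G' y"
  shows "wcomp G K x = wcomp G' K x"
  using christoffel_cong[OF assms] assms(2,3) by (simp add: wcomp_def mcurv_def fun_eq_iff)

context conformal_manifold
begin

lemma metric_germ:
  assumes "g \<in> c" "u \<in> A" "p \<in> dom_of u"
  shows "metric_germ (g u) (coord u ` dom_of u) (coord u p)"
proof
  show "posdef (g u y)" if "y \<in> coord u ` dom_of u" for y
    using metric_posdef[OF assms(1,2)] that by auto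
qed (use assms(3) in \<open>auto intro: open_image[OF assms(2)] metric_smooth[OF assms(1,2)]\<close>)

lemma slice_germ:
  assumes "g \<in> c" "slice_chart A d S u K" "p \<in> dom_of u \<inter> S" "i \<notin> K"
  shows "slice_germ (g u) (coord u ` dom_of u) (coord u p) (coord u ` (dom_of u \<inter> S)) i"
proof -
  have u: "u \<in> A" using assms(2) by (auto simp: slice_chart_def)
  interpret metric_germ "g u" "coord u ` dom_of u" "coord u p"
    by (rule metric_germ[OF assms(1) u]) (use assms(3) in auto)
  show ?thesis
    by unfold_locales (use assms(3) slice_curve[OF assms(2,3,4) open_UNIV] in auto)
qed

end

section \<open>The annihilator of a parallel form along a slice\<close>

locale parallel_form = conformal_manifold A c
  for A :: "('a::{t2_space, second_countable_topology}, 'n::finite) chart set"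
    and c :: "('a, 'n) metric set" +
  fixes g :: "('a, 'n) metric" and k :: nat and S :: "'a set" and u :: "('a, 'n) chart" and K :: "'n set"
    and \<psi> :: "real^'n \<Rightarrow> 'n tractor list \<Rightarrow> real"
  assumes g: "g \<in> c" and slice: "slice_chart A (Suc k) S u K" and k: "Suc k < CARD('n)"
    and alt: "\<And>y. y \<in> coord u ` (dom_of u \<inter> S) \<Longrightarrow> alternating_form (Suc k) (\<psi> y)"
    and smooth_\<psi>: "\<And>Vs. length Vs = Suc k \<Longrightarrow> smooth_on_subset (coord u ` (dom_of u \<inter> S)) (\<lambda>y. \<psi> y Vs)"
    and X: "\<And>y Vs. y \<in> coord u ` (dom_of u \<inter> S) \<Longrightarrow> length Vs = k \<Longrightarrow> \<psi> y (canonical_tractor # Vs) = 0"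
    and parallel: "\<And>y i Vs. y \<in> coord u ` (dom_of u \<inter> S) \<Longrightarrow> i \<notin> K \<Longrightarrow> length Vs = Suc k
        \<Longrightarrow> form_nabla (g u) i \<psi> y Vs = 0"
begin

abbreviation "B \<equiv> coord u ` (dom_of u \<inter> S)"
abbreviation "G \<equiv> g u"

lemma chart: "u \<in> A" using slice by (auto simp: slice_chart_def)

lemma germ: "y \<in> B \<Longrightarrow> i \<notin> K \<Longrightarrow> slice_germ G (coord u ` dom_of u) y B i"
  using slice_germ[OF g slice] by auto

lemma posdef_G: "y \<in> B \<Longrightarrow> posdef (G y)"
  using metric_posdef[OF g chart] by auto

text \<open>The tractor is the covariant derivative of the canonical tractor along
  \<open>i\<close>.\<close>

lemma kills_tangent:
  assumes y: "y \<in> B" and i: "i \<notin> K" and Us: "length Us = k"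
  shows "\<psi> y ((0, G y $ i, 0) # Us) = 0"
proof -
  interpret slice_germ G "coord u ` dom_of u" y B i by (rule germ[OF y i])
  have "\<psi> y ((0 + connection_form G y i canonical_tractor) # Us) = 0"
    by (rule parallel_contract[where V = "\<lambda>_. canonical_tractor", OF alt smooth_\<psi> parallel[OF y i] _ X Us]) simp_all
  then show ?thesis by (simp add: connection_form_eq canonical_tractor_def)
qed

text \<open>The covariant derivative along \<open>j\<close> of the tractor field
  \<open>(0, G y $ i, 0)\<close>. Metric compatibility turns its middle slot into the lowered
  Christoffel symbol, so that its trace shows the mean curvature.\<close>

definition second_derivative where
  "second_derivative y i j = (- G y $ i $ j, G y *v christoffel G y i j,
     - (schouten G y $ j \<bullet> (matrix_inv (G y) *v G y $ i)))"

lemma kills_second_derivative: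
  assumes y: "y \<in> B" and ij: "i \<notin> K" "j \<notin> K" and Us: "length Us = k"
  shows "\<psi> y (second_derivative y i j # Us) = 0"
proof -
  interpret slice_germ G "coord u ` dom_of u" y B j by (rule germ[OF y ij(2)])
  have "((\<lambda>t. G (y + t *\<^sub>R axis j 1) $ i) has_vector_derivative DG j $ i) (at 0)"
    by (rule bounded_linear.has_vector_derivative[OF bounded_linear_vec_nth curve_derivative])
  then have D: "((\<lambda>t. (0 :: real, G (y + t *\<^sub>R axis j 1) $ i, 0 :: real)) has_vector_derivative (0, DG j $ i, 0)) (at 0)"
    by (intro has_vector_derivative_Pair has_vector_derivative_const)
  have "\<psi> y (((0, DG j $ i, 0) + connection_form G y j (0, G y $ i, 0)) # Us) = 0"
    by (rule parallel_contract[where V = "\<lambda>y. (0, G y $ i, 0)", OF alt smooth_\<psi> parallel[OF y ij(2)] D _ Us])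
       (use kills_tangent ij(1) in auto)
  moreover have "DG j $ i - \<Gamma>mat j *v G y $ i = G y *v christoffel G y i j"
  proof -
    have "(DG j $ i - \<Gamma>mat j *v G y $ i) $ b = (G y *v christoffel G y i j) $ b" for b
    proof -
      have "(\<Gamma>mat j *v G y $ i) $ b = (\<Sum>k\<in>UNIV. christoffel G y j b $ k * G y $ k $ i)"
        by (simp add: \<Gamma>mat_def matrix_vector_mult_def posdef_sym[OF pdx, of i])
      moreover have "(G y *v christoffel G y i j) $ b = (\<Sum>k\<in>UNIV. christoffel G y j i $ k * G y $ k $ b)"
        by (simp add: matrix_vector_mult_def posdef_sym[OF pdx, of b] christoffel_sym[of i j] mult.commute)
      ultimately show ?thesis by (simp add: metric_compatible)
    qed
    then show ?thesis by (simp add: vec_eq_iff)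
  qed
  ultimately show ?thesis by (simp add: connection_form_eq second_derivative_def)
qed

lemma card_K: "card K = Suc k" using slice by (auto simp: slice_chart_def)

text \<open>\<open>T\<close>, the normalised tangential trace of the second derivatives, has top
  slot -1 and middle slot the lowered \<open>mcurv\<close>. Hence every tractor in the common kernel
  is a combination of \<open>T\<close>, tangent tractors and \<open>X\<close>.\<close>

lemma kills_perp:
  assumes y: "y \<in> B" and V: "\<forall>l\<in>K. wcomp G K y l V = 0" and Us: "length Us = k"
  shows "\<psi> y (V # Us) = 0"
proof -
  let ?m = "real (CARD('n) - card K)"
  let ?\<gamma> = "matrix_inv (tangential_block K (G y))"
  have pd: "posdef (G y)" by (rule posdef_G[OF y])
  have m: "?m > 0" using k card_K by simp
  define f where "f W = \<psi> y (W # Us)" for W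
  have lin: "linear f" unfolding f_def by (rule alternating_form_Cons_linear[OF alt[OF y] Us])
  define T where "T = inverse ?m *\<^sub>R (\<Sum>i\<in>-K. \<Sum>j\<in>-K. ?\<gamma> $ i $ j *\<^sub>R second_derivative y i j)"
  have "f (second_derivative y i j) = 0" if "i \<notin> K" "j \<notin> K" for i j
    unfolding f_def by (rule kills_second_derivative[OF y that Us])
  then have fT: "f T = 0"
    unfolding T_def by (simp add: linear_scale[OF lin] linear_sum[OF lin])
  have T1: "fst T = - 1"
  proof -
    have "fst T = - (inverse ?m * (\<Sum>i\<in>-K. \<Sum>j\<in>-K. ?\<gamma> $ i $ j * G y $ i $ j))"
      by (simp add: T_def second_derivative_def fst_sum sum_negf)
    then show ?thesis unfolding trace_tangential[OF pd] using m by simp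
  qed
  have T2: "fst (snd T) = G y *v mcurv G K y"
    by (simp add: T_def second_derivative_def fst_sum snd_sum mcurv_def linear_sum[OF matrix_vector_mul_linear]
        matrix_vector_mult_scaleR)
  obtain s \<mu> r where Veq: "V = (s, \<mu>, r)" by (cases V) auto
  \<comment> \<open>Adding \<open>s\<close> times \<open>T\<close> removes the top slot of
    \<open>V\<close> and leaves the lowered \<open>z\<close> in the middle. The coordinates of
    \<open>z\<close> in \<open>K\<close> are the values of the functionals on \<open>V\<close>, so
    \<open>z\<close> is tangential.\<close>
  define z where "z = matrix_inv (G y) *v \<mu> + s *\<^sub>R mcurv G K y"
  have zK: "z $ l = 0" if "l \<in> K" for l using V that by (simp add: z_def wcomp_def Veq add.commute)
  have Gz: "G y *v z = \<mu> + s *\<^sub>R fst (snd T)"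
    by (simp add: z_def T2 matrix_vector_right_distrib matrix_vector_mult_scaleR matrix_vector_mul_assoc
        matrix_inv_inverse[OF posdef_det_nonzero[OF pd]])
  have Gz': "(0, G y *v z, 0) = (\<Sum>i\<in>-K. z $ i *\<^sub>R (0 :: real, G y $ i, 0 :: real))"
  proof -
    have "(G y *v z) $ b = (\<Sum>i\<in>-K. z $ i * G y $ i $ b)" for b
    proof -
      have "(G y *v z) $ b = (\<Sum>i\<in>UNIV. z $ i * G y $ i $ b)"
        by (simp add: matrix_vector_mult_def posdef_sym[OF pd, of b] mult.commute)
      also have "\<dots> = (\<Sum>i\<in>-K. z $ i * G y $ i $ b)"
        by (rule sum.mono_neutral_right) (auto simp: zK)
      finally show ?thesis .
    qed
    then show ?thesis by (simp add: prod_eq_iff fst_sum snd_sum vec_eq_iff sum_component)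
  qed
  have "V = (0, G y *v z, 0) + (r + s * snd (snd T)) *\<^sub>R canonical_tractor - s *\<^sub>R T"
    by (simp add: Veq Gz T1 canonical_tractor_def prod_eq_iff)
  then have "f V = f (0, G y *v z, 0) + (r + s * snd (snd T)) * f canonical_tractor - s * f T"
    by (simp add: linear_add[OF lin] linear_diff[OF lin] linear_scale[OF lin])
  also have "f (0, G y *v z, 0) = (\<Sum>i\<in>-K. z $ i * f (0, G y $ i, 0))"
    unfolding Gz' by (simp only: linear_sum[OF lin] linear_scale[OF lin] real_scaleR_def)
  also have "\<dots> = 0"
    by (rule sum.neutral) (simp add: f_def kills_tangent[OF y _ Us])
  finally show ?thesis using fT X[OF y Us] by (simp add: f_def)
qed

text \<open>If \<open>V\<close> annihilated the form without being in the common kernel, it could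
  replace one of the \<open>Suc k\<close> dual tractors; the other \<open>k\<close> would span
  modulo the annihilator, too few for a nonzero form.\<close>

lemma killed_perp:
  assumes y: "y \<in> B" and nz: "length Vs = Suc k" "\<psi> y Vs \<noteq> 0"
    and V: "\<And>Us. length Us = k \<Longrightarrow> \<psi> y (V # Us) = 0" and l: "l \<in> K"
  shows "wcomp G K y l V = 0"
proof (rule ccontr)
  assume neq: "wcomp G K y l V \<noteq> 0"
  let ?w = "wcomp G K y"
  define n where "n = (\<lambda>m :: 'n. (0 :: real, G y *v axis m 1, 0 :: real))"
  have wn: "?w l (n m) = (if l = m then 1 else 0)" for l m
    unfolding n_def by (rule wcomp_dual[where G = G and x = y, OF posdef_G[OF y]])
  have inj: "inj_on n (K - {l})"
  proof (rule inj_onI)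
    fix m m' assume "n m = n m'"
    then show "m = m'" using wn[of m m] wn[of m m'] by (auto split: if_splits)
  qed
  have "\<psi> y Vs = 0"
  proof (rule alternating_form_vanish_card[OF alt[OF y], of "n ` (K - {l})"])
    have "card (n ` (K - {l})) = card (K - {l})" by (rule card_image[OF inj])
    then show "card (n ` (K - {l})) < Suc k" using l card_K by simp
    fix U :: "'n tractor"
    \<comment> \<open>Subtracting a multiple of \<open>V\<close> removes the \<open>l\<close>-th
      value, the dual tractors remove the other values, and the rest \<open>R\<close> lies in the
      common kernel.\<close>
    define a where "a = ?w l U / ?w l V"
    define R where "R = (U - a *\<^sub>R V) - (\<Sum>m\<in>K - {l}. ?w m (U - a *\<^sub>R V) *\<^sub>R n m)"
    have Ul: "?w l (U - a *\<^sub>R V) = 0"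
      using neq by (simp add: a_def linear_diff[OF linear_wcomp] linear_scale[OF linear_wcomp])
    have "?w q R = 0" if q: "q \<in> K" for q
    proof -
      have "?w q R = ?w q (U - a *\<^sub>R V) - (\<Sum>m\<in>K - {l}. ?w m (U - a *\<^sub>R V) * (if q = m then 1 else 0))"
        unfolding R_def by (simp only: linear_diff[OF linear_wcomp, of _ _ _ _ "U - a *\<^sub>R V"] linear_sum[OF linear_wcomp] linear_scale[OF linear_wcomp] wn real_scaleR_def)
      also have "(\<Sum>m\<in>K - {l}. ?w m (U - a *\<^sub>R V) * (if q = m then 1 else 0))
          = (if q = l then 0 else ?w q (U - a *\<^sub>R V))"
        using q by (simp add: if_distrib[of "\<lambda>x. _ * x"] cong: if_cong)
      finally show ?thesis using Ul by simp
    qed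
    then have R: "\<psi> y (R # Us) = 0" if "length Us = k" for Us
      using kills_perp[OF y _ that] by blast
    have "U = (\<Sum>f\<in>n ` (K - {l}). ?w (the_inv_into (K - {l}) n f) (U - a *\<^sub>R V) *\<^sub>R f) + (a *\<^sub>R V + R)"
    proof -
      have "(\<Sum>f\<in>n ` (K - {l}). ?w (the_inv_into (K - {l}) n f) (U - a *\<^sub>R V) *\<^sub>R f)
          = (\<Sum>m\<in>K - {l}. ?w m (U - a *\<^sub>R V) *\<^sub>R n m)"
        by (subst sum.reindex[OF inj]) (simp add: the_inv_into_f_f[OF inj])
      then show ?thesis by (simp add: R_def)
    qed
    moreover have "\<psi> y ((a *\<^sub>R V + R) # Us) = 0" if Us: "length Us + 1 = Suc k" for Us
    proof -
      have len: "length Us = k" using Us by simp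
      have lin: "linear (\<lambda>W. \<psi> y (W # Us))" by (rule alternating_form_Cons_linear[OF alt[OF y] len])
      show ?thesis using V[OF len] R[OF len] by (simp add: linear_add[OF lin] linear_scale[OF lin])
    qed
    moreover note exI[of "\<lambda>c. \<exists>a. U = (\<Sum>f\<in>n ` (K - {l}). c f *\<^sub>R f) + a
        \<and> (\<forall>Vs. length Vs + 1 = Suc k \<longrightarrow> \<psi> y (a # Vs) = 0)" "\<lambda>f. ?w (the_inv_into (K - {l}) n f) (U - a *\<^sub>R V)"]
    ultimately show "\<exists>c a. U = (\<Sum>f\<in>n ` (K - {l}). c f *\<^sub>R f) + a
        \<and> (\<forall>Vs. length Vs + 1 = Suc k \<longrightarrow> \<psi> y (a # Vs) = 0)" by blast
  qed (use nz in auto)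
  then show False using nz by simp
qed

lemma nabla_perp:
  assumes y: "y \<in> B" and i: "i \<notin> K" and nz: "length Vs = Suc k" "\<psi> y Vs \<noteq> 0"
    and V: "smooth_on_subset B V" "\<And>y l. y \<in> B \<Longrightarrow> l \<in> K \<Longrightarrow> wcomp G K y l (V y) = 0" and l: "l \<in> K"
  shows "wcomp G K y l (tractor_nabla G i V y) = 0"
proof (rule killed_perp[OF y nz _ l])
  interpret slice_germ G "coord u ` dom_of u" y B i by (rule germ[OF y i])
  fix Us :: "'n tractor list" assume Us: "length Us = k"
  have D: "((\<lambda>t. V (y + t *\<^sub>R axis i 1)) has_vector_derivative pdiff i V y) (at 0)"
    by (rule smooth_on_subset_curve[OF V(1) y curve])
  show "\<psi> y (tractor_nabla G i V y # Us) = 0"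
    unfolding tractor_nabla_def
    by (rule parallel_contract[where V = V, OF alt smooth_\<psi> parallel[OF y i] D _ Us]) (use kills_perp V(2) in auto)
qed

end

section \<open>From parallel forms to distinguished submanifolds\<close>

context conformal_manifold
begin

text \<open>A slice chart of \<open>S \<inter> W\<close> may reach outside \<open>W\<close>, where
  it says nothing about \<open>S\<close>. Cutting its domain down to \<open>W\<close> makes it a
  slice chart of \<open>S\<close>.\<close>

lemma restricted_slice:
  assumes "slice_chart A d (S \<inter> W) u K" "open W"
  defines "u' \<equiv> (dom_of u \<inter> W, coord u)"
  shows "slice_chart A d S u' K" "slice_chart A d (S \<inter> W) u' K"
proof -
  have u: "u \<in> A" "card K = d" using assms(1) by (auto simp: slice_chart_def)
  have u': "u' \<in> A" unfolding u'_def by (rule restrict_chart[OF u(1) assms(2)])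
  have "coord u ` (dom_of u \<inter> W \<inter> S) = coord u ` (dom_of u \<inter> W) \<inter> {x. \<forall>k\<in>K. x $ k = 0}"
  proof (intro equalityI subsetI)
    fix x assume "x \<in> coord u ` (dom_of u \<inter> W \<inter> S)"
    then obtain q where "q \<in> dom_of u" "q \<in> W" "q \<in> S" "x = coord u q" by auto
    then show "x \<in> coord u ` (dom_of u \<inter> W) \<inter> {x. \<forall>k\<in>K. x $ k = 0}"
      using slice_iff[OF assms(1), of q] by auto
  next
    fix x assume "x \<in> coord u ` (dom_of u \<inter> W) \<inter> {x. \<forall>k\<in>K. x $ k = 0}"
    then obtain q where "q \<in> dom_of u" "q \<in> W" "x = coord u q" "\<forall>k\<in>K. coord u q $ k = 0" by auto
    then show "x \<in> coord u ` (dom_of u \<inter> W \<inter> S)"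
      using slice_iff[OF assms(1), of q] by auto
  qed
  moreover have "dom_of u \<inter> W \<inter> (S \<inter> W) = dom_of u \<inter> W \<inter> S" by auto
  ultimately show "slice_chart A d S u' K" "slice_chart A d (S \<inter> W) u' K"
    using u u' by (auto simp: slice_chart_def u'_def)
qed

lemma restricted_jac:
  assumes "u \<in> A" "open W" "p \<in> dom_of u \<inter> W"
  defines "u' \<equiv> (dom_of u \<inter> W, coord u)"
  shows "jac u u' p = mat 1" "jac u' u p = mat 1"
proof -
  have u': "u' \<in> A" unfolding u'_def by (rule restrict_chart[OF assms(1,2)])
  show j: "jac u u' p = mat 1"
    using jac_same[OF assms(1), of p] assms(3) by (simp add: u'_def jac_def)
  show "jac u' u p = mat 1"
    using jac_inverse[OF assms(1) u', of p] assms(3) by (simp add: j) (simp add: u'_def)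
qed

lemma restricted_metric:
  assumes "g \<in> c" "u \<in> A" "open W" "p \<in> dom_of u \<inter> W"
  shows "g u (coord u p) = g (dom_of u \<inter> W, coord u) (coord u p)"
  using metric_change[OF assms(1,2) restrict_chart[OF assms(2,3)], of p] assms(4)
    restricted_jac(1)[OF assms(2-4)] by (simp add: transpose_mat)

lemma restricted_tractor_change:
  assumes "u \<in> A" "open W" "p \<in> dom_of u \<inter> W"
  shows "tractor_change g u (\<lambda>_. 1) (dom_of u \<inter> W, coord u) p V = V"
proof -
  have "((\<lambda>x. 1 :: real) has_derivative (\<lambda>h. 0)) (at (coord u p))" by simp
  then have "grad u (\<lambda>_. 1) p = 0" by (intro grad_unique) (simp_all add: o_def)
  then show ?thesis
    by (simp add: tractor_change_eq tchange_def restricted_jac(2)[OF assms] transpose_mat)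
qed

lemma parallel_imp_distinguished:
  fixes S :: "'a set"
  assumes d: "1 \<le> d" "d < CARD('n)"
    and \<Psi>: "form_section A c S d \<Psi>" "nowhere_zero A c S d \<Psi>" "X_contraction_zero A c S d \<Psi>"
      "parallel_along A c d S d \<Psi>"
  shows "distinguished A c d S"
  unfolding distinguished_def
proof (intro allI impI ballI)
  fix W V g u K x i
  assume W: "open W" and V: "perp_section A c d (S \<inter> W) V" and g: "g \<in> c"
    and sl: "slice_chart A d (S \<inter> W) u K" and x: "x \<in> coord u ` (dom_of u \<inter> (S \<inter> W))" and i: "i \<in> - K"
  \<comment> \<open>The form is given on \<open>S\<close>, the test section on
    \<open>S \<inter> W\<close>. The argument runs in the restricted chart and is carried back to
    \<open>u\<close> by the agreement of metric and section near the point.\<close>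
  define u' where "u' = (dom_of u \<inter> W, coord u)"
  note sl' = restricted_slice[OF sl W, folded u'_def]
  have u: "u \<in> A" "u' \<in> A" using sl sl' by (auto simp: slice_chart_def)
  obtain k where kd: "d = Suc k" using d by (cases d) auto
  obtain p where p: "p \<in> dom_of u" "p \<in> S" "p \<in> W" "x = coord u p" using x by auto
  have dom': "dom_of u' = dom_of u \<inter> W" "coord u' = coord u" by (simp_all add: u'_def)
  let ?B = "coord u' ` (dom_of u' \<inter> S)"
  have xB: "x \<in> ?B" using p by (auto simp: dom')
  interpret parallel_form A c g k S u' K "\<Psi> g u'"
  proof (unfold_locales)
    show "g \<in> c" "slice_chart A (Suc k) S u' K" "Suc k < CARD('n)" using g sl'(1) d kd by auto
    show "alternating_form (Suc k) (\<Psi> g u' y)" if "y \<in> ?B" for y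
      using \<Psi>(1) g u(2) that kd unfolding form_section_def by blast
    show "smooth_on_subset ?B (\<lambda>y. \<Psi> g u' y Vs)" if "length Vs = Suc k" for Vs
      using \<Psi>(1) g u(2) that kd unfolding form_section_def by blast
    show "\<Psi> g u' y (canonical_tractor # Vs) = 0" if "y \<in> ?B" "length Vs = k" for y Vs
      using \<Psi>(3) g u(2) that kd unfolding X_contraction_zero_def contract_def by (metis Suc_eq_plus1)
    show "form_nabla (g u') i (\<Psi> g u') y Vs = 0" if "y \<in> ?B" "i \<notin> K" "length Vs = Suc k" for y i Vs
      using \<Psi>(4) g sl'(1) that kd unfolding parallel_along_def by blast
  qed
  obtain Vs where Vs: "length Vs = Suc k" "\<Psi> g u' x Vs \<noteq> 0"
    using \<Psi>(2) g u(2) xB kd unfolding nowhere_zero_def by blast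
  have Bset: "coord u' ` (dom_of u' \<inter> (S \<inter> W)) = ?B" by (auto simp: dom')
  have sec: "tractor_section A c (S \<inter> W) V" using V by (simp add: perp_section_def)
  have sV: "smooth_on_subset ?B (V g u')"
    using sec g u(2) Bset unfolding tractor_section_def by metis
  have wV: "wcomp (g u') K y l (V g u' y) = 0" if "y \<in> ?B" "l \<in> K" for y l
  proof -
    have "\<forall>Z\<in>normal_tractors (g u') K y. tractor_metric (g u' y) (V g u' y) Z = 0"
      using V g sl'(2) that(1) unfolding perp_section_def Bset[symmetric] by blast
    then show ?thesis
      using perp_iff_wcomp[where G = "g u'" and x = y, OF posdef_G[OF that(1)]] that(2) by blast
  qed
  have z: "wcomp (g u') K x l (tractor_nabla (g u') i (V g u') x) = 0" if "l \<in> K" for l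
    by (rule nabla_perp[OF xB _ Vs sV wV that]) (use i in auto)
  have Veq: "V g u' (coord u q) = V g u (coord u q)" if q: "q \<in> dom_of u" "q \<in> S" "q \<in> W" for q
  proof -
    have "V g u' (coord u' q) = tractor_change g u (\<lambda>_. 1) u' q (V g u (coord u q))"
      using sec g u rescaling_refl[of g] q unfolding tractor_section_def dom'(1)[symmetric]
      by (metis IntI dom'(1))
    then show ?thesis using restricted_tractor_change[OF u(1) W, of q g] q by (simp add: dom' u'_def)
  qed
  let ?U = "coord u ` (dom_of u \<inter> W)"
  have U: "open ?U" "x \<in> ?U" using open_coord_image[OF u(1) W] p by auto
  have Geq: "g u y = g u' y" if "y \<in> ?U" for y
    using restricted_metric[OF g u(1) W] that unfolding u'_def by auto
  have "pdiff i (V g u) x = pdiff i (V g u') x"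
  proof (rule pdiff_cong_ev)
    have "\<forall>\<^sub>F t in nhds 0. coord u p + t *\<^sub>R axis i 1 \<in> coord u ` (dom_of u \<inter> (S \<inter> W) \<inter> UNIV)"
      by (rule slice_curve[OF sl]) (use p i in auto)
    then show "\<forall>\<^sub>F t in nhds 0. V g u (x + t *\<^sub>R axis i 1) = V g u' (x + t *\<^sub>R axis i 1)"
      unfolding p(4) by eventually_elim (use Veq in auto)
  qed
  then have "tractor_nabla (g u) i (V g u) x = tractor_nabla (g u') i (V g u') x"
    unfolding tractor_nabla_def using connection_form_cong[OF U Geq] Veq p by simp
  then have "\<forall>l\<in>K. wcomp (g u) K x l (tractor_nabla (g u) i (V g u) x) = 0"
    using z wcomp_cong[OF U Geq] by simp
  then show "tractor_second_ff (g u) K i (V g u) x = 0"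
    using tractor_second_ff_zero_iff[where G = "g u" and x = x] metric_posdef[OF g u(1) p(1)] p(4) by blast
qed

subsection \<open>Parallel forms and the Hodge star\<close>

lemma smooth_volume_form:
  assumes "g \<in> c" "u \<in> A"
  shows "smooth_on (coord u ` dom_of u) (\<lambda>y. volume_form (g u y) Us)"
proof -
  have "det (g u y) > 0" if "y \<in> coord u ` dom_of u" for y
    using posdef_det_pos[OF metric_posdef[OF assms]] that by auto
  then show ?thesis unfolding volume_form_eq
    by (intro smooth_on_mult smooth_on_inverse smooth_on_sqrt smooth_on_det smooth_on_const open_image[OF assms(2)]
        metric_smooth[OF assms]) (simp_all add: order_less_imp_not_eq2)
qed

lemma form_section_alternating:
  "form_section A c S d \<Psi> \<Longrightarrow> g \<in> c \<Longrightarrow> u \<in> A \<Longrightarrow> y \<in> coord u ` (dom_of u \<inter> S) \<Longrightarrow> alternating_form d (\<Psi> g u y)"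
  unfolding form_section_def by blast

lemma form_section_smooth:
  "form_section A c S d \<Psi> \<Longrightarrow> g \<in> c \<Longrightarrow> u \<in> A \<Longrightarrow> length Vs = d \<Longrightarrow>
    smooth_on_subset (coord u ` (dom_of u \<inter> S)) (\<lambda>y. \<Psi> g u y Vs)"
  unfolding form_section_def by blast

lemma form_section_change:
  "form_section A c S d \<Psi> \<Longrightarrow> g \<in> c \<Longrightarrow> g' \<in> c \<Longrightarrow> rescaling A \<Omega> g g' \<Longrightarrow> u \<in> A \<Longrightarrow> v \<in> A \<Longrightarrow>
    p \<in> dom_of u \<inter> dom_of v \<inter> S \<Longrightarrow> length Vs = d \<Longrightarrow>
    \<Psi> g' v (coord v p) (map (tractor_change g u \<Omega> v p) Vs) = \<Psi> g u (coord u p) Vs"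
  unfolding form_section_def by blast

lemma hodge_form_section:
  assumes \<Psi>: "form_section A c S d \<Psi>" and d: "d \<le> CARD('n) + 2"
  shows "form_section A c S (CARD('n) + 2 - d) (hodge_star_field d \<Psi>)"
  unfolding form_section_def hodge_star_field_def
proof (intro conjI ballI allI impI)
  fix g u y assume "g \<in> c" "u \<in> A"
  show "alternating_form (CARD('n) + 2 - d) (hodge_star d (g u y) (\<Psi> g u y))"
    by (rule alternating_hodge_star[OF d])
next
  fix g u and Vs :: "'n tractor list"
  assume g: "g \<in> c" and u: "u \<in> A"
  let ?B = "coord u ` (dom_of u \<inter> S)"
  have sh: "smooth_on_subset ?B (\<lambda>y. sharp (g u y) e \<bullet> b)" for e b
  proof (rule smooth_on_subset_of_smooth_on[OF open_image[OF u]])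
    show "smooth_on (coord u ` dom_of u) (\<lambda>y. sharp (g u y) e \<bullet> b)"
      unfolding sharp_def split_beta
      by (intro smooth_on_inner smooth_on_Pair smooth_on_const smooth_on_matrix_vector_mult
          open_image[OF u] metric_smooth[OF g u])
  qed auto
  have "smooth_on_subset ?B (\<lambda>y. \<Psi> g u y (map (sharp (g u y)) es))" if "length es = d" for es
  proof -
    have "smooth_on_subset ?B (\<lambda>y. \<Psi> g u y (map (\<lambda>p. p y) (map (\<lambda>e y. sharp (g u y) e) es)))"
      by (rule smooth_on_subset_form[OF form_section_alternating[OF \<Psi> g u] form_section_smooth[OF \<Psi> g u]])
         (use that sh in auto)
    then show ?thesis by (simp add: o_def)
  qed
  moreover have "smooth_on_subset ?B (\<lambda>y. volume_form (g u y) Us)" for Us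
    by (rule smooth_on_subset_of_smooth_on[OF open_image[OF u] smooth_volume_form[OF g u]]) auto
  ultimately show "smooth_on_subset ?B (\<lambda>y. hodge_star d (g u y) (\<Psi> g u y) Vs)"
    unfolding hodge_star_def by (intro smooth_on_subset_mult smooth_on_subset_sum smooth_on_subset_const) auto
next
  fix g g' \<Omega> u v p and Vs :: "'n tractor list"
  assume *: "g \<in> c" "g' \<in> c" "rescaling A \<Omega> g g'" "u \<in> A" "v \<in> A" "p \<in> dom_of u \<inter> dom_of v \<inter> S"
    "length Vs = CARD('n) + 2 - d"
  show "hodge_star d (g' v (coord v p)) (\<Psi> g' v (coord v p)) (map (tractor_change g u \<Omega> v p) Vs)
      = hodge_star d (g u (coord u p)) (\<Psi> g u (coord u p)) Vs"
    by (rule hodge_star_change[OF *(1-5) _ _ form_section_alternating[OF \<Psi> *(1,4)]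
          form_section_change[OF \<Psi> *(1-6)] d *(7)]) (use *(6) in auto)
qed

lemma hodge_nowhere_zero:
  assumes \<Psi>: "form_section A c S d \<Psi>" and d: "d \<le> CARD('n) + 2"
  shows "nowhere_zero A c S (CARD('n) + 2 - d) (hodge_star_field d \<Psi>) \<longleftrightarrow> nowhere_zero A c S d \<Psi>"
proof -
  have "(\<exists>Ws. length Ws = CARD('n) + 2 - d \<and> hodge_star d (g u x) (\<Psi> g u x) Ws \<noteq> 0)
      \<longleftrightarrow> (\<exists>Vs. length Vs = d \<and> \<Psi> g u x Vs \<noteq> 0)"
    if g: "g \<in> c" and u: "u \<in> A" and x: "x \<in> coord u ` (dom_of u \<inter> S)" for g u x
  proof -
    have pd: "posdef (g u x)" using metric_posdef[OF g u] x by auto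
    show ?thesis
      using hodge_star_injective[OF pd form_section_alternating[OF \<Psi> g u x] d] hodge_star_zero[of d "\<Psi> g u x" "g u x"] by blast
  qed
  then show ?thesis unfolding nowhere_zero_def hodge_star_field_def by (simp cong: ball_cong)
qed

lemma hodge_X:
  assumes \<Psi>: "form_section A c S d \<Psi>" and d: "1 \<le> d" "d \<le> CARD('n) + 2"
  shows "X_wedge_zero A c S (CARD('n) + 2 - d) (hodge_star_field d \<Psi>) \<longleftrightarrow> X_contraction_zero A c S d \<Psi>"
proof -
  have "(\<forall>Vs. length Vs = CARD('n) + 2 - d + 1 \<longrightarrow>
        wedge_vector (g u x) canonical_tractor (hodge_star d (g u x) (\<Psi> g u x)) Vs = 0)
      \<longleftrightarrow> (\<forall>Vs. length Vs + 1 = d \<longrightarrow> contract canonical_tractor (\<Psi> g u x) Vs = 0)"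
    if g: "g \<in> c" and u: "u \<in> A" and x: "x \<in> coord u ` (dom_of u \<inter> S)" for g u x
    using contract_zero_iff_wedge_zero[OF _ form_section_alternating[OF \<Psi> g u x] d, of "g u x"] metric_posdef[OF g u] x
    by blast
  then show ?thesis unfolding X_wedge_zero_def X_contraction_zero_def hodge_star_field_def by (simp cong: ball_cong)
qed

text \<open>The star commutes with the covariant derivative, and it is injective on the alternating
  form \<open>form_nabla\<close>.\<close>

lemma hodge_parallel:
  assumes \<Psi>: "form_section A c S d \<Psi>" and d: "d \<le> CARD('n) + 2"
  shows "parallel_along A c d S (CARD('n) + 2 - d) (hodge_star_field d \<Psi>) \<longleftrightarrow> parallel_along A c d S d \<Psi>"
proof -
  have "(\<forall>Ws. length Ws = CARD('n) + 2 - d \<longrightarrow> form_nabla (g u) i (\<lambda>x. hodge_star d (g u x) (\<Psi> g u x)) x Ws = 0)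
      \<longleftrightarrow> (\<forall>Vs. length Vs = d \<longrightarrow> form_nabla (g u) i (\<Psi> g u) x Vs = 0)"
    if g: "g \<in> c" and sl: "slice_chart A d S u K" and x: "x \<in> coord u ` (dom_of u \<inter> S)" and i: "i \<in> - K" for g u K x i
  proof -
    have u: "u \<in> A" using sl by (auto simp: slice_chart_def)
    obtain p where p: "p \<in> dom_of u \<inter> S" "x = coord u p" using x by auto
    interpret slice_germ "g u" "coord u ` dom_of u" x "coord u ` (dom_of u \<inter> S)" i
      unfolding p(2) by (rule slice_germ[OF g sl p(1)]) (use i in auto)
    note alt = form_section_alternating[OF \<Psi> g u] and sm = form_section_smooth[OF \<Psi> g u]
    have eq: "form_nabla (g u) i (\<lambda>x. hodge_star d (g u x) (\<Psi> g u x)) x Ws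
        = hodge_star d (g u x) (form_nabla (g u) i (\<Psi> g u) x) Ws" if "length Ws = CARD('n) + 2 - d" for Ws
      by (rule hodge_nabla[OF alt sm d that])
    show ?thesis
    proof (intro iffI allI impI)
      fix Vs :: "'n tractor list"
      assume z: "\<forall>Ws. length Ws = CARD('n) + 2 - d \<longrightarrow> form_nabla (g u) i (\<lambda>x. hodge_star d (g u x) (\<Psi> g u x)) x Ws = 0"
        and len: "length Vs = d"
      show "form_nabla (g u) i (\<Psi> g u) x Vs = 0"
        by (rule hodge_star_injective[OF pdx alternating_form_nabla[OF alt sm] d _ len]) (use z eq in auto)
    next
      fix Ws :: "'n tractor list"
      assume "\<forall>Vs. length Vs = d \<longrightarrow> form_nabla (g u) i (\<Psi> g u) x Vs = 0" and len: "length Ws = CARD('n) + 2 - d"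
      then have "hodge_star d (g u x) (form_nabla (g u) i (\<Psi> g u) x) Ws = 0" by (intro hodge_star_zero) simp
      then show "form_nabla (g u) i (\<lambda>x. hodge_star d (g u x) (\<Psi> g u x)) x Ws = 0" by (simp only: eq[OF len])
    qed
  qed
  then show ?thesis unfolding parallel_along_def hodge_star_field_def by blast
qed

end

section \<open>Local sections of the orthogonal complement of the normal bundle\<close>

lemma smooth_on_tchange:
  fixes M :: "'a::real_normed_vector \<Rightarrow> real^'n::finite^'n"
  assumes "open U" "smooth_on U M" "smooth_on U \<omega>" "smooth_on U \<Upsilon>" "smooth_on U P" "smooth_on U V"
    and "\<And>y. y \<in> U \<Longrightarrow> det (M y) \<noteq> 0" "\<And>y. y \<in> U \<Longrightarrow> \<omega> y \<noteq> 0"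
  shows "smooth_on U (\<lambda>y. tchange (M y) (\<omega> y) (\<Upsilon> y) (P y) (V y))"
  unfolding tchange_def
  by (intro smooth_on_Pair smooth_on_mult smooth_on_scaleR smooth_on_add smooth_on_diff smooth_on_inner
      smooth_on_matrix_vector_mult smooth_on_inverse smooth_on_matrix_inv smooth_on_fst smooth_on_snd
      smooth_on_const assms)

section \<open>The covariant derivative of the normal functionals\<close>

context metric_germ
begin

lemma smooth_inv: "smooth_on U (\<lambda>y. matrix_inv (G y))"
  by (intro smooth_on_matrix_inv U smooth_G posdef_det_nonzero pd)

lemma smooth_christoffel: "smooth_on U (\<lambda>y. christoffel G y a b)"
  unfolding christoffel_def
  by (intro smooth_on_vec_lambda smooth_on_sum smooth_on_mult smooth_on_const smooth_on_add smooth_on_diff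
      smooth_on_pdiff smooth_on_nth smooth_inv smooth_G U)

lemma smooth_tangential_block: "smooth_on U (\<lambda>y. tangential_block K (G y))"
  unfolding tangential_block_def
proof (intro smooth_on_vec_lambda U)
  fix i j
  show "smooth_on U (\<lambda>y. if i \<in> K \<or> j \<in> K then if i = j then 1 else 0 else G y $ i $ j)"
    by (cases "i \<in> K \<or> j \<in> K") (auto intro!: smooth_on_const smooth_on_nth smooth_G U)
qed

lemma smooth_mcurv: "smooth_on U (mcurv G K)"
  unfolding mcurv_def[abs_def]
  by (intro smooth_on_scaleR smooth_on_const smooth_on_sum smooth_on_nth smooth_on_matrix_inv smooth_tangential_block
      smooth_christoffel U posdef_det_nonzero posdef_tangential_block pd)

lemma smooth_wcomp:
  assumes "open W" "\<And>y. y \<in> W \<Longrightarrow> \<phi> y \<in> U" "smooth_on W \<phi>" "smooth_on W V"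
  shows "smooth_on W (\<lambda>y. wcomp G K (\<phi> y) k (V y))"
  unfolding wcomp_def
  by (intro smooth_on_add smooth_on_mult smooth_on_nth smooth_on_matrix_vector_mult smooth_on_fst smooth_on_snd
      assms smooth_on_compose[OF assms(1) U(1) assms(2,3) smooth_mcurv] smooth_on_compose[OF assms(1) U(1) assms(2,3) smooth_inv])

text \<open>Differentiate \<open>G ** matrix_inv G = mat 1\<close> and insert metric
  compatibility.\<close>

lemma inv_derivative:
  "((\<lambda>t. matrix_inv (G (x + t *\<^sub>R axis i 1))) has_vector_derivative
     - (matrix_inv (G x) ** \<Gamma>mat i + transpose (\<Gamma>mat i) ** matrix_inv (G x))) (at 0)"
proof -
  let ?N = "\<lambda>t. matrix_inv (G (x + t *\<^sub>R axis i 1))"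
  have mm: "bounded_bilinear ((**) :: real^'n^'n \<Rightarrow> real^'n^'n \<Rightarrow> real^'n^'n)"
    unfolding bilinear_conv_bounded_bilinear[symmetric] bilinear_def
    by (auto intro!: linearI simp: matrix_mult_add scaleR_matrix_mult)
  obtain N' where N': "(?N has_vector_derivative N') (at 0)"
    using has_derivative_imp_pdiff[OF smooth_on_has_derivative[OF smooth_inv U(2)]] by blast
  have D: "((\<lambda>t. G (x + t *\<^sub>R axis i 1) ** ?N t) has_vector_derivative
      G (x + 0 *\<^sub>R axis i 1) ** N' + DG i ** ?N 0) (at 0)"
    by (rule bounded_bilinear.has_vector_derivative[OF mm curve_derivative N'])
  have "\<forall>\<^sub>F t in nhds (0 :: real). x + t *\<^sub>R axis i 1 \<in> U" by (rule eventually_line[OF U])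
  then have "\<forall>\<^sub>F t in nhds (0 :: real). G (x + t *\<^sub>R axis i 1) ** ?N t = mat 1"
    by eventually_elim (rule matrix_inv_inverse(1)[OF posdef_det_nonzero[OF pd]])
  from has_vector_derivative_unique_ev[OF D has_vector_derivative_const this]
  have "G x ** N' = - (DG i ** matrix_inv (G x))" by (simp add: eq_neg_iff_add_eq_0)
  then have "matrix_inv (G x) ** (G x ** N') = matrix_inv (G x) ** (- (DG i ** matrix_inv (G x)))" by simp
  moreover have "matrix_inv (G x) ** (- Q) = - (matrix_inv (G x) ** Q)" for Q
    using scaleR_matrix_mult(2)[of "matrix_inv (G x)" "-1" Q] by simp
  moreover have "matrix_inv (G x) ** (G x ** N') = N'"
    by (simp add: matrix_mul_assoc matrix_inv_inverse[OF nz])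
  ultimately have "N' = - (matrix_inv (G x) ** (DG i ** matrix_inv (G x)))" by simp
  also have "matrix_inv (G x) ** (DG i ** matrix_inv (G x))
      = matrix_inv (G x) ** \<Gamma>mat i ** (G x ** matrix_inv (G x))
        + (matrix_inv (G x) ** G x) ** transpose (\<Gamma>mat i) ** matrix_inv (G x)"
    unfolding DG_eq by (simp add: matrix_mult_add matrix_mul_assoc)
  finally show ?thesis using N' by (simp add: matrix_inv_inverse[OF nz])
qed

text \<open>The covariant derivative of the functional, by the Leibniz rule on an argument with
  constant components.\<close>

definition nabla_wcomp where
  "nabla_wcomp K i k V = pdiff i (\<lambda>y. wcomp G K y k V) x - wcomp G K x k (connection_form G x i V)"

lemma wcomp_derivative:
  "((\<lambda>t. wcomp G K (x + t *\<^sub>R axis i 1) k V) has_vector_derivative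
     nabla_wcomp K i k V + wcomp G K x k (connection_form G x i V)) (at 0)"
proof -
  have "smooth_on U (\<lambda>y. wcomp G K y k V)" by (intro smooth_wcomp U smooth_on_ident smooth_on_const)
  from has_derivative_imp_pdiff[OF smooth_on_has_derivative[OF this U(2)]]
  show ?thesis by (simp add: nabla_wcomp_def pdiff_frechet[OF smooth_on_has_derivative[OF \<open>smooth_on U (\<lambda>y. wcomp G K y k V)\<close> U(2)]])
qed

text \<open>The derivative of the inverse metric and the connection form share a Christoffel term,
  which cancels. The bottom slot disappears because raising \<open>G x $ i\<close> gives the
  \<open>i\<close>-th unit vector, whose \<open>k\<close>-th coordinate is zero.\<close>

lemma nabla_wcomp_eq:
  assumes "i \<notin> K" "k \<in> K"
  shows "nabla_wcomp K i k V = fst V * (pdiff i (\<lambda>y. mcurv G K y $ k) x - (matrix_inv (G x) *v schouten G x $ i) $ k)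
     + fst (snd V) $ i * mcurv G K x $ k
     - (transpose (\<Gamma>mat i) *v (matrix_inv (G x) *v fst (snd V))) $ k"
proof -
  obtain s \<mu> r where V: "V = (s, \<mu>, r)" by (cases V) auto
  have sm: "smooth_on U (\<lambda>y. mcurv G K y $ k)" by (intro smooth_on_nth smooth_mcurv U)
  have h: "((\<lambda>t. mcurv G K (x + t *\<^sub>R axis i 1) $ k) has_vector_derivative pdiff i (\<lambda>y. mcurv G K y $ k) x) (at 0)"
    using has_derivative_imp_pdiff[OF smooth_on_has_derivative[OF sm U(2)]]
    by (simp add: pdiff_frechet[OF smooth_on_has_derivative[OF sm U(2)]])
  have "bounded_linear (\<lambda>M :: real^'n^'n. (M *v \<mu>) $ k)"
    unfolding linear_conv_bounded_linear[symmetric]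
    by (rule linearI) (simp_all add: matrix_vector_mult_add_rdistrib scaleR_matrix_vector_assoc[symmetric])
  from bounded_linear.has_vector_derivative[OF this inv_derivative]
  have n: "((\<lambda>t. (matrix_inv (G (x + t *\<^sub>R axis i 1)) *v \<mu>) $ k) has_vector_derivative
     ((- (matrix_inv (G x) ** \<Gamma>mat i + transpose (\<Gamma>mat i) ** matrix_inv (G x))) *v \<mu>) $ k) (at 0)" .
  have neg: "(- Q) *v \<mu> = - (Q *v \<mu>)" for Q :: "real^'n^'n"
    using scaleR_matrix_vector_assoc[of "-1" Q \<mu>] by simp
  have "((\<lambda>t. wcomp G K (x + t *\<^sub>R axis i 1) k V) has_vector_derivative
     s * pdiff i (\<lambda>y. mcurv G K y $ k) x
     + ((- (matrix_inv (G x) ** \<Gamma>mat i + transpose (\<Gamma>mat i) ** matrix_inv (G x))) *v \<mu>) $ k) (at 0)"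
    unfolding wcomp_def V fst_conv snd_conv
    by (intro has_vector_derivative_add has_vector_derivative_mult_right h n)
  from vector_derivative_unique_at[OF wcomp_derivative this]
  have "nabla_wcomp K i k V = s * pdiff i (\<lambda>y. mcurv G K y $ k) x
     - (matrix_inv (G x) *v (\<Gamma>mat i *v \<mu>)) $ k - (transpose (\<Gamma>mat i) *v (matrix_inv (G x) *v \<mu>)) $ k
     - wcomp G K x k (connection_form G x i V)"
    unfolding neg matrix_vector_mult_add_rdistrib
    by (simp add: matrix_vector_mul_assoc[symmetric] del: transpose_matrix_vector)
  moreover have "matrix_inv (G x) *v G x $ i = axis i 1"
  proof -
    have "G x $ i = G x *v axis i 1"
      using posdef_sym[OF pdx] by (simp add: vec_eq_iff matrix_vector_mult_basis column_def)
    then show ?thesis by (simp add: matrix_vector_mul_assoc matrix_inv_inverse[OF nz])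
  qed
  then have "wcomp G K x k (connection_form G x i V) = - \<mu> $ i * mcurv G K x $ k
      - (matrix_inv (G x) *v (\<Gamma>mat i *v \<mu>)) $ k + s * (matrix_inv (G x) *v schouten G x $ i) $ k"
    using assms by (auto simp: wcomp_def connection_form_eq V matrix_vector_right_distrib matrix_vector_mult_scaleR
        matrix_vector_mult_diff_distrib linear_neg[OF matrix_vector_mul_linear] axis_def)
  ultimately show ?thesis by (simp add: V algebra_simps del: transpose_matrix_vector)
qed

lemma linear_nabla_wcomp:
  assumes "i \<notin> K" "k \<in> K" shows "linear (nabla_wcomp K i k)"
  unfolding nabla_wcomp_eq[OF assms, abs_def]
  by (rule linearI) (simp_all add: algebra_simps matrix_vector_right_distrib matrix_vector_mult_scaleR
      del: transpose_matrix_vector)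

lemma wcomp_curve:
  assumes ik: "i \<notin> K" "k \<in> K"
    and V: "((\<lambda>t. V (x + t *\<^sub>R axis i 1)) has_vector_derivative V') (at 0)"
  shows "((\<lambda>t. wcomp G K (x + t *\<^sub>R axis i 1) k (V (x + t *\<^sub>R axis i 1))) has_vector_derivative
     nabla_wcomp K i k (V x) + wcomp G K x k (V' + connection_form G x i (V x))) (at 0)"
proof -
  let ?w = "\<lambda>y. wcomp G K y k" and ?c = "\<lambda>t. x + t *\<^sub>R axis i 1" and ?C = "connection_form G x i"
  have rep: "f Z = (\<Sum>b\<in>Basis. (Z \<bullet> b) * f b)" if f: "linear f" for f :: "'n tractor \<Rightarrow> real" and Z
  proof -
    have "f (\<Sum>b\<in>Basis. (Z \<bullet> b) *\<^sub>R b) = (\<Sum>b\<in>Basis. (Z \<bullet> b) * f b)"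
      by (simp only: linear_sum[OF f] linear_scale[OF f] real_scaleR_def)
    then show ?thesis by (simp only: euclidean_representation)
  qed
  have lin: "linear (\<lambda>Z. nabla_wcomp K i k Z + ?w x (?C Z))"
    using linear_compose_add[OF linear_nabla_wcomp[OF ik]
        linear_compose[OF linear_connection_form[of i] linear_wcomp[of G K x k]]] by (simp add: o_def)
  have summand: "((\<lambda>t. (V (?c t) \<bullet> b) * ?w (?c t) b) has_vector_derivative
     (V (?c 0) \<bullet> b) * (nabla_wcomp K i k b + ?w x (?C b)) + (V' \<bullet> b) * ?w (?c 0) b) (at 0)" for b
  proof (rule has_vector_derivative_mult)
    show "((\<lambda>t. V (?c t) \<bullet> b) has_vector_derivative V' \<bullet> b) (at 0)"
      by (rule bounded_linear.has_vector_derivative[OF bounded_linear_inner_left V])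
    show "((\<lambda>t. ?w (?c t) b) has_vector_derivative nabla_wcomp K i k b + ?w x (?C b)) (at 0)"
      by (rule wcomp_derivative)
  qed
  have "((\<lambda>t. \<Sum>b\<in>Basis. (V (?c t) \<bullet> b) * ?w (?c t) b) has_vector_derivative
     (\<Sum>b\<in>Basis. (V (?c 0) \<bullet> b) * (nabla_wcomp K i k b + ?w x (?C b)) + (V' \<bullet> b) * ?w (?c 0) b)) (at 0)"
    by (rule has_vector_derivative_sum) (rule summand)
  moreover have "(\<Sum>b\<in>Basis. (V (?c t) \<bullet> b) * ?w (?c t) b) = ?w (?c t) (V (?c t))" for t
    by (rule rep[OF linear_wcomp, symmetric])
  moreover have "(\<Sum>b\<in>Basis. (V (?c 0) \<bullet> b) * (nabla_wcomp K i k b + ?w x (?C b)) + (V' \<bullet> b) * ?w (?c 0) b)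
      = (nabla_wcomp K i k (V x) + ?w x (?C (V x))) + ?w x V'"
    unfolding sum.distrib scaleR_zero_left add_0_right
    by (rule arg_cong2[where f = "(+)", OF rep[OF lin, symmetric] rep[OF linear_wcomp, symmetric]])
  ultimately have "((\<lambda>t. ?w (?c t) (V (?c t))) has_vector_derivative
     (nabla_wcomp K i k (V x) + ?w x (?C (V x))) + ?w x V') (at 0)"
    by (simp only:)
  then show ?thesis by (simp add: linear_add[OF linear_wcomp] add_ac)
qed

end

section \<open>Test sections, transported to all scales and charts\<close>

context conformal_manifold
begin

definition scale_factor :: "('a, 'n) metric \<Rightarrow> ('a, 'n) metric \<Rightarrow> 'a \<Rightarrow> real" where
  "scale_factor g g' = (SOME \<Omega>. rescaling A \<Omega> g g')"

lemma scale_factor: "g \<in> c \<Longrightarrow> g' \<in> c \<Longrightarrow> rescaling A (scale_factor g g') g g'"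
  unfolding scale_factor_def using someI_ex[OF rescaling_exists] .

lemma scale_factor_eq: "g \<in> c \<Longrightarrow> g' \<in> c \<Longrightarrow> rescaling A \<Omega> g g' \<Longrightarrow> scale_factor g g' = \<Omega>"
  by (rule rescaling_unique[OF _ scale_factor])

lemma smooth_jac:
  assumes "u \<in> A" "v \<in> A"
  shows "smooth_on (coord u ` (dom_of u \<inter> dom_of v)) (\<lambda>y. jac u v (point_of u y))"
proof -
  let ?O = "coord u ` (dom_of u \<inter> dom_of v)"
  have O: "open ?O" by (rule open_coord_image[OF assms(1) open_dom[OF assms(2)]])
  have "smooth_on ?O (\<lambda>y. \<chi> i j. frechet_derivative (coord v \<circ> point_of u) (at y) (axis j 1) $ i)"
    by (intro smooth_on_vec_lambda smooth_on_nth smooth_on_derivative smooth_transition[OF assms] O)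
  then show ?thesis
    by (rule smooth_on_cong[OF O, rotated])
       (use point_of_coord[OF assms(1)] in \<open>auto simp: jac_def jacobian_def matrix_def\<close>)
qed

lemma smooth_tractor_change:
  assumes g: "g \<in> c" "rescaling A \<Omega> g g'" and uv: "u \<in> A" "v \<in> A"
    and V: "smooth_on (coord u ` dom_of u) V"
  shows "smooth_on (coord v ` (dom_of v \<inter> dom_of u))
    (\<lambda>y. tractor_change g u \<Omega> v (point_of v y) (V (coord u (point_of v y))))"
proof -
  let ?O = "coord v ` (dom_of v \<inter> dom_of u)" and ?U = "coord u ` dom_of u"
  let ?\<phi> = "coord u \<circ> point_of v"
  have O: "open ?O" by (rule open_coord_image[OF uv(2) open_dom[OF uv(1)]])
  have U: "open ?U" by (rule open_image[OF uv(1)])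
  have \<phi>: "?\<phi> y \<in> ?U" if "y \<in> ?O" for y using that point_of_coord[OF uv(2)] by auto
  have comp: "smooth_on ?O (\<lambda>y. f (?\<phi> y))" if "smooth_on ?U f" for f :: "real^'n \<Rightarrow> 'z::euclidean_space"
    by (rule smooth_on_compose[OF O U \<phi> smooth_transition[OF uv(2,1)] that])
  have s\<Omega>: "smooth_on ?U (\<Omega> \<circ> point_of u)" by (rule rescaling_smooth[OF g(2) uv(1)])
  have pos: "\<Omega> q \<noteq> 0" for q using rescaling_pos[OF g(2), of q] by simp
  have "smooth_on ?O (\<lambda>y. tchange (g u (?\<phi> y)) ((\<Omega> \<circ> point_of u) (?\<phi> y))
      (\<chi> a. inverse ((\<Omega> \<circ> point_of u) (?\<phi> y)) * pdiff a (\<Omega> \<circ> point_of u) (?\<phi> y))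
      (transpose (jac v u (point_of v y))) (V (?\<phi> y)))"
  proof (intro smooth_on_tchange O comp metric_smooth[OF g(1) uv(1)] s\<Omega> V smooth_on_transpose smooth_jac[OF uv(2,1)]
      smooth_on_vec_lambda smooth_on_mult smooth_on_inverse smooth_on_pdiff U)
    show "det (g u (?\<phi> y)) \<noteq> 0" if "y \<in> ?O" for y
      using that posdef_det_nonzero[OF metric_posdef[OF g(1) uv(1)]] point_of_coord[OF uv(2)] by auto
  qed (use pos in auto)
  then show ?thesis
  proof (rule smooth_on_cong[OF O, rotated])
    fix y assume "y \<in> ?O"
    then have "point_of v y \<in> dom_of u" using point_of_coord[OF uv(2)] by auto
    then show "tchange (g u (?\<phi> y)) ((\<Omega> \<circ> point_of u) (?\<phi> y))
      (\<chi> a. inverse ((\<Omega> \<circ> point_of u) (?\<phi> y)) * pdiff a (\<Omega> \<circ> point_of u) (?\<phi> y))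
      (transpose (jac v u (point_of v y))) (V (?\<phi> y))
      = tractor_change g u \<Omega> v (point_of v y) (V (coord u (point_of v y)))"
      unfolding tractor_change_eq grad_def using point_of_coord[OF uv(1)] by simp
  qed
qed

text \<open>A section is a family over all scales and charts; this is the one with representative
  \<open>V\<close> in the scale \<open>g\<close> and the chart \<open>u\<close>.\<close>

definition transport ::
    "('a, 'n) metric \<Rightarrow> ('a, 'n) chart \<Rightarrow> (real^'n \<Rightarrow> 'n tractor) \<Rightarrow> ('a, 'n) tractor_field" where
  "transport g u V g' v y =
     tractor_change g u (scale_factor g g') v (point_of v y) (V (coord u (point_of v y)))"

lemma transport_section:
  assumes g: "g \<in> c" and u: "u \<in> A" and V: "smooth_on (coord u ` dom_of u) V" and S: "S \<subseteq> dom_of u"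
  shows "tractor_section A c S (transport g u V)"
  unfolding tractor_section_def
proof (intro conjI ballI allI impI)
  fix g' v assume g': "g' \<in> c" and v: "v \<in> A"
  show "smooth_on_subset (coord v ` (dom_of v \<inter> S)) (transport g u V g' v)"
    unfolding transport_def[abs_def]
    by (rule smooth_on_subset_of_smooth_on[OF open_coord_image[OF v open_dom[OF u]]
          smooth_tractor_change[OF g scale_factor[OF g g'] u v V]]) (use S in auto)
next
  fix g1 g2 \<Omega> v w p
  assume g12: "g1 \<in> c" "g2 \<in> c" "rescaling A \<Omega> g1 g2" and vw: "v \<in> A" "w \<in> A" and p: "p \<in> dom_of v \<inter> dom_of w \<inter> S"
  have pu: "p \<in> dom_of u" "p \<in> dom_of v" "p \<in> dom_of w" using p S by auto
  have "scale_factor g g2 = (\<lambda>q. \<Omega> q * scale_factor g g1 q)"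
    by (rule scale_factor_eq[OF g g12(2) rescaling_compose[OF scale_factor[OF g g12(1)] g12(3)]])
  then show "transport g u V g2 w (coord w p) = tractor_change g1 v \<Omega> w p (transport g u V g1 v (coord v p))"
    unfolding transport_def point_of_coord[OF vw(1) pu(2)] point_of_coord[OF vw(2) pu(3)]
    by (simp add: tractor_change_compose[OF g g12(1) scale_factor[OF g g12(1)] g12(3) u vw pu])
qed

text \<open>Any \<open>V1\<close> in the common kernel extends to a local section of the orthogonal
  complement. The functional is zero along it, so by Leibniz its derivative on \<open>V1\<close> is
  minus its value on the derivative of the section, which distinguishedness makes zero.\<close>

lemma distinguished_nabla_wcomp:
  assumes dist: "distinguished A c d S" and d: "d < CARD('n)" and g: "g \<in> c" and sl: "slice_chart A d S u K"
    and p: "p \<in> dom_of u \<inter> S" and i: "i \<notin> K" and k: "k \<in> K"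
    and V1: "\<And>l. l \<in> K \<Longrightarrow> wcomp (g u) K (coord u p) l V1 = 0"
  shows "metric_germ.nabla_wcomp (g u) (coord u p) K i k V1 = 0"
proof -
  let ?U = "coord u ` dom_of u" and ?x = "coord u p" and ?G = "g u"
  have u: "u \<in> A" using sl by (auto simp: slice_chart_def)
  interpret slice_germ ?G ?U ?x "coord u ` (dom_of u \<inter> S)" i by (rule slice_germ[OF g sl p i])
  have wn: "wcomp ?G K y l (0, ?G y *v axis m 1, 0) = (if l = m then 1 else 0)" if "y \<in> ?U" for y l m
    by (rule wcomp_dual[where G = ?G and x = y, OF pd[OF that]])
  \<comment> \<open>The constant extension of \<open>V1\<close>, corrected by the dual tractors so
    that all functionals vanish throughout the chart; at the point itself the correction is
    zero.\<close>
  define V where "V y = V1 - (\<Sum>m\<in>K. wcomp ?G K y m V1 *\<^sub>R (0 :: real, ?G y *v axis m 1, 0 :: real))" for y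
  have wV: "wcomp ?G K y l (V y) = 0" if "y \<in> ?U" "l \<in> K" for y l
  proof -
    have "wcomp ?G K y l (V y) = wcomp ?G K y l V1 - (\<Sum>m\<in>K. wcomp ?G K y m V1 * (if l = m then 1 else 0))"
      unfolding V_def
      by (simp only: linear_diff[OF linear_wcomp] linear_sum[OF linear_wcomp] linear_scale[OF linear_wcomp]
          wn[OF that(1)] real_scaleR_def)
    then show ?thesis using that(2) by (simp add: if_distrib[of "\<lambda>x. _ * x"] cong: if_cong)
  qed
  have Vx: "V ?x = V1" unfolding V_def using V1 by (simp add: zero_prod_def[symmetric])
  have sV: "smooth_on ?U V"
    unfolding V_def[abs_def]
    by (intro smooth_on_diff smooth_on_sum smooth_on_scaleR smooth_on_const smooth_wcomp smooth_on_ident smooth_on_Pair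
        smooth_on_matrix_vector_mult smooth_G U) auto
  let ?S = "S \<inter> dom_of u" and ?V = "transport g u V"
  have Sdom: "dom_of u \<inter> ?S = dom_of u \<inter> S" by auto
  have sl': "slice_chart A d ?S u K" using sl unfolding slice_chart_def Sdom .
  have "perp_section A c d ?S ?V"
    unfolding perp_section_def
  proof (intro conjI ballI allI impI)
    show "tractor_section A c ?S ?V" by (rule transport_section[OF g u sV]) auto
    fix g' v K' y Z
    assume g': "g' \<in> c" and slv: "slice_chart A d ?S v K'" and y: "y \<in> coord v ` (dom_of v \<inter> ?S)"
      and Z: "Z \<in> normal_tractors (g' v) K' y"
    have v: "v \<in> A" using slv by (auto simp: slice_chart_def)
    obtain q where q: "q \<in> dom_of v" "q \<in> S" "q \<in> dom_of u" "y = coord v q" using y by auto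
    \<comment> \<open>Orthogonality is known for \<open>g\<close> and \<open>u\<close>; the
      transformation law of the functionals carries it to every other scale and slice chart.\<close>
    interpret slice_change A c g g' "scale_factor g g'" d ?S u v K K'
      by unfold_locales (use g g' scale_factor sl' slv d in auto)
    have "\<forall>l\<in>K'. wcomp (g' v) K' y l (?V g' v y) = 0"
    proof
      fix l assume l: "l \<in> K'"
      have "wcomp (g' v) K' (coord v q) l (tractor_change g u (scale_factor g g') v q (V (coord u q))) = 0"
        by (subst wcomp_change[OF _ l]) (use q wV in auto)
      then show "wcomp (g' v) K' y l (?V g' v y) = 0"
        unfolding transport_def q(4) point_of_coord[OF v q(1)] .
    qed
    then show "tractor_metric (g' v y) (?V g' v y) Z = 0"
      using perp_iff_wcomp[where G = "g' v" and x = y] metric_posdef[OF g' v q(1)] q(4) Z by blast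
  qed
  then have "tractor_second_ff ?G K i (?V g u) ?x = 0"
    using dist open_dom[OF u] g sl' p i unfolding distinguished_def by blast
  then have z: "wcomp ?G K ?x k (tractor_nabla ?G i (?V g u) ?x) = 0"
    using tractor_second_ff_zero_iff[where G = ?G and x = ?x, OF pdx] k by blast
  have Veq: "?V g u y = V y" if "y \<in> ?U" for y
  proof -
    from that obtain q where q: "q \<in> dom_of u" "y = coord u q" by auto
    have "scale_factor g g = (\<lambda>_. 1)" by (rule scale_factor_eq[OF g g rescaling_refl])
    then show ?thesis unfolding transport_def q(2) point_of_coord[OF u q(1)] by (simp add: tractor_change_id[OF u q(1)])
  qed
  have D: "((\<lambda>t. V (?x + t *\<^sub>R axis i 1)) has_vector_derivative pdiff i V ?x) (at 0)"
    using has_derivative_imp_pdiff[OF smooth_on_has_derivative[OF sV U(2)]]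
    by (simp add: pdiff_frechet[OF smooth_on_has_derivative[OF sV U(2)]])
  have "tractor_nabla ?G i (?V g u) ?x = pdiff i V ?x + connection_form ?G ?x i (V ?x)"
    unfolding tractor_nabla_def using pdiff_cong_open[OF U Veq] Veq[OF U(2)] by simp
  then have z': "wcomp ?G K ?x k (pdiff i V ?x + connection_form ?G ?x i (V ?x)) = 0" using z by simp
  have "\<forall>\<^sub>F t in nhds 0. wcomp ?G K (?x + t *\<^sub>R axis i 1) k (V (?x + t *\<^sub>R axis i 1)) = 0"
    using eventually_line[OF U, of "axis i 1"] by eventually_elim (rule wV[OF _ k])
  from has_vector_derivative_unique_ev[OF wcomp_curve[OF i k D] has_vector_derivative_const this]
  show ?thesis using z' Vx by simp
qed

end

section \<open>The volume form of the normal bundle\<close>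

text \<open>With the complement as index set, \<open>tangential_block\<close> keeps the block over
  \<open>L\<close> and is the identity elsewhere, so products do not mix the two parts.\<close>

lemma tangential_block_product:
  fixes a b :: "'n::finite \<Rightarrow> 'n \<Rightarrow> real"
  shows "tangential_block (-L) (\<chi> i j. \<Sum>m\<in>L. a i m * b m j)
    = tangential_block (-L) (\<chi> i j. a i j) ** tangential_block (-L) (\<chi> i j. b i j)"
proof -
  have "tangential_block (-L) (\<chi> i j. \<Sum>m\<in>L. a i m * b m j) $ i $ j
      = (tangential_block (-L) (\<chi> i j. a i j) ** tangential_block (-L) (\<chi> i j. b i j)) $ i $ j" for i j
  proof (cases "i \<in> L \<and> j \<in> L")
    case True
    have "(\<Sum>m\<in>UNIV. tangential_block (-L) (\<chi> i j. a i j) $ i $ m * tangential_block (-L) (\<chi> i j. b i j) $ m $ j)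
       = (\<Sum>m\<in>L. a i m * b m j)"
      by (rule sum.mono_neutral_cong_right) (use True in \<open>auto simp: tangential_block_def\<close>)
    then show ?thesis using True by (simp add: matrix_matrix_mult_def) (simp add: tangential_block_def)
  next
    case False
    have "(\<Sum>m\<in>UNIV. tangential_block (-L) (\<chi> i j. a i j) $ i $ m * tangential_block (-L) (\<chi> i j. b i j) $ m $ j)
       = (\<Sum>m\<in>UNIV. if m = i then (if i = j then 1 else 0) else 0)"
      by (rule sum.cong) (use False in \<open>auto simp: tangential_block_def\<close>)
    then show ?thesis using False by (simp add: matrix_matrix_mult_def) (auto simp: tangential_block_def)
  qed
  then show ?thesis by (simp add: vec_eq_iff)
qed

lemma posdef_permute:
  fixes N :: "real^'n::finite^'n"
  assumes N: "posdef N" and \<tau>: "bij \<tau>"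
  shows "posdef (\<chi> i j. N $ \<tau> i $ \<tau> j)"
proof -
  have "v \<bullet> ((\<chi> i j. N $ \<tau> i $ \<tau> j) *v v) > 0" if v: "v \<noteq> 0" for v
  proof -
    define w where "w = (\<chi> i. v $ inv \<tau> i)"
    have wt: "w $ \<tau> i = v $ i" for i using bij_is_inj[OF \<tau>] by (simp add: w_def)
    have "w \<noteq> 0"
    proof
      assume "w = 0"
      then have "v $ i = 0" for i using wt[of i] by simp
      then show False using v by (simp add: vec_eq_iff)
    qed
    then have "w \<bullet> (N *v w) > 0" using N by (simp add: posdef_def)
    also have "w \<bullet> (N *v w) = (\<Sum>i\<in>UNIV. \<Sum>j\<in>UNIV. w $ i * (N $ i $ j * w $ j))"
      by (simp add: inner_vec_def matrix_vector_mult_def sum_distrib_left)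
    also have "\<dots> = (\<Sum>i\<in>UNIV. \<Sum>j\<in>UNIV. w $ \<tau> i * (N $ \<tau> i $ \<tau> j * w $ \<tau> j))"
      using sum.reindex_bij_betw[OF \<tau>, of "\<lambda>i. \<Sum>j\<in>UNIV. w $ i * (N $ i $ j * w $ j)"]
        sum.reindex_bij_betw[OF \<tau>, of "\<lambda>j. w $ i * (N $ i $ j * w $ j)" for i] by simp
    also have "\<dots> = v \<bullet> ((\<chi> i j. N $ \<tau> i $ \<tau> j) *v v)"
      by (simp add: inner_vec_def matrix_vector_mult_def sum_distrib_left wt)
    finally show ?thesis .
  qed
  moreover have "transpose (\<chi> i j. N $ \<tau> i $ \<tau> j) = (\<chi> i j. N $ \<tau> i $ \<tau> j)"
    using posdef_sym[OF N] by (simp add: vec_eq_iff transpose_def)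
  ultimately show ?thesis by (simp add: posdef_def)
qed

text \<open>Conjugating with the diagonal matrix with entries \<open>s\<close> off \<open>K\<close> and \<open>1\<close> on \<open>K\<close> multiplies the
  off-diagonal block by \<open>s\<close>; let \<open>s\<close> tend to \<open>0\<close>.\<close>

lemma det_block_triangular:
  fixes J :: "real^'n::finite^'n"
  assumes J0: "\<And>i j. i \<in> K \<Longrightarrow> j \<notin> K \<Longrightarrow> J $ i $ j = 0"
  shows "det J = det (tangential_block K J) * det (tangential_block (-K) J)"
proof -
  define Js where "Js s = (\<chi> i j. if i \<notin> K \<and> j \<in> K then s * J $ i $ j else J $ i $ j)" for s :: real
  define D where "D s = ((\<chi> i j. if i = j then if i \<in> K then 1 else s else 0) :: real^'n^'n)" for s :: real
  have "det (Js s) = det J" if s: "s \<noteq> 0" for s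
  proof -
    have "D s ** J = Js s ** D s"
      unfolding matrix_matrix_mult_def D_def Js_def
      by (simp add: vec_eq_iff if_distrib[of "\<lambda>x. x * _"] if_distrib[of "\<lambda>x. _ * x"] J0 cong: if_cong)
    then have "det (D s) * det J = det (Js s) * det (D s)" by (metis det_mul)
    moreover have "det (D s) \<noteq> 0"
      by (subst det_diagonal) (use s in \<open>auto simp: D_def\<close>)
    ultimately show ?thesis by simp
  qed
  then have "((\<lambda>s. det (Js s)) \<longlongrightarrow> det J) (at 0)"
    by (intro tendsto_eventually) (auto simp: eventually_at_filter)
  moreover have "continuous (at 0) (\<lambda>s. det (Js s))"
  proof -
    have "continuous (at 0) (\<lambda>s. Js s $ i $ j)" for i j
      by (cases "i \<notin> K \<and> j \<in> K") (auto simp: Js_def intro!: continuous_intros)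
    then show ?thesis unfolding det_def by (intro continuous_sum continuous_mult continuous_prod continuous_const)
  qed
  then have "((\<lambda>s. det (Js s)) \<longlongrightarrow> det (Js 0)) (at 0)" by (simp add: continuous_at)
  ultimately have "det J = det (Js 0)" using tendsto_unique[OF at_neq_bot] by blast
  also have "Js 0 = tangential_block K J ** tangential_block (-K) J"
  proof -
    have "Js 0 $ i $ j = (\<Sum>m\<in>UNIV. tangential_block K J $ i $ m * tangential_block (-K) J $ m $ j)" for i j
    proof (cases "j \<in> K")
      case True
      have "(\<Sum>m\<in>UNIV. tangential_block K J $ i $ m * tangential_block (-K) J $ m $ j)
         = (\<Sum>m\<in>UNIV. if m = i then (if i \<in> K then J $ i $ j else 0) else 0)"
        by (rule sum.cong) (use True in \<open>auto simp: tangential_block_def\<close>)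
      then show ?thesis using True by (simp add: Js_def)
    next
      case False
      have "(\<Sum>m\<in>UNIV. tangential_block K J $ i $ m * tangential_block (-K) J $ m $ j)
         = (\<Sum>m\<in>UNIV. if m = j then (if i \<in> K then 0 else J $ i $ j) else 0)"
        by (rule sum.cong) (use False in \<open>auto simp: tangential_block_def\<close>)
      then show ?thesis using False J0 by (simp add: Js_def)
    qed
    then show ?thesis by (simp add: vec_eq_iff matrix_matrix_mult_def)
  qed
  finally show ?thesis by (simp add: det_mul)
qed

lemma sum_bij_image:
  assumes "bij \<tau>" "\<tau> ` L = K"
  shows "(\<Sum>m\<in>K. f m) = (\<Sum>n\<in>L. f (\<tau> n))"
proof -
  have "bij_betw \<tau> L K" using assms by (auto simp: bij_betw_def bij_def intro: inj_on_subset)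
  then show ?thesis by (rule sum.reindex_bij_betw[symmetric])
qed

text \<open>The normal covectors are indexed by a reference set \<open>L\<close> through \<open>\<tau>\<close>, the arguments of the form
  through \<open>idx\<close>; this turns \<open>d\<close>-fold determinants into determinants over the type \<open>'n\<close>.\<close>

locale normal_index =
  fixes L :: "'n::finite set" and idx :: "'n \<Rightarrow> nat" and d :: nat
  assumes idx: "bij_betw idx L {..<d}"
begin

definition wmat :: "(real^'n \<Rightarrow> real^'n^'n) \<Rightarrow> 'n set \<Rightarrow> ('n \<Rightarrow> 'n) \<Rightarrow> real^'n \<Rightarrow> 'n tractor list \<Rightarrow> real^'n^'n" where
  "wmat G K \<tau> y Vs = tangential_block (-L) (\<chi> l k. wcomp G K y (\<tau> k) (Vs ! idx l))"

text \<open>The Gram matrix of the normal tractors behind the functionals: their top slots are zero,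
  so only the middle slots contribute.\<close>

definition qmat :: "(real^'n \<Rightarrow> real^'n^'n) \<Rightarrow> ('n \<Rightarrow> 'n) \<Rightarrow> real^'n \<Rightarrow> real^'n^'n" where
  "qmat G \<tau> y = tangential_block (-L) (\<chi> l k. matrix_inv (G y) $ \<tau> l $ \<tau> k)"

definition locform :: "(real^'n \<Rightarrow> real^'n^'n) \<Rightarrow> 'n set \<Rightarrow> ('n \<Rightarrow> 'n) \<Rightarrow> real^'n \<Rightarrow> 'n tractor list \<Rightarrow> real" where
  "locform G K \<tau> y Vs = inverse (sqrt (det (qmat G \<tau> y))) * det (wmat G K \<tau> y Vs)"

lemma qmat_posdef: "posdef (G y) \<Longrightarrow> bij \<tau> \<Longrightarrow> posdef (qmat G \<tau> y)"
  unfolding qmat_def by (intro posdef_tangential_block posdef_permute posdef_matrix_inv)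

definition wrow where
  "wrow G K \<tau> y V = (\<chi> k. if k \<in> L then wcomp G K y (\<tau> k) V else 0)"

lemma wmat_row: "l \<in> L \<Longrightarrow> wmat G K \<tau> y Vs $ l = wrow G K \<tau> y (Vs ! idx l)"
  by (auto simp: wmat_def tangential_block_def wrow_def vec_eq_iff)

lemma wmat_row_out: "l \<notin> L \<Longrightarrow> wmat G K \<tau> y Vs $ l = axis l 1"
  by (auto simp: wmat_def tangential_block_def vec_eq_iff axis_def)

lemma linear_wrow: "linear (wrow G K \<tau> y)"
  by (rule linearI) (simp_all add: wrow_def vec_eq_iff linear_add[OF linear_wcomp] linear_scale[OF linear_wcomp])

lemma wmat_update:
  assumes l: "l \<in> L" and len: "length Vs = d"
  shows "wmat G K \<tau> y (Vs[idx l := V]) = (\<chi> m. if m = l then wrow G K \<tau> y V else wmat G K \<tau> y Vs $ m)"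
proof -
  have "wmat G K \<tau> y (Vs[idx l := V]) $ m = (if m = l then wrow G K \<tau> y V else wmat G K \<tau> y Vs $ m)" for m
  proof (cases "m \<in> L")
    case True
    have "idx m = idx l \<longleftrightarrow> m = l" using idx l True by (auto simp: bij_betw_def inj_on_def)
    moreover have "idx l < length Vs" using idx l len by (auto simp: bij_betw_def)
    ultimately show ?thesis using True by (auto simp: wmat_row nth_list_update)
  qed (use l in \<open>auto simp: wmat_row_out\<close>)
  then show ?thesis by (simp add: vec_eq_iff)
qed

lemma alternating_locform: "alternating_form d (locform G K \<tau> y)"
proof -
  have "alternating_form d (\<lambda>Vs. det (wmat G K \<tau> y Vs))"
  proof (rule alternating_formI)
    fix xs ys :: "'n tractor list" assume len: "length xs + length ys + 1 = d"
    then have "length xs \<in> idx ` L" using idx by (simp add: bij_betw_def)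
    then obtain l where l: "l \<in> L" "idx l = length xs" by auto
    let ?Vs = "xs @ 0 # ys"
    \<comment> \<open>One argument influences one row only, and the determinant is linear in a
      row.\<close>
    have row: "wmat G K \<tau> y (xs @ v # ys) = (\<chi> m. if m = l then wrow G K \<tau> y v else wmat G K \<tau> y ?Vs $ m)" for v
      using wmat_update[OF l(1), of ?Vs G K \<tau> y v] len l(2) by simp
    have eq: "det (wmat G K \<tau> y (xs @ v # ys)) = ddet (wmat G K \<tau> y ?Vs) (\<chi> m. if m = l then wrow G K \<tau> y v else 0)" for v
      by (subst row) (simp add: ddet_row)
    have "linear (\<lambda>v. (\<chi> m. if m = l then wrow G K \<tau> y v else 0) :: real^'n^'n)"
      by (rule linearI) (simp_all add: vec_eq_iff linear_add[OF linear_wrow] linear_scale[OF linear_wrow])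
    from linear_compose[OF this linear_ddet] show "linear (\<lambda>v. det (wmat G K \<tau> y (xs @ v # ys)))"
      unfolding eq by (simp add: o_def)
  next
    fix xs :: "'n tractor list" assume xs: "length xs = d" "\<not> distinct xs"
    then obtain p q where pq: "p < d" "q < d" "p \<noteq> q" "xs ! p = xs ! q" by (auto simp: distinct_conv_nth)
    have "p \<in> idx ` L" "q \<in> idx ` L" using idx pq by (simp_all add: bij_betw_def)
    then obtain l m where lm: "l \<in> L" "idx l = p" "m \<in> L" "idx m = q" by auto
    show "det (wmat G K \<tau> y xs) = 0"
      by (rule det_identical_rows[of l m]) (use lm pq in \<open>auto simp: row_def wmat_row\<close>)
  qed
  then show ?thesis unfolding locform_def[abs_def] by (rule alternating_form_cmult)
qed

end

text \<open>The assumption \<open>umbilic\<close> is what a distinguished submanifold supplies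
  through \<open>distinguished_nabla_wcomp\<close>; its name refers to its consequence on tangent
  tractors.\<close>

locale parallel_normal = slice_germ G U x B i + normal_index L idx d
  for G :: "real^'n::finite \<Rightarrow> real^'n^'n" and U x B i and L :: "'n set" and idx d +
  fixes K :: "'n set" and \<tau> :: "'n \<Rightarrow> 'n"
  assumes i: "i \<notin> K" and \<tau>: "bij \<tau>" "\<tau> ` L = K"
    and umbilic: "\<And>k V. k \<in> K \<Longrightarrow> (\<And>l. l \<in> K \<Longrightarrow> wcomp G K x l V = 0) \<Longrightarrow> nabla_wcomp K i k V = 0"
begin

text \<open>The coefficients of the normal connection: the derivative of the \<open>k\<close>-th
  functional on the \<open>m\<close>-th dual tractor.\<close>

definition coef where "coef k m = G x $ i $ m * mcurv G K x $ k - christoffel G x i m $ k"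

lemma nabla_wcomp_dual: "k \<in> K \<Longrightarrow> nabla_wcomp K i k (0, G x *v axis m 1, 0) = coef k m"
  by (simp add: nabla_wcomp_eq[OF i] coef_def matrix_vector_mul_assoc matrix_inv_inverse[OF nz] del: transpose_matrix_vector)
     (simp add: matrix_vector_mult_basis column_def \<Gamma>mat_def transpose_def)

text \<open>A functional vanishing on the common kernel is a combination of the given ones, with
  coefficients read off on the dual tractors.\<close>

lemma nabla_wcomp_expand:
  assumes k: "k \<in> K"
  shows "nabla_wcomp K i k V = (\<Sum>m\<in>K. coef k m * wcomp G K x m V)"
proof -
  let ?n = "\<lambda>m. (0 :: real, G x *v axis m 1, 0 :: real)"
  let ?R = "V - (\<Sum>m\<in>K. wcomp G K x m V *\<^sub>R ?n m)"
  have "wcomp G K x l ?R = 0" if "l \<in> K" for l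
  proof -
    have "wcomp G K x l ?R = wcomp G K x l V - (\<Sum>m\<in>K. wcomp G K x m V * (if l = m then 1 else 0))"
      by (simp only: linear_diff[OF linear_wcomp] linear_sum[OF linear_wcomp] linear_scale[OF linear_wcomp]
          wcomp_dual[where G = G and x = x, OF pdx] real_scaleR_def)
    then show ?thesis using that by (simp add: if_distrib[of "\<lambda>x. _ * x"] cong: if_cong)
  qed
  then have "nabla_wcomp K i k ?R = 0" by (rule umbilic[OF k])
  then have "nabla_wcomp K i k V - (\<Sum>m\<in>K. wcomp G K x m V * coef k m) = 0"
    by (simp only: linear_diff[OF linear_nabla_wcomp[OF i k]] linear_sum[OF linear_nabla_wcomp[OF i k]]
        linear_scale[OF linear_nabla_wcomp[OF i k]] nabla_wcomp_dual[OF k] real_scaleR_def)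
  then show ?thesis by (simp add: mult.commute)
qed

text \<open>For tangential \<open>j\<close> the tractor \<open>(0, G x *v axis j 1, 0)\<close> is in
  the common kernel. The result is umbilicity: the normal part of the second fundamental form is the
  metric times the mean curvature.\<close>

lemma coef_tangential:
  assumes "k \<in> K" "j \<notin> K"
  shows "coef k j = 0"
proof -
  have "wcomp G K x l (0, G x *v axis j 1, 0) = 0" if "l \<in> K" for l
    using that assms(2) by (auto simp: wcomp_dual[where G = G and x = x, OF pdx])
  from umbilic[OF assms(1) this] show ?thesis by (simp add: nabla_wcomp_dual[OF assms(1)])
qed

lemmas sum_tau = sum_bij_image[OF \<tau>]

lemma tau_mem: "n \<in> L \<Longrightarrow> \<tau> n \<in> K" using \<tau>(2) by auto

text \<open>Umbilicity lets the sum run over all indices; then the mean curvature multiplies an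
  off-diagonal entry of \<open>G x ** matrix_inv (G x)\<close>.\<close>

lemma coef_inverse_metric:
  assumes "k \<in> K" "l \<in> K"
  shows "(\<Sum>m\<in>K. coef k m * matrix_inv (G x) $ m $ l)
    = - (transpose (\<Gamma>mat i) ** matrix_inv (G x)) $ k $ l"
proof -
  have "(\<Sum>m\<in>K. coef k m * matrix_inv (G x) $ m $ l) = (\<Sum>m\<in>UNIV. coef k m * matrix_inv (G x) $ m $ l)"
    by (rule sum.mono_neutral_left) (auto simp: coef_tangential assms(1))
  also have "\<dots> = mcurv G K x $ k * (\<Sum>m\<in>UNIV. G x $ i $ m * matrix_inv (G x) $ m $ l)
      - (\<Sum>m\<in>UNIV. christoffel G x i m $ k * matrix_inv (G x) $ m $ l)"
  proof -
    have "coef k m * matrix_inv (G x) $ m $ l = mcurv G K x $ k * (G x $ i $ m * matrix_inv (G x) $ m $ l)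
        - christoffel G x i m $ k * matrix_inv (G x) $ m $ l" for m
      by (simp add: coef_def left_diff_distrib)
    then show ?thesis by (simp only: sum_subtractf sum_distrib_left)
  qed
  also have "(\<Sum>m\<in>UNIV. G x $ i $ m * matrix_inv (G x) $ m $ l) = (G x ** matrix_inv (G x)) $ i $ l"
    by (simp add: matrix_matrix_mult_def)
  also have "\<dots> = 0" using i assms(2) by (auto simp: matrix_inv_inverse[OF nz] mat_def)
  also have "(\<Sum>m\<in>UNIV. christoffel G x i m $ k * matrix_inv (G x) $ m $ l)
      = (transpose (\<Gamma>mat i) ** matrix_inv (G x)) $ k $ l"
    by (simp add: matrix_matrix_mult_def \<Gamma>mat_def transpose_def)
  finally show ?thesis by simp
qed

definition Amat :: "real^'n^'n" where
  "Amat = (\<chi> k n. if k \<in> L \<and> n \<in> L then coef (\<tau> k) (\<tau> n) else 0)"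

lemma has_vector_derivative_vec_lambda:
  fixes f :: "'n \<Rightarrow> real \<Rightarrow> 'b::euclidean_space"
  assumes "\<And>i. (f i has_vector_derivative f' i) (at t)"
  shows "((\<lambda>t. \<chi> i. f i t) has_vector_derivative (\<chi> i. f' i)) (at t)"
proof -
  have eq: "(\<chi> i. h i) = (\<Sum>i\<in>UNIV. axis i (h i))" for h :: "'n \<Rightarrow> 'b"
    by (simp add: vec_eq_iff sum_component axis_def)
  have "bounded_linear (axis i :: 'b \<Rightarrow> 'b^'n)" for i
    unfolding linear_conv_bounded_linear[symmetric] by (rule linearI) (simp_all add: vec_eq_iff axis_def)
  then show ?thesis unfolding eq
    by (intro has_vector_derivative_sum bounded_linear.has_vector_derivative[OF _ assms])
qed

lemma has_vector_derivative_block: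
  assumes "\<And>l k. l \<in> L \<Longrightarrow> k \<in> L \<Longrightarrow> (a l k has_vector_derivative a' l k) (at t)"
  shows "((\<lambda>t. tangential_block (-L) (\<chi> l k. a l k t)) has_vector_derivative
     (\<chi> l k. if l \<in> L \<and> k \<in> L then a' l k else 0)) (at t)"
  unfolding tangential_block_def
proof (intro has_vector_derivative_vec_lambda)
  fix l k
  show "((\<lambda>t. if l \<in> -L \<or> k \<in> -L then if l = k then 1 else 0 else (\<chi> l k. a l k t) $ l $ k)
     has_vector_derivative (if l \<in> L \<and> k \<in> L then a' l k else 0)) (at t)"
    using assms[of l k] by (cases "l \<in> L \<and> k \<in> L") auto
qed

abbreviation "\<gamma> t \<equiv> x + t *\<^sub>R axis i 1"

text \<open>By \<open>coef_inverse_metric\<close>, \<open>Amat\<close> times the Gram matrix is one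
  of the two summands in the derivative of the inverse metric, and the other is its transpose. So
  the normal connection is metric.\<close>

lemma qmat_derivative:
  "((\<lambda>t. qmat G \<tau> (\<gamma> t)) has_vector_derivative
     Amat ** qmat G \<tau> x + qmat G \<tau> x ** transpose Amat) (at 0)"
proof -
  let ?N = "matrix_inv (G x)"
  let ?D = "- (?N ** \<Gamma>mat i + transpose (\<Gamma>mat i) ** ?N)"
  have "((\<lambda>t. matrix_inv (G (\<gamma> t)) $ \<tau> l $ \<tau> k) has_vector_derivative ?D $ \<tau> l $ \<tau> k) (at 0)" for l k
    by (intro bounded_linear.has_vector_derivative[OF bounded_linear_vec_nth] inv_derivative)
  then have "((\<lambda>t. qmat G \<tau> (\<gamma> t)) has_vector_derivative
      (\<chi> l k. if l \<in> L \<and> k \<in> L then ?D $ \<tau> l $ \<tau> k else 0)) (at 0)"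
    unfolding qmat_def by (rule has_vector_derivative_block)
  also have "(\<chi> l k. if l \<in> L \<and> k \<in> L then ?D $ \<tau> l $ \<tau> k else 0)
      = Amat ** qmat G \<tau> x + qmat G \<tau> x ** transpose Amat"
  proof -
    have Nsym: "?N $ a $ b = ?N $ b $ a" for a b by (rule posdef_sym[OF posdef_matrix_inv[OF pdx]])
    have qs: "qmat G \<tau> x $ a $ b = qmat G \<tau> x $ b $ a" for a b by (rule posdef_sym[OF qmat_posdef[where G = G and y = x, OF pdx \<tau>(1)]])
    have Aq: "(Amat ** qmat G \<tau> x) $ l $ k
        = (if l \<in> L \<and> k \<in> L then - (transpose (\<Gamma>mat i) ** ?N) $ \<tau> l $ \<tau> k else 0)" for l k
    proof (cases "l \<in> L \<and> k \<in> L")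
      case True
      have "(Amat ** qmat G \<tau> x) $ l $ k = (\<Sum>n\<in>L. coef (\<tau> l) (\<tau> n) * ?N $ \<tau> n $ \<tau> k)"
        unfolding matrix_matrix_mult_def vec_lambda_beta
        by (rule sum.mono_neutral_cong_right) (use True in \<open>auto simp: Amat_def qmat_def tangential_block_def\<close>)
      also have "\<dots> = (\<Sum>m\<in>K. coef (\<tau> l) m * ?N $ m $ \<tau> k)" by (rule sum_tau[symmetric])
      also have "\<dots> = - (transpose (\<Gamma>mat i) ** ?N) $ \<tau> l $ \<tau> k"
        by (rule coef_inverse_metric) (use True tau_mem in auto)
      finally show ?thesis using True by simp
    next
      case False
      have "(Amat ** qmat G \<tau> x) $ l $ k = 0"
        unfolding matrix_matrix_mult_def vec_lambda_beta
        by (rule sum.neutral) (use False in \<open>auto simp: Amat_def qmat_def tangential_block_def\<close>)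
      then show ?thesis by (simp only: False if_False)
    qed
    have qA: "(qmat G \<tau> x ** transpose Amat) $ l $ k = (Amat ** qmat G \<tau> x) $ k $ l" for l k
      by (simp add: matrix_matrix_mult_def transpose_def qs[of l] mult.commute)
    have NG: "(?N ** \<Gamma>mat i) $ a $ b = (transpose (\<Gamma>mat i) ** ?N) $ b $ a" for a b
      by (simp add: matrix_matrix_mult_def transpose_def Nsym[of a] mult.commute)
    show ?thesis by (simp add: vec_eq_iff Aq qA NG)
  qed
  finally show ?thesis .
qed

text \<open>Two contributions: the functionals change by \<open>Amat\<close>, which acts on columns,
  and the arguments by the connection form, which acts on rows.\<close>

lemma wmat_derivative:
  assumes len: "length Vs = d"
  shows "((\<lambda>t. wmat G K \<tau> (\<gamma> t) Vs) has_vector_derivative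
     wmat G K \<tau> x Vs ** transpose Amat
     + (\<chi> l. if l \<in> L then wrow G K \<tau> x (C (Vs ! idx l)) else 0)) (at 0)"
proof -
  have "((\<lambda>t. wmat G K \<tau> (\<gamma> t) Vs) has_vector_derivative
      (\<chi> l k. if l \<in> L \<and> k \<in> L then nabla_wcomp K i (\<tau> k) (Vs ! idx l) + wcomp G K x (\<tau> k) (C (Vs ! idx l)) else 0)) (at 0)"
    unfolding wmat_def by (rule has_vector_derivative_block) (rule wcomp_derivative)
  also have "(\<chi> l k. if l \<in> L \<and> k \<in> L then nabla_wcomp K i (\<tau> k) (Vs ! idx l) + wcomp G K x (\<tau> k) (C (Vs ! idx l)) else 0)
     = wmat G K \<tau> x Vs ** transpose Amat
       + (\<chi> l. if l \<in> L then wrow G K \<tau> x (C (Vs ! idx l)) else 0)"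
  proof -
    have "(wmat G K \<tau> x Vs ** transpose Amat) $ l $ k
        = (if l \<in> L \<and> k \<in> L then nabla_wcomp K i (\<tau> k) (Vs ! idx l) else 0)" for l k
    proof (cases "l \<in> L \<and> k \<in> L")
      case True
      have "(wmat G K \<tau> x Vs ** transpose Amat) $ l $ k
          = (\<Sum>n\<in>L. coef (\<tau> k) (\<tau> n) * wcomp G K x (\<tau> n) (Vs ! idx l))"
        unfolding matrix_matrix_mult_def vec_lambda_beta
        by (rule sum.mono_neutral_cong_right)
           (use True in \<open>auto simp: Amat_def wmat_def tangential_block_def transpose_def\<close>)
      also have "\<dots> = nabla_wcomp K i (\<tau> k) (Vs ! idx l)"
        using nabla_wcomp_expand[of "\<tau> k" "Vs ! idx l"] tau_mem True by (simp add: sum_tau)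
      finally show ?thesis using True by simp
    next
      case False
      have "(wmat G K \<tau> x Vs ** transpose Amat) $ l $ k = 0"
        unfolding matrix_matrix_mult_def vec_lambda_beta
        by (rule sum.neutral)
           (use False in \<open>auto simp: Amat_def wmat_def tangential_block_def transpose_def\<close>)
      then show ?thesis by (simp only: False if_False)
    qed
    then show ?thesis by (auto simp: vec_eq_iff wrow_def)
  qed
  finally show ?thesis .
qed

text \<open>The trace of \<open>Amat\<close> enters once through the matrix of values and twice
  through the Gram determinant, whose power -1/2 cancels it. Only the action of the connection form
  on the arguments is left.\<close>

lemma locform_parallel:
  assumes len: "length Vs = d"
  shows "((\<lambda>t. locform G K \<tau> (\<gamma> t) Vs) has_vector_derivative (\<Sum>j<d. locform G K \<tau> x (Vs[j := C (Vs ! j)]))) (at 0)"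
proof -
  let ?q = "det (qmat G \<tau> x)" and ?w = "det (wmat G K \<tau> x Vs)" and ?tr = "\<Sum>l\<in>UNIV. Amat $ l $ l"
  let ?R = "\<chi> l. if l \<in> L then wrow G K \<tau> x (C (Vs ! idx l)) else 0"
  have pos: "?q > 0" by (rule posdef_det_pos[OF qmat_posdef[where G = G and y = x, OF pdx \<tau>(1)]])
  have "((\<lambda>t. det (qmat G \<tau> (\<gamma> t))) has_vector_derivative
      ddet (qmat G \<tau> (\<gamma> 0)) (Amat ** qmat G \<tau> x + qmat G \<tau> x ** transpose Amat)) (at 0)"
    by (rule has_vector_derivative_det[OF qmat_derivative])
  then have dq: "((\<lambda>t. det (qmat G \<tau> (\<gamma> t))) has_real_derivative 2 * ?tr * ?q) (at 0)"
    by (simp add: linear_add[OF linear_ddet] ddet_mult_left ddet_mult_right ddet_one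
        transpose_def has_real_derivative_iff_has_vector_derivative mult_ac)
  have "((\<lambda>t. det (wmat G K \<tau> (\<gamma> t) Vs)) has_vector_derivative
      ddet (wmat G K \<tau> (\<gamma> 0) Vs) (wmat G K \<tau> x Vs ** transpose Amat + ?R)) (at 0)"
    by (rule has_vector_derivative_det[OF wmat_derivative[OF len]])
  then have dw: "((\<lambda>t. det (wmat G K \<tau> (\<gamma> t) Vs)) has_real_derivative ?tr * ?w + ddet (wmat G K \<tau> x Vs) ?R) (at 0)"
    by (simp add: linear_add[OF linear_ddet] ddet_mult_right ddet_one
        transpose_def has_real_derivative_iff_has_vector_derivative)
  \<comment> \<open>Rows outside \<open>L\<close> are constant, so the sum over rows becomes a sum
    over arguments.\<close>
  have R: "ddet (wmat G K \<tau> x Vs) ?R = (\<Sum>j<d. det (wmat G K \<tau> x (Vs[j := C (Vs ! j)])))"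
  proof -
    have "ddet (wmat G K \<tau> x Vs) ?R = (\<Sum>l\<in>UNIV. det (\<chi> m. if m = l then ?R $ l else wmat G K \<tau> x Vs $ m))"
      by (rule ddet_rows)
    also have "\<dots> = (\<Sum>l\<in>L. det (wmat G K \<tau> x (Vs[idx l := C (Vs ! idx l)])))"
    proof (rule sum.mono_neutral_cong_right)
      show "\<forall>l\<in>UNIV - L. det (\<chi> m. if m = l then ?R $ l else wmat G K \<tau> x Vs $ m) = 0"
      proof
        fix l assume "l \<in> UNIV - L"
        then show "det (\<chi> m. if m = l then ?R $ l else wmat G K \<tau> x Vs $ m) = 0"
          by (intro det_zero_row(1)[of l]) (simp add: row_def vec_eq_iff)
      qed
      fix l assume l: "l \<in> L"
      then show "det (\<chi> m. if m = l then ?R $ l else wmat G K \<tau> x Vs $ m) = det (wmat G K \<tau> x (Vs[idx l := C (Vs ! idx l)]))"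
        by (simp add: wmat_update[OF l len] cong: if_cong)
    qed auto
    also have "\<dots> = (\<Sum>j<d. det (wmat G K \<tau> x (Vs[j := C (Vs ! j)])))"
      by (rule sum.reindex_bij_betw[OF idx])
    finally show ?thesis .
  qed
  have "((\<lambda>t. sqrt (det (qmat G \<tau> (\<gamma> t)))) has_real_derivative inverse (sqrt ?q) / 2 * (2 * ?tr * ?q)) (at 0)"
    using DERIV_chain2[OF DERIV_real_sqrt[of "det (qmat G \<tau> (\<gamma> 0))"] dq] pos by simp
  from DERIV_mult[OF DERIV_inverse'[OF this] dw] pos
  have "((\<lambda>t. locform G K \<tau> (\<gamma> t) Vs) has_real_derivative
      - (inverse (sqrt ?q) * (inverse (sqrt ?q) / 2 * (2 * ?tr * ?q)) * inverse (sqrt ?q)) * ?w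
      + (?tr * ?w + ddet (wmat G K \<tau> x Vs) ?R) * inverse (sqrt ?q)) (at 0)"
    unfolding locform_def by simp
  also have "- (inverse (sqrt ?q) * (inverse (sqrt ?q) / 2 * (2 * ?tr * ?q)) * inverse (sqrt ?q)) * ?w
      + (?tr * ?w + ddet (wmat G K \<tau> x Vs) ?R) * inverse (sqrt ?q) = inverse (sqrt ?q) * ddet (wmat G K \<tau> x Vs) ?R"
  proof -
    have "inverse (sqrt ?q) * inverse (sqrt ?q) * ?q = 1" using pos by (simp add: field_simps)
    then have "- (inverse (sqrt ?q) * (inverse (sqrt ?q) / 2 * (2 * ?tr * ?q)) * inverse (sqrt ?q)) = - ?tr * inverse (sqrt ?q)"
      by (simp add: mult_ac)
    then show ?thesis by (simp only:) (simp add: algebra_simps)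
  qed
  finally show ?thesis unfolding R locform_def sum_distrib_left has_real_derivative_iff_has_vector_derivative .
qed

end

section \<open>Change of scale and chart for the normal volume form\<close>

locale normal_change = slice_change A c g g' \<Omega> d S u v K K' + normal_index L idx d
  for A :: "('a::{t2_space, second_countable_topology}, 'n::finite) chart set" and c g g' \<Omega> d S u v K K'
    and L :: "'n set" and idx +
  fixes \<tau> \<tau>' :: "'n \<Rightarrow> 'n"
  assumes \<tau>: "bij \<tau>" "\<tau> ` L = K" and \<tau>': "bij \<tau>'" "\<tau>' ` L = K'"
begin

definition Qmat where
  "Qmat p = tangential_block (-L) (\<chi> k l. inverse (\<Omega> p) * jac u v p $ \<tau>' k $ \<tau> l)"

lemmas sum_tau = sum_bij_image[OF \<tau>]

lemma tangential_block_cong: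
  assumes "\<And>i j. i \<in> L \<Longrightarrow> j \<in> L \<Longrightarrow> a i j = b i j"
  shows "tangential_block (-L) (\<chi> i j. a i j) = tangential_block (-L) (\<chi> i j. b i j)"
  using assms by (simp add: tangential_block_def vec_eq_iff)

lemma transpose_block:
  "transpose (tangential_block (-L) (\<chi> i j. a i j)) = tangential_block (-L) (\<chi> i j. a j i)"
  by (auto simp: tangential_block_def transpose_def vec_eq_iff)

lemma wmat_change:
  assumes p: "p \<in> dom_of u \<inter> dom_of v \<inter> S" and len: "length Vs = d"
  shows "wmat (g' v) K' \<tau>' (coord v p) (map (tractor_change g u \<Omega> v p) Vs)
    = wmat (g u) K \<tau> (coord u p) Vs ** transpose (Qmat p)"
proof -
  have "wcomp (g' v) K' (coord v p) (\<tau>' k) (map (tractor_change g u \<Omega> v p) Vs ! idx l)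
      = (\<Sum>n\<in>L. wcomp (g u) K (coord u p) (\<tau> n) (Vs ! idx l) * (inverse (\<Omega> p) * jac u v p $ \<tau>' k $ \<tau> n))"
    if "l \<in> L" "k \<in> L" for l k
  proof -
    have "idx l < length Vs" using idx that(1) len by (auto simp: bij_betw_def)
    moreover have "\<tau>' k \<in> K'" using \<tau>'(2) that(2) by auto
    ultimately show ?thesis by (simp add: wcomp_change[OF p] sum_tau sum_distrib_left mult_ac)
  qed
  then show ?thesis
    unfolding wmat_def Qmat_def transpose_block tangential_block_product[symmetric]
    by (rule tangential_block_cong)
qed

text \<open>Along \<open>S\<close> the normal rows of the Jacobian have only normal entries, so the
  transformed block involves only the block of the original inverse metric.\<close>

lemma qmat_change:
  assumes p: "p \<in> dom_of u \<inter> dom_of v \<inter> S"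
  shows "qmat (g' v) \<tau>' (coord v p) = Qmat p ** qmat (g u) \<tau> (coord u p) ** transpose (Qmat p)"
proof -
  let ?M = "g u (coord u p)" and ?J = "jac u v p"
  have pp: "p \<in> dom_of u" "p \<in> dom_of v" using p by auto
  have nz: "\<Omega> p \<noteq> 0" using rescaling_pos[OF g(3), of p] by simp
  have "matrix_inv (g' v (coord v p)) $ \<tau>' l $ \<tau>' k
      = (\<Sum>m\<in>L. (\<Sum>n\<in>L. (inverse (\<Omega> p) * ?J $ \<tau>' l $ \<tau> n) * matrix_inv ?M $ \<tau> n $ \<tau> m)
          * (inverse (\<Omega> p) * ?J $ \<tau>' k $ \<tau> m))" if lk: "l \<in> L" "k \<in> L" for l k
  proof -
    have K': "\<tau>' l \<in> K'" "\<tau>' k \<in> K'" using \<tau>'(2) lk by auto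
    have "matrix_inv (g' v (coord v p)) $ \<tau>' l $ \<tau>' k
       = inverse ((\<Omega> p)\<^sup>2) * (\<Sum>m\<in>UNIV. (\<Sum>n\<in>UNIV. ?J $ \<tau>' l $ n * matrix_inv ?M $ n $ m) * ?J $ \<tau>' k $ m)"
      unfolding rescaled_metric_inv[OF g charts pp]
      by (simp add: matrix_matrix_mult_def transpose_def)
    also have "(\<Sum>m\<in>UNIV. (\<Sum>n\<in>UNIV. ?J $ \<tau>' l $ n * matrix_inv ?M $ n $ m) * ?J $ \<tau>' k $ m)
       = (\<Sum>m\<in>K. (\<Sum>n\<in>UNIV. ?J $ \<tau>' l $ n * matrix_inv ?M $ n $ m) * ?J $ \<tau>' k $ m)"
      by (rule sum.mono_neutral_right) (auto simp: jac_normal_tangential[OF p _ K'(2)])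
    also have "\<dots> = (\<Sum>m\<in>K. (\<Sum>n\<in>K. ?J $ \<tau>' l $ n * matrix_inv ?M $ n $ m) * ?J $ \<tau>' k $ m)"
      by (intro sum.cong refl arg_cong2[where f = "(*)"] sum.mono_neutral_right)
         (auto simp: jac_normal_tangential[OF p _ K'(1)])
    also have "inverse ((\<Omega> p)\<^sup>2) * \<dots> = (\<Sum>m\<in>L. (\<Sum>n\<in>L. (inverse (\<Omega> p) * ?J $ \<tau>' l $ \<tau> n) * matrix_inv ?M $ \<tau> n $ \<tau> m)
          * (inverse (\<Omega> p) * ?J $ \<tau>' k $ \<tau> m))"
      unfolding sum_tau power2_eq_square inverse_mult_distrib sum_distrib_left sum_distrib_right by (simp only: mult_ac)
    finally show ?thesis .
  qed
  then show ?thesis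
    unfolding qmat_def Qmat_def transpose_block tangential_block_product[symmetric]
    by (rule tangential_block_cong)
qed

lemma det_Qmat_nonzero:
  assumes p: "p \<in> dom_of u \<inter> dom_of v \<inter> S"
  shows "det (Qmat p) \<noteq> 0"
proof -
  have "posdef (g' v (coord v p))" using metric_posdef[OF g(2) charts(2)] p by auto
  from posdef_det_nonzero[OF qmat_posdef[where G = "g' v" and y = "coord v p", OF this \<tau>'(1)]]
  show ?thesis unfolding qmat_change[OF p] det_mul by simp
qed

text \<open>The matrix of values contributes \<open>det (Qmat p)\<close> and the Gram determinant
  its square; after the square root only a sign is left, to be settled by orientations.\<close>

lemma locform_change:
  assumes p: "p \<in> dom_of u \<inter> dom_of v \<inter> S" and len: "length Vs = d"
  shows "locform (g' v) K' \<tau>' (coord v p) (map (tractor_change g u \<Omega> v p) Vs)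
    = sgn (det (Qmat p)) * locform (g u) K \<tau> (coord u p) Vs"
proof -
  have "det (qmat (g' v) \<tau>' (coord v p)) = (det (Qmat p))\<^sup>2 * det (qmat (g u) \<tau> (coord u p))"
    unfolding qmat_change[OF p] det_mul by (simp add: power2_eq_square)
  then have "sqrt (det (qmat (g' v) \<tau>' (coord v p))) = \<bar>det (Qmat p)\<bar> * sqrt (det (qmat (g u) \<tau> (coord u p)))"
    by (simp add: real_sqrt_mult)
  then show ?thesis
    unfolding locform_def wmat_change[OF p len] det_mul
    using det_Qmat_nonzero[OF p] by (simp add: sgn_if abs_if)
qed

end

lemma tendsto_sgn_eventually:
  fixes f :: "'b \<Rightarrow> real"
  assumes "(f \<longlongrightarrow> l) F" "l \<noteq> 0"
  shows "\<forall>\<^sub>F x in F. sgn (f x) = sgn l"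
proof (cases "l > 0")
  case True
  from order_tendstoD(1)[OF assms(1) this] show ?thesis by eventually_elim (use True in simp)
next
  case False
  then have l: "l < 0" using assms(2) by simp
  from order_tendstoD(2)[OF assms(1) this] show ?thesis by eventually_elim (use l in simp)
qed

lemma bij_extending:
  fixes L K :: "'n::finite set"
  assumes "card L = card K"
  shows "\<exists>\<tau>. bij \<tau> \<and> \<tau> ` L = K"
proof -
  obtain f where f: "bij_betw f L K" using finite_same_card_bij[OF _ _ assms] by auto
  have "card (-L) = card (-K)" using assms by (simp add: Compl_eq_Diff_UNIV card_Diff_subset)
  then obtain h where h: "bij_betw h (-L) (-K)" using finite_same_card_bij[of "-L" "-K"] by auto
  let ?\<tau> = "\<lambda>n. if n \<in> L then f n else h n"
  have "bij_betw ?\<tau> L K" using f by (simp cong: bij_betw_cong)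
  moreover have "bij_betw ?\<tau> (-L) (-K)" using h by (subst bij_betw_cong[of "-L" _ h]) auto
  ultimately have "bij_betw ?\<tau> (L \<union> - L) (K \<union> - K)" by (rule bij_betw_combine) auto
  then have "bij ?\<tau>" by simp
  moreover have "?\<tau> ` L = K" using f by (simp add: bij_betw_def)
  ultimately show ?thesis by blast
qed

text \<open>Scaling the block is multiplication by a diagonal matrix with entries \<open>a\<close>
  on \<open>L\<close> and 1 elsewhere.\<close>

lemma det_scaled_block:
  fixes J :: "real^'n::finite^'n"
  assumes "a > 0" "det (tangential_block (-L) J) > 0"
  shows "det (tangential_block (-L) (\<chi> k l. a * J $ k $ l)) > 0"
proof -
  define D where "D = ((\<chi> i j. if i = j then if i \<in> L then a else 1 else 0) :: real^'n^'n)"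
  have "tangential_block (-L) (\<chi> k l. a * J $ k $ l) = D ** tangential_block (-L) J"
    unfolding matrix_matrix_mult_def D_def
    by (auto simp: vec_eq_iff tangential_block_def if_distrib[of "\<lambda>x. x * _"] cong: if_cong)
  moreover have "det D = (\<Prod>i\<in>UNIV. D $ i $ i)" by (rule det_diagonal) (simp add: D_def)
  then have "det D > 0" using assms(1) by (auto simp: D_def intro: prod_pos)
  ultimately show ?thesis using assms(2) by (simp add: det_mul)
qed

lemma (in normal_index) smooth_locform:
  assumes germ: "metric_germ G U x" and W: "open W" "W \<subseteq> U" and \<tau>: "bij \<tau>"
    and Vs: "\<And>n. n < d \<Longrightarrow> smooth_on W (\<lambda>y. Vs y ! n)"
  shows "smooth_on W (\<lambda>y. locform G K \<tau> y (Vs y))"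
proof -
  interpret metric_germ G U x by (rule germ)
  have WU: "y \<in> U" if "y \<in> W" for y using W(2) that by blast
  have inv: "smooth_on W (\<lambda>y. matrix_inv (G y))" by (rule smooth_on_subset'[OF smooth_inv W(2)])
  have "smooth_on W (\<lambda>y. wmat G K \<tau> y (Vs y))"
    unfolding wmat_def tangential_block_def
  proof (intro smooth_on_vec_lambda W)
    fix l k
    show "smooth_on W (\<lambda>y. if l \<in> - L \<or> k \<in> - L then if l = k then 1 else 0
        else (\<chi> l k. wcomp G K y (\<tau> k) (Vs y ! idx l)) $ l $ k)"
    proof (cases "l \<in> L \<and> k \<in> L")
      case True
      then have "idx l < d" using idx by (auto simp: bij_betw_def)
      from smooth_wcomp[OF W(1) WU smooth_on_ident[OF W(1)] Vs[OF this]] show ?thesis using True by simp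
    next
      case False
      then show ?thesis using smooth_on_const[OF W(1)] by auto
    qed
  qed
  moreover have "smooth_on W (\<lambda>y. qmat G \<tau> y)"
    unfolding qmat_def tangential_block_def
  proof (intro smooth_on_vec_lambda W)
    fix l k
    show "smooth_on W (\<lambda>y. if l \<in> - L \<or> k \<in> - L then if l = k then 1 else 0
        else (\<chi> l k. matrix_inv (G y) $ \<tau> l $ \<tau> k) $ l $ k)"
      using smooth_on_const[OF W(1)] smooth_on_nth[OF W(1) smooth_on_nth[OF W(1) inv]]
      by (cases "l \<in> L \<and> k \<in> L") auto
  qed
  moreover have "det (qmat G \<tau> y) > 0" if "y \<in> W" for y
    by (rule posdef_det_pos[OF qmat_posdef[where G = G and y = y, OF pd[OF WU[OF that]] \<tau>]])
  ultimately show ?thesis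
    unfolding locform_def
    by (intro smooth_on_mult smooth_on_inverse smooth_on_sqrt smooth_on_det W) (auto simp: less_imp_neq[THEN not_sym])
qed

section \<open>The global normal volume form of an oriented submanifold\<close>

locale normal_orientation = conformal_manifold A c + normal_index L idx d
  for A :: "('a::{t2_space, second_countable_topology}, 'n::finite) chart set" and c
    and L :: "'n set" and idx d +
  fixes S :: "'a set" and B :: "('a, 'n) chart set"
  assumes codim: "d < CARD('n)"
    and slices: "\<And>u. u \<in> B \<Longrightarrow> slice_chart A d S u L"
    and cover: "S \<subseteq> (\<Union>u\<in>B. dom_of u)"
    and oriented: "\<And>u v p. u \<in> B \<Longrightarrow> v \<in> B \<Longrightarrow> p \<in> dom_of u \<inter> dom_of v \<inter> S \<Longrightarrow>
      det (tangential_block L (jac u v p)) > 0"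
begin

lemma B_charts: "b \<in> B \<Longrightarrow> b \<in> A" using slices by (auto simp: slice_chart_def)

definition base_chart :: "'a \<Rightarrow> ('a, 'n) chart" where
  "base_chart p = (SOME b. b \<in> B \<and> p \<in> dom_of b)"

lemma base_chart:
  assumes "p \<in> S" shows "base_chart p \<in> B" "p \<in> dom_of (base_chart p)"
proof -
  have "\<exists>b. b \<in> B \<and> p \<in> dom_of b" using cover assms by blast
  from someI_ex[OF this] show "base_chart p \<in> B" "p \<in> dom_of (base_chart p)" unfolding base_chart_def by auto
qed

text \<open>Each point uses an oriented slice chart picked by choice, with no relation between
  neighbouring points; \<open>locform_invariant\<close> makes the value independent of the
  choice.\<close>

definition normal_form :: "('a, 'n) tractor_form" where
  "normal_form g v y Vs = (let p = point_of v y; b = base_chart p in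
     locform (g b) L id (coord b p) (map (tractor_change g v (\<lambda>_. 1) b p) Vs))"

lemma normal_form_at:
  "v \<in> A \<Longrightarrow> p \<in> dom_of v \<Longrightarrow> normal_form g v (coord v p) Vs =
     locform (g (base_chart p)) L id (coord (base_chart p) p) (map (tractor_change g v (\<lambda>_. 1) (base_chart p) p) Vs)"
  by (simp add: normal_form_def Let_def point_of_coord)

text \<open>The Jacobian is block triangular along \<open>S\<close>. Its determinant is positive by
  the orientation of \<open>M\<close>, that of its tangential block by the orientation of
  \<open>S\<close>, so the normal block has positive determinant and no sign appears.\<close>

lemma locform_invariant:
  assumes g: "g \<in> c" "g' \<in> c" "rescaling A \<Omega> g g'" and b: "b \<in> B" "b' \<in> B"
    and p: "p \<in> dom_of b \<inter> dom_of b' \<inter> S" and len: "length Vs = d"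
  shows "locform (g' b') L id (coord b' p) (map (tractor_change g b \<Omega> b' p) Vs) = locform (g b) L id (coord b p) Vs"
proof -
  interpret normal_change A c g g' \<Omega> d S b b' L L L idx id id
    by unfold_locales (use g b slices codim in auto)
  have "0 < det (tangential_block (-L) (jac b b' p))"
  proof -
    have "det (jac b b' p) = det (tangential_block L (jac b b' p)) * det (tangential_block (-L) (jac b b' p))"
      by (rule det_block_triangular) (rule jac_normal_tangential[OF p])
    moreover have "det (jac b b' p) > 0" by (rule det_jac_pos) (use p B_charts b in auto)
    ultimately show ?thesis using oriented[OF b p] by (simp add: zero_less_mult_iff)
  qed
  then have "det (Qmat p) > 0"
    unfolding Qmat_def id_apply by (intro det_scaled_block) (use rescaling_pos[OF g(3)] in auto)
  then show ?thesis by (simp add: locform_change[OF p len])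
qed

lemma normal_form_chart:
  assumes g: "g \<in> c" and b: "b \<in> B" and v: "v \<in> A" and p: "p \<in> dom_of b \<inter> dom_of v \<inter> S" and len: "length Vs = d"
  shows "normal_form g v (coord v p) Vs = locform (g b) L id (coord b p) (map (tractor_change g v (\<lambda>_. 1) b p) Vs)"
proof -
  let ?b = "base_chart p"
  have S: "p \<in> S" "p \<in> dom_of b" "p \<in> dom_of v" using p by auto
  note bc = base_chart[OF S(1)]
  have comp: "tractor_change g b (\<lambda>_. 1) ?b p (tractor_change g v (\<lambda>_. 1) b p V) = tractor_change g v (\<lambda>_. 1) ?b p V" for V
    using tractor_change_compose[OF g g rescaling_refl rescaling_refl v B_charts[OF b] B_charts[OF bc(1)] S(3,2) bc(2), of V]
    by simp
  have "locform (g ?b) L id (coord ?b p) (map (tractor_change g b (\<lambda>_. 1) ?b p) (map (tractor_change g v (\<lambda>_. 1) b p) Vs))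
      = locform (g b) L id (coord b p) (map (tractor_change g v (\<lambda>_. 1) b p) Vs)"
    by (rule locform_invariant[OF g g rescaling_refl b bc(1)]) (use bc p len in auto)
  then show ?thesis unfolding normal_form_at[OF v S(3)] by (simp add: comp o_def)
qed

lemma normal_form_invariant:
  assumes g: "g \<in> c" "g' \<in> c" "rescaling A \<Omega> g g'" and uv: "u \<in> A" "v \<in> A"
    and p: "p \<in> dom_of u \<inter> dom_of v \<inter> S" and len: "length Vs = d"
  shows "normal_form g' v (coord v p) (map (tractor_change g u \<Omega> v p) Vs) = normal_form g u (coord u p) Vs"
proof -
  let ?b = "base_chart p"
  have S: "p \<in> S" "p \<in> dom_of u" "p \<in> dom_of v" using p by auto
  note bc = base_chart[OF S(1)]
  have 1: "tractor_change g' v (\<lambda>_. 1) ?b p (tractor_change g u \<Omega> v p V) = tractor_change g u \<Omega> ?b p V" for V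
    using tractor_change_compose[OF g rescaling_refl uv B_charts[OF bc(1)] S(2,3) bc(2), of V] by simp
  have 2: "tractor_change g ?b \<Omega> ?b p (tractor_change g u (\<lambda>_. 1) ?b p V) = tractor_change g u \<Omega> ?b p V" for V
    using tractor_change_compose[OF g(1) g(1) rescaling_refl g(3) uv(1) B_charts[OF bc(1)] B_charts[OF bc(1)] S(2) bc(2) bc(2), of V]
    by simp
  have "locform (g' ?b) L id (coord ?b p) (map (tractor_change g ?b \<Omega> ?b p) (map (tractor_change g u (\<lambda>_. 1) ?b p) Vs))
      = locform (g ?b) L id (coord ?b p) (map (tractor_change g u (\<lambda>_. 1) ?b p) Vs)"
    by (rule locform_invariant[OF g bc(1) bc(1)]) (use bc p len in auto)
  then show ?thesis unfolding normal_form_at[OF uv(1) S(2)] normal_form_at[OF uv(2) S(3)] by (simp add: 1 2 o_def)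
qed

text \<open>Near a point, the base chart of that one point serves for all points of
  \<open>S\<close>. The resulting expression is defined off \<open>S\<close> as well and is the
  required smooth extension.\<close>

lemma normal_form_smooth:
  assumes g: "g \<in> c" and v: "v \<in> A" and len: "length Vs = d"
  shows "smooth_on_subset (coord v ` (dom_of v \<inter> S)) (\<lambda>y. normal_form g v y Vs)"
  unfolding smooth_on_subset_def
proof
  fix x assume "x \<in> coord v ` (dom_of v \<inter> S)"
  then obtain p where p: "x = coord v p" "p \<in> dom_of v" "p \<in> S" by auto
  let ?b = "base_chart p"
  note bc = base_chart[OF p(3)]
  have b: "?b \<in> A" by (rule B_charts[OF bc(1)])
  let ?W = "coord v ` (dom_of v \<inter> dom_of ?b)" and ?O = "coord ?b ` (dom_of ?b \<inter> dom_of v)"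
  have W: "open ?W" by (rule open_coord_image[OF v open_dom[OF b]])
  have O: "open ?O" by (rule open_coord_image[OF b open_dom[OF v]])
  let ?F = "\<lambda>z. locform (g ?b) L id z (map (tractor_change g v (\<lambda>_. 1) ?b (point_of ?b z)) Vs)"
  have pt: "(coord ?b \<circ> point_of v) (coord v q) = coord ?b q" if "q \<in> dom_of v" for q
    using point_of_coord[OF v that] by simp
  have "smooth_on ?O ?F"
  proof (rule smooth_locform[OF metric_germ[OF g b bc(2)] O _ bij_id])
    fix n assume n: "n < d"
    from smooth_tractor_change[OF g rescaling_refl v b smooth_on_const[OF open_image[OF v]], of "Vs ! n"]
    show "smooth_on ?O (\<lambda>y. map (tractor_change g v (\<lambda>_. 1) ?b (point_of ?b y)) Vs ! n)" using n len by simp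
  qed auto
  from smooth_on_compose[where f = ?F, OF W O _ smooth_transition[OF v b] this]
  have "smooth_on ?W (\<lambda>y. ?F ((coord ?b \<circ> point_of v) y))" using pt by auto
  moreover have "?F ((coord ?b \<circ> point_of v) y) = normal_form g v y Vs" if y: "y \<in> coord v ` (dom_of v \<inter> S) \<inter> ?W" for y
  proof -
    obtain q where q: "y = coord v q" "q \<in> dom_of v" "q \<in> S" using y by auto
    obtain q' where q': "coord v q = coord v q'" "q' \<in> dom_of v" "q' \<in> dom_of ?b" using y q(1) by auto
    have "q' = q" using inj_onD[OF inj_coord[OF v] q'(1) q(2) q'(2)] by simp
    then have qb: "q \<in> dom_of ?b" using q'(3) by simp
    show ?thesis
      unfolding q(1) pt[OF q(2)] point_of_coord[OF b qb]
      by (rule normal_form_chart[symmetric]) (use g bc v q qb len in auto)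
  qed
  ultimately show "\<exists>W F. open W \<and> x \<in> W \<and> smooth_on W F \<and>
      (\<forall>y\<in>coord v ` (dom_of v \<inter> S) \<inter> W. F y = normal_form g v y Vs)"
    using W p bc(2) by (intro exI[of _ ?W] exI[of _ "\<lambda>y. ?F ((coord ?b \<circ> point_of v) y)"]) blast
qed

lemma normal_form_section: "form_section A c S d normal_form"
  unfolding form_section_def
proof (intro conjI ballI allI impI)
  fix g v y assume "g \<in> c" and v: "v \<in> A" and "y \<in> coord v ` (dom_of v \<inter> S)"
  then obtain p where p: "p \<in> dom_of v" "y = coord v p" by auto
  show "alternating_form d (normal_form g v y)"
    unfolding p(2) normal_form_at[OF v p(1), abs_def]
    by (rule alternating_form_map[OF alternating_locform linear_tractor_change])
qed (use normal_form_smooth normal_form_invariant in auto)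

lemma normal_form_nowhere_zero: "nowhere_zero A c S d normal_form"
  unfolding nowhere_zero_def
proof (intro ballI)
  fix g v y assume g: "g \<in> c" and v: "v \<in> A" and "y \<in> coord v ` (dom_of v \<inter> S)"
  then obtain p where p: "p \<in> dom_of v" "p \<in> S" "y = coord v p" by auto
  let ?b = "base_chart p"
  note bc = base_chart[OF p(2)]
  have b: "?b \<in> A" by (rule B_charts[OF bc(1)])
  let ?x = "coord ?b p"
  let ?M = "g ?b ?x"
  have pd: "posdef ?M" by (rule metric_posdef[OF g b bc(2)])
  \<comment> \<open>The dual tractors in the order given by \<open>idx\<close>; on them the matrix
    of values is the identity.\<close>
  define Ws where "Ws = map (\<lambda>j. (0 :: real, ?M *v axis (the_inv_into L idx j) 1, 0 :: real)) [0..<d]"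
  have Ws: "Ws ! idx l = (0, ?M *v axis l 1, 0)" if "l \<in> L" for l
  proof -
    have "idx l < d" using idx that by (auto simp: bij_betw_def)
    moreover have "the_inv_into L idx (idx l) = l" using idx that by (simp add: bij_betw_def the_inv_into_f_f)
    ultimately show ?thesis by (simp add: Ws_def)
  qed
  have len: "length Ws = d" by (simp add: Ws_def)
  have "wcomp (g ?b) L ?x k (0, ?M *v axis l 1, 0) = (if l = k then 1 else 0)" for l k
    using wcomp_dual[where G = "g ?b" and x = ?x, OF pd] by auto
  then have "wmat (g ?b) L id ?x Ws $ l $ k = mat 1 $ l $ k" for l k
    using Ws[of l] by (auto simp: wmat_def tangential_block_def mat_def)
  then have "wmat (g ?b) L id ?x Ws = mat 1" by (simp add: vec_eq_iff)
  moreover have "det (qmat (g ?b) id ?x) > 0"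
    by (rule posdef_det_pos[OF qmat_posdef[where G = "g ?b" and y = ?x, OF pd bij_id]])
  ultimately have "locform (g ?b) L id ?x Ws \<noteq> 0" by (simp add: locform_def)
  moreover have "map (tractor_change g v (\<lambda>_. 1) ?b p) (map (tractor_change g ?b (\<lambda>_. 1) v p) Ws) = Ws"
    using tractor_change_inverse[OF g g rescaling_refl rescaling_refl b v bc(2) p(1)] by (simp add: o_def)
  ultimately have "normal_form g v y (map (tractor_change g ?b (\<lambda>_. 1) v p) Ws) \<noteq> 0"
    unfolding p(3) normal_form_at[OF v p(1)] by (simp only: not_False_eq_True)
  then show "\<exists>Vs. length Vs = d \<and> normal_form g v y Vs \<noteq> 0"
    using len by (intro exI[of _ "map (tractor_change g ?b (\<lambda>_. 1) v p) Ws"]) simp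
qed

lemma normal_form_X: "X_contraction_zero A c S d normal_form"
  unfolding X_contraction_zero_def contract_def
proof (intro ballI allI impI)
  fix g v y and Vs :: "'n tractor list"
  assume g: "g \<in> c" and v: "v \<in> A" and "y \<in> coord v ` (dom_of v \<inter> S)" and len: "length Vs + 1 = d"
  then obtain p where p: "p \<in> dom_of v" "p \<in> S" "y = coord v p" by auto
  let ?b = "base_chart p"
  let ?G = "g ?b" and ?x = "coord ?b p" and ?T = "tractor_change g v (\<lambda>_. 1) ?b p"
  have X: "?T canonical_tractor = canonical_tractor"
    by (simp add: tractor_change_eq tchange_def canonical_tractor_def)
  have "0 \<in> idx ` L" using idx len by (auto simp: bij_betw_def)
  then obtain l where l: "l \<in> L" "idx l = 0" by auto
  \<comment> \<open>All functionals vanish on the canonical tractor, which fills the row of the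
    first argument.\<close>
  have "row l (wmat ?G L id ?x (map ?T (canonical_tractor # Vs))) = 0"
    using l X by (simp add: row_def wmat_row vec_eq_iff wrow_def wcomp_def canonical_tractor_def)
  then have "det (wmat ?G L id ?x (map ?T (canonical_tractor # Vs))) = 0" by (rule det_zero_row(1))
  then show "normal_form g v y (canonical_tractor # Vs) = 0"
    unfolding p(3) normal_form_at[OF v p(1)] locform_def by simp
qed

text \<open>An arbitrary slice chart may lie outside the oriented family, so there the form equals
  \<open>locform\<close> up to a sign. The sign is that of a continuous nonvanishing determinant,
  hence constant for small \<open>t\<close>, and \<open>locform\<close> is parallel.\<close>

lemma normal_form_parallel:
  assumes dist: "distinguished A c d S"
  shows "parallel_along A c d S d normal_form"
  unfolding parallel_along_def
proof (intro ballI allI impI)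
  fix g u K x i and Vs :: "'n tractor list"
  assume g: "g \<in> c" and sl: "slice_chart A d S u K" and "x \<in> coord u ` (dom_of u \<inter> S)" and "i \<in> - K"
    and len: "length Vs = d"
  then obtain p where p: "p \<in> dom_of u" "p \<in> S" "x = coord u p" and i: "i \<notin> K" by auto
  have pp: "p \<in> dom_of u \<inter> S" using p by simp
  have u: "u \<in> A" and cK: "card K = d" using sl by (auto simp: slice_chart_def)
  let ?b = "base_chart p" and ?G = "g u" and ?c = "\<lambda>t. coord u p + t *\<^sub>R axis i 1"
  note bc = base_chart[OF p(2)]
  have b: "?b \<in> A" by (rule B_charts[OF bc(1)])
  \<comment> \<open>The chart \<open>u\<close> has its own set \<open>K\<close> of normal indices;
    \<tau> identifies the reference set \<open>L\<close> with it.\<close>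
  have "card L = d" using bij_betw_same_card[OF idx] by simp
  then obtain \<tau> where \<tau>: "bij \<tau>" "\<tau> ` L = K" using bij_extending[of L K] cK by auto
  interpret slice_germ ?G "coord u ` dom_of u" "coord u p" "coord u ` (dom_of u \<inter> S)" i
    by (rule slice_germ[OF g sl pp i])
  interpret parallel_normal ?G "coord u ` dom_of u" "coord u p" "coord u ` (dom_of u \<inter> S)" i L idx d K \<tau>
    by unfold_locales (use i \<tau> distinguished_nabla_wcomp[OF dist codim g sl pp i] in auto)
  interpret N: normal_change A c g g "\<lambda>_. 1" d S u ?b K L L idx \<tau> id
    by unfold_locales (use g sl slices[OF bc(1)] \<tau> rescaling_refl codim in auto)
  let ?s = "sgn (det (N.Qmat p))"
  have nf: "normal_form g u (coord u q) Ws = sgn (det (N.Qmat q)) * locform ?G K \<tau> (coord u q) Ws"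
    if "q \<in> dom_of u \<inter> dom_of ?b \<inter> S" "length Ws = d" for q Ws
    by (subst normal_form_chart[OF g bc(1) u]) (use that N.locform_change in auto)
  let ?O = "coord u ` (dom_of u \<inter> dom_of ?b)"
  have O: "open ?O" "coord u p \<in> ?O" using open_coord_image[OF u open_dom[OF b]] p bc by auto
  have "\<forall>\<^sub>F t in nhds 0. sgn (det (N.Qmat (point_of u (?c t)))) = sgn (det (N.Qmat (point_of u (?c 0))))"
  proof (rule tendsto_sgn_eventually)
    have sQ: "smooth_on ?O (\<lambda>y. det (N.Qmat (point_of u y)))"
    proof (rule smooth_on_det[OF O(1)])
      show "smooth_on ?O (\<lambda>y. N.Qmat (point_of u y))"
        unfolding N.Qmat_def tangential_block_def
      proof (intro smooth_on_vec_lambda O)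
        fix k l
        show "smooth_on ?O (\<lambda>y. if k \<in> - L \<or> l \<in> - L then if k = l then 1 else 0
            else (\<chi> k l. inverse 1 * jac u ?b (point_of u y) $ id k $ \<tau> l) $ k $ l)"
          using smooth_on_const[OF O(1)] smooth_on_nth[OF O(1) smooth_on_nth[OF O(1) smooth_jac[OF u b]]]
          by (cases "k \<in> L \<and> l \<in> L") auto
      qed
    qed
    have "isCont (\<lambda>y. det (N.Qmat (point_of u y))) (?c 0)"
      using bspec[OF iffD1[OF continuous_on_eq_continuous_at[OF O(1)] smooth_on_continuous[OF sQ]] O(2)] by simp
    moreover have "((\<lambda>t. ?c t) \<longlongrightarrow> ?c 0) (nhds 0)" by (intro tendsto_intros) (simp add: tendsto_def eventually_nhds, blast)
    ultimately show "((\<lambda>t. det (N.Qmat (point_of u (?c t)))) \<longlongrightarrow> det (N.Qmat (point_of u (?c 0)))) (nhds 0)"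
      by (rule isCont_tendsto_compose)
    show "det (N.Qmat (point_of u (?c 0))) \<noteq> 0"
      using N.det_Qmat_nonzero[of p] p bc by (simp add: point_of_coord[OF u])
  qed
  moreover have "\<forall>\<^sub>F t in nhds 0. ?c t \<in> coord u ` (dom_of u \<inter> S \<inter> dom_of ?b)"
    by (rule slice_curve[OF sl pp i open_dom[OF b] bc(2)])
  ultimately have "\<forall>\<^sub>F t in nhds 0. normal_form g u (?c t) Vs = ?s * locform ?G K \<tau> (?c t) Vs"
  proof eventually_elim
    case (elim t)
    then obtain q where q: "?c t = coord u q" "q \<in> dom_of u" "q \<in> S" "q \<in> dom_of ?b" by auto
    have "sgn (det (N.Qmat q)) = ?s"
      using elim(1) unfolding q(1) point_of_coord[OF u q(2)] by (simp add: point_of_coord[OF u p(1)])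
    then show ?case unfolding q(1) using nf[of q Vs] q len by simp
  qed
  then have "pdiff i (\<lambda>y. normal_form g u y Vs) x = pdiff i (\<lambda>y. ?s * locform ?G K \<tau> y Vs) x"
    unfolding p(3) by (rule pdiff_cong_ev)
  also have "\<dots> = ?s * (\<Sum>j<d. locform ?G K \<tau> x (Vs[j := connection_form ?G x i (Vs ! j)]))"
    unfolding pdiff_def p(3)
    by (rule vector_derivative_at[OF has_vector_derivative_mult_right[OF locform_parallel[OF len]]])
  also have "\<dots> = (\<Sum>j<length Vs. normal_form g u x (Vs[j := connection_form ?G x i (Vs ! j)]))"
    unfolding sum_distrib_left len p(3) by (rule sum.cong) (use nf[of p] p bc len in auto)
  finally show "form_nabla ?G i (normal_form g u) x Vs = 0"
    unfolding form_nabla_def by simp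
qed

end

context conformal_manifold
begin

lemma distinguished_imp_parallel:
  assumes dist: "distinguished A c d S" and d: "d < CARD('n)" and or: "orientable_submanifold A d S"
  shows "\<exists>\<Psi>. form_section A c S d \<Psi> \<and> nowhere_zero A c S d \<Psi> \<and>
              X_contraction_zero A c S d \<Psi> \<and> parallel_along A c d S d \<Psi>"
proof (cases "S = {}")
  \<comment> \<open>For empty \<open>S\<close> the oriented family may be empty, and then the size
    of \<open>L\<close> is undetermined; all conditions hold vacuously.\<close>
  case True
  then show ?thesis
    by (simp add: form_section_def nowhere_zero_def X_contraction_zero_def parallel_along_def smooth_on_subset_def)
next
  case False
  obtain L B where B: "\<And>u. u \<in> B \<Longrightarrow> slice_chart A d S u L" "S \<subseteq> (\<Union>u\<in>B. dom_of u)"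
    "\<And>u v p. u \<in> B \<Longrightarrow> v \<in> B \<Longrightarrow> p \<in> dom_of u \<inter> dom_of v \<inter> S \<Longrightarrow> det (tangential_block L (jac u v p)) > 0"
  proof -
    obtain L B where "(\<forall>u\<in>B. slice_chart A d S u L) \<and> S \<subseteq> (\<Union>u\<in>B. dom_of u) \<and>
        (\<forall>u\<in>B. \<forall>v\<in>B. \<forall>p\<in>dom_of u \<inter> dom_of v \<inter> S. det (tangential_block L (jac u v p)) > 0)"
      using or unfolding orientable_submanifold_def by (elim exE)
    then show ?thesis by (intro that[of B L]) (elim conjE; simp)+
  qed
  obtain p where "p \<in> S" using False by blast
  then obtain u where "u \<in> B" using B(2) by blast
  then have "card L = d" using B(1) by (simp add: slice_chart_def)
  then obtain idx where idx: "bij_betw idx L {..<d}"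
    using finite_same_card_bij[of L "{..<d}"] by auto
  interpret normal_orientation A c L idx d S B
    by unfold_locales (use B idx d in auto)
  show ?thesis
    by (intro exI[of _ normal_form] conjI normal_form_section normal_form_nowhere_zero normal_form_X normal_form_parallel[OF dist])
qed

end

theorem theorem1p5:
  fixes A :: "('a::{t2_space, second_countable_topology}, 'n::finite) chart set"
    and c :: "('a, 'n) metric set"
    and S :: "'a set"
    and d :: nat
  assumes "CARD('n) \<ge> 3"
    and "connected (UNIV :: 'a set)"
    and "oriented_smooth_structure A"
    and "conformal_class A c"
    and "1 \<le> d" and "d \<le> CARD('n) - 1"
    and "embedded_submanifold A d S"
    and "orientable_submanifold A d S"
  shows "(distinguished A c d S \<longleftrightarrow>
           (\<exists>\<Psi>. form_section A c S d \<Psi> \<and> nowhere_zero A c S d \<Psi> \<and>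
              X_contraction_zero A c S d \<Psi> \<and> parallel_along A c d S d \<Psi>))
       \<and> (distinguished A c d S \<longleftrightarrow>
           (\<exists>\<Psi> \<Phi>. form_section A c S d \<Psi> \<and> \<Phi> = hodge_star_field d \<Psi> \<and>
              form_section A c S (CARD('n) + 2 - d) \<Phi> \<and> nowhere_zero A c S (CARD('n) + 2 - d) \<Phi> \<and>
              X_wedge_zero A c S (CARD('n) + 2 - d) \<Phi> \<and>
              parallel_along A c d S (CARD('n) + 2 - d) \<Phi>))"
proof -
  interpret conformal_manifold A c
    by unfold_locales (rule assms)+
  have d: "d < CARD('n)" "d \<le> CARD('n) + 2" using assms(1,6) by auto
  have form: "distinguished A c d S \<longleftrightarrow>
      (\<exists>\<Psi>. form_section A c S d \<Psi> \<and> nowhere_zero A c S d \<Psi> \<and>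
         X_contraction_zero A c S d \<Psi> \<and> parallel_along A c d S d \<Psi>)"
    using parallel_imp_distinguished[OF assms(5) d(1)] distinguished_imp_parallel[OF _ d(1) assms(8)] by blast
  \<comment> \<open>The conditions match for each fixed \<Psi>, so the second equivalence reduces to
    the first one with the same witness.\<close>
  moreover have "form_section A c S (CARD('n) + 2 - d) (hodge_star_field d \<Psi>) \<and>
      nowhere_zero A c S (CARD('n) + 2 - d) (hodge_star_field d \<Psi>) \<and>
      X_wedge_zero A c S (CARD('n) + 2 - d) (hodge_star_field d \<Psi>) \<and>
      parallel_along A c d S (CARD('n) + 2 - d) (hodge_star_field d \<Psi>) \<longleftrightarrow>
      nowhere_zero A c S d \<Psi> \<and> X_contraction_zero A c S d \<Psi> \<and> parallel_along A c d S d \<Psi>"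
    if "form_section A c S d \<Psi>" for \<Psi>
    unfolding hodge_nowhere_zero[OF that d(2)] hodge_X[OF that assms(5) d(2)] hodge_parallel[OF that d(2)]
    using hodge_form_section[OF that d(2)] by blast
  ultimately show ?thesis by blast
qed


end
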